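(* Every infinite subgroup of $\mathrm{PC}_{\mathbf{Proj}}(\mathbf{P}^1)$ with Property FW has a non-abelian free subgroup. In particular, $\mathrm{PC}_{\mathbf{Proj}}(\mathbf{P}^1)$ has no infinite amenable subgroup with Property FW.
   Context: $\mathbf{P}^1=\mathbf{R}\cup\{\infty\}$ denotes the real projective line, with its usual topology (a circle) and the action of $\mathrm{PGL}_2(\mathbf{R})$ by homographies $x\mapsto\frac{ax+b}{cx+d}$. $\mathrm{PC}(\mathbf{P}^1)$ is the group of piecewise continuous self-transformations of $\mathbf{P}^1$: its elements are represented by maps $f:\mathbf{P}^1\to\mathbf{P}^1$, continuous outside a finite subset, for which there exists another such map $g:\mathbf{P}^1\to\mathbf{P}^1$ such that $f\circ g$ and $g\circ f$ coincide with the identity outside a finite subset; two such maps are identified if they coincide outside a finite subset. The group law is composition. $\mathrm{PC}_{\mathbf{Proj}}(\mathbf{P}^1)$ is the subgroup of $\mathrm{PC}(\mathbf{P}^1)$ of those elements represented by a map $f$ such that for all but finitely many $x\in\mathbf{P}^1$ there exist a neighborhood $V$ of $x$ and $g\in\mathrm{PGL}_2(\mathbf{R})$ such that $f(x')=g(x')$ for all $x'\in V$. A (discrete) group $\Gamma$ has Property FW if for every $\Gamma$-set $E$ and every subset $X\subset E$ such that $X\triangle\gamma X$ is finite for every $\gamma\in\Gamma$, there exists a $\Gamma$-invariant subset $X'\subset E$ such that $X\triangle X'$ is finite. Here $\triangle$ denotes symmetric difference. Amenability is that of discrete groups. *)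

theory Defs
  imports "HOL-Analysis.Urysohn" "HOL-Algebra.Group_Action"
begin

section \<open>The projective line and the homographies\<close>

text \<open>The real projective line \<open>\<real> \<union> {\<infinity>}\<close> is the type \<^typ>\<open>real option\<close>, with \<^term>\<open>None\<close> as the
  point at infinity. Its topology is that of the one-point compactification of the real line.\<close>

type_synonym p1 = "real option"

definition P1 :: "p1 topology" where
  "P1 = Alexandroff_compactification euclideanreal"

fun homography :: "real \<Rightarrow> real \<Rightarrow> real \<Rightarrow> real \<Rightarrow> p1 \<Rightarrow> p1" where
  "homography a b c d (Some x) = (if c * x + d = 0 then None else Some ((a * x + b) / (c * x + d)))"
| "homography a b c d None = (if c = 0 then None else Some (a / c))"

text \<open>The action on the projective line is faithful, so the elements of \<open>PGL\<^sub>2(\<real>)\<close> are identified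
  with the transformations they induce.\<close>

definition PGL2 :: "(p1 \<Rightarrow> p1) set" where
  "PGL2 = {homography a b c d | a b c d. a * d - b * c \<noteq> 0}"


section \<open>Piecewise continuous and piecewise projective transformations\<close>

text \<open>\<open>\<forall>\<^sub>\<infinity>x. P x\<close> says that \<open>P\<close> holds outside a finite set.\<close>

definition pc_continuous :: "(p1 \<Rightarrow> p1) \<Rightarrow> bool" where
  "pc_continuous f \<longleftrightarrow> (\<forall>\<^sub>\<infinity>x. topcontinuous_at P1 P1 f x)"

definition pc_maps :: "(p1 \<Rightarrow> p1) set" where
  "pc_maps = {f. pc_continuous f \<and>
     (\<exists>g. pc_continuous g \<and> (\<forall>\<^sub>\<infinity>x. f (g x) = x) \<and> (\<forall>\<^sub>\<infinity>x. g (f x) = x))}"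

definition pc_eq :: "((p1 \<Rightarrow> p1) \<times> (p1 \<Rightarrow> p1)) set" where
  "pc_eq = {(f, g). f \<in> pc_maps \<and> g \<in> pc_maps \<and> (\<forall>\<^sub>\<infinity>x. f x = g x)}"

definition PC :: "(p1 \<Rightarrow> p1) set monoid" where
  "PC = \<lparr>carrier = pc_maps // pc_eq,
         mult = (\<lambda>A B. \<Union>f\<in>A. \<Union>g\<in>B. pc_eq `` {f \<circ> g}),
         one = pc_eq `` {id}\<rparr>"

definition piecewise_projective :: "(p1 \<Rightarrow> p1) \<Rightarrow> bool" where
  "piecewise_projective f \<longleftrightarrow>
     (\<forall>\<^sub>\<infinity>x. \<exists>V. openin P1 V \<and> x \<in> V \<and> (\<exists>h\<in>PGL2. \<forall>x'\<in>V. f x' = h x'))"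

definition PC_Proj :: "(p1 \<Rightarrow> p1) set monoid" where
  "PC_Proj = PC\<lparr>carrier := {A \<in> carrier PC. \<exists>f\<in>A. piecewise_projective f}\<rparr>"


section \<open>Property FW\<close>

definition property_FW_on :: "'e itself \<Rightarrow> ('a, 'b) monoid_scheme \<Rightarrow> bool" where
  "property_FW_on _ G \<longleftrightarrow>
     (\<forall>(E :: 'e set) \<phi> X.
        group_action G E \<phi> \<and> X \<subseteq> E \<and> (\<forall>g\<in>carrier G. finite (sym_diff X (\<phi> g ` X))) \<longrightarrow>
        (\<exists>X'\<subseteq>E. (\<forall>g\<in>carrier G. \<phi> g ` X' = X') \<and> finite (sym_diff X X')))"

text \<open>A formula cannot quantify over all types, so the sets acted upon are taken in the type of the
  elements of the group. This loses nothing: by the theorem \<open>property_FW_universal\<close> below, the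
  property then holds for the actions on sets of every other type.\<close>

definition property_FW :: "('a, 'b) monoid_scheme \<Rightarrow> bool" where
  "property_FW G \<longleftrightarrow> property_FW_on TYPE('a) G"


section \<open>Free groups\<close>

text \<open>The letter \<open>(s, True)\<close> stands for \<open>s\<close> and the letter \<open>(s, False)\<close> for its inverse.\<close>

definition word_value :: "('a, 'b) monoid_scheme \<Rightarrow> ('a \<times> bool) list \<Rightarrow> 'a" where
  "word_value G w =
     foldr (\<lambda>(s, e) y. (if e then s else inv\<^bsub>G\<^esub> s) \<otimes>\<^bsub>G\<^esub> y) w \<one>\<^bsub>G\<^esub>"

definition reduced_words :: "'a set \<Rightarrow> ('a \<times> bool) list set" where
  "reduced_words S =
     {w \<in> lists (S \<times> UNIV). successively (\<lambda>(s, e) (t, e'). \<not> (s = t \<and> e \<noteq> e')) w}"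

definition free_group :: "('a, 'b) monoid_scheme \<Rightarrow> bool" where
  "free_group G \<longleftrightarrow> group G \<and>
     (\<exists>S\<subseteq>carrier G. bij_betw (word_value G) (reduced_words S) (carrier G))"

definition has_nonabelian_free_subgroup :: "('a, 'b) monoid_scheme \<Rightarrow> bool" where
  "has_nonabelian_free_subgroup G \<longleftrightarrow>
     (\<exists>F. subgroup F G \<and> free_group (G\<lparr>carrier := F\<rparr>) \<and> \<not> comm_group (G\<lparr>carrier := F\<rparr>))"


section \<open>Amenability of discrete groups\<close>

definition amenable :: "('a, 'b) monoid_scheme \<Rightarrow> bool" where
  "amenable G \<longleftrightarrow>
     (\<exists>\<mu> :: 'a set \<Rightarrow> real.
        (\<forall>A\<subseteq>carrier G. 0 \<le> \<mu> A) \<and>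
        \<mu> (carrier G) = 1 \<and>
        (\<forall>A\<subseteq>carrier G. \<forall>B\<subseteq>carrier G. A \<inter> B = {} \<longrightarrow> \<mu> (A \<union> B) = \<mu> A + \<mu> B) \<and>
        (\<forall>g\<in>carrier G. \<forall>A\<subseteq>carrier G. \<mu> (g <#\<^bsub>G\<^esub> A) = \<mu> A))"


section \<open>\<open>PC\<close> and \<open>PC_Proj\<close> are groups\<close>

lemma topspace_P1 [simp]: "topspace P1 = UNIV"
proof -
  have "x \<in> insert None (Some ` UNIV)" for x :: p1
    by (cases x) auto
  then show ?thesis
    unfolding P1_def by auto
qed

lemma closedin_P1_finite: "finite S \<Longrightarrow> closedin P1 S"
proof -
  have "Hausdorff_space P1"
    unfolding P1_def
    by (simp add: Hausdorff_space_Alexandroff_compactification locally_compact_space_euclidean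
        Hausdorff_space_euclidean)
  then show "finite S \<Longrightarrow> closedin P1 S"
    by (simp add: closedin_Hausdorff_finite)
qed

lemma topcontinuous_at_P1:
  "topcontinuous_at P1 P1 f x \<longleftrightarrow>
     (\<forall>V. openin P1 V \<and> f x \<in> V \<longrightarrow> (\<exists>U. openin P1 U \<and> x \<in> U \<and> (\<forall>y\<in>U. f y \<in> V)))"
  by (auto simp: topcontinuous_at_def)

lemma MOST_preimage:
  assumes "\<forall>\<^sub>\<infinity>x. g (f x) = (x::'a)" and "\<forall>\<^sub>\<infinity>y. P y"
  shows "\<forall>\<^sub>\<infinity>x. P (f x)"
proof -
  let ?N = "{x. g (f x) \<noteq> x}" and ?B = "{y. \<not> P y}"
  have "{x. \<not> P (f x)} \<subseteq> ?N \<union> g ` ?B"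
    by force
  moreover have "finite (?N \<union> g ` ?B)"
    using assms by (simp add: eventually_cofinite)
  ultimately show ?thesis
    unfolding eventually_cofinite by (rule finite_subset)
qed

lemma pc_mapsE:
  assumes "f \<in> pc_maps"
  obtains g where "g \<in> pc_maps" "pc_continuous f" "pc_continuous g"
    "\<forall>\<^sub>\<infinity>x. f (g x) = x" "\<forall>\<^sub>\<infinity>x. g (f x) = x"
  using assms unfolding pc_maps_def by blast

lemma pc_maps_MOST:
  assumes "f \<in> pc_maps" and "\<forall>\<^sub>\<infinity>y. P y"
  shows "\<forall>\<^sub>\<infinity>x. P (f x)"
proof -
  obtain g where "\<forall>\<^sub>\<infinity>x. g (f x) = x"
    using assms(1) by (rule pc_mapsE)
  then show ?thesis
    using assms(2) by (rule MOST_preimage)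
qed

lemma pc_continuous_comp:
  assumes f: "pc_continuous f" and g: "g \<in> pc_maps"
  shows "pc_continuous (f \<circ> g)"
proof -
  have 1: "\<forall>\<^sub>\<infinity>x. topcontinuous_at P1 P1 f (g x)"
    using f pc_maps_MOST[OF g] by (simp add: pc_continuous_def)
  have 2: "\<forall>\<^sub>\<infinity>x. topcontinuous_at P1 P1 g x"
    using g by (auto simp: pc_maps_def pc_continuous_def)
  from 1 2 show ?thesis
    unfolding pc_continuous_def
  proof eventually_elim
    case (elim x)
    then show ?case
      unfolding topcontinuous_at_P1 o_def by meson
  qed
qed

lemma pc_maps_comp:
  assumes "f \<in> pc_maps" "g \<in> pc_maps"
  shows "f \<circ> g \<in> pc_maps"
proof -
  obtain f' where f': "f' \<in> pc_maps" "pc_continuous f" "pc_continuous f'"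
    "\<forall>\<^sub>\<infinity>x. f (f' x) = x" "\<forall>\<^sub>\<infinity>x. f' (f x) = x"
    using assms(1) by (rule pc_mapsE)
  obtain g' where g': "g' \<in> pc_maps" "pc_continuous g" "pc_continuous g'"
    "\<forall>\<^sub>\<infinity>x. g (g' x) = x" "\<forall>\<^sub>\<infinity>x. g' (g x) = x"
    using assms(2) by (rule pc_mapsE)
  have "\<forall>\<^sub>\<infinity>x. g (g' (f' x)) = f' x"
    using pc_maps_MOST[OF f'(1) g'(4)] .
  then have 1: "\<forall>\<^sub>\<infinity>x. f (g (g' (f' x))) = x"
    using f'(4) by eventually_elim simp
  have "\<forall>\<^sub>\<infinity>x. f' (f (g x)) = g x"
    using pc_maps_MOST[OF assms(2) f'(5)] .
  then have 2: "\<forall>\<^sub>\<infinity>x. g' (f' (f (g x))) = x"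
    using g'(5) by eventually_elim simp
  have "pc_continuous (f \<circ> g)" "pc_continuous (g' \<circ> f')"
    using pc_continuous_comp assms f' g' by blast+
  then show ?thesis
    unfolding pc_maps_def using 1 2 by (auto intro!: exI[of _ "g' \<circ> f'"])
qed

lemma pc_continuous_id: "pc_continuous id"
  unfolding pc_continuous_def by (rule always_eventually) (auto simp: topcontinuous_at_P1)

lemma pc_maps_id: "id \<in> pc_maps"
  by (auto simp: pc_maps_def intro!: exI[of _ id] pc_continuous_id)

lemma equiv_pc_eq: "equiv pc_maps pc_eq"
proof (rule equivI)
  show "pc_eq \<subseteq> pc_maps \<times> pc_maps"
    by (auto simp: pc_eq_def)
  show "refl_on pc_maps pc_eq"
    by (auto simp: pc_eq_def refl_on_def)
  show "sym pc_eq"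
    by (auto simp: pc_eq_def sym_def eq_commute)
  show "trans pc_eq"
  proof (rule transI)
    fix f g h
    assume "(f, g) \<in> pc_eq" "(g, h) \<in> pc_eq"
    then have "f \<in> pc_maps" "h \<in> pc_maps" "\<forall>\<^sub>\<infinity>x. f x = g x" "\<forall>\<^sub>\<infinity>x. g x = h x"
      by (auto simp: pc_eq_def)
    moreover from this(3,4) have "\<forall>\<^sub>\<infinity>x. f x = h x"
      by eventually_elim simp
    ultimately show "(f, h) \<in> pc_eq"
      by (simp add: pc_eq_def)
  qed
qed

lemma pc_eq_comp:
  assumes "(f, f') \<in> pc_eq" "(g, g') \<in> pc_eq"
  shows "(f \<circ> g, f' \<circ> g') \<in> pc_eq"
proof -
  have "\<forall>\<^sub>\<infinity>x. f (g x) = f' (g x)" "\<forall>\<^sub>\<infinity>x. g x = g' x"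
    using assms pc_maps_MOST[of g "\<lambda>y. f y = f' y"] by (auto simp: pc_eq_def)
  then have "\<forall>\<^sub>\<infinity>x. f (g x) = f' (g' x)"
    by eventually_elim simp
  then show ?thesis
    using assms pc_maps_comp by (simp add: pc_eq_def)
qed

lemma PC_mult_class:
  assumes "f \<in> pc_maps" "g \<in> pc_maps"
  shows "pc_eq `` {f} \<otimes>\<^bsub>PC\<^esub> pc_eq `` {g} = pc_eq `` {f \<circ> g}"
proof -
  have fg: "f \<in> pc_eq `` {f}" "g \<in> pc_eq `` {g}"
    using assms by (auto simp: pc_eq_def)
  have eq: "pc_eq `` {f' \<circ> g'} = pc_eq `` {f \<circ> g}"
    if "f' \<in> pc_eq `` {f}" "g' \<in> pc_eq `` {g}" for f' g'
    using pc_eq_comp[of f f' g g'] that equiv_class_eq[OF equiv_pc_eq] by blast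
  have "pc_eq `` {f} \<otimes>\<^bsub>PC\<^esub> pc_eq `` {g} = (\<Union>f'\<in>pc_eq `` {f}. \<Union>g'\<in>pc_eq `` {g}. pc_eq `` {f \<circ> g})"
    by (simp only: PC_def monoid.simps eq cong: SUP_cong)
  also have "\<dots> = pc_eq `` {f \<circ> g}"
    using fg by blast
  finally show ?thesis .
qed

lemma PC_carrierE:
  assumes "A \<in> carrier PC"
  obtains f where "f \<in> pc_maps" "A = pc_eq `` {f}"
  using assms unfolding PC_def by (auto elim!: quotientE)

lemma PC_class_carrier: "f \<in> pc_maps \<Longrightarrow> pc_eq `` {f} \<in> carrier PC"
  by (simp add: PC_def quotientI)

lemma PC_one: "\<one>\<^bsub>PC\<^esub> = pc_eq `` {id}"
  by (simp add: PC_def)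

lemma pc_class_eqI: "(f, g) \<in> pc_eq \<Longrightarrow> pc_eq `` {f} = pc_eq `` {g}"
  using equiv_class_eq[OF equiv_pc_eq] .

theorem group_PC: "group PC"
proof (rule groupI)
  fix A B assume "A \<in> carrier PC" "B \<in> carrier PC"
  then show "A \<otimes>\<^bsub>PC\<^esub> B \<in> carrier PC"
    by (metis PC_carrierE PC_mult_class PC_class_carrier pc_maps_comp)
next
  show "\<one>\<^bsub>PC\<^esub> \<in> carrier PC"
    by (simp add: PC_one PC_class_carrier pc_maps_id)
next
  fix A B C assume "A \<in> carrier PC" "B \<in> carrier PC" "C \<in> carrier PC"
  then obtain f g h where "f \<in> pc_maps" "A = pc_eq `` {f}" "g \<in> pc_maps" "B = pc_eq `` {g}"
    "h \<in> pc_maps" "C = pc_eq `` {h}"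
    by (meson PC_carrierE)
  then show "A \<otimes>\<^bsub>PC\<^esub> B \<otimes>\<^bsub>PC\<^esub> C = A \<otimes>\<^bsub>PC\<^esub> (B \<otimes>\<^bsub>PC\<^esub> C)"
    by (simp add: PC_mult_class pc_maps_comp o_assoc)
next
  fix A assume "A \<in> carrier PC"
  then show "\<one>\<^bsub>PC\<^esub> \<otimes>\<^bsub>PC\<^esub> A = A"
    by (metis PC_carrierE PC_mult_class PC_one pc_maps_id id_o)
next
  fix A assume "A \<in> carrier PC"
  then obtain f where f: "f \<in> pc_maps" "A = pc_eq `` {f}"
    by (rule PC_carrierE)
  obtain g where g: "g \<in> pc_maps" "\<forall>\<^sub>\<infinity>x. g (f x) = x"
    using f(1) by (rule pc_mapsE)
  have "(g \<circ> f, id) \<in> pc_eq"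
    using f g pc_maps_comp pc_maps_id by (simp add: pc_eq_def)
  then have "pc_eq `` {g} \<otimes>\<^bsub>PC\<^esub> A = \<one>\<^bsub>PC\<^esub>"
    using f g by (simp add: PC_mult_class PC_one pc_class_eqI)
  then show "\<exists>B\<in>carrier PC. B \<otimes>\<^bsub>PC\<^esub> A = \<one>\<^bsub>PC\<^esub>"
    using PC_class_carrier g by blast
qed

lemma PC_inv_class:
  assumes "f \<in> pc_maps" "g \<in> pc_maps" "\<forall>\<^sub>\<infinity>x. g (f x) = x"
  shows "inv\<^bsub>PC\<^esub> (pc_eq `` {f}) = pc_eq `` {g}"
proof -
  have "(g \<circ> f, id) \<in> pc_eq"
    using assms pc_maps_comp pc_maps_id by (simp add: pc_eq_def)
  then have "pc_eq `` {g} \<otimes>\<^bsub>PC\<^esub> pc_eq `` {f} = \<one>\<^bsub>PC\<^esub>"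
    using assms by (simp add: PC_mult_class PC_one pc_class_eqI)
  then show ?thesis
    using group.inv_equality[OF group_PC] PC_class_carrier assms by blast
qed

text \<open>Homographies in homogeneous coordinates.\<close>

definition hpoint :: "real \<Rightarrow> real \<Rightarrow> p1" where
  "hpoint u v = (if v = 0 then None else Some (u / v))"

lemma homography_hpoint:
  assumes "u \<noteq> 0 \<or> v \<noteq> 0"
  shows "homography a b c d (hpoint u v) = hpoint (a * u + b * v) (c * u + d * v)"
proof (cases "v = 0")
  case False
  then have "c * (u / v) + d = (c * u + d * v) / v" "a * (u / v) + b = (a * u + b * v) / v"
    by (simp_all add: field_simps)
  with False show ?thesis
    by (simp add: hpoint_def)
qed (use assms in \<open>simp add: hpoint_def\<close>)

lemma hpoint_cases:
  obtains u v where "p = hpoint u v" "u \<noteq> 0 \<or> v \<noteq> 0"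
proof (cases p)
  case None
  then show ?thesis using that[of 1 0] by (simp add: hpoint_def)
next
  case (Some x)
  then show ?thesis using that[of x 1] by (simp add: hpoint_def)
qed

lemma homography_comp:
  assumes "a' * d' - b' * c' \<noteq> 0"
  shows "homography a b c d (homography a' b' c' d' p) =
    homography (a * a' + b * c') (a * b' + b * d') (c * a' + d * c') (c * b' + d * d') p"
proof -
  obtain u v where p: "p = hpoint u v" "u \<noteq> 0 \<or> v \<noteq> 0"
    by (rule hpoint_cases)
  have nz: "a' * u + b' * v \<noteq> 0 \<or> c' * u + d' * v \<noteq> 0"
  proof (rule ccontr)
    assume "\<not> ?thesis"
    then have z: "a' * u + b' * v = 0" "c' * u + d' * v = 0" by auto
    have "(a' * d' - b' * c') * u = d' * (a' * u + b' * v) - b' * (c' * u + d' * v)"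
      "(a' * d' - b' * c') * v = a' * (c' * u + d' * v) - c' * (a' * u + b' * v)"
      by (simp_all add: algebra_simps)
    then show False
      using p(2) assms z by simp
  qed
  show ?thesis
    using p by (simp add: homography_hpoint[OF p(2)] homography_hpoint[OF nz] algebra_simps)
qed

lemma PGL2_comp:
  assumes "h \<in> PGL2" "h' \<in> PGL2"
  shows "h \<circ> h' \<in> PGL2"
proof -
  obtain a b c d where h: "h = homography a b c d" "a * d - b * c \<noteq> 0"
    using assms by (auto simp: PGL2_def)
  obtain a' b' c' d' where h': "h' = homography a' b' c' d'" "a' * d' - b' * c' \<noteq> 0"
    using assms by (auto simp: PGL2_def)
  have "(a * a' + b * c') * (c * b' + d * d') - (a * b' + b * d') * (c * a' + d * c')
      = (a * d - b * c) * (a' * d' - b' * c')"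
    by (simp add: algebra_simps)
  also have "\<dots> \<noteq> 0"
    using h(2) h'(2) by simp
  finally show ?thesis
    unfolding PGL2_def using h(1) h'(1) homography_comp[OF h'(2)]
    by (auto simp: fun_eq_iff)
qed

lemma homography_scalar: "a \<noteq> 0 \<Longrightarrow> homography a 0 0 a p = p"
  by (cases p) auto

lemma PGL2_id: "id \<in> PGL2"
proof -
  have "id = homography 1 0 0 1"
    by (simp add: fun_eq_iff homography_scalar)
  then show ?thesis
    unfolding PGL2_def by force
qed

lemma PGL2_inverse:
  assumes "h \<in> PGL2"
  obtains h' where "h' \<in> PGL2" "\<And>x. h' (h x) = x"
proof -
  obtain a b c d where h: "h = homography a b c d" and det: "a * d - b * c \<noteq> 0"
    using assms by (auto simp: PGL2_def)
  have "homography d (- b) (- c) a (h p) = p" for p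
    using homography_scalar[OF det, of p] unfolding h homography_comp[OF det]
    by (simp add: algebra_simps)
  moreover have "homography d (- b) (- c) a \<in> PGL2"
    unfolding PGL2_def using det
    by (intro CollectI exI[of _ d] exI[of _ "- b"] exI[of _ "- c"] exI[of _ a])
      (simp add: algebra_simps)
  ultimately show ?thesis
    using that by blast
qed

lemma piecewise_projective_comp:
  assumes f: "piecewise_projective f" and g: "piecewise_projective g" and gpc: "g \<in> pc_maps"
  shows "piecewise_projective (f \<circ> g)"
proof -
  have "\<forall>\<^sub>\<infinity>x. \<exists>V. openin P1 V \<and> g x \<in> V \<and> (\<exists>h\<in>PGL2. \<forall>x'\<in>V. f x' = h x')"
    using f pc_maps_MOST[OF gpc] by (simp add: piecewise_projective_def)
  moreover have "\<forall>\<^sub>\<infinity>x. topcontinuous_at P1 P1 g x"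
    using gpc by (auto simp: pc_maps_def pc_continuous_def)
  ultimately show ?thesis
    using g unfolding piecewise_projective_def
  proof eventually_elim
    case (elim x)
    obtain V h where V: "openin P1 V" "g x \<in> V" "h \<in> PGL2" "\<forall>x'\<in>V. f x' = h x'"
      using elim by blast
    obtain W k where W: "openin P1 W" "x \<in> W" "k \<in> PGL2" "\<forall>x'\<in>W. g x' = k x'"
      using elim by blast
    obtain U where U: "openin P1 U" "x \<in> U" "\<forall>y\<in>U. g y \<in> V"
      using elim V by (auto simp: topcontinuous_at_P1)
    have "\<forall>x'\<in>U \<inter> W. (f \<circ> g) x' = (h \<circ> k) x'"
      using U V W by (metis IntE o_apply)
    moreover have "openin P1 (U \<inter> W)" "x \<in> U \<inter> W" "h \<circ> k \<in> PGL2"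
      using U V W PGL2_comp by auto
    ultimately show ?case
      by blast
  qed
qed

lemma piecewise_projective_inverse:
  assumes f: "piecewise_projective f" and g: "g \<in> pc_maps" and fg: "\<forall>\<^sub>\<infinity>x. f (g x) = x"
  shows "piecewise_projective g"
proof -
  define N where "N = {x. f (g x) \<noteq> x}"
  have N: "closedin P1 N"
    using fg closedin_P1_finite by (simp add: N_def eventually_cofinite)
  have "\<forall>\<^sub>\<infinity>x. \<exists>V. openin P1 V \<and> g x \<in> V \<and> (\<exists>h\<in>PGL2. \<forall>x'\<in>V. f x' = h x')"
    using f pc_maps_MOST[OF g] by (simp add: piecewise_projective_def)
  moreover have "\<forall>\<^sub>\<infinity>x. topcontinuous_at P1 P1 g x"
    using g by (auto simp: pc_maps_def pc_continuous_def)
  ultimately show ?thesis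
    using fg unfolding piecewise_projective_def
  proof eventually_elim
    case (elim x)
    obtain V h where V: "openin P1 V" "g x \<in> V" "h \<in> PGL2" "\<forall>x'\<in>V. f x' = h x'"
      using elim by blast
    obtain h' where h': "h' \<in> PGL2" "\<And>x. h' (h x) = x"
      using PGL2_inverse[OF V(3)] by blast
    obtain U where U: "openin P1 U" "x \<in> U" "\<forall>y\<in>U. g y \<in> V"
      using elim V by (auto simp: topcontinuous_at_P1)
    have "g y = h' y" if "y \<in> U - N" for y
    proof -
      have "h (g y) = y"
        using that U V by (auto simp: N_def)
      then show ?thesis
        using h'(2) by metis
    qed
    moreover have "openin P1 (U - N)" "x \<in> U - N"
      using U N elim by (auto simp: N_def openin_diff)
    ultimately show ?case
      using h'(1) by blast
  qed
qed

theorem subgroup_PC_Proj: "subgroup (carrier PC_Proj) PC"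
proof -
  have carr: "carrier PC_Proj = {A \<in> carrier PC. \<exists>f\<in>A. piecewise_projective f}"
    by (simp add: PC_Proj_def)
  have E: "\<exists>f\<in>pc_maps. A = pc_eq `` {f} \<and> piecewise_projective f" if A: "A \<in> carrier PC_Proj" for A
  proof -
    obtain f0 f where "f0 \<in> pc_maps" "A = pc_eq `` {f0}" "f \<in> A" "piecewise_projective f"
      using A carr by (auto elim!: PC_carrierE)
    then show ?thesis
      using pc_class_eqI by (metis (no_types, lifting) Image_singleton_iff mem_Collect_eq case_prodD pc_eq_def)
  qed
  have I: "pc_eq `` {f} \<in> carrier PC_Proj" if "f \<in> pc_maps" "piecewise_projective f" for f
    using that PC_class_carrier equiv_class_self[OF equiv_pc_eq] carr by blast
  show ?thesis
  proof (rule group.subgroupI[OF group_PC])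
    show "carrier PC_Proj \<subseteq> carrier PC"
      using carr by blast
    have "piecewise_projective id"
      unfolding piecewise_projective_def
      using openin_topspace[of P1]
      by (intro always_eventually allI exI[of _ UNIV] conjI bexI[OF _ PGL2_id]) auto
    then show "carrier PC_Proj \<noteq> {}"
      using I pc_maps_id by blast
  next
    fix A assume "A \<in> carrier PC_Proj"
    then obtain f where f: "f \<in> pc_maps" "A = pc_eq `` {f}" "piecewise_projective f"
      using E by blast
    obtain g where g: "g \<in> pc_maps" "\<forall>\<^sub>\<infinity>x. f (g x) = x" "\<forall>\<^sub>\<infinity>x. g (f x) = x"
      using f(1) by (rule pc_mapsE)
    have "inv\<^bsub>PC\<^esub> A = pc_eq `` {g}"
      unfolding f(2) by (rule PC_inv_class[OF f(1) g(1) g(3)])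
    moreover have "piecewise_projective g"
      using f(3) g(1,2) by (rule piecewise_projective_inverse)
    ultimately show "inv\<^bsub>PC\<^esub> A \<in> carrier PC_Proj"
      using I g(1) by simp
  next
    fix A B assume "A \<in> carrier PC_Proj" "B \<in> carrier PC_Proj"
    then obtain f g where f: "f \<in> pc_maps" "A = pc_eq `` {f}" "piecewise_projective f"
      and g: "g \<in> pc_maps" "B = pc_eq `` {g}" "piecewise_projective g"
      using E by meson
    have "pc_eq `` {f \<circ> g} \<in> carrier PC_Proj"
      using I pc_maps_comp[OF f(1) g(1)] piecewise_projective_comp[OF f(3) g(3) g(1)] by blast
    then show "A \<otimes>\<^bsub>PC\<^esub> B \<in> carrier PC_Proj"
      using f g by (simp add: PC_mult_class)
  qed
qed

theorem group_PC_Proj: "group PC_Proj"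
  using subgroup.subgroup_is_group[OF subgroup_PC_Proj group_PC] by (simp add: PC_Proj_def)


section \<open>Property FW does not depend on the type of the sets acted upon\<close>

lemma FW_transport:
  fixes E :: "'e set" and G :: "('a, 'b) monoid_scheme"
  assumes FW: "property_FW_on TYPE('c) G"
    and act: "group_action G E \<phi>" and X: "X \<subseteq> E"
    and fin: "\<And>g. g \<in> carrier G \<Longrightarrow> finite (sym_diff X (\<phi> g ` X))"
    and j: "inj_on (j :: 'e \<Rightarrow> 'c) E"
  shows "\<exists>X'\<subseteq>E. (\<forall>g\<in>carrier G. \<phi> g ` X' = X') \<and> finite (sym_diff X X')"
proof -
  interpret group_action G E \<phi> by fact
  interpret G: group G using group_hom group_hom.axioms(1) by blast
  define k where "k = inv_into E j"
  have kj: "k (j x) = x" if "x \<in> E" for x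
    using that j by (simp add: k_def)
  define \<psi> where "\<psi> g = (\<lambda>y\<in>j ` E. j (\<phi> g (k y)))" for g
  have \<psi>j: "\<psi> g (j x) = j (\<phi> g x)" if "x \<in> E" for g x
    using that kj by (simp add: \<psi>_def)
  have \<phi>E: "\<phi> g x \<in> E" if "g \<in> carrier G" "x \<in> E" for g x
    using that element_image by blast
  have img: "\<psi> g ` j ` Y = j ` \<phi> g ` Y" if "Y \<subseteq> E" for g Y
    using that \<psi>j by (force simp: image_image subset_iff)
  have Bij: "\<psi> g \<in> Bij (j ` E)" if g: "g \<in> carrier G" for g
  proof -
    have "inj_on (\<psi> g) (j ` E)"
      using inj_onD[OF inj_prop[OF g]] inj_onD[OF j] \<phi>E[OF g] by (intro inj_onI) (auto simp: \<psi>j, blast)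
    moreover have "\<psi> g ` j ` E = j ` E"
      using img[of E g] surj_prop[OF g] by simp
    ultimately show ?thesis
      by (simp add: Bij_def bij_betw_def \<psi>_def)
  qed
  have hom: "\<psi> (g \<otimes>\<^bsub>G\<^esub> h) = \<psi> g \<otimes>\<^bsub>BijGroup (j ` E)\<^esub> \<psi> h"
    if "g \<in> carrier G" "h \<in> carrier G" for g h
  proof -
    have "\<psi> (g \<otimes>\<^bsub>G\<^esub> h) = compose (j ` E) (\<psi> g) (\<psi> h)"
    proof (rule extensionalityI[of _ "j ` E"])
      fix y assume "y \<in> j ` E"
      then obtain x where "x \<in> E" "y = j x" by blast
      then show "\<psi> (g \<otimes>\<^bsub>G\<^esub> h) y = compose (j ` E) (\<psi> g) (\<psi> h) y"
        using that \<phi>E by (simp add: compose_def \<psi>j composition_rule)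
    qed (simp_all add: \<psi>_def)
    then show ?thesis
      using Bij that by (simp add: BijGroup_def)
  qed
  have act': "group_action G (j ` E) \<psi>"
    unfolding group_action_def group_hom_def group_hom_axioms_def
    using Bij hom G.is_group group_BijGroup by (auto simp: hom_def BijGroup_def)
  have "finite (sym_diff (j ` X) (\<psi> g ` j ` X))" if g: "g \<in> carrier G" for g
  proof -
    have "sym_diff (j ` X) (\<psi> g ` j ` X) \<subseteq> j ` sym_diff X (\<phi> g ` X)"
      using img[OF X] by auto
    then show ?thesis
      using fin[OF g] by (meson finite_imageI finite_subset)
  qed
  then have "\<exists>Y\<subseteq>j ` E. (\<forall>g\<in>carrier G. \<psi> g ` Y = Y) \<and> finite (sym_diff (j ` X) Y)"
    using act' image_mono[OF X, of j]
    by (intro FW[unfolded property_FW_on_def, rule_format, of "j ` E" \<psi> "j ` X"]) simp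
  then obtain Y where Y: "Y \<subseteq> j ` E" "\<And>g. g \<in> carrier G \<Longrightarrow> \<psi> g ` Y = Y"
    "finite (sym_diff (j ` X) Y)"
    by blast
  obtain Z where Z: "Z \<subseteq> E" "Y = j ` Z"
    using Y(1) by (meson subset_image_iff)
  have "\<phi> g ` Z = Z" if g: "g \<in> carrier G" for g
  proof -
    have "j ` \<phi> g ` Z = j ` Z"
      using img[OF Z(1)] Y(2)[OF g] Z(2) by simp
    moreover have "\<phi> g ` Z \<subseteq> E"
      using \<phi>E[OF g] Z(1) by blast
    ultimately show ?thesis
      using j Z(1) by (simp add: inj_on_image_eq_iff)
  qed
  moreover have "finite (sym_diff X Z)"
  proof -
    have "j ` sym_diff X Z \<subseteq> sym_diff (j ` X) Y"
      using j X Z by (auto simp: inj_on_def)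
    moreover have "inj_on j (sym_diff X Z)"
      using j by (rule inj_on_subset) (use X Z in blast)
    ultimately show ?thesis
      using Y(3) finite_subset finite_imageD by metis
  qed
  ultimately show ?thesis
    using Z(1) by blast
qed

theorem property_FW_universal:
  includes cardinal_syntax
  fixes G :: "('a, 'b) monoid_scheme"
  assumes FW: "property_FW G"
  shows "property_FW_on TYPE('e) G"
  unfolding property_FW_on_def
proof (intro allI impI, elim conjE)
  fix E :: "'e set" and \<phi> X
  assume act: "group_action G E \<phi>" and X: "X \<subseteq> E"
    and fin: "\<forall>g\<in>carrier G. finite (sym_diff X (\<phi> g ` X))"
  interpret group_action G E \<phi> by fact
  interpret G: group G using group_hom group_hom.axioms(1) by blast
  have \<phi>E: "\<phi> g x \<in> E" if "g \<in> carrier G" "x \<in> E" for g x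
    using that element_image by blast
  define D where "D g = sym_diff X (\<phi> g ` X)" for g
  have DE: "D g \<subseteq> E" if "g \<in> carrier G" for g
    using X \<phi>E[OF that] by (auto simp: D_def)
  \<comment> \<open>the union of the orbits whose trace on \<open>X\<close> is not invariant\<close>
  define E0 where "E0 = (\<Union>h\<in>carrier G. \<Union>g\<in>carrier G. \<phi> h ` D g)"
  have E0E: "E0 \<subseteq> E"
    using DE \<phi>E by (fastforce simp: E0_def)
  have inv0: "\<phi> g x \<in> E0" if g: "g \<in> carrier G" and x: "x \<in> E0" for g x
  proof -
    obtain h g' y where h: "h \<in> carrier G" "g' \<in> carrier G" "y \<in> D g'" "x = \<phi> h y"
      using x by (auto simp: E0_def)
    then have "\<phi> g x = \<phi> (g \<otimes>\<^bsub>G\<^esub> h) y"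
      using DE[OF h(2)] g composition_rule[of y g h] by auto
    then show ?thesis
      using h g by (auto simp: E0_def)
  qed
  have DE0: "D g \<subseteq> E0" if "g \<in> carrier G" for g
  proof
    fix x assume x: "x \<in> D g"
    then have "\<phi> \<one>\<^bsub>G\<^esub> x = x"
      using DE[OF that] id_eq_one by (metis restrict_apply' subsetD)
    then show "x \<in> E0"
      using x that G.one_closed unfolding E0_def by (metis UN_I image_eqI)
  qed
  have cancel_left: "\<phi> (inv\<^bsub>G\<^esub> g) (\<phi> g x) = x" if "g \<in> carrier G" "x \<in> E" for g x
    using that orbit_sym_aux by blast
  have cancel_right: "\<phi> g (\<phi> (inv\<^bsub>G\<^esub> g) x) = x" if "g \<in> carrier G" "x \<in> E" for g x
    using cancel_left[of "inv\<^bsub>G\<^esub> g" x] that by simp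
  have invI: "\<phi> g ` Y = Y" if "g \<in> carrier G" "Y \<subseteq> E"
    "\<And>g x. g \<in> carrier G \<Longrightarrow> x \<in> Y \<Longrightarrow> \<phi> g x \<in> Y" for g Y
  proof
    show "\<phi> g ` Y \<subseteq> Y" using that by blast
    show "Y \<subseteq> \<phi> g ` Y"
    proof
      fix x assume "x \<in> Y"
      then show "x \<in> \<phi> g ` Y"
        using that cancel_right[of g x] G.inv_closed by (metis image_eqI subsetD)
    qed
  qed
  show "\<exists>X'\<subseteq>E. (\<forall>g\<in>carrier G. \<phi> g ` X' = X') \<and> finite (sym_diff X X')"
  proof (cases "finite (carrier G)")
    case True
    then have f0: "finite E0"
      using fin unfolding E0_def D_def by blast
    have "\<phi> g x \<in> X - E0" if "g \<in> carrier G" "x \<in> X - E0" for g x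
    proof -
      have x: "x \<in> E" using that X by blast
      have n: "\<phi> g x \<notin> E0"
        using inv0[of "inv\<^bsub>G\<^esub> g" "\<phi> g x"] cancel_left[OF that(1) x] that by auto
      moreover have "\<phi> g x \<in> X"
        using n DE0[OF that(1)] that by (auto simp: D_def)
      ultimately show ?thesis by blast
    qed
    then have "\<forall>g\<in>carrier G. \<phi> g ` (X - E0) = X - E0"
      using invI[of _ "X - E0"] X by blast
    moreover have "finite (sym_diff X (X - E0))"
      by (rule finite_subset[OF _ f0]) blast
    moreover have "X - E0 \<subseteq> E"
      using X by blast
    ultimately show ?thesis
      by (intro exI[of _ "X - E0"]) simp
  next
    case False
    have leD: "|\<phi> h ` D g| \<le>o |carrier G|" if "g \<in> carrier G" for h g
    proof -
      have "finite (\<phi> h ` D g)"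
        using fin that by (simp add: D_def)
      then show ?thesis
        using False ordLeq_total[OF card_of_Well_order card_of_Well_order] card_of_ordLeq_finite
        by blast
    qed
    have r: "|carrier G| \<le>o |carrier G|" by (rule ordLeq_refl[OF card_of_Card_order])
    have "|\<Union>g\<in>carrier G. \<phi> h ` D g| \<le>o |carrier G|" for h
      using leD by (intro card_of_UNION_ordLeq_infinite[OF False r]) blast
    then have "|E0| \<le>o |carrier G|"
      unfolding E0_def by (intro card_of_UNION_ordLeq_infinite[OF False r]) blast
    then obtain j :: "'e \<Rightarrow> 'a" where j: "inj_on j E0"
      unfolding card_of_ordLeq[symmetric] by blast
    define \<psi> where "\<psi> g = restrict (\<phi> g) E0" for g
    have Bij: "\<psi> g \<in> Bij E0" if g: "g \<in> carrier G" for g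
    proof -
      have "inj_on (\<phi> g) E0"
        using inj_prop[OF g] E0E by (rule inj_on_subset)
      moreover have "\<phi> g ` E0 = E0"
        using invI[OF g E0E] inv0 by blast
      ultimately show ?thesis
        by (simp add: Bij_def bij_betw_def \<psi>_def)
    qed
    have hom: "\<psi> (g \<otimes>\<^bsub>G\<^esub> h) = \<psi> g \<otimes>\<^bsub>BijGroup E0\<^esub> \<psi> h"
      if "g \<in> carrier G" "h \<in> carrier G" for g h
    proof -
      have "\<psi> (g \<otimes>\<^bsub>G\<^esub> h) = compose E0 (\<psi> g) (\<psi> h)"
        using that inv0 E0E composition_rule
        by (auto simp: \<psi>_def compose_def fun_eq_iff restrict_def)
      then show ?thesis
        using Bij that by (simp add: BijGroup_def)
    qed
    have act0: "group_action G E0 \<psi>"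
      unfolding group_action_def group_hom_def group_hom_axioms_def
      using Bij hom G.is_group group_BijGroup by (auto simp: hom_def BijGroup_def)
    have fin0: "finite (sym_diff (X \<inter> E0) (\<psi> g ` (X \<inter> E0)))" if g: "g \<in> carrier G" for g
    proof -
      have "sym_diff (X \<inter> E0) (\<psi> g ` (X \<inter> E0)) \<subseteq> D g"
      proof
        fix x assume x: "x \<in> sym_diff (X \<inter> E0) (\<psi> g ` (X \<inter> E0))"
        show "x \<in> D g"
        proof (cases "x \<in> X \<inter> E0")
          case True
          have "x \<notin> \<phi> g ` X"
          proof
            assume "x \<in> \<phi> g ` X"
            then obtain y where y: "y \<in> X" "x = \<phi> g y" by blast
            then have "y \<in> E0"
              using True inv0[of "inv\<^bsub>G\<^esub> g" x] cancel_left[of g y] g X by auto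
            then have "x \<in> \<psi> g ` (X \<inter> E0)"
              using y by (auto simp: \<psi>_def)
            then show False using x True by blast
          qed
          then show ?thesis using True by (simp add: D_def)
        next
          case False
          then obtain y where "y \<in> X \<inter> E0" "x = \<phi> g y"
            using x by (auto simp: \<psi>_def)
          then show ?thesis
            using False inv0[OF g] by (auto simp: D_def)
        qed
      qed
      then show ?thesis
        using fin g by (metis D_def finite_subset)
    qed
    obtain Y where Y: "Y \<subseteq> E0" "\<And>g. g \<in> carrier G \<Longrightarrow> \<psi> g ` Y = Y"
      "finite (sym_diff (X \<inter> E0) Y)"
      using FW_transport[OF FW[unfolded property_FW_def] act0 Int_lower2 fin0 j] by blast
    define X' where "X' = Y \<union> (X - E0)"
    have "\<phi> g x \<in> X'" if g: "g \<in> carrier G" and x: "x \<in> X'" for g x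
    proof (cases "x \<in> Y")
      case True
      then have "\<psi> g x \<in> Y" "\<psi> g x = \<phi> g x"
        using Y(1) Y(2)[OF g] by (auto simp: \<psi>_def)
      then show ?thesis by (simp add: X'_def)
    next
      case False
      then have x': "x \<in> X" "x \<notin> E0" "x \<in> E"
        using x X by (auto simp: X'_def)
      have n: "\<phi> g x \<notin> E0"
        using inv0[of "inv\<^bsub>G\<^esub> g" "\<phi> g x"] cancel_left[OF g x'(3)] g x' by auto
      moreover have "\<phi> g x \<in> X"
        using n DE0[OF g] x' by (auto simp: D_def)
      ultimately show ?thesis by (simp add: X'_def)
    qed
    moreover have X'E: "X' \<subseteq> E"
      using Y(1) E0E X by (auto simp: X'_def)
    ultimately have "\<forall>g\<in>carrier G. \<phi> g ` X' = X'"
      using invI[of _ X'] by blast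
    moreover have "finite (sym_diff X X')"
      by (rule finite_subset[OF _ Y(3)]) (use Y(1) in \<open>auto simp: X'_def\<close>)
    ultimately show ?thesis
      using X'E by (intro exI[of _ X']) simp
  qed
qed

end

theory Submission
  imports Defs "HOL-Computational_Algebra.Primes" "HOL-Algebra.Generated_Groups"
begin

text \<open>
  The angle \<open>\<theta>\<close> of a line identifies the projective line with \<open>\<real> / \<pi>\<int>\<close>, so that homographies lift to
  monotone bijections of the real line. Cut the circle open at one point. A piecewise projective
  transformation \<open>f\<close> is then recorded by its one-sided germs: to a point \<open>p\<close> of the interval
  \<open>[0, \<pi>]\<close> approached from one side it associates a lift \<open>c f p\<close> of a homography, and \<open>c\<close> is a
  cocycle which, for each \<open>f\<close>, jumps at finitely many points only.

  The first idea is that Property FW removes the breaks. Consider all ways to continue the circle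
  projectively beyond a one-sided point \<open>p\<close>, that is, all gluings of \<open>p\<close> to a one-sided point \<open>q\<close>
  by a lift. The group acts on this set, and the gluings of the two sides of each point by the identity
  form a subset that every group element preserves up to finitely many members. By Property FW
  there is an invariant set of gluings which differs from it by a finite set (\<open>FW_reglue\<close>). The effect is that the circle is cut at
  finitely many points and its pieces are glued together again in another way, leaving perhaps some ends free, so that the
  group acts on the new curve by projective transformations without breaks.

  The new curve has finitely many components, and each is developed into the real line, the universal
  cover of the projective line. A subgroup \<open>\<Delta>\<close> of finite index preserves a given component and the
  orientation, and acts on the developed component through lifts of homographies; such a lift is
  well defined up to the deck transformations, which form a cyclic group (\<open>Hplus_cyclic\<close>). There are three cases.
  If the developed component is bounded above, its supremum is a fixed point of all these lifts. If it
  is unbounded and the deck group is generated by a lift \<open>t\<close> of a nontrivial homography, every lift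
  conjugates \<open>t\<close> to \<open>t\<close> or to its inverse. Otherwise the deck transformations are translations by multiples of
  \<open>\<pi>\<close>, and \<open>\<Delta>\<close> acts on the projective line by homographies. If some element of \<open>\<Delta>\<close> then acts
  hyperbolically, its powers play ping-pong with those of a conjugate, unless \<open>\<Delta>\<close> has a finite orbit
  on the projective line (\<open>hyperbolic_pingpong\<close>); if none does, the matrices have a common eigenvector or all commute with
  one nonscalar matrix (\<open>no_hyperbolic\<close>).

  The second idea is that Property FW rules out everything except ping-pong. A group with
  Property FW has finite abelianization (\<open>FW_abelianization_finite\<close>), so passing to derived subgroups
  means passing to subgroups of finite index. In each case without ping-pong the lifts lie in a
  solvable group after passing to a subgroup of finite index, hence some subgroup of finite index acts trivially on the component
  (\<open>pingpong_or_Fix\<close>). If this happens for every component, a subgroup of finite index acts trivially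
  on the whole curve and is therefore trivial, and the group is finite.

  So an infinite group with Property FW contains a ping-pong pair inside a subgroup of finite index. The pair generates a free group,
  and it also excludes an invariant mean, because the two attracting regions of each of the two
  elements would together have full measure.
\<close>

section \<open>Subgroups of finite index\<close>

definition finite_index :: "('a, 'b) monoid_scheme \<Rightarrow> 'a set \<Rightarrow> bool" where
  "finite_index G H \<longleftrightarrow>
     (\<exists>T\<subseteq>carrier G. finite T \<and> (\<forall>x\<in>carrier G. \<exists>t\<in>T. inv\<^bsub>G\<^esub> t \<otimes>\<^bsub>G\<^esub> x \<in> H))"

context group
begin

lemma cancel_left_inv [simp]:
  assumes "x \<in> carrier G" "y \<in> carrier G"
  shows "inv x \<otimes> (x \<otimes> y) = y" "x \<otimes> (inv x \<otimes> y) = y"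
  using m_assoc[of "inv x" x y] m_assoc[of x "inv x" y] assms by simp_all

lemma coset_quotient:
  assumes "subgroup H G" "t \<in> carrier G" "x \<in> carrier G" "y \<in> carrier G"
    "inv t \<otimes> x \<in> H" "inv t \<otimes> y \<in> H"
  shows "inv x \<otimes> y \<in> H"
proof -
  have "inv (inv t \<otimes> x) \<otimes> (inv t \<otimes> y) \<in> H"
    using assms(1,5,6) by (simp add: subgroup.m_closed subgroup.m_inv_closed)
  also have "inv (inv t \<otimes> x) \<otimes> (inv t \<otimes> y) = inv x \<otimes> y"
    using assms(2-4) by (simp add: inv_mult_group m_assoc)
  finally show ?thesis .
qed

lemma finite_indexI:
  assumes fin: "finite (\<tau> ` carrier G)"
    and \<tau>: "\<And>x y. x \<in> carrier G \<Longrightarrow> y \<in> carrier G \<Longrightarrow> \<tau> x = \<tau> y \<Longrightarrow> inv x \<otimes> y \<in> H"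
  shows "finite_index G H"
proof -
  define r where "r k = (SOME x. x \<in> carrier G \<and> \<tau> x = k)" for k
  have r: "r (\<tau> x) \<in> carrier G \<and> \<tau> (r (\<tau> x)) = \<tau> x" if "x \<in> carrier G" for x
    unfolding r_def by (rule someI[of _ x]) (use that in simp)
  show ?thesis
    unfolding finite_index_def
  proof (intro exI conjI ballI)
    show "r ` \<tau> ` carrier G \<subseteq> carrier G" using r by blast
    show "finite (r ` \<tau> ` carrier G)" using fin by simp
    fix x assume x: "x \<in> carrier G"
    show "\<exists>t\<in>r ` \<tau> ` carrier G. inv t \<otimes> x \<in> H"
      by (rule bexI[of _ "r (\<tau> x)"]) (use \<tau>[of "r (\<tau> x)" x] r[OF x] x in auto)
  qed
qed

text \<open>The representatives are chosen to be constant on left cosets, so that group elements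
  act on them.\<close>

lemma finite_indexE:
  assumes H: "subgroup H G" and fi: "finite_index G H"
  obtains \<tau> where "finite (\<tau> ` carrier G)" "\<And>x. x \<in> carrier G \<Longrightarrow> \<tau> x \<in> carrier G"
    "\<And>x. x \<in> carrier G \<Longrightarrow> inv (\<tau> x) \<otimes> x \<in> H"
    "\<And>x y. x \<in> carrier G \<Longrightarrow> y \<in> carrier G \<Longrightarrow> inv x \<otimes> y \<in> H \<Longrightarrow> \<tau> x = \<tau> y"
proof -
  obtain T where T: "T \<subseteq> carrier G" "finite T" "\<And>x. x \<in> carrier G \<Longrightarrow> \<exists>t\<in>T. inv t \<otimes> x \<in> H"
    using fi unfolding finite_index_def by blast
  define \<tau> where "\<tau> x = (SOME t. t \<in> T \<and> inv t \<otimes> x \<in> H)" for x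
  have \<tau>: "\<tau> x \<in> T \<and> inv (\<tau> x) \<otimes> x \<in> H" if "x \<in> carrier G" for x
    unfolding \<tau>_def by (rule someI_ex) (use T(3)[OF that] in blast)
  have const: "\<tau> x = \<tau> y" if xy: "x \<in> carrier G" "y \<in> carrier G" "inv x \<otimes> y \<in> H" for x y
  proof -
    have "inv t \<otimes> x \<in> H \<longleftrightarrow> inv t \<otimes> y \<in> H" if t: "t \<in> T" for t
    proof
      have tc: "t \<in> carrier G" using t T by blast
      have e1: "(inv t \<otimes> x) \<otimes> (inv x \<otimes> y) = inv t \<otimes> y"
        using xy tc by (simp add: m_assoc)
      have e2: "(inv t \<otimes> y) \<otimes> inv (inv x \<otimes> y) = inv t \<otimes> x"
        using xy tc by (simp add: m_assoc inv_mult_group)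
      show "inv t \<otimes> y \<in> H" if "inv t \<otimes> x \<in> H"
        using subgroup.m_closed[OF H that xy(3)] e1 by simp
      show "inv t \<otimes> x \<in> H" if "inv t \<otimes> y \<in> H"
        using subgroup.m_closed[OF H that subgroup.m_inv_closed[OF H xy(3)]] e2 by simp
    qed
    then show ?thesis
      unfolding \<tau>_def by (metis (lifting))
  qed
  show ?thesis
  proof (rule that[of \<tau>])
    show "finite (\<tau> ` carrier G)"
      by (rule finite_subset[OF _ T(2)]) (use \<tau> in blast)
  qed (use \<tau> T(1) const in blast)+
qed

lemma finite_index_mono: "finite_index G H \<Longrightarrow> H \<subseteq> K \<Longrightarrow> finite_index G K"
  unfolding finite_index_def by (meson subsetD)

lemma finite_index_carrier: "finite_index G (carrier G)"
  by (rule finite_indexI[of "\<lambda>_. ()"]) auto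

lemma finite_index_Int:
  assumes "subgroup H G" "finite_index G H" "subgroup K G" "finite_index G K"
  shows "finite_index G (H \<inter> K)"
proof -
  obtain \<tau> where t: "finite (\<tau> ` carrier G)" "\<And>x. x \<in> carrier G \<Longrightarrow> \<tau> x \<in> carrier G"
    "\<And>x. x \<in> carrier G \<Longrightarrow> inv (\<tau> x) \<otimes> x \<in> H"
    by (rule finite_indexE[OF assms(1,2)]) blast
  obtain \<tau>' where t': "finite (\<tau>' ` carrier G)" "\<And>x. x \<in> carrier G \<Longrightarrow> \<tau>' x \<in> carrier G"
    "\<And>x. x \<in> carrier G \<Longrightarrow> inv (\<tau>' x) \<otimes> x \<in> K"
    by (rule finite_indexE[OF assms(3,4)]) blast
  show ?thesis
  proof (rule finite_indexI[of "\<lambda>x. (\<tau> x, \<tau>' x)"])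
    show "finite ((\<lambda>x. (\<tau> x, \<tau>' x)) ` carrier G)"
      by (rule finite_subset[of _ "\<tau> ` carrier G \<times> \<tau>' ` carrier G"]) (use t t' in auto)
    fix x y assume "x \<in> carrier G" "y \<in> carrier G" and eq: "(\<tau> x, \<tau>' x) = (\<tau> y, \<tau>' y)"
    then show "inv x \<otimes> y \<in> H \<inter> K"
      using coset_quotient[OF assms(1), of "\<tau> x" x y] coset_quotient[OF assms(3), of "\<tau>' x" x y]
        t(2,3)[of x] t'(2,3)[of x] t(3)[of y] t'(3)[of y] by simp
  qed
qed

lemma finite_index_INT:
  assumes "finite I" "\<And>i. i \<in> I \<Longrightarrow> subgroup (H i) G \<and> finite_index G (H i)"
  shows "finite_index G (carrier G \<inter> (\<Inter>i\<in>I. H i))"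
proof -
  have "subgroup (carrier G \<inter> (\<Inter>i\<in>I. H i)) G \<and> finite_index G (carrier G \<inter> (\<Inter>i\<in>I. H i))"
    using assms
  proof (induction I)
    case empty
    then show ?case by (simp add: finite_index_carrier subgroup_self)
  next
    case (insert i I)
    have "carrier G \<inter> (\<Inter>j\<in>insert i I. H j) = H i \<inter> (carrier G \<inter> (\<Inter>i\<in>I. H i))"
      by auto
    then show ?case
      using insert finite_index_Int[of "H i"] subgroups_Inter_pair[of "H i"] by (metis insertCI)
  qed
  then show ?thesis by blast
qed

lemma finite_index_trans:
  assumes H: "subgroup H G" "finite_index G H"
    and K: "subgroup K G" "K \<subseteq> H" "finite_index (G\<lparr>carrier := H\<rparr>) K"
  shows "finite_index G K"
proof -
  obtain \<tau> where t: "finite (\<tau> ` carrier G)" "\<And>x. x \<in> carrier G \<Longrightarrow> \<tau> x \<in> carrier G"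
    "\<And>x. x \<in> carrier G \<Longrightarrow> inv (\<tau> x) \<otimes> x \<in> H"
    by (rule finite_indexE[OF H]) blast
  have "subgroup K (G\<lparr>carrier := H\<rparr>)"
    using K H subgroup_incl by blast
  then obtain \<sigma> where "finite (\<sigma> ` carrier (G\<lparr>carrier := H\<rparr>))"
    "\<And>x. x \<in> carrier (G\<lparr>carrier := H\<rparr>) \<Longrightarrow> \<sigma> x \<in> carrier (G\<lparr>carrier := H\<rparr>)"
    "\<And>x. x \<in> carrier (G\<lparr>carrier := H\<rparr>) \<Longrightarrow>
      inv\<^bsub>G\<lparr>carrier := H\<rparr>\<^esub> (\<sigma> x) \<otimes>\<^bsub>G\<lparr>carrier := H\<rparr>\<^esub> x \<in> K"
    by (rule group.finite_indexE[OF subgroup_imp_group[OF H(1)] _ K(3)]) blast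
  note \<sigma> = this
  have s1: "finite (\<sigma> ` H)" using \<sigma>(1) by simp
  have s2: "\<sigma> x \<in> H" if "x \<in> H" for x using \<sigma>(2)[of x] that by simp
  have s3: "inv (\<sigma> x) \<otimes> x \<in> K" if "x \<in> H" for x
    using \<sigma>(3)[of x] that m_inv_consistent[OF H(1) s2[OF that]] by simp
  have Hc: "\<And>x. x \<in> H \<Longrightarrow> x \<in> carrier G" using subgroup.mem_carrier[OF H(1)] by blast
  show ?thesis
  proof (rule finite_indexI[of "\<lambda>x. (\<tau> x, \<sigma> (inv (\<tau> x) \<otimes> x))"])
    show "finite ((\<lambda>x. (\<tau> x, \<sigma> (inv (\<tau> x) \<otimes> x))) ` carrier G)"
    proof (rule finite_subset)
      show "(\<lambda>x. (\<tau> x, \<sigma> (inv (\<tau> x) \<otimes> x))) ` carrier G \<subseteq> \<tau> ` carrier G \<times> \<sigma> ` H"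
        using t(3) by blast
      show "finite (\<tau> ` carrier G \<times> \<sigma> ` H)"
        using t(1) s1 by blast
    qed
    fix x y assume xy: "x \<in> carrier G" "y \<in> carrier G"
      and eq: "(\<tau> x, \<sigma> (inv (\<tau> x) \<otimes> x)) = (\<tau> y, \<sigma> (inv (\<tau> y) \<otimes> y))"
    let ?u = "inv (\<tau> x) \<otimes> x" and ?v = "inv (\<tau> x) \<otimes> y"
    have uv: "?u \<in> H" "?v \<in> H" using t(3)[OF xy(1)] t(3)[OF xy(2)] eq by simp_all
    have eq2: "\<sigma> ?u = \<sigma> ?v" using eq by (metis prod.inject)
    have "inv ?u \<otimes> ?v \<in> K"
      by (rule coset_quotient[OF K(1) Hc[OF s2[OF uv(1)]] Hc[OF uv(1)] Hc[OF uv(2)]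
            s3[OF uv(1)] s3[OF uv(2), folded eq2]])
    also have "inv ?u \<otimes> ?v = inv x \<otimes> y"
      using xy t(2)[OF xy(1)] by (simp add: inv_mult_group m_assoc)
    finally show "inv x \<otimes> y \<in> K" .
  qed
qed

lemma finite_index_one_imp_finite:
  assumes "finite_index G {\<one>}"
  shows "finite (carrier G)"
proof -
  obtain T where T: "T \<subseteq> carrier G" "finite T" "\<And>x. x \<in> carrier G \<Longrightarrow> \<exists>t\<in>T. inv t \<otimes> x \<in> {\<one>}"
    using assms unfolding finite_index_def by blast
  have "x \<in> T" if x: "x \<in> carrier G" for x
  proof -
    obtain t where "t \<in> T" "inv t \<otimes> x = \<one>" using T(3)[OF x] by blast
    then have "t \<in> T" "t \<in> carrier G" "t \<otimes> (inv t \<otimes> x) = t" using T(1) by auto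
    then show ?thesis using cancel_left_inv(2)[of t x] x by simp
  qed
  then have "carrier G \<subseteq> T" by auto
  then show ?thesis using T(2) by (rule finite_subset)
qed

end


section \<open>Groups with Property FW\<close>

lemma group_action_restrict:
  assumes G: "group G"
    and closed: "\<And>g x. g \<in> carrier G \<Longrightarrow> x \<in> E \<Longrightarrow> act g x \<in> E"
    and one: "\<And>x. x \<in> E \<Longrightarrow> act \<one>\<^bsub>G\<^esub> x = x"
    and mult: "\<And>g h x. g \<in> carrier G \<Longrightarrow> h \<in> carrier G \<Longrightarrow> x \<in> E \<Longrightarrow>
      act (g \<otimes>\<^bsub>G\<^esub> h) x = act g (act h x)"
  shows "group_action G E (\<lambda>g. restrict (act g) E)"
proof -
  interpret group G by fact
  have inverse: "act (inv\<^bsub>G\<^esub> g) (act g x) = x" "act g (act (inv\<^bsub>G\<^esub> g) x) = x"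
    if "g \<in> carrier G" "x \<in> E" for g x
    using mult[of "inv\<^bsub>G\<^esub> g" g x] mult[of g "inv\<^bsub>G\<^esub> g" x] one that by simp_all
  have Bij: "restrict (act g) E \<in> Bij E" if g: "g \<in> carrier G" for g
  proof -
    have "bij_betw (act g) E E"
      by (rule bij_betw_byWitness[where f' = "act (inv\<^bsub>G\<^esub> g)"]) (use g inverse closed in auto)
    then show ?thesis by (simp add: Bij_def)
  qed
  have "restrict (act (g \<otimes>\<^bsub>G\<^esub> h)) E = compose E (restrict (act g) E) (restrict (act h) E)"
    if "g \<in> carrier G" "h \<in> carrier G" for g h
    using that mult closed by (auto simp: compose_def fun_eq_iff restrict_def)
  then show ?thesis
    unfolding group_action_def group_hom_def group_hom_axioms_def
    using Bij group_axioms group_BijGroup by (auto simp: hom_def BijGroup_def)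
qed

text \<open>In the hypothesis and in the conclusion one inclusion is enough, because it can be
  applied to the inverse element as well. The action may be on a set of any type by
  \<open>property_FW_universal\<close>.\<close>

lemma FW_commensurated:
  fixes act :: "'a \<Rightarrow> 'e \<Rightarrow> 'e"
  assumes FW: "property_FW G" and G: "group G"
    and closed: "\<And>g x. g \<in> carrier G \<Longrightarrow> x \<in> E \<Longrightarrow> act g x \<in> E"
    and one: "\<And>x. x \<in> E \<Longrightarrow> act \<one>\<^bsub>G\<^esub> x = x"
    and mult: "\<And>g h x. g \<in> carrier G \<Longrightarrow> h \<in> carrier G \<Longrightarrow> x \<in> E \<Longrightarrow>
      act (g \<otimes>\<^bsub>G\<^esub> h) x = act g (act h x)"
    and X: "X \<subseteq> E" and fin: "\<And>g. g \<in> carrier G \<Longrightarrow> finite (act g ` X - X)"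
  obtains Y where "Y \<subseteq> E" "\<And>g x. g \<in> carrier G \<Longrightarrow> x \<in> Y \<Longrightarrow> act g x \<in> Y"
    "finite (sym_diff X Y)"
proof -
  interpret group G by fact
  have "finite (sym_diff X (act g ` X))" if g: "g \<in> carrier G" for g
  proof -
    have "X - act g ` X \<subseteq> act g ` (act (inv\<^bsub>G\<^esub> g) ` X - X)"
    proof
      fix x assume x: "x \<in> X - act g ` X"
      have "act g (act (inv\<^bsub>G\<^esub> g) x) = x"
        using mult[of g "inv\<^bsub>G\<^esub> g" x] g x X one by auto
      then show "x \<in> act g ` (act (inv\<^bsub>G\<^esub> g) ` X - X)"
        using x by (metis DiffD1 DiffD2 DiffI imageI)
    qed
    then show ?thesis
      using fin[OF g] fin[of "inv\<^bsub>G\<^esub> g"] g by (meson finite_Un finite_imageI finite_subset inv_closed)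
  qed
  moreover have "restrict (act g) E ` X = act g ` X" for g
    using X by (auto simp: image_def)
  ultimately have "\<exists>Y\<subseteq>E. (\<forall>g\<in>carrier G. restrict (act g) E ` Y = Y) \<and> finite (sym_diff X Y)"
    using property_FW_universal[OF FW, unfolded property_FW_on_def, rule_format,
        of E "\<lambda>g. restrict (act g) E" X]
      group_action_restrict[of G E act, OF G closed one mult] X by simp
  then obtain Y where Y: "Y \<subseteq> E" "\<And>g. g \<in> carrier G \<Longrightarrow> restrict (act g) E ` Y = Y"
    "finite (sym_diff X Y)" by blast
  show ?thesis
  proof (rule that[OF Y(1) _ Y(3)])
    fix g x assume "g \<in> carrier G" "x \<in> Y"
    then show "act g x \<in> Y" using Y(1) Y(2)[of g] by (metis image_eqI restrict_apply' subsetD)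
  qed
qed

text \<open>It suffices that each element maps \<open>Y\<close> into itself: applied to the
  inverse, this gives equality.\<close>

lemma property_FWI:
  fixes G :: "('a, 'b) monoid_scheme"
  assumes ex: "\<And>(E :: 'a set) act X. X \<subseteq> E \<Longrightarrow>
      (\<And>g x. g \<in> carrier G \<Longrightarrow> x \<in> E \<Longrightarrow> act g x \<in> E) \<Longrightarrow>
      (\<And>x. x \<in> E \<Longrightarrow> act \<one>\<^bsub>G\<^esub> x = x) \<Longrightarrow>
      (\<And>g h x. g \<in> carrier G \<Longrightarrow> h \<in> carrier G \<Longrightarrow> x \<in> E \<Longrightarrow>
        act (g \<otimes>\<^bsub>G\<^esub> h) x = act g (act h x)) \<Longrightarrow>
      (\<And>g. g \<in> carrier G \<Longrightarrow> finite (act g ` X - X)) \<Longrightarrow>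
      \<exists>Y\<subseteq>E. (\<forall>g\<in>carrier G. act g ` Y \<subseteq> Y) \<and> finite (sym_diff X Y)"
  shows "property_FW G"
  unfolding property_FW_def property_FW_on_def
proof (intro allI impI, elim conjE)
  fix E :: "'a set" and \<phi> X
  assume act: "group_action G E \<phi>" and X: "X \<subseteq> E"
    and fin: "\<forall>g\<in>carrier G. finite (sym_diff X (\<phi> g ` X))"
  interpret group_action G E \<phi> by fact
  interpret G: group G using group_hom group_hom.axioms(1) by blast
  have closed: "\<phi> g x \<in> E" if "g \<in> carrier G" "x \<in> E" for g x
    using that element_image by blast
  have one: "\<phi> \<one>\<^bsub>G\<^esub> x = x" if "x \<in> E" for x
    using id_eq_one that by (metis restrict_apply')
  have "\<exists>Y\<subseteq>E. (\<forall>g\<in>carrier G. \<phi> g ` Y \<subseteq> Y) \<and> finite (sym_diff X Y)"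
    by (rule ex) (use X closed one composition_rule fin in auto)
  then obtain Y where Y: "Y \<subseteq> E" "\<And>g. g \<in> carrier G \<Longrightarrow> \<phi> g ` Y \<subseteq> Y" "finite (sym_diff X Y)"
    by blast
  have "Y \<subseteq> \<phi> g ` Y" if g: "g \<in> carrier G" for g
  proof
    fix x assume x: "x \<in> Y"
    then have "\<phi> (inv\<^bsub>G\<^esub> g) x \<in> Y" "\<phi> g (\<phi> (inv\<^bsub>G\<^esub> g) x) = x"
      using Y(1) Y(2)[of "inv\<^bsub>G\<^esub> g"] g composition_rule[of x g "inv\<^bsub>G\<^esub> g"] one by auto
    then show "x \<in> \<phi> g ` Y" by (metis imageI)
  qed
  then show "\<exists>X'\<subseteq>E. (\<forall>g\<in>carrier G. \<phi> g ` X' = X') \<and> finite (sym_diff X X')"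
    using Y by (metis subset_antisym)
qed

text \<open>Every action of \<open>Q\<close> is an action of \<open>G\<close> through
  \<open>f\<close>.\<close>

lemma FW_hom_surj:
  fixes G :: "('a, 'b) monoid_scheme" and Q :: "('c, 'd) monoid_scheme"
  assumes FW: "property_FW G" and G: "group G" and Q: "group Q"
    and f: "f \<in> hom G Q" and surj: "f ` carrier G = carrier Q"
  shows "property_FW Q"
proof (rule property_FWI)
  fix E :: "'c set" and act X
  assume X: "X \<subseteq> E"
    and closed: "\<And>g x. g \<in> carrier Q \<Longrightarrow> x \<in> E \<Longrightarrow> act g x \<in> E"
    and one: "\<And>x. x \<in> E \<Longrightarrow> act \<one>\<^bsub>Q\<^esub> x = x"
    and mult: "\<And>g h x. g \<in> carrier Q \<Longrightarrow> h \<in> carrier Q \<Longrightarrow> x \<in> E \<Longrightarrow>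
        act (g \<otimes>\<^bsub>Q\<^esub> h) x = act g (act h x)"
    and fin: "\<And>g. g \<in> carrier Q \<Longrightarrow> finite (act g ` X - X)"
  interpret group_hom G Q f
    by (rule group_hom.intro[OF G Q group_hom_axioms.intro[OF f]])
  obtain Y where Y: "Y \<subseteq> E" "\<And>g x. g \<in> carrier G \<Longrightarrow> x \<in> Y \<Longrightarrow> act (f g) x \<in> Y"
    "finite (sym_diff X Y)"
    by (rule FW_commensurated[OF FW G, of E "\<lambda>g. act (f g)" X])
      (use X closed one mult fin in auto)
  then show "\<exists>Y\<subseteq>E. (\<forall>g\<in>carrier Q. act g ` Y \<subseteq> Y) \<and> finite (sym_diff X Y)"
    unfolding surj[symmetric] by blast
qed

text \<open>An action of \<open>H\<close> induces an action of \<open>G\<close> on finitely many copies of the given set, one for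
  each coset; the copies of a commensurated subset form a commensurated subset.\<close>

theorem FW_finite_index:
  fixes G :: "('a, 'b) monoid_scheme" (structure)
  assumes FW: "property_FW G" and G: "group G" and H: "subgroup H G" "finite_index G H"
  shows "property_FW (G\<lparr>carrier := H\<rparr>)"
proof (rule property_FWI)
  interpret group G by fact
  fix E :: "'a set" and act X
  assume X: "X \<subseteq> E"
    and closed0: "\<And>g x. g \<in> carrier (G\<lparr>carrier := H\<rparr>) \<Longrightarrow> x \<in> E \<Longrightarrow> act g x \<in> E"
    and one0: "\<And>x. x \<in> E \<Longrightarrow> act \<one>\<^bsub>G\<lparr>carrier := H\<rparr>\<^esub> x = x"
    and mult0: "\<And>g h x. g \<in> carrier (G\<lparr>carrier := H\<rparr>) \<Longrightarrow> h \<in> carrier (G\<lparr>carrier := H\<rparr>) \<Longrightarrow>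
        x \<in> E \<Longrightarrow> act (g \<otimes>\<^bsub>G\<lparr>carrier := H\<rparr>\<^esub> h) x = act g (act h x)"
    and fin0: "\<And>g. g \<in> carrier (G\<lparr>carrier := H\<rparr>) \<Longrightarrow> finite (act g ` X - X)"
  have closed: "\<And>g x. g \<in> H \<Longrightarrow> x \<in> E \<Longrightarrow> act g x \<in> E"
    and one: "\<And>x. x \<in> E \<Longrightarrow> act \<one> x = x"
    and mult: "\<And>g h x. g \<in> H \<Longrightarrow> h \<in> H \<Longrightarrow> x \<in> E \<Longrightarrow> act (g \<otimes> h) x = act g (act h x)"
    and fin: "\<And>g. g \<in> H \<Longrightarrow> finite (act g ` X - X)"
    using closed0 one0 mult0 fin0 by simp_all
  have Hc: "\<And>x. x \<in> H \<Longrightarrow> x \<in> carrier G" using subgroup.mem_carrier[OF H(1)] by blast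
  obtain \<tau> where t: "finite (\<tau> ` carrier G)" "\<And>x. x \<in> carrier G \<Longrightarrow> \<tau> x \<in> carrier G"
    "\<And>x. x \<in> carrier G \<Longrightarrow> inv (\<tau> x) \<otimes> x \<in> H"
    and const: "\<And>x y. x \<in> carrier G \<Longrightarrow> y \<in> carrier G \<Longrightarrow> inv x \<otimes> y \<in> H \<Longrightarrow> \<tau> x = \<tau> y"
    by (rule finite_indexE[OF H]) blast
  define T where "T = \<tau> ` carrier G"
  have Tc: "s \<in> T \<Longrightarrow> s \<in> carrier G" for s using t by (auto simp: T_def)
  have idem: "\<tau> s = s" if "s \<in> T" for s
    using that t const[of "\<tau> _"] by (force simp: T_def)
  \<comment> \<open>The cocycle by which \<open>g\<close> acts on the copy of the coset
    represented by \<open>s\<close>.\<close>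
  define \<delta> where "\<delta> g s = inv (\<tau> (g \<otimes> s)) \<otimes> (g \<otimes> s)" for g s
  have \<delta>: "\<delta> g s \<in> H" if "g \<in> carrier G" "s \<in> T" for g s
    using t(3) that Tc by (simp add: \<delta>_def)
  have \<tau>_mult: "\<tau> (g \<otimes> \<tau> x) = \<tau> (g \<otimes> x)" if "g \<in> carrier G" "x \<in> carrier G" for g x
  proof (rule const)
    have "inv (g \<otimes> \<tau> x) \<otimes> (g \<otimes> x) = inv (\<tau> x) \<otimes> x"
      using that t(2)[OF that(2)] by (simp add: inv_mult_group m_assoc)
    then show "inv (g \<otimes> \<tau> x) \<otimes> (g \<otimes> x) \<in> H" using t(3) that by simp
  qed (use that t in auto)
  have \<delta>_mult: "\<delta> (g \<otimes> h) s = \<delta> g (\<tau> (h \<otimes> s)) \<otimes> \<delta> h s"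
    if "g \<in> carrier G" "h \<in> carrier G" "s \<in> T" for g h s
  proof -
    have c: "\<tau> (h \<otimes> s) \<in> carrier G" "\<tau> (g \<otimes> (h \<otimes> s)) \<in> carrier G" "s \<in> carrier G"
      using that Tc t(2) by auto
    show ?thesis
      using that c \<tau>_mult[of g "h \<otimes> s"] by (simp add: \<delta>_def m_assoc)
  qed
  define act' where "act' g = (\<lambda>(s, x). (\<tau> (g \<otimes> s), act (\<delta> g s) x))" for g
  obtain Y where Y: "Y \<subseteq> T \<times> E" "\<And>g z. g \<in> carrier G \<Longrightarrow> z \<in> Y \<Longrightarrow> act' g z \<in> Y"
    "finite (sym_diff (T \<times> X) Y)"
  proof (rule FW_commensurated[OF FW G, of "T \<times> E" act' "T \<times> X"])
    fix g z assume g: "g \<in> carrier G" and z: "z \<in> T \<times> E"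
    then show "act' g z \<in> T \<times> E"
      using closed \<delta> Tc by (auto simp: act'_def T_def)
  next
    fix z assume z: "z \<in> T \<times> E"
    then show "act' \<one> z = z"
      using idem Tc one by (auto simp: act'_def \<delta>_def)
  next
    fix g h z assume gh: "g \<in> carrier G" "h \<in> carrier G" and z: "z \<in> T \<times> E"
    then obtain s x where sx: "z = (s, x)" "s \<in> T" "x \<in> E" by blast
    have "\<tau> (h \<otimes> s) \<in> T" using sx gh Tc by (auto simp: T_def)
    then show "act' (g \<otimes> h) z = act' g (act' h z)"
      using sx gh \<delta>_mult[OF gh sx(2)] mult[of "\<delta> g (\<tau> (h \<otimes> s))" "\<delta> h s" x] \<delta> \<tau>_mult[of g "h \<otimes> s"] Tc
      by (simp add: act'_def m_assoc)
  next
    show "T \<times> X \<subseteq> T \<times> E" using X by blast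
  next
    fix g assume g: "g \<in> carrier G"
    have "act' g ` (T \<times> X) - T \<times> X \<subseteq> (\<Union>s\<in>T. {\<tau> (g \<otimes> s)} \<times> (act (\<delta> g s) ` X - X))"
      using g Tc by (auto simp: act'_def T_def)
    moreover have "finite (\<Union>s\<in>T. {\<tau> (g \<otimes> s)} \<times> (act (\<delta> g s) ` X - X))"
    proof (rule finite_UN_I)
      show "finite T" using t(1) by (simp add: T_def)
      show "finite ({\<tau> (g \<otimes> s)} \<times> (act (\<delta> g s) ` X - X))" if "s \<in> T" for s
        using fin[OF \<delta>[OF g that]] by simp
    qed
    ultimately show "finite (act' g ` (T \<times> X) - T \<times> X)" by (rule finite_subset)
  qed blast
  define s0 where "s0 = \<tau> \<one>"
  have s0: "s0 \<in> T" "s0 \<in> carrier G" using t by (auto simp: s0_def T_def)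
  define Z where "Z = {x \<in> E. (s0, x) \<in> Y}"
  have "act h x \<in> Z" if h: "h \<in> H" and x: "x \<in> Z" for h x
  proof -
    \<comment> \<open>This element preserves the copy at \<open>s0\<close> and acts on it as
      \<open>h\<close>.\<close>
    let ?g = "s0 \<otimes> h \<otimes> inv s0"
    have hc: "h \<in> carrier G" using h Hc by blast
    have gs: "?g \<otimes> s0 = s0 \<otimes> h"
      using hc s0 by (simp add: m_assoc)
    have "\<tau> (s0 \<otimes> h) = s0"
      using const[of s0 "s0 \<otimes> h"] idem[OF s0(1)] s0 hc h by (simp add: m_assoc[symmetric])
    moreover from this have "\<delta> ?g s0 = h"
      using s0 hc by (simp add: \<delta>_def gs m_assoc[symmetric])
    ultimately have "act' ?g (s0, x) = (s0, act h x)"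
      by (simp add: act'_def gs)
    then show ?thesis
      using Y(2)[of ?g "(s0, x)"] x s0 hc closed[OF h] by (auto simp: Z_def)
  qed
  moreover have "finite (sym_diff X Z)"
  proof (rule finite_subset)
    show "sym_diff X Z \<subseteq> snd ` sym_diff (T \<times> X) Y"
    proof
      fix x assume "x \<in> sym_diff X Z"
      then have "(s0, x) \<in> sym_diff (T \<times> X) Y"
        using s0 X by (auto simp: Z_def)
      then show "x \<in> snd ` sym_diff (T \<times> X) Y" by force
    qed
  qed (use Y(3) in blast)
  moreover have "Z \<subseteq> E" by (auto simp: Z_def)
  ultimately show "\<exists>Y\<subseteq>E. (\<forall>g\<in>carrier (G\<lparr>carrier := H\<rparr>). act g ` Y \<subseteq> Y) \<and> finite (sym_diff X Y)"
    by (intro exI[of _ Z]) auto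
qed

(* The symbol is used for left cosets. *)
no_notation subset_mset (infix \<open><#\<close> 50)

section \<open>Abelian groups with Property FW\<close>

text \<open>Otherwise \<open>G\<close> acts on the disjoint union of the nontrivial coset spaces
  \<open>G / N i\<close>. The set of the base points \<open>N i\<close> is commensurated, because
  each element fixes all but finitely many of them. An invariant set differing from it by a finite
  set would contain the base point and nothing else in almost all of these orbits, although they
  are nontrivial.\<close>

lemma FW_not_exhausted_by_subgroups:
  fixes G :: "('a, 'b) monoid_scheme" (structure) and N :: "nat \<Rightarrow> 'a set"
  assumes FW: "property_FW G" and G: "group G"
    and N: "\<And>i. subgroup (N i) G"
    and ev: "\<And>g. g \<in> carrier G \<Longrightarrow> \<exists>k. \<forall>i\<ge>k. g \<in> N i"
  shows "\<exists>i. N i = carrier G"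
proof (rule ccontr)
  interpret group G by fact
  assume no: "\<not> ?thesis"
  have Nc: "N i \<subseteq> carrier G" for i using subgroup.subset[OF N] .
  have "\<exists>g. g \<in> carrier G \<and> g \<notin> N i" for i using no Nc[of i] by (metis subsetI subset_antisym)
  then obtain w where w: "\<And>i. w i \<in> carrier G" "\<And>i. w i \<notin> N i" by metis
  define E where "E = {(i, C). \<exists>g\<in>carrier G. C = g <# N i}"
  define act where "act g = (\<lambda>(i::nat, C). (i, g <# C))" for g
  define X where "X = range (\<lambda>i. (i, N i))"
  have one_coset: "\<one> <# N i = N i" for i
    using coset_join3[OF one_closed N subgroup.one_closed[OF N]] .
  obtain Y where Y: "Y \<subseteq> E" "\<And>g z. g \<in> carrier G \<Longrightarrow> z \<in> Y \<Longrightarrow> act g z \<in> Y"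
    "finite (sym_diff X Y)"
  proof (rule FW_commensurated[OF FW G, of E act X])
    fix g z assume g: "g \<in> carrier G" and z: "z \<in> E"
    then obtain i h where "z = (i, h <# N i)" "h \<in> carrier G" unfolding E_def by auto
    then show "act g z \<in> E"
      using lcos_m_assoc[OF Nc g] g by (auto simp: act_def E_def)
  next
    fix z assume "z \<in> E"
    then obtain i h where "z = (i, h <# N i)" "h \<in> carrier G" unfolding E_def by auto
    then show "act \<one> z = z"
      using lcos_m_assoc[OF Nc one_closed] by (auto simp: act_def)
  next
    fix g k z assume gk: "g \<in> carrier G" "k \<in> carrier G" and "z \<in> E"
    then obtain i h where z: "z = (i, h <# N i)" "h \<in> carrier G" unfolding E_def by auto
    have "g \<otimes> k <# (h <# N i) = g <# (k <# (h <# N i))"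
      using lcos_m_assoc[of "h <# N i" g k] l_coset_subset_G[OF Nc z(2)] gk by simp
    then show "act (g \<otimes> k) z = act g (act k z)"
      by (simp add: act_def z)
  next
    show "X \<subseteq> E"
      unfolding X_def E_def using one_coset by (auto intro!: bexI[of _ \<one>])
  next
    fix g assume g: "g \<in> carrier G"
    obtain k where k: "\<And>i. i \<ge> k \<Longrightarrow> g \<in> N i" using ev[OF g] by blast
    have "act g ` X - X \<subseteq> (\<lambda>i. (i, g <# N i)) ` {..<k}"
    proof
      fix z assume z: "z \<in> act g ` X - X"
      then obtain i where i: "z = (i, g <# N i)" by (auto simp: X_def act_def)
      have "i < k"
      proof (rule ccontr)
        assume "\<not> i < k"
        then have "g <# N i = N i" using coset_join3[OF g N k] by simp
        then show False using z i by (auto simp: X_def)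
      qed
      then show "z \<in> (\<lambda>i. (i, g <# N i)) ` {..<k}" using i by auto
    qed
    then show "finite (act g ` X - X)" by (rule finite_subset) simp
  qed blast
  have "i \<in> fst ` sym_diff X Y" for i
  proof (cases "(i, N i) \<in> Y")
    case False
    then have "(i, N i) \<in> sym_diff X Y" by (auto simp: X_def)
    then show ?thesis by force
  next
    case True
    then have "(i, w i <# N i) \<in> Y" using Y(2)[OF w(1), of "(i, N i)"] by (simp add: act_def)
    moreover have "w i \<in> w i <# N i"
      using subgroup.one_closed[OF N, of i] r_one[OF w(1), of i] unfolding l_coset_def by (intro UN_I) auto
    then have "w i <# N i \<noteq> N i" using w(2) by metis
    then have "(i, w i <# N i) \<notin> X" unfolding X_def by blast
    ultimately have "(i, w i <# N i) \<in> sym_diff X Y" by simp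
    then show ?thesis by force
  qed
  then have "finite (UNIV :: nat set)"
    using Y(3) by (metis finite_imageI finite_subset subsetI)
  then show False by simp
qed

text \<open>Through \<open>\<kappa>\<close> the group acts on \<open>\<int>\<close> by
  translations and commensurates the half-line \<open>{0..}\<close>. A set differing from it by a
  finite set is not invariant under a nonzero translation.\<close>

lemma FW_hom_int_trivial:
  fixes G :: "('a, 'b) monoid_scheme" (structure) and \<kappa> :: "'a \<Rightarrow> int"
  assumes FW: "property_FW G" and G: "group G"
    and \<kappa>: "\<And>g h. g \<in> carrier G \<Longrightarrow> h \<in> carrier G \<Longrightarrow> \<kappa> (g \<otimes> h) = \<kappa> g + \<kappa> h"
    and a: "a \<in> carrier G"
  shows "\<kappa> a = 0"
proof (rule ccontr)
  interpret group G by fact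
  assume a0: "\<kappa> a \<noteq> 0"
  have \<kappa>1: "\<kappa> \<one> = 0" using \<kappa>[of \<one> \<one>] by simp
  have "\<kappa> (inv a) = - \<kappa> a" using \<kappa>[of "inv a" a] \<kappa>1 a by simp
  then have "\<exists>b\<in>carrier G. \<kappa> b < 0"
    using a a0 inv_closed[OF a] by (metis linorder_neqE_linordered_idom neg_less_0_iff_less)
  then obtain b where b: "b \<in> carrier G" "\<kappa> b < 0" by auto
  obtain Y where Y: "\<And>g z. g \<in> carrier G \<Longrightarrow> z \<in> Y \<Longrightarrow> z + \<kappa> g \<in> Y"
    "finite (sym_diff {0..} Y)"
  proof (rule FW_commensurated[OF FW G, of UNIV "\<lambda>g z. z + \<kappa> g" "{0..}"])
    fix g
    have "(\<lambda>z. z + \<kappa> g) ` {0..} - {0..} \<subseteq> {\<kappa> g..<0}" by auto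
    then show "finite ((\<lambda>z. z + \<kappa> g) ` {0..} - {0..})" by (rule finite_subset) simp
  next
    fix Y assume "\<And>g z. g \<in> carrier G \<Longrightarrow> z \<in> Y \<Longrightarrow> z + \<kappa> g \<in> Y" "finite (sym_diff {0..} Y)"
    then show thesis by (rule that)
  qed (simp_all add: \<kappa> \<kappa>1)
  \<comment> \<open>Beyond \<open>B\<close> the set \<open>Y\<close> coincides with the half-line.\<close>
  define B where "B = Max (insert 0 (abs ` sym_diff {0..} Y))"
  have B: "\<bar>z\<bar> \<le> B" if "z \<in> sym_diff {0..} Y" for z
    unfolding B_def by (rule Max_ge) (use Y(2) that in auto)
  have it: "z + int k * \<kappa> b \<in> Y" if "z \<in> Y" for z k
  proof (induction k)
    case (Suc k)
    show ?case using Y(1)[OF b(1) Suc.IH] by (simp add: algebra_simps)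
  qed (use that in simp)
  define n where "n = (\<bar>B\<bar> + 1) * (- \<kappa> b)"
  have n: "n \<ge> \<bar>B\<bar> + 1"
  proof -
    have "(\<bar>B\<bar> + 1) * 1 \<le> (\<bar>B\<bar> + 1) * (- \<kappa> b)" by (rule mult_left_mono) (use b in auto)
    then show ?thesis by (simp add: n_def)
  qed
  have n0: "n > 0" using n by linarith
  have "n \<in> Y"
  proof (rule ccontr)
    assume "n \<notin> Y"
    then have "\<bar>n\<bar> \<le> B" using n0 by (intro B) auto
    then show False using n by linarith
  qed
  then have "n + int (nat (2 * (\<bar>B\<bar> + 1))) * \<kappa> b \<in> Y" by (rule it)
  moreover have e: "n + int (nat (2 * (\<bar>B\<bar> + 1))) * \<kappa> b = - n" by (simp add: n_def algebra_simps)
  ultimately have "- n \<in> Y" by (simp only:)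
  then have "- n \<in> sym_diff {0..} Y" using n0 by auto
  then show False using B[of "- n"] n by linarith
qed

context group
begin

lemma subgroup_Union_chain:
  assumes sub: "\<And>H. H \<in> \<C> \<Longrightarrow> subgroup H G" and ne: "\<C> \<noteq> {}"
    and chain: "\<And>H K. H \<in> \<C> \<Longrightarrow> K \<in> \<C> \<Longrightarrow> H \<subseteq> K \<or> K \<subseteq> H"
  shows "subgroup (\<Union>\<C>) G"
proof (rule subgroupI)
  show "\<Union>\<C> \<subseteq> carrier G" using sub subgroup.subset by (metis Union_least)
  obtain H where H: "H \<in> \<C>" using ne by blast
  show "\<Union>\<C> \<noteq> {}" using subgroup.one_closed[OF sub[OF H]] H by (metis UnionI empty_iff)
  fix a assume "a \<in> \<Union>\<C>"
  then obtain H where H: "H \<in> \<C>" "a \<in> H" by (rule UnionE)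
  show "inv a \<in> \<Union>\<C>" using subgroup.m_inv_closed[OF sub[OF H(1)] H(2)] H(1) by (rule UnionI[rotated])
  fix b assume "b \<in> \<Union>\<C>"
  then obtain K where K: "K \<in> \<C>" "b \<in> K" by (rule UnionE)
  from chain[OF H(1) K(1)] show "a \<otimes> b \<in> \<Union>\<C>"
  proof
    assume "H \<subseteq> K"
    then have "a \<otimes> b \<in> K" using subgroup.m_closed[OF sub[OF K(1)], of a b] H K by auto
    then show ?thesis using K(1) by (rule UnionI[rotated])
  next
    assume "K \<subseteq> H"
    then have "a \<otimes> b \<in> H" using subgroup.m_closed[OF sub[OF H(1)], of a b] H K by auto
    then show ?thesis using H(1) by (rule UnionI[rotated])
  qed
qed

text \<open>Zorn's lemma; such a subgroup replaces a complement in the arguments on abelian groups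
  below.\<close>

lemma maximal_subgroup_avoiding:
  assumes "\<one> \<notin> Z"
  obtains N where "subgroup N G" "N \<inter> Z = {}"
    "\<And>M. subgroup M G \<Longrightarrow> N \<subseteq> M \<Longrightarrow> M \<inter> Z = {} \<Longrightarrow> M = N"
proof -
  let ?\<A> = "{N. subgroup N G \<and> N \<inter> Z = {}}"
  have "\<exists>M\<in>?\<A>. \<forall>X\<in>?\<A>. M \<subseteq> X \<longrightarrow> X = M"
  proof (rule subset_Zorn_nonempty)
    have "{\<one>} \<in> ?\<A>" using assms triv_subgroup by simp
    then show "?\<A> \<noteq> {}" by (metis empty_iff)
    fix \<C> assume ne: "\<C> \<noteq> {}" and ch: "subset.chain ?\<A> \<C>"
    have sub: "H \<in> ?\<A>" if "H \<in> \<C>" for H using ch that by (auto simp: subset.chain_def)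
    have "subgroup (\<Union>\<C>) G"
      by (rule subgroup_Union_chain) (use ne sub ch in \<open>auto simp: subset_chain_def\<close>)
    moreover have "\<Union>\<C> \<inter> Z = {}" using sub by auto
    ultimately show "\<Union>\<C> \<in> ?\<A>" by simp
  qed
  then show ?thesis using that by auto
qed

lemma finite_index_finite:
  assumes H: "finite H" "H \<subseteq> carrier G" "finite_index G H"
  shows "finite (carrier G)"
proof -
  obtain T where T: "T \<subseteq> carrier G" "finite T" "\<And>x. x \<in> carrier G \<Longrightarrow> \<exists>t\<in>T. inv t \<otimes> x \<in> H"
    using assms(3) unfolding finite_index_def by auto
  have "carrier G \<subseteq> (\<lambda>(t, h). t \<otimes> h) ` (T \<times> H)"
  proof
    fix x assume x: "x \<in> carrier G"
    then obtain t where t: "t \<in> T" "inv t \<otimes> x \<in> H" using T(3) by auto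
    have "x = t \<otimes> (inv t \<otimes> x)" using t T(1) x by auto
    then show "x \<in> (\<lambda>(t, h). t \<otimes> h) ` (T \<times> H)" using t by force
  qed
  then show ?thesis by (rule finite_subset) (use T(2) H(1) in simp)
qed

end

definition adjoin :: "('a, 'b) monoid_scheme \<Rightarrow> 'a set \<Rightarrow> 'a \<Rightarrow> 'a set" where
  "adjoin G N b = {x \<otimes>\<^bsub>G\<^esub> b [^]\<^bsub>G\<^esub> (i::int) | x i. x \<in> N}"

context comm_group
begin

lemma comm_group_subgroup: "subgroup H G \<Longrightarrow> comm_group (G\<lparr>carrier := H\<rparr>)"
  by (rule group.group_comm_groupI[OF subgroup_imp_group]) (auto simp: m_comm subgroup.mem_carrier)

lemma subgroup_adjoin:
  assumes N: "subgroup N G" and b: "b \<in> carrier G"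
  shows "subgroup (adjoin G N b) G" "N \<subseteq> adjoin G N b" "b \<in> adjoin G N b"
proof -
  have Nc: "\<And>x. x \<in> N \<Longrightarrow> x \<in> carrier G" using subgroup.mem_carrier[OF N] .
  have mem: "x \<otimes> b [^] i \<in> adjoin G N b" if "x \<in> N" for x and i :: int
    using that unfolding adjoin_def by auto
  show "N \<subseteq> adjoin G N b"
  proof
    fix x assume "x \<in> N"
    then show "x \<in> adjoin G N b" using mem[of x 0] Nc by simp
  qed
  show "b \<in> adjoin G N b" using mem[OF subgroup.one_closed[OF N], of 1] b by (simp add: int_pow_1)
  show "subgroup (adjoin G N b) G"
  proof (rule subgroupI)
    show "adjoin G N b \<subseteq> carrier G" unfolding adjoin_def using Nc b by auto
    show "adjoin G N b \<noteq> {}" using mem[OF subgroup.one_closed[OF N], of 1] by (metis empty_iff)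
    fix u assume "u \<in> adjoin G N b"
    then obtain x i where u: "u = x \<otimes> b [^] (i::int)" "x \<in> N" unfolding adjoin_def by auto
    have "inv u = inv x \<otimes> b [^] (- i)"
      using u Nc b by (simp add: inv_mult int_pow_neg)
    then show "inv u \<in> adjoin G N b" using mem[of "inv x"] subgroup.m_inv_closed[OF N u(2)] by metis
    fix v assume "v \<in> adjoin G N b"
    then obtain y j where v: "v = y \<otimes> b [^] (j::int)" "y \<in> N" unfolding adjoin_def by auto
    have "u \<otimes> v = (x \<otimes> y) \<otimes> b [^] (i + j)"
      using u v Nc b by (simp add: int_pow_mult m_ac)
    then show "u \<otimes> v \<in> adjoin G N b" using mem[of "x \<otimes> y"] subgroup.m_closed[OF N u(2) v(2)] by metis
  qed
qed

lemma subgroup_product: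
  assumes H: "subgroup H G" and K: "subgroup K G"
  shows "subgroup {x \<otimes> y | x y. x \<in> H \<and> y \<in> K} G"
proof (rule subgroupI)
  have c: "\<And>x. x \<in> H \<Longrightarrow> x \<in> carrier G" "\<And>x. x \<in> K \<Longrightarrow> x \<in> carrier G"
    using subgroup.mem_carrier[OF H] subgroup.mem_carrier[OF K] by auto
  show "{x \<otimes> y | x y. x \<in> H \<and> y \<in> K} \<subseteq> carrier G" using c by auto
  show "{x \<otimes> y | x y. x \<in> H \<and> y \<in> K} \<noteq> {}"
    using subgroup.one_closed[OF H] subgroup.one_closed[OF K] by auto
  fix u assume "u \<in> {x \<otimes> y | x y. x \<in> H \<and> y \<in> K}"
  then obtain x y where u: "u = x \<otimes> y" "x \<in> H" "y \<in> K" by auto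
  have "inv u = inv x \<otimes> inv y" using u c by (simp add: inv_mult)
  then show "inv u \<in> {x \<otimes> y | x y. x \<in> H \<and> y \<in> K}"
    using subgroup.m_inv_closed[OF H u(2)] subgroup.m_inv_closed[OF K u(3)] by auto
  fix v assume "v \<in> {x \<otimes> y | x y. x \<in> H \<and> y \<in> K}"
  then obtain x' y' where v: "v = x' \<otimes> y'" "x' \<in> H" "y' \<in> K" by auto
  have "u \<otimes> v = (x \<otimes> x') \<otimes> (y \<otimes> y')" using u v c by (simp add: m_ac)
  then show "u \<otimes> v \<in> {x \<otimes> y | x y. x \<in> H \<and> y \<in> K}"
    using subgroup.m_closed[OF H u(2) v(2)] subgroup.m_closed[OF K u(3) v(3)] by auto
qed

text \<open>Otherwise \<open>a\<close> has infinite order. For a subgroup \<open>N\<close> maximal among those without positive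
  powers of \<open>a\<close>, every element of the quotient by \<open>N\<close> has a power in the cyclic group of \<open>a\<close>, and
  by Property FW the exponent can be chosen uniformly. This gives a homomorphism onto a nontrivial
  subgroup of the integers.\<close>

lemma FW_torsion:
  assumes FW: "property_FW G" and a: "a \<in> carrier G"
  shows "\<exists>n::nat. n > 0 \<and> a [^] n = \<one>"
proof (rule ccontr)
  assume no: "\<not> ?thesis"
  have "\<one> \<notin> {a [^] n | n::nat. n > 0}" using no by (auto dest: sym)
  then obtain N where N: "subgroup N G" "N \<inter> {a [^] n | n::nat. n > 0} = {}"
    and max: "\<And>M. subgroup M G \<Longrightarrow> N \<subseteq> M \<Longrightarrow> M \<inter> {a [^] n | n::nat. n > 0} = {} \<Longrightarrow> M = N"
    by (rule maximal_subgroup_avoiding) blast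
  have Nc: "\<And>x. x \<in> N \<Longrightarrow> x \<in> carrier G" using subgroup.mem_carrier[OF N(1)] .
  have Ninv: "\<And>x. x \<in> N \<Longrightarrow> inv x \<in> N" using subgroup.m_inv_closed[OF N(1)] .
  have aN: "i = 0" if "a [^] (i::int) \<in> N" for i
  proof (rule ccontr)
    assume "i \<noteq> 0"
    have "a [^] (- i) \<in> N" using Ninv[OF that] a by (simp add: int_pow_neg)
    then have "a [^] \<bar>i\<bar> \<in> N" using that by (simp add: abs_if)
    then have "a [^] (nat \<bar>i\<bar>) \<in> N" using int_pow_int[of G a "nat \<bar>i\<bar>"] by simp
    moreover have "nat \<bar>i\<bar> > 0" using \<open>i \<noteq> 0\<close> by simp
    ultimately show False using N(2) by blast
  qed
  have ex: "\<exists>m::nat. m > 0 \<and> (\<exists>j::int. b [^] m \<otimes> a [^] j \<in> N)" if b: "b \<in> carrier G" for b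
  proof (cases "adjoin G N b \<inter> {a [^] n | n::nat. n > 0} = {}")
    case True
    then have "adjoin G N b = N" using max[OF subgroup_adjoin(1,2)[OF N(1) b]] by simp
    then have "b \<in> N" using subgroup_adjoin(3)[OF N(1) b] by simp
    then have "b [^] (1::nat) \<otimes> a [^] (0::int) \<in> N" using b by simp
    then show ?thesis by (metis zero_less_one)
  next
    case False
    then obtain y where "y \<in> adjoin G N b" "y \<in> {a [^] n | n::nat. n > 0}" by auto
    then obtain n x i where n': "n > 0" "y = a [^] (n::nat)" "y = x \<otimes> b [^] (i::int)" "x \<in> N"
      unfolding adjoin_def by blast
    have n: "n > 0" "a [^] n = x \<otimes> b [^] i" "x \<in> N" using n' by simp_all
    have xc: "x \<in> carrier G" using n Nc by simp
    have i0: "i \<noteq> 0" using aN[of "int n"] n xc by (auto simp: int_pow_int)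
    have e1: "b [^] i \<otimes> a [^] (- int n) = inv x"
    proof -
      have "b [^] i \<otimes> inv (a [^] n) = inv x"
        unfolding n(2) using xc b by (simp add: inv_mult m_ac)
      then show ?thesis using a by (simp add: int_pow_neg int_pow_int)
    qed
    show ?thesis
    proof (cases "i > 0")
      case True
      then have "b [^] (nat i) \<otimes> a [^] (- int n) \<in> N"
        using e1 Ninv[OF n(3)] int_pow_int[of G b "nat i"] by simp
      then show ?thesis using True by (metis zero_less_nat_eq)
    next
      case False
      have "b [^] (- i) \<otimes> a [^] (int n) = inv (b [^] i \<otimes> a [^] (- int n))"
        using a b by (simp add: int_pow_neg inv_mult)
      then have "b [^] (- i) \<otimes> a [^] (int n) \<in> N" using e1 xc n(3) by simp
      then have "b [^] (nat (- i)) \<otimes> a [^] (int n) \<in> N"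
        using int_pow_int[of G b "nat (- i)"] False by simp
      then show ?thesis using False i0 by (intro exI[of _ "nat (- i)"]) auto
    qed
  qed
  \<comment> \<open>Factorials as exponents make these subgroups increase with \<open>k\<close>.\<close>
  define B where "B k = {b \<in> carrier G. \<exists>j::int. b [^] (fact k :: nat) \<otimes> a [^] j \<in> N}" for k :: nat
  have "\<exists>k. B k = carrier G"
  proof (rule FW_not_exhausted_by_subgroups[OF FW group_axioms])
    fix k :: nat
    show "subgroup (B k) G"
    proof (rule subgroupI)
      show "B k \<subseteq> carrier G" by (auto simp: B_def)
      have "\<one> \<in> B k" using subgroup.one_closed[OF N(1)] by (auto simp: B_def intro!: exI[of _ 0])
      then show "B k \<noteq> {}" by (metis empty_iff)
      fix x assume "x \<in> B k"
      then obtain i where x: "x \<in> carrier G" "x [^] (fact k :: nat) \<otimes> a [^] (i::int) \<in> N"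
        by (auto simp: B_def)
      have "inv (x [^] (fact k :: nat) \<otimes> a [^] i) = (inv x) [^] (fact k :: nat) \<otimes> a [^] (- i)"
        using x(1) a by (simp add: inv_mult int_pow_neg nat_pow_inv)
      then show "inv x \<in> B k" using Ninv[OF x(2)] x(1) by (auto simp: B_def)
      fix y assume "y \<in> B k"
      then obtain j where y: "y \<in> carrier G" "y [^] (fact k :: nat) \<otimes> a [^] (j::int) \<in> N"
        by (auto simp: B_def)
      have "(x [^] (fact k :: nat) \<otimes> a [^] i) \<otimes> (y [^] (fact k :: nat) \<otimes> a [^] j)
          = (x \<otimes> y) [^] (fact k :: nat) \<otimes> a [^] (i + j)"
        using x(1) y(1) a by (simp add: nat_pow_distrib int_pow_mult m_ac)
      then have "(x \<otimes> y) [^] (fact k :: nat) \<otimes> a [^] (i + j) \<in> N"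
        using subgroup.m_closed[OF N(1) x(2) y(2)] by simp
      then show "x \<otimes> y \<in> B k" using x(1) y(1) by (auto simp: B_def)
    qed
  next
    fix b assume b: "b \<in> carrier G"
    obtain m j where m: "m > 0" "b [^] (m::nat) \<otimes> a [^] (j::int) \<in> N" using ex[OF b] by auto
    have "b \<in> B i" if i: "i \<ge> m" for i
    proof -
      obtain q where q: "(fact i :: nat) = m * q" using dvd_fact[of m i] m(1) i by auto
      have "(b [^] m \<otimes> a [^] j) [^] int q \<in> N"
        using subgroup_int_pow_closed[OF N(1) m(2)] .
      also have "(b [^] m \<otimes> a [^] j) [^] int q = b [^] (m * q) \<otimes> a [^] (j * int q)"
        using a b by (simp add: int_pow_int nat_pow_distrib nat_pow_pow flip: int_pow_pow)
      finally show ?thesis using b q by (auto simp: B_def)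
    qed
    then show "\<exists>k. \<forall>i\<ge>k. b \<in> B i" by auto
  qed
  then obtain k where k: "B k = carrier G" by auto
  define j where "j b = (SOME j::int. b [^] (fact k :: nat) \<otimes> a [^] j \<in> N)" for b
  have j: "b [^] (fact k :: nat) \<otimes> a [^] j b \<in> N" if "b \<in> carrier G" for b
    unfolding j_def by (rule someI_ex) (use that k in \<open>auto simp: B_def\<close>)
  have uniq: "i = j b" if b: "b \<in> carrier G" "b [^] (fact k :: nat) \<otimes> a [^] (i::int) \<in> N" for b i
  proof -
    have "inv (b [^] (fact k :: nat) \<otimes> a [^] j b) \<otimes> (b [^] (fact k :: nat) \<otimes> a [^] i) \<in> N"
      using subgroup.m_closed[OF N(1) Ninv[OF j[OF b(1)]] b(2)] .
    also have "inv (b [^] (fact k :: nat) \<otimes> a [^] j b) \<otimes> (b [^] (fact k :: nat) \<otimes> a [^] i)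
        = a [^] (i - j b)"
      using a b(1) by (simp add: inv_mult int_pow_diff m_ac)
    finally show ?thesis using aN by fastforce
  qed
  have "j a = 0"
  proof (rule FW_hom_int_trivial[OF FW group_axioms _ a])
    fix x y assume xy: "x \<in> carrier G" "y \<in> carrier G"
    have "(x [^] (fact k :: nat) \<otimes> a [^] j x) \<otimes> (y [^] (fact k :: nat) \<otimes> a [^] j y)
          = (x \<otimes> y) [^] (fact k :: nat) \<otimes> a [^] (j x + j y)"
      using xy a by (simp add: nat_pow_distrib int_pow_mult m_ac)
    then show "j (x \<otimes> y) = j x + j y"
      using subgroup.m_closed[OF N(1) j[OF xy(1)] j[OF xy(2)]] uniq[of "x \<otimes> y" "j x + j y"] xy by simp
  qed
  moreover have "a [^] (fact k :: nat) \<otimes> a [^] (- int (fact k)) \<in> N"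
    using a subgroup.one_closed[OF N(1)] by (simp add: int_pow_neg int_pow_int del: of_nat_fact)
  then have "- int (fact k) = j a" using uniq[OF a] by metis
  ultimately show False by simp
qed

text \<open>The elements of order dividing \<open>k!\<close> form an increasing sequence of
  subgroups with union \<open>G\<close>, by \<open>FW_torsion\<close>.\<close>

lemma FW_bounded_exponent:
  assumes FW: "property_FW G"
  shows "\<exists>m::nat. m > 0 \<and> (\<forall>x\<in>carrier G. x [^] m = \<one>)"
proof -
  define B where "B k = {x \<in> carrier G. x [^] (fact k :: nat) = \<one>}" for k :: nat
  have "\<exists>k. B k = carrier G"
  proof (rule FW_not_exhausted_by_subgroups[OF FW group_axioms])
    fix k :: nat
    show "subgroup (B k) G"
    proof (rule subgroupI)
      have "\<one> \<in> B k" by (simp add: B_def)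
      then show "B k \<noteq> {}" by (metis empty_iff)
    qed (auto simp: B_def nat_pow_inv nat_pow_distrib)
  next
    fix b assume b: "b \<in> carrier G"
    obtain m where m: "m > 0" "b [^] (m::nat) = \<one>" using FW_torsion[OF FW b] by auto
    have "b \<in> B i" if i: "i \<ge> m" for i
    proof -
      obtain q where q: "(fact i :: nat) = m * q" using dvd_fact[of m i] m(1) i by auto
      have "b [^] (m * q) = \<one>" using b m(2) nat_pow_pow[of b m q] by simp
      then show ?thesis using b q by (simp add: B_def)
    qed
    then show "\<exists>k. \<forall>i\<ge>k. b \<in> B i" by auto
  qed
  then obtain k where "B k = carrier G" by auto
  then show ?thesis by (intro exI[of _ "fact k"]) (auto simp: B_def)
qed

text \<open>In an infinite group of prime exponent the union \<open>B\<close> of a strictly increasing sequence of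
  finite subgroups has a complement, by Zorn's lemma; the products of the complement with these
  subgroups exhaust the group.\<close>

lemma FW_prime_exponent_finite:
  assumes FW: "property_FW G" and p: "prime p" and ex: "\<And>x. x \<in> carrier G \<Longrightarrow> x [^] (p::nat) = \<one>"
  shows "finite (carrier G)"
proof (rule ccontr)
  assume inf: "infinite (carrier G)"
  have pow_mod: "x [^] (i::int) = x [^] (i mod int p)" if x: "x \<in> carrier G" for x i
  proof -
    have "x [^] i = x [^] (int p * (i div int p) + i mod int p)" by simp
    also have "\<dots> = (x [^] int p) [^] (i div int p) \<otimes> x [^] (i mod int p)"
      using x by (simp only: int_pow_mult int_pow_pow)
    also have "x [^] int p = \<one>" using ex[OF x] by (simp add: int_pow_int)
    finally show ?thesis using x by simp
  qed
  have "\<exists>f. \<forall>n::nat. (subgroup (f n) G \<and> finite (f n)) \<and> f n \<subset> f (Suc n)"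
  proof (rule dependent_nat_choice[where P = "\<lambda>_ H. subgroup H G \<and> finite H" and Q = "\<lambda>_ H K. H \<subset> K"])
    show "\<exists>H. subgroup H G \<and> finite H" using triv_subgroup by (intro exI[of _ "{\<one>}"]) simp
    fix H assume H: "subgroup H G \<and> finite H"
    then have "H \<noteq> carrier G" using inf by auto
    then obtain b where b: "b \<in> carrier G" "b \<notin> H" using subgroup.subset[of H G] H by auto
    have "adjoin G H b \<subseteq> (\<lambda>(x, i). x \<otimes> b [^] i) ` (H \<times> {0..<int p})"
    proof
      fix u assume "u \<in> adjoin G H b"
      then obtain x i where u: "u = x \<otimes> b [^] (i::int)" "x \<in> H" unfolding adjoin_def by auto
      then have "u = x \<otimes> b [^] (i mod int p)" using pow_mod[OF b(1)] by metis
      moreover have "i mod int p \<in> {0..<int p}" using prime_gt_0_nat[OF p] by simp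
      ultimately show "u \<in> (\<lambda>(x, i). x \<otimes> b [^] i) ` (H \<times> {0..<int p})"
        using u(2) by (intro image_eqI[of _ _ "(x, i mod int p)"]) auto
    qed
    then have "finite (adjoin G H b)" by (rule finite_subset) (use H in simp)
    moreover have "H \<subset> adjoin G H b" using subgroup_adjoin(2,3)[of H b] H b by auto
    ultimately show "\<exists>K. (subgroup K G \<and> finite K) \<and> H \<subset> K"
      using subgroup_adjoin(1)[of H b] H b by auto
  qed
  then obtain B where B': "\<forall>n::nat. (subgroup (B n) G \<and> finite (B n)) \<and> B n \<subset> B (Suc n)"
    by (rule exE)
  have B: "\<And>n. subgroup (B n) G" "\<And>n::nat. B n \<subset> B (Suc n)" using B' by simp_all
  have mono: "B m \<subseteq> B n" if "m \<le> n" for m n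
    using lift_Suc_mono_le[of B, OF _ that] B(2) by (metis psubsetE)
  define U where "U = (\<Union>n. B n)"
  have U: "subgroup U G"
    unfolding U_def
  proof (rule subgroup_Union_chain)
    fix H K assume "H \<in> range B" "K \<in> range B"
    then show "H \<subseteq> K \<or> K \<subseteq> H" using mono by (metis imageE linorder_linear)
  qed (use B(1) in auto)
  have "\<one> \<notin> U - {\<one>}" by simp
  then obtain C where C: "subgroup C G" "C \<inter> (U - {\<one>}) = {}"
    and max: "\<And>M. subgroup M G \<Longrightarrow> C \<subseteq> M \<Longrightarrow> M \<inter> (U - {\<one>}) = {} \<Longrightarrow> M = C"
    by (rule maximal_subgroup_avoiding) blast
  have Cc: "\<And>x. x \<in> C \<Longrightarrow> x \<in> carrier G" using subgroup.mem_carrier[OF C(1)] .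
  have Uc: "\<And>x. x \<in> U \<Longrightarrow> x \<in> carrier G" using subgroup.mem_carrier[OF U] .
  have cover: "\<exists>c\<in>C. \<exists>u\<in>U. x = c \<otimes> u" if x: "x \<in> carrier G" for x
  proof (cases "adjoin G C x \<inter> (U - {\<one>}) = {}")
    case True
    then have "x \<in> C" using max[OF subgroup_adjoin(1,2)[OF C(1) x]] subgroup_adjoin(3)[OF C(1) x] by simp
    then show ?thesis using subgroup.one_closed[OF U] x by (metis r_one)
  next
    case False
    then obtain c i where u: "c \<otimes> x [^] (i::int) \<in> U" "c \<otimes> x [^] i \<noteq> \<one>" "c \<in> C"
      unfolding adjoin_def by auto
    have "\<not> int p dvd i"
    proof
      assume "int p dvd i"
      then have "x [^] i = \<one>" using pow_mod[OF x, of i] by simp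
      then show False using u C(2) Cc by auto
    qed
    then have "coprime i (int p)"
      using p prime_imp_coprime[of "int p" i] by (simp add: coprime_commute)
    then obtain s t where st: "i * s + int p * t = 1"
      using bezout_int[of i "int p"] by (metis coprime_imp_gcd_eq_1 mult.commute)
    have "x = x [^] (i * s + int p * t)" using x st by (simp add: int_pow_1)
    also have "\<dots> = (x [^] i) [^] s \<otimes> (x [^] int p) [^] t" using x by (simp only: int_pow_mult int_pow_pow int_pow_closed)
    also have "x [^] int p = \<one>" using ex[OF x] by (simp add: int_pow_int)
    also have "x [^] i = inv c \<otimes> (c \<otimes> x [^] i)" using x Cc[OF u(3)] by simp
    finally have "x = (inv c \<otimes> (c \<otimes> x [^] i)) [^] s" using x Cc[OF u(3)] by simp
    also have "\<dots> = inv c [^] s \<otimes> (c \<otimes> x [^] i) [^] s"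
      using x Cc[OF u(3)] by (intro int_pow_distrib) auto
    finally have "x = inv c [^] s \<otimes> (c \<otimes> x [^] i) [^] s" .
    moreover have "inv c [^] s \<in> C"
      using subgroup_int_pow_closed[OF C(1)] subgroup.m_inv_closed[OF C(1) u(3)] by simp
    moreover have "(c \<otimes> x [^] i) [^] s \<in> U" using subgroup_int_pow_closed[OF U u(1)] .
    ultimately show ?thesis by metis
  qed
  define A where "A n = {x \<otimes> y | x y. x \<in> C \<and> y \<in> B n}" for n
  have "\<exists>n. A n = carrier G"
  proof (rule FW_not_exhausted_by_subgroups[OF FW group_axioms])
    show "subgroup (A n) G" for n unfolding A_def by (rule subgroup_product[OF C(1) B(1)])
    fix x assume x: "x \<in> carrier G"
    obtain c u where cu: "c \<in> C" "u \<in> U" "x = c \<otimes> u" using cover[OF x] by auto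
    obtain n where n: "u \<in> B n" using cu(2) by (auto simp: U_def)
    have "x \<in> A i" if "i \<ge> n" for i
      unfolding A_def using cu subsetD[OF mono[OF that] n] by auto
    then have "\<forall>i\<ge>n. x \<in> A i" by auto
    then show "\<exists>n. \<forall>i\<ge>n. x \<in> A i" by auto
  qed
  then obtain n where n: "A n = carrier G" by auto
  obtain y where y: "y \<in> B (Suc n)" "y \<notin> B n" using B(2)[of n] by auto
  have yU: "y \<in> U" using y by (auto simp: U_def)
  then have "y \<in> A n" using Uc n by simp
  then obtain c b where cb: "c \<in> C" "b \<in> B n" "y = c \<otimes> b" by (auto simp: A_def)
  have bU: "b \<in> U" using cb by (auto simp: U_def)
  have "c = y \<otimes> inv b" using cb Cc Uc bU by (simp add: m_assoc)
  then have "c \<in> U" using subgroup.m_closed[OF U yU subgroup.m_inv_closed[OF U bU]] by simp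
  then have "c = \<one>" using cb(1) C(2) by auto
  then show False using cb y Uc[OF bU] by simp
qed

end

text \<open>Induction on the exponent: for a prime \<open>p\<close> dividing \<open>m\<close>, the
  map \<open>x \<mapsto> x\<^sup>p\<close> has an image of smaller exponent and a kernel of
  exponent \<open>p\<close>.\<close>

lemma FW_exponent_finite:
  fixes G :: "('a, 'b) monoid_scheme"
  assumes "comm_group G" "property_FW G" "m > 0" "\<And>x. x \<in> carrier G \<Longrightarrow> x [^]\<^bsub>G\<^esub> (m::nat) = \<one>\<^bsub>G\<^esub>"
  shows "finite (carrier G)"
  using assms
proof (induction m arbitrary: G rule: less_induct)
  case (less m G)
  interpret comm_group G by fact
  show ?case
  proof (cases "m = 1")
    case True
    then have "carrier G \<subseteq> {\<one>\<^bsub>G\<^esub>}" using less.prems(4) by fastforce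
    then show ?thesis by (rule finite_subset) simp
  next
    case False
    then obtain p where p: "prime p" "p dvd m" using prime_factor_nat by auto
    then obtain k where k: "m = p * k" by (auto elim: dvdE)
    have kpos: "k > 0" "k < m" using k less.prems(3) prime_gt_1_nat[OF p(1)] by auto
    define f where "f x = x [^]\<^bsub>G\<^esub> p" for x
    define H where "H = f ` carrier G"
    have H: "subgroup H G"
    proof (rule subgroupI)
      show "H \<subseteq> carrier G" by (auto simp: H_def f_def)
      show "H \<noteq> {}" using one_closed by (auto simp: H_def)
      fix u assume "u \<in> H"
      then obtain x where x: "x \<in> carrier G" "u = f x" by (auto simp: H_def)
      show "inv\<^bsub>G\<^esub> u \<in> H" unfolding H_def
        by (rule image_eqI[of _ _ "inv\<^bsub>G\<^esub> x"]) (use x in \<open>auto simp: f_def nat_pow_inv\<close>)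
      fix v assume "v \<in> H"
      then obtain y where y: "y \<in> carrier G" "v = f y" by (auto simp: H_def)
      show "u \<otimes>\<^bsub>G\<^esub> v \<in> H" unfolding H_def
        by (rule image_eqI[of _ _ "x \<otimes>\<^bsub>G\<^esub> y"]) (use x y in \<open>auto simp: f_def nat_pow_distrib\<close>)
    qed
    have commH: "comm_group (G\<lparr>carrier := H\<rparr>)"
      by (rule comm_group_subgroup[OF H])
    have "property_FW (G\<lparr>carrier := H\<rparr>)"
      by (rule FW_hom_surj[OF less.prems(2) group_axioms comm_group.axioms(2)[OF commH], of f])
        (auto simp: hom_def H_def f_def nat_pow_distrib)
    moreover have "x [^]\<^bsub>G\<lparr>carrier := H\<rparr>\<^esub> k = \<one>\<^bsub>G\<lparr>carrier := H\<rparr>\<^esub>" if x: "x \<in> H" for x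
    proof -
      obtain y where y: "y \<in> carrier G" "x = f y" using x by (auto simp: H_def)
      have "x [^]\<^bsub>G\<^esub> k = \<one>\<^bsub>G\<^esub>"
        using less.prems(4)[OF y(1)] y by (simp add: f_def nat_pow_pow k)
      then show ?thesis using nat_pow_consistent[of x k H] by simp
    qed
    ultimately have finH: "finite H"
      using less.IH[of k "G\<lparr>carrier := H\<rparr>"] kpos commH by simp
    define K where "K = {x \<in> carrier G. f x = \<one>\<^bsub>G\<^esub>}"
    have K: "subgroup K G"
    proof (rule subgroupI)
      have "\<one>\<^bsub>G\<^esub> \<in> K" by (simp add: K_def f_def)
      then show "K \<noteq> {}" by (metis empty_iff)
    qed (auto simp: K_def f_def nat_pow_inv nat_pow_distrib)
    have fiK: "finite_index G K"
    proof (rule finite_indexI[of f])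
      show "finite (f ` carrier G)" using finH by (simp add: H_def)
      fix x y assume xy: "x \<in> carrier G" "y \<in> carrier G" "f x = f y"
      have "f (inv\<^bsub>G\<^esub> x \<otimes>\<^bsub>G\<^esub> y) = inv\<^bsub>G\<^esub> (f x) \<otimes>\<^bsub>G\<^esub> f y"
        using xy by (simp add: f_def nat_pow_distrib nat_pow_inv)
      also have "\<dots> = \<one>\<^bsub>G\<^esub>" using xy(2) unfolding xy(3) by (simp add: f_def)
      finally show "inv\<^bsub>G\<^esub> x \<otimes>\<^bsub>G\<^esub> y \<in> K" using xy by (simp add: K_def)
    qed
    have "finite (carrier (G\<lparr>carrier := K\<rparr>))"
    proof (rule comm_group.FW_prime_exponent_finite[OF comm_group_subgroup[OF K] _ p(1)])
      show "property_FW (G\<lparr>carrier := K\<rparr>)"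
        by (rule FW_finite_index[OF less.prems(2) group_axioms K fiK])
      fix x assume "x \<in> carrier (G\<lparr>carrier := K\<rparr>)"
      then have "x [^]\<^bsub>G\<^esub> p = \<one>\<^bsub>G\<^esub>" by (simp add: K_def f_def)
      then show "x [^]\<^bsub>G\<lparr>carrier := K\<rparr>\<^esub> p = \<one>\<^bsub>G\<lparr>carrier := K\<rparr>\<^esub>"
        using nat_pow_consistent[of x p K] by simp
    qed
    then show ?thesis
      using finite_index_finite[OF _ subgroup.subset[OF K] fiK] by simp
  qed
qed

theorem FW_comm_group_finite:
  assumes "comm_group G" "property_FW G"
  shows "finite (carrier G)"
  using comm_group.FW_bounded_exponent[OF assms] FW_exponent_finite[OF assms] by auto

context group
begin

theorem FW_abelianization_finite:
  assumes FW: "property_FW G"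
  shows "finite_index G (derived G (carrier G))"
proof -
  let ?D = "derived G (carrier G)"
  have D: "?D \<lhd> G" by (rule derived_self_is_normal)
  have "property_FW (G Mod ?D)"
  proof (rule FW_hom_surj[OF FW group_axioms])
    show "group (G Mod ?D)" using derived_quot_is_comm_group comm_group.axioms(2) by metis
    show "(\<lambda>a. ?D #> a) \<in> hom G (G Mod ?D)" by (rule normal.r_coset_hom_Mod[OF D])
    show "(\<lambda>a. ?D #> a) ` carrier G = carrier (G Mod ?D)"
      by (auto simp: FactGroup_def RCOSETS_def)
  qed
  then have fin: "finite (carrier (G Mod ?D))"
    by (rule FW_comm_group_finite[OF derived_quot_is_comm_group])
  show ?thesis
  proof (rule finite_indexI[of "\<lambda>a. ?D #> a"])
    show "finite ((\<lambda>a. ?D #> a) ` carrier G)"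
      by (rule finite_subset[OF _ fin]) (auto simp: FactGroup_def RCOSETS_def)
    fix x y assume xy: "x \<in> carrier G" "y \<in> carrier G" "?D #> x = ?D #> y"
    have sub: "subgroup ?D G" using D by (rule normal_imp_subgroup)
    have "y \<in> ?D #> x" using rcos_self[OF xy(2) sub] xy(3) by simp
    then obtain d where d: "d \<in> ?D" "y = d \<otimes> x" unfolding r_coset_def by auto
    have "inv x \<otimes> d \<otimes> x \<in> ?D"
      using normal.inv_op_closed1[OF D xy(1) d(1)] .
    then show "inv x \<otimes> y \<in> ?D"
      using d xy subgroup.mem_carrier[OF sub d(1)] by (simp add: m_assoc)
  qed
qed

text \<open>This makes a descent along the derived series possible without leaving the subgroups
  of finite index.\<close>

lemma FW_derived:
  assumes H: "subgroup H G" "finite_index G H" "property_FW (G\<lparr>carrier := H\<rparr>)"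
  shows "subgroup (derived G H) G" "finite_index G (derived G H)"
    "property_FW (G\<lparr>carrier := derived G H\<rparr>)" "derived G H \<subseteq> H"
proof -
  show sub: "subgroup (derived G H) G"
    by (rule derived_is_subgroup[OF subgroup.subset[OF H(1)]])
  show le: "derived G H \<subseteq> H" by (rule derived_incl[OF subset_refl H(1)])
  have grp: "group (G\<lparr>carrier := H\<rparr>)" by (rule subgroup_imp_group[OF H(1)])
  have "finite_index (G\<lparr>carrier := H\<rparr>) (derived G H)"
    using group.FW_abelianization_finite[OF grp H(3)] derived_consistent[OF subset_refl H(1)] by simp
  then show fi: "finite_index G (derived G H)"
    by (rule finite_index_trans[OF H(1,2) sub le])
  show "property_FW (G\<lparr>carrier := derived G H\<rparr>)"
  proof -
    have "property_FW (G\<lparr>carrier := H\<rparr>\<lparr>carrier := derived G H\<rparr>)"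
      by (rule FW_finite_index[OF H(3) grp subgroup_incl[OF sub H(1) le]]) fact
    then show ?thesis by simp
  qed
qed

end

section \<open>Ping-pong\<close>

definition letter :: "('a, 'b) monoid_scheme \<Rightarrow> 'a \<times> bool \<Rightarrow> 'a" where
  "letter G l = (if snd l then fst l else inv\<^bsub>G\<^esub> (fst l))"

lemma word_value_simps:
  "word_value G [] = \<one>\<^bsub>G\<^esub>"
  "word_value G (l # w) = letter G l \<otimes>\<^bsub>G\<^esub> word_value G w"
  by (auto simp: word_value_def letter_def split: prod.splits)

lemma reduced_words_Cons:
  "l # w \<in> reduced_words S \<longleftrightarrow>
     fst l \<in> S \<and> w \<in> reduced_words S \<and> (w \<noteq> [] \<longrightarrow> hd w \<noteq> (fst l, \<not> snd l))"
proof (cases w)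
  case Nil
  then show ?thesis by (cases l) (auto simp: reduced_words_def)
next
  case (Cons l' w')
  obtain s e t e' where "l = (s, e)" "l' = (t, e')" by (cases l, cases l') auto
  then show ?thesis using Cons by (auto simp: reduced_words_def)
qed

text \<open>The letter \<open>(s, True)\<close> stands for \<open>s\<close> and \<open>(s,
  False)\<close> for its inverse; \<open>D l\<close> is the attracting region of the letter
  \<open>l\<close>, and every point outside the region that repels \<open>l\<close> is mapped into
  it.\<close>

locale pingpong = group G for G :: "('a, 'b) monoid_scheme" (structure) +
  fixes \<Delta> S :: "'a set" and act :: "'a \<Rightarrow> 'x \<Rightarrow> 'x" and D :: "'a \<times> bool \<Rightarrow> 'x set" and x0 :: 'x
  assumes \<Delta>: "subgroup \<Delta> G" and S: "S \<subseteq> \<Delta>"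
    and act_one: "act \<one> x = x"
    and act_mult: "g \<in> \<Delta> \<Longrightarrow> h \<in> \<Delta> \<Longrightarrow> act (g \<otimes> h) x = act g (act h x)"
    and disjoint: "fst l \<in> S \<Longrightarrow> fst l' \<in> S \<Longrightarrow> l \<noteq> l' \<Longrightarrow> D l \<inter> D l' = {}"
    and attract: "s \<in> S \<Longrightarrow> x \<notin> D (s, \<not> e) \<Longrightarrow> act (letter G (s, e)) x \<in> D (s, e)"
    and x0: "fst l \<in> S \<Longrightarrow> x0 \<notin> D l"
begin

lemma letter_closed: "fst l \<in> S \<Longrightarrow> letter G l \<in> \<Delta>"
  using S \<Delta> subgroup.m_inv_closed[OF \<Delta>] by (auto simp: letter_def)

lemma \<Delta>_carrier: "g \<in> \<Delta> \<Longrightarrow> g \<in> carrier G"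
  using subgroup.mem_carrier[OF \<Delta>] .

lemma word_closed: "w \<in> reduced_words S \<Longrightarrow> word_value G w \<in> \<Delta>"
proof (induction w)
  case Nil
  then show ?case by (simp add: word_value_simps subgroup.one_closed[OF \<Delta>])
next
  case (Cons l w)
  then show ?case
    by (simp add: word_value_simps reduced_words_Cons subgroup.m_closed[OF \<Delta>] letter_closed)
qed

text \<open>By induction, the image of \<open>x0\<close> stays in the attracting region of the
  letter applied last, and the next letter of a reduced word is not its inverse.\<close>

lemma word_moves:
  assumes "w \<in> reduced_words S" "w \<noteq> []"
  shows "act (word_value G w) x0 \<in> D (hd w)"
  using assms
proof (induction w)
  case Nil
  then show ?case by simp
next
  case (Cons l w)
  have l: "fst l \<in> S" and w: "w \<in> reduced_words S" and h: "w \<noteq> [] \<Longrightarrow> hd w \<noteq> (fst l, \<not> snd l)"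
    using Cons.prems(1) by (auto simp: reduced_words_Cons)
  have "act (word_value G w) x0 \<notin> D (fst l, \<not> snd l)"
  proof (cases "w = []")
    case True
    then show ?thesis using x0[of "(fst l, \<not> snd l)"] l by (simp add: word_value_simps act_one)
  next
    case False
    have "fst (hd w) \<in> S" using w False by (cases w) (auto simp: reduced_words_Cons)
    then have "D (hd w) \<inter> D (fst l, \<not> snd l) = {}"
      using disjoint[of "hd w" "(fst l, \<not> snd l)"] l h[OF False] by simp
    then show ?thesis using Cons.IH[OF w False] by blast
  qed
  from attract[OF l this] show ?case
    using act_mult[OF letter_closed[OF l] word_closed[OF w]] by (simp add: word_value_simps)
qed

lemma word_value_inj: "inj_on (word_value G) (reduced_words S)"
proof (rule inj_onI)
  fix w w' assume "w \<in> reduced_words S" "w' \<in> reduced_words S" "word_value G w = word_value G w'"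
  then show "w = w'"
  proof (induction w arbitrary: w')
    case Nil
    show ?case
    proof (rule ccontr)
      assume "[] \<noteq> w'"
      then have "act (word_value G w') x0 \<in> D (hd w')" "fst (hd w') \<in> S"
        using word_moves[OF Nil.prems(2)] Nil.prems(2) by (cases w'; auto simp: reduced_words_Cons)+
      then show False using Nil.prems(3) x0[of "hd w'"] by (simp add: word_value_simps act_one flip: Nil.prems(3))
    qed
  next
    case (Cons l w)
    have m: "act (word_value G (l # w)) x0 \<in> D l" using word_moves[OF Cons.prems(1)] by simp
    have l: "fst l \<in> S" "w \<in> reduced_words S" using Cons.prems(1) by (auto simp: reduced_words_Cons)
    show ?case
    proof (cases w')
      case Nil
      then show ?thesis using m Cons.prems(3) x0[of l] l by (simp add: word_value_simps(1) act_one)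
    next
      case (Cons l' v)
      have l': "fst l' \<in> S" "v \<in> reduced_words S" using Cons.prems(2) Cons by (auto simp: reduced_words_Cons)
      have "act (word_value G (l # w)) x0 \<in> D l'"
        using word_moves[OF Cons.prems(2)] Cons Cons.prems(3) by simp
      then have eq: "l = l'" using m disjoint[OF l(1) l'(1)] by blast
      have "letter G l \<otimes> word_value G w = letter G l \<otimes> word_value G v"
        using Cons.prems(3) Cons eq by (simp add: word_value_simps)
      then have "word_value G w = word_value G v"
        using l l' word_closed letter_closed \<Delta>_carrier by (metis cancel_left_inv(1))
      then show ?thesis using Cons.IH[OF l(2) l'(2)] Cons eq by simp
    qed
  qed
qed

text \<open>The subgroup generated by \<open>S\<close>, as the set of values of reduced words.\<close>

definition F :: "'a set" where "F = word_value G ` reduced_words S"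

lemma F_carrier: "x \<in> F \<Longrightarrow> x \<in> carrier G"
  unfolding F_def using word_closed \<Delta>_carrier by auto

lemma F_letter_mult:
  assumes l: "fst l \<in> S" and x: "x \<in> F"
  shows "letter G l \<otimes> x \<in> F"
proof -
  obtain w where w: "w \<in> reduced_words S" "x = word_value G w" using x by (auto simp: F_def)
  show ?thesis
  proof (cases "w \<noteq> [] \<and> hd w = (fst l, \<not> snd l)")
    case False
    then have "l # w \<in> reduced_words S" using l w by (auto simp: reduced_words_Cons)
    then show ?thesis using w by (auto simp: F_def word_value_simps intro!: image_eqI[of _ _ "l # w"])
  next
    case True
    then obtain v where v: "w = (fst l, \<not> snd l) # v" by (metis list.collapse)
    then have vr: "v \<in> reduced_words S" using w by (simp add: reduced_words_Cons)
    have c: "fst l \<in> carrier G" "word_value G v \<in> carrier G"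
      using l S \<Delta>_carrier word_closed[OF vr] by auto
    have "letter G l \<otimes> x = word_value G v"
      using c by (cases "snd l") (simp_all add: w v word_value_simps letter_def)
    then show ?thesis using vr by (simp add: F_def)
  qed
qed

lemma F_one: "\<one> \<in> F"
  unfolding F_def by (rule image_eqI[of _ _ "[]"]) (auto simp: word_value_simps reduced_words_def)

lemma F_word_mult:
  assumes "w \<in> reduced_words S" "x \<in> F"
  shows "word_value G w \<otimes> x \<in> F"
  using assms(1)
proof (induction w)
  case Nil
  then show ?case using assms(2) F_carrier by (simp add: word_value_simps)
next
  case (Cons l w)
  then have l: "fst l \<in> S" "w \<in> reduced_words S" by (auto simp: reduced_words_Cons)
  then show ?case
    using F_letter_mult[OF l(1) Cons.IH[OF l(2)]] letter_closed[OF l(1)] word_closed[OF l(2)] \<Delta>_carrier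
      F_carrier[OF assms(2)] by (simp add: word_value_simps m_assoc)
qed

lemma F_letter:
  assumes "fst l \<in> S" shows "letter G l \<in> F"
  using F_letter_mult[OF assms F_one] letter_closed[OF assms] \<Delta>_carrier by simp

lemma subgroup_F: "subgroup F G"
proof (rule subgroupI)
  show "F \<subseteq> carrier G" using F_carrier by auto
  show "F \<noteq> {}" using F_one by auto
  have mult: "x \<otimes> y \<in> F" if "x \<in> F" "y \<in> F" for x y
    using that(1) F_word_mult[OF _ that(2)] by (auto simp: F_def)
  then show "x \<otimes> y \<in> F" if "x \<in> F" "y \<in> F" for x y using that .
  fix x assume "x \<in> F"
  then obtain w where w: "w \<in> reduced_words S" "x = word_value G w" by (auto simp: F_def)
  have "inv (word_value G w) \<in> F" using w(1)
  proof (induction w)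
    case Nil
    then show ?case using F_one by (simp add: word_value_simps)
  next
    case (Cons l w)
    then have l: "fst l \<in> S" "w \<in> reduced_words S" by (auto simp: reduced_words_Cons)
    have lc: "fst l \<in> carrier G" using l(1) S \<Delta>_carrier by auto
    have "inv (letter G l) = letter G (fst l, \<not> snd l)"
      using lc by (simp add: letter_def)
    then have "inv (letter G l) \<in> F" using F_letter[of "(fst l, \<not> snd l)"] l by simp
    then have "inv (word_value G w) \<otimes> inv (letter G l) \<in> F" using mult Cons.IH[OF l(2)] by simp
    then show ?case
      using letter_closed[OF l(1)] word_closed[OF l(2)] \<Delta>_carrier
      by (simp add: word_value_simps inv_mult_group)
  qed
  then show "inv x \<in> F" using w by simp
qed

theorem nonabelian_free:
  assumes st: "s \<in> S" "t \<in> S" "s \<noteq> t"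
  shows "has_nonabelian_free_subgroup G"
  unfolding has_nonabelian_free_subgroup_def
proof (intro exI conjI)
  let ?F = "G\<lparr>carrier := F\<rparr>"
  show "subgroup F G" by (rule subgroup_F)
  have SF: "S \<subseteq> F"
  proof
    fix s assume "s \<in> S" then show "s \<in> F" using F_letter[of "(s, True)"] by (simp add: letter_def)
  qed
  have "letter ?F l = letter G l" if "fst l \<in> S" for l
    using m_inv_consistent[OF subgroup_F, of "fst l"] SF that by (auto simp: letter_def)
  then have val: "word_value ?F w = word_value G w" if "w \<in> reduced_words S" for w
    using that by (induction w) (auto simp: word_value_simps reduced_words_Cons)
  have "bij_betw (word_value ?F) (reduced_words S) (carrier ?F)"
    using word_value_inj val unfolding bij_betw_def
    by (simp add: F_def cong: inj_on_cong image_cong)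
  then show "free_group ?F"
    unfolding free_group_def using SF subgroup_imp_group[OF subgroup_F] by auto
  show "\<not> comm_group ?F"
  proof
    assume comm: "comm_group ?F"
    have "s \<otimes> t = t \<otimes> s"
      using comm_groupE(4)[OF comm, of s t] SF st by auto
    moreover have "s \<in> carrier G" "t \<in> carrier G" using st S \<Delta>_carrier by auto
    ultimately have "word_value G [(s, True), (t, True)] = word_value G [(t, True), (s, True)]"
      by (simp add: word_value_simps letter_def)
    moreover have "[(s, True), (t, True)] \<in> reduced_words S" "[(t, True), (s, True)] \<in> reduced_words S"
      using st by (auto simp: reduced_words_def)
    ultimately have "[(s, True), (t, True)] = [(t, True), (s, True)]"
      using inj_onD[OF word_value_inj] by metis
    then show False using st by simp
  qed
qed

text \<open>An invariant mean on \<open>G\<close> would induce, through the orbit map at \<open>x0\<close>, a finitely additive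
  measure on the space acted upon, invariant under \<open>\<Delta>\<close> and of positive total mass \<open>m\<close>. Ping-pong forces each of the
  pairs \<open>D (s, True)\<close>, \<open>D (s, False)\<close> to have mass at least \<open>m\<close>, and there are two disjoint such pairs.\<close>

theorem not_amenable:
  assumes st: "s \<in> S" "t \<in> S" "s \<noteq> t" and fi: "finite_index G \<Delta>"
  shows "\<not> amenable G"
proof
  assume "amenable G"
  then obtain \<mu> :: "'a set \<Rightarrow> real" where \<mu>: "(\<forall>A\<subseteq>carrier G. 0 \<le> \<mu> A) \<and> \<mu> (carrier G) = 1 \<and>
      (\<forall>A\<subseteq>carrier G. \<forall>B\<subseteq>carrier G. A \<inter> B = {} \<longrightarrow> \<mu> (A \<union> B) = \<mu> A + \<mu> B) \<and>
      (\<forall>g\<in>carrier G. \<forall>A\<subseteq>carrier G. \<mu> (g <# A) = \<mu> A)"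
    unfolding amenable_def by (rule exE)
  have nonneg: "\<And>A. A \<subseteq> carrier G \<Longrightarrow> 0 \<le> \<mu> A"
    and total: "\<mu> (carrier G) = 1"
    and add: "\<And>A B. A \<subseteq> carrier G \<Longrightarrow> B \<subseteq> carrier G \<Longrightarrow> A \<inter> B = {} \<Longrightarrow> \<mu> (A \<union> B) = \<mu> A + \<mu> B"
    and inv: "\<And>g A. g \<in> carrier G \<Longrightarrow> A \<subseteq> carrier G \<Longrightarrow> \<mu> (g <# A) = \<mu> A"
    using \<mu> by simp_all
  have mono: "\<mu> A \<le> \<mu> B" if "A \<subseteq> B" "B \<subseteq> carrier G" for A B
  proof -
    have "\<mu> (A \<union> (B - A)) = \<mu> A + \<mu> (B - A)" by (rule add) (use that in auto)
    moreover have "A \<union> (B - A) = B" using that by auto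
    moreover have "\<mu> (B - A) \<ge> 0" by (rule nonneg) (use that in auto)
    ultimately show ?thesis by simp
  qed
  have subadd: "\<mu> (A \<union> B) \<le> \<mu> A + \<mu> B" if "A \<subseteq> carrier G" "B \<subseteq> carrier G" for A B
  proof -
    have "\<mu> (A \<union> (B - A)) = \<mu> A + \<mu> (B - A)" by (rule add) (use that in auto)
    moreover have "A \<union> (B - A) = A \<union> B" by auto
    moreover have "\<mu> (B - A) \<le> \<mu> B" by (rule mono) (use that in auto)
    ultimately show ?thesis by simp
  qed
  have \<Delta>c: "\<Delta> \<subseteq> carrier G" using subgroup.subset[OF \<Delta>] .
  \<comment> \<open>Finitely many translates of \<open>\<Delta>\<close> cover the group.\<close>
  have "\<mu> \<Delta> > 0"
  proof (rule ccontr)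
    assume "\<not> ?thesis"
    then have m0: "\<mu> \<Delta> = 0" using nonneg[OF \<Delta>c] by simp
    obtain T where T: "T \<subseteq> carrier G" "finite T" "\<And>x. x \<in> carrier G \<Longrightarrow> \<exists>t\<in>T. inv t \<otimes> x \<in> \<Delta>"
      using fi unfolding finite_index_def by auto
    have e0: "\<mu> {} = 0" using add[of "{}" "{}"] by simp
    have "(\<Union>t\<in>U. t <# \<Delta>) \<subseteq> carrier G \<and> \<mu> (\<Union>t\<in>U. t <# \<Delta>) \<le> 0" if "finite U" "U \<subseteq> carrier G" for U
      using that
    proof (induction U)
      case empty
      then show ?case by (simp add: e0)
    next
      case (insert u U)
      have "u <# \<Delta> \<subseteq> carrier G" using l_coset_subset_G[OF \<Delta>c] insert by auto
      then show ?case using insert subadd[of "u <# \<Delta>" "\<Union>t\<in>U. t <# \<Delta>"] inv[of u \<Delta>] m0 \<Delta>c by auto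
    qed
    then have "\<mu> (\<Union>t\<in>T. t <# \<Delta>) \<le> 0" using T by auto
    moreover have "(\<Union>t\<in>T. t <# \<Delta>) = carrier G"
    proof
      show "(\<Union>t\<in>T. t <# \<Delta>) \<subseteq> carrier G" using l_coset_subset_G[OF \<Delta>c] T(1) by auto
      show "carrier G \<subseteq> (\<Union>t\<in>T. t <# \<Delta>)"
      proof
        fix x assume x: "x \<in> carrier G"
        then obtain t where t: "t \<in> T" "inv t \<otimes> x \<in> \<Delta>" using T(3) by auto
        have "x = t \<otimes> (inv t \<otimes> x)" using t(1) T(1) x by auto
        then have "x \<in> t <# \<Delta>" using t(2) unfolding l_coset_def by auto
        then show "x \<in> (\<Union>t\<in>T. t <# \<Delta>)" using t(1) by auto
      qed
    qed
    ultimately show False using total by simp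
  qed
  \<comment> \<open>The mean induces a finitely additive measure on the space by the orbit map at
    \<open>x0\<close>.\<close>
  define \<nu> where "\<nu> Y = \<mu> {g \<in> \<Delta>. act g x0 \<in> Y}" for Y
  have pair: "\<mu> \<Delta> \<le> \<nu> (D (u, True)) + \<nu> (D (u, False))" if u: "u \<in> S" for u
  proof -
    let ?A = "{g \<in> \<Delta>. act g x0 \<notin> D (u, False)}"
    have Ac: "?A \<subseteq> carrier G" using \<Delta>c by auto
    have u\<Delta>: "u \<in> \<Delta>" using u S by auto
    have "u <# ?A \<subseteq> {g \<in> \<Delta>. act g x0 \<in> D (u, True)}"
    proof
      fix x assume "x \<in> u <# ?A"
      then obtain g where g: "x = u \<otimes> g" "g \<in> \<Delta>" "act g x0 \<notin> D (u, False)"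
        unfolding l_coset_def by auto
      then show "x \<in> {g \<in> \<Delta>. act g x0 \<in> D (u, True)}"
        using attract[OF u, of "act g x0" True] act_mult[OF u\<Delta> g(2)] subgroup.m_closed[OF \<Delta> u\<Delta> g(2)]
        by (simp add: letter_def)
    qed
    then have "\<mu> (u <# ?A) \<le> \<nu> (D (u, True))"
      unfolding \<nu>_def by (rule mono) (use \<Delta>c in auto)
    then have "\<mu> ?A \<le> \<nu> (D (u, True))" using inv[OF \<Delta>_carrier[OF u\<Delta>] Ac] by simp
    moreover have "\<mu> (?A \<union> {g \<in> \<Delta>. act g x0 \<in> D (u, False)}) = \<mu> ?A + \<nu> (D (u, False))"
      unfolding \<nu>_def by (rule add) (use \<Delta>c in auto)
    moreover have "?A \<union> {g \<in> \<Delta>. act g x0 \<in> D (u, False)} = \<Delta>" by auto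
    ultimately show ?thesis by simp
  qed
  have \<nu>_add: "\<nu> (Y \<union> Z) = \<nu> Y + \<nu> Z" if "Y \<inter> Z = {}" for Y Z
  proof -
    have "{g \<in> \<Delta>. act g x0 \<in> Y \<union> Z} = {g \<in> \<Delta>. act g x0 \<in> Y} \<union> {g \<in> \<Delta>. act g x0 \<in> Z}" by auto
    then show ?thesis
      unfolding \<nu>_def by (simp, intro add) (use that \<Delta>c in auto)
  qed
  have dis: "D l \<inter> D l' = {}" if "l \<noteq> l'" "l \<in> {s, t} \<times> UNIV" "l' \<in> {s, t} \<times> UNIV" for l l'
    by (rule disjoint) (use that st in auto)
  have "\<nu> ((D (s, True) \<union> D (s, False)) \<union> (D (t, True) \<union> D (t, False)))
      = \<nu> (D (s, True) \<union> D (s, False)) + \<nu> (D (t, True) \<union> D (t, False))"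
    by (rule \<nu>_add) (use dis st in \<open>auto simp: Int_Un_distrib Int_Un_distrib2\<close>)
  also have "\<nu> (D (s, True) \<union> D (s, False)) = \<nu> (D (s, True)) + \<nu> (D (s, False))"
    by (rule \<nu>_add) (use dis in auto)
  also have "\<nu> (D (t, True) \<union> D (t, False)) = \<nu> (D (t, True)) + \<nu> (D (t, False))"
    by (rule \<nu>_add) (use dis in auto)
  finally have "2 * \<mu> \<Delta> \<le> \<nu> ((D (s, True) \<union> D (s, False)) \<union> (D (t, True) \<union> D (t, False)))"
    using pair[OF st(1)] pair[OF st(2)] by simp
  moreover have "\<nu> ((D (s, True) \<union> D (s, False)) \<union> (D (t, True) \<union> D (t, False))) \<le> \<mu> \<Delta>"
    unfolding \<nu>_def by (rule mono) (use \<Delta>c in auto)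
  ultimately show False using \<open>\<mu> \<Delta> > 0\<close> by simp
qed

end

section \<open>Two by two matrices and homographies\<close>

text \<open>Matrices are written as quadruples, row by row. The adjugate \<open>madj m\<close>
  takes the place of the inverse, which it equals up to a scalar.\<close>

type_synonym mat2 = "real \<times> real \<times> real \<times> real"
type_synonym vec2 = "real \<times> real"

fun mdet :: "mat2 \<Rightarrow> real" where "mdet (a, b, c, d) = a * d - b * c"
fun mtr :: "mat2 \<Rightarrow> real" where "mtr (a, b, c, d) = a + d"
fun mmul :: "mat2 \<Rightarrow> mat2 \<Rightarrow> mat2" where
  "mmul (a, b, c, d) (a', b', c', d') =
     (a * a' + b * c', a * b' + b * d', c * a' + d * c', c * b' + d * d')"
fun madj :: "mat2 \<Rightarrow> mat2" where "madj (a, b, c, d) = (d, - b, - c, a)"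
fun mapp :: "mat2 \<Rightarrow> vec2 \<Rightarrow> vec2" where
  "mapp (a, b, c, d) (u, v) = (a * u + b * v, c * u + d * v)"
fun mhom :: "mat2 \<Rightarrow> p1 \<Rightarrow> p1" where "mhom (a, b, c, d) = homography a b c d"
definition mscal :: "real \<Rightarrow> mat2" where "mscal k = (k, 0, 0, k)"
definition is_scal :: "mat2 \<Rightarrow> bool" where "is_scal m \<longleftrightarrow> (\<exists>k. m = mscal k)"
fun vdet :: "vec2 \<Rightarrow> vec2 \<Rightarrow> real" where "vdet (u, v) (u', v') = u * v' - u' * v"
fun vpoint :: "vec2 \<Rightarrow> p1" where "vpoint (u, v) = hpoint u v"
fun vscale :: "real \<Rightarrow> vec2 \<Rightarrow> vec2" where "vscale k (u, v) = (k * u, k * v)"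
abbreviation vzero :: vec2 where "vzero \<equiv> (0, 0)"

lemma mdet_mmul: "mdet (mmul m n) = mdet m * mdet n"
  by (cases m, cases n) (simp add: algebra_simps)

lemma mdet_madj [simp]: "mdet (madj m) = mdet m"
  by (cases m) (simp add: algebra_simps)

lemma mmul_assoc: "mmul (mmul l m) n = mmul l (mmul m n)"
  by (cases l, cases m, cases n) (simp add: algebra_simps)

lemma mmul_madj: "mmul m (madj m) = mscal (mdet m)" "mmul (madj m) m = mscal (mdet m)"
  by (cases m; simp add: mscal_def algebra_simps)+

lemma mapp_mmul: "mapp (mmul m n) v = mapp m (mapp n v)"
  by (cases m, cases n, cases v) (simp add: algebra_simps)

lemma vdet_mapp: "vdet (mapp m v) (mapp m w) = mdet m * vdet v w"
  by (cases m, cases v, cases w) (simp add: algebra_simps)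

lemma mapp_nonzero:
  assumes "mdet m \<noteq> 0" "v \<noteq> vzero"
  shows "mapp m v \<noteq> vzero"
proof
  assume z: "mapp m v = vzero"
  obtain a b c d where m: "m = (a, b, c, d)" by (metis prod_cases4)
  obtain x y where v: "v = (x, y)" by (cases v)
  have "(a * d - b * c) * x = d * (a * x + b * y) - b * (c * x + d * y)"
    "(a * d - b * c) * y = a * (c * x + d * y) - c * (a * x + b * y)" by (simp_all add: algebra_simps)
  then show False using z assms by (simp add: m v)
qed

lemma mhom_vpoint: "v \<noteq> vzero \<Longrightarrow> mhom m (vpoint v) = vpoint (mapp m v)"
  by (cases m, cases v) (auto simp: homography_hpoint)

lemma vpoint_cases:
  obtains v where "p = vpoint v" "v \<noteq> vzero"
  by (rule hpoint_cases[of p]) (metis fst_conv snd_conv vpoint.simps)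

lemma vpoint_eq_iff:
  assumes "v \<noteq> vzero" "w \<noteq> vzero"
  shows "vpoint v = vpoint w \<longleftrightarrow> vdet v w = 0"
proof -
  obtain x y x' y' where vw: "v = (x, y)" "w = (x', y')" by (cases v, cases w)
  show ?thesis
    using assms unfolding vw by (auto simp: hpoint_def frac_eq_eq)
qed

lemma vdet_eq_0_iff:
  assumes "v \<noteq> vzero"
  shows "vdet v w = 0 \<longleftrightarrow> (\<exists>k. w = vscale k v)"
proof -
  obtain x y x' y' where vw: "v = (x, y)" "w = (x', y')" by (cases v, cases w)
  show ?thesis
  proof
    assume "vdet v w = 0"
    then have e: "x * y' = x' * y" by (simp add: vw)
    show "\<exists>k. w = vscale k v"
    proof (cases "x = 0")
      case False
      then show ?thesis using e by (intro exI[of _ "x' / x"]) (simp add: vw field_simps)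
    next
      case True
      then show ?thesis using e assms by (intro exI[of _ "y' / y"]) (simp add: vw field_simps)
    qed
  qed (auto simp: vw algebra_simps)
qed

lemma mhom_mmul:
  assumes "mdet n \<noteq> 0"
  shows "mhom (mmul m n) p = mhom m (mhom n p)"
  by (rule vpoint_cases[of p]) (simp add: mhom_vpoint mapp_mmul mapp_nonzero assms)

lemma mhom_scal: "k \<noteq> 0 \<Longrightarrow> mhom (mscal k) p = p"
  by (simp add: mscal_def homography_scalar)

lemma PGL2_E:
  assumes "h \<in> PGL2" obtains m where "mdet m \<noteq> 0" "h = mhom m"
proof -
  obtain a b c d where "h = homography a b c d" "a * d - b * c \<noteq> 0" using assms by (auto simp: PGL2_def)
  then show ?thesis using that[of "(a, b, c, d)"] by simp
qed

lemma mhom_madj: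
  assumes "mdet m \<noteq> 0"
  shows "mhom (madj m) (mhom m p) = p" "mhom m (mhom (madj m) p) = p"
  using assms by (simp_all flip: mhom_mmul add: mmul_madj mhom_scal)

lemma scal_iff: "is_scal (a, b, c, d) \<longleftrightarrow> b = 0 \<and> c = 0 \<and> a = d"
  by (auto simp: is_scal_def mscal_def)

text \<open>The finite fixed points are the roots of a polynomial of degree at most two.\<close>

lemma mhom_fixes_infinite:
  assumes inf: "infinite {p. mhom m p = p}"
  shows "is_scal m"
proof -
  obtain a b c d where m: "m = (a, b, c, d)" by (metis prod_cases4)
  let ?F = "{x. mhom m (Some x) = Some x}"
  have "{p. mhom m p = p} \<subseteq> insert None (Some ` ?F)"
  proof
    fix p assume "p \<in> {p. mhom m p = p}"
    then show "p \<in> insert None (Some ` ?F)" by (cases p) auto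
  qed
  then have infF: "infinite ?F" using inf finite_subset[of _ "insert None (Some ` ?F)"] by blast
  have root: "c * x * x + (d - a) * x - b = 0" if "x \<in> ?F" for x
  proof -
    have "homography a b c d (Some x) = Some x" using that by (simp add: m)
    then have "c * x + d \<noteq> 0" "(a * x + b) / (c * x + d) = x"
      by (simp_all split: if_splits)
    then show ?thesis by (simp add: field_simps)
  qed
  obtain x where x: "x \<in> ?F" using infF by (metis all_not_in_conv finite.emptyI)
  have "infinite (?F - {x})" using infF by simp
  then obtain y where y: "y \<in> ?F - {x}" by (metis all_not_in_conv finite.emptyI)
  have "infinite (?F - {x} - {y})" using \<open>infinite (?F - {x})\<close> by simp
  then obtain z where z: "z \<in> ?F - {x} - {y}" by (metis all_not_in_conv finite.emptyI)
  have r: "c * x * x + (d - a) * x - b = 0" "c * y * y + (d - a) * y - b = 0"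
    "c * z * z + (d - a) * z - b = 0" using root x y z by auto
  have "(x - y) * (c * (x + y) + (d - a)) = 0" "(x - z) * (c * (x + z) + (d - a)) = 0"
    using r by (simp_all add: algebra_simps)
  then have e: "c * (x + y) + (d - a) = 0" "c * (x + z) + (d - a) = 0" using y z by auto
  moreover have "c * (y - z) = (c * (x + y) + (d - a)) - (c * (x + z) + (d - a))"
    by (simp add: algebra_simps)
  ultimately have "c * (y - z) = 0" by simp
  then have "c = 0" using z by auto
  then show ?thesis using e r by (simp add: m scal_iff)
qed

lemma mhom_agree_infinite:
  assumes "mdet m \<noteq> 0" "mdet n \<noteq> 0" "infinite {p. mhom m p = mhom n p}"
  shows "is_scal (mmul (madj n) m)"
proof (rule mhom_fixes_infinite)
  have "{p. mhom m p = mhom n p} \<subseteq> {p. mhom (mmul (madj n) m) p = p}"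
    using assms(1,2) by (auto simp: mhom_mmul mhom_madj)
  then show "infinite {p. mhom (mmul (madj n) m) p = p}" using assms(3) finite_subset by auto
qed

lemma mhom_eq_of_scal:
  assumes "mdet m \<noteq> 0" "mdet n \<noteq> 0" "is_scal (mmul (madj n) m)"
  shows "mhom m = mhom n"
proof
  fix p
  obtain k where k: "mmul (madj n) m = mscal k" using assms(3) by (auto simp: is_scal_def)
  have "mdet (mmul (madj n) m) \<noteq> 0" using assms by (simp add: mdet_mmul)
  then have "k \<noteq> 0" by (auto simp: k mscal_def)
  then have "mhom (madj n) (mhom m p) = p" using mhom_mmul[OF assms(1), of "madj n" p] k by (simp add: mhom_scal)
  then show "mhom m p = mhom n p" using mhom_madj(2)[OF assms(2)] by metis
qed

text \<open>The commutator multiplied by \<open>mdet m * mdet n\<close>, which avoids division.\<close>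

definition mcomm :: "mat2 \<Rightarrow> mat2 \<Rightarrow> mat2" where
  "mcomm m n = mmul (mmul (mmul m n) (madj m)) (madj n)"

lemma mcomm_scal:
  assumes "mmul m n = mmul n m"
  shows "mcomm m n = mscal (mdet m * mdet n)"
proof -
  have "mcomm m n = mmul n (mmul (mmul m (madj m)) (madj n))"
    unfolding mcomm_def assms by (simp add: mmul_assoc)
  then show ?thesis
    by (cases n) (simp add: mmul_madj mscal_def algebra_simps)
qed

lemma mdet_mcomm: "mdet (mcomm m n) = (mdet m * mdet n)\<^sup>2"
  by (simp add: mcomm_def mdet_mmul power2_eq_square)

definition fixes_line :: "vec2 \<Rightarrow> mat2 \<Rightarrow> bool" where
  "fixes_line v m \<longleftrightarrow> (\<exists>k. mapp m v = vscale k v)"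

text \<open>The condition on the determinant says that the second eigenvalue equals the first:
  these are the scalar multiples of the unipotent matrices fixing \<open>v\<close>.\<close>

definition unip_line :: "vec2 \<Rightarrow> mat2 \<Rightarrow> bool" where
  "unip_line v m \<longleftrightarrow> (\<exists>k. k \<noteq> 0 \<and> mapp m v = vscale k v \<and> mdet m = k\<^sup>2)"

lemma fixes_line_madj:
  assumes "mdet m \<noteq> 0" "v \<noteq> vzero" "mapp m v = vscale k v"
  shows "k \<noteq> 0" "mapp (madj m) v = vscale (mdet m / k) v"
proof -
  show k: "k \<noteq> 0" using mapp_nonzero[OF assms(1,2)] assms(3) by (cases v) auto
  have "mapp (madj m) (mapp m v) = vscale (mdet m) v"
    by (cases v) (simp add: mmul_madj mscal_def flip: mapp_mmul)
  then have "mapp (madj m) (vscale k v) = vscale (mdet m) v" using assms(3) by simp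
  then show "mapp (madj m) v = vscale (mdet m / k) v"
    using k by (cases m, cases v) (simp add: field_simps)
qed

lemma vscale_vscale [simp]: "vscale k (vscale l v) = vscale (k * l) v"
  by (cases v) simp

lemma mapp_vscale [simp]: "mapp m (vscale k v) = vscale k (mapp m v)"
  by (cases v, cases m) (simp add: algebra_simps)

text \<open>A commutator of triangular matrices is unipotent.\<close>

lemma fixes_line_mcomm:
  assumes "mdet m \<noteq> 0" "mdet n \<noteq> 0" "v \<noteq> vzero" "fixes_line v m" "fixes_line v n"
  shows "unip_line v (mcomm m n)"
proof -
  obtain k l where kl: "mapp m v = vscale k v" "mapp n v = vscale l v"
    using assms(4,5) by (auto simp: fixes_line_def)
  note km = fixes_line_madj[OF assms(1,3) kl(1)] and ln = fixes_line_madj[OF assms(2,3) kl(2)]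
  have "mapp (mcomm m n) v = vscale (mdet n / l * (mdet m / k) * l * k) v"
    by (simp add: mcomm_def mapp_mmul kl km ln)
  also have "mdet n / l * (mdet m / k) * l * k = mdet m * mdet n" using km(1) ln(1) by simp
  finally show ?thesis
    unfolding unip_line_def mdet_mcomm using assms(1,2) by (intro exI[of _ "mdet m * mdet n"]) simp
qed

text \<open>Such a matrix is \<open>k\<close> plus a multiple of the nilpotent matrix with image
  and kernel spanned by \<open>(u, w)\<close>.\<close>

lemma unip_line_form:
  assumes v: "(u, w) \<noteq> vzero" and m: "unip_line (u, w) m"
  shows "\<exists>k s. m = (k + s * (u * w), - s * (u * u), s * (w * w), k - s * (u * w))"
proof -
  obtain a b c d where mm: "m = (a, b, c, d)" by (metis prod_cases4)
  obtain k where k0: "k \<noteq> 0"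
    and k: "a * u + b * w = k * u" "c * u + d * w = k * w" "a * d - b * c = k\<^sup>2"
    using m by (auto simp: unip_line_def mm)
  have "(a - k) * (d - k) = b * c"
  proof (cases "u = 0")
    case True
    then have "w \<noteq> 0" using v by simp
    then show ?thesis using True k by simp
  next
    case False
    have "u * ((a - k) * (d - k)) = ((a - k) * u) * (d - k)" by simp
    also have "(a - k) * u = - b * w" using k(1) by (simp add: algebra_simps)
    also have "- b * w * (d - k) = b * (- (d - k) * w)" by (simp add: algebra_simps)
    also have "- (d - k) * w = c * u" using k(2) by (simp add: algebra_simps)
    finally show ?thesis using False by simp
  qed
  then have "k * (a + d) = k * (2 * k)" using k(3) by (simp add: algebra_simps power2_eq_square)
  then have tr: "d = 2 * k - a" using k0 by simp
  show ?thesis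
  proof (cases "u = 0")
    case True
    then have "w \<noteq> 0" using v by simp
    then show ?thesis
      using True k tr by (intro exI[of _ k] exI[of _ "c / (w * w)"]) (simp add: mm)
  next
    case False
    have a: "a = k - b * w / u" using k(1) False by (simp add: field_simps)
    have c: "c = - (d - k) * w / u" using k(2) False by (simp add: field_simps)
    show ?thesis
      by (intro exI[of _ k] exI[of _ "- b / (u * u)"])
        (use False in \<open>simp add: mm a c tr field_simps\<close>)
  qed
qed

lemma unip_line_commute:
  assumes v: "v \<noteq> vzero" and m: "unip_line v m" and n: "unip_line v n"
  shows "mmul m n = mmul n m"
proof -
  obtain u w where uw: "v = (u, w)" by (cases v)
  obtain k s where "m = (k + s * (u * w), - s * (u * u), s * (w * w), k - s * (u * w))"
    using unip_line_form[of u w m] v m uw by auto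
  moreover obtain l t where "n = (l + t * (u * w), - t * (u * u), t * (w * w), l - t * (u * w))"
    using unip_line_form[of u w n] v n uw by auto
  ultimately show ?thesis by (simp add: algebra_simps)
qed

text \<open>The matrices commuting with a non-scalar matrix are its polynomials.\<close>

lemma centralizer_commute:
  assumes T: "\<not> is_scal T" and m: "mmul m T = mmul T m" and n: "mmul n T = mmul T n"
  shows "mmul m n = mmul n m"
proof -
  obtain p q r s where t: "T = (p, q, r, s)" by (metis prod_cases4)
  have *: "b * r = q * c \<and> q * (a - d) = b * (p - s) \<and> c * (p - s) = r * (a - d)"
    if "mmul (a, b, c, d) T = mmul T (a, b, c, d)" for a b c d
  proof -
    have e: "a * p + b * r = p * a + q * c" "a * q + b * s = p * b + q * d" "c * p + d * r = r * a + s * c"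
      using that by (simp_all add: t)
    show ?thesis
    proof (intro conjI)
      show "b * r = q * c" using e(1) by simp
      have "q * (a - d) - b * (p - s) = (a * q + b * s) - (p * b + q * d)" by (simp add: algebra_simps)
      then show "q * (a - d) = b * (p - s)" using e(2) by simp
      have "c * (p - s) - r * (a - d) = (c * p + d * r) - (r * a + s * c)" by (simp add: algebra_simps)
      then show "c * (p - s) = r * (a - d)" using e(3) by simp
    qed
  qed
  obtain a b c d where mm: "m = (a, b, c, d)" by (metis prod_cases4)
  obtain a' b' c' d' where nn: "n = (a', b', c', d')" by (metis prod_cases4)
  note 1 = *[of a b c d] and 2 = *[of a' b' c' d']
  have e: "b * r = q * c" "q * (a - d) = b * (p - s)" "c * (p - s) = r * (a - d)"
    "b' * r = q * c'" "q * (a' - d') = b' * (p - s)" "c' * (p - s) = r * (a' - d')"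
    using 1 2 m n by (simp_all add: mm nn)
  have nz: "q \<noteq> 0 \<or> r \<noteq> 0 \<or> p - s \<noteq> 0" using T by (auto simp: t scal_iff)
  have "b * c' = b' * c \<and> b * (a' - d') = b' * (a - d) \<and> c * (a' - d') = c' * (a - d)"
  proof (cases "q = 0")
    case False
    have c: "c = b * r / q" "c' = b' * r / q" "a - d = b * (p - s) / q" "a' - d' = b' * (p - s) / q"
      using e False by (simp_all add: field_simps)
    show ?thesis unfolding c by simp
  next
    case q: True
    show ?thesis
    proof (cases "r = 0")
      case False
      have c: "b = 0" "b' = 0" "a - d = c * (p - s) / r" "a' - d' = c' * (p - s) / r"
        using e False q by (simp_all add: field_simps)
      show ?thesis unfolding c by simp
    next
      case True
      then have "p - s \<noteq> 0" using nz q by simp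
      then show ?thesis using e q True by simp
    qed
  qed
  then have f: "b * c' = b' * c" "b * (a' - d') = b' * (a - d)" "c * (a' - d') = c' * (a - d)" by auto
  show ?thesis
    unfolding mm nn using f by (simp add: algebra_simps)
qed

section \<open>Groups of matrices without hyperbolic elements\<close>

definition hyperbolic :: "mat2 \<Rightarrow> bool" where
  "hyperbolic m \<longleftrightarrow> (mtr m)\<^sup>2 > 4 * mdet m"

lemma mtr_mcomm_not_hyperbolic:
  assumes d: "mdet T > 0" "mdet h > 0" and C: "\<not> hyperbolic (mcomm T h)"
  shows "mtr (mcomm T h) \<le> 2 * (mdet T * mdet h)"
proof -
  have "(mtr (mcomm T h))\<^sup>2 \<le> (2 * (mdet T * mdet h))\<^sup>2"
    using C by (simp add: hyperbolic_def mdet_mcomm power_mult_distrib)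
  then show ?thesis using d by (metis abs_le_square_iff abs_of_nonneg abs_le_D1 less_imp_le mult_nonneg_nonneg zero_le_numeral)
qed

text \<open>With \<open>N = T h - h T\<close>, one has \<open>2 det T det h - tr (mcomm T h) = det
  N\<close>. The matrix \<open>N = (x, y, z, - x)\<close> is traceless, with determinant \<open>-
  (x\<^sup>2 + y z)\<close>, and orthogonal to the traceless part \<open>(\<alpha>, q, r, -
  \<alpha>)\<close> of \<open>T\<close> for the bilinear form of the determinant.\<close>

lemma commutator_det:
  assumes T: "T = (p, q, r, s)" and h: "h = (a, b, c, d)"
    and le: "mtr (mcomm T h) \<le> 2 * (mdet T * mdet h)"
    and x: "x = q * c - b * r" and y: "y = p * b + q * d - a * q - b * s"
    and z: "z = r * a + s * c - c * p - d * r" and \<alpha>: "\<alpha> = (p - s) / 2"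
  shows "x\<^sup>2 + y * z \<le> 0" "2 * x * \<alpha> + y * r + z * q = 0"
proof -
  have "2 * (mdet T * mdet h) - mtr (mcomm T h) = - (x\<^sup>2 + y * z)"
    unfolding T h x y z by (simp add: mcomm_def algebra_simps power2_eq_square)
  then show "x\<^sup>2 + y * z \<le> 0" using le by simp
  show "2 * x * \<alpha> + y * r + z * q = 0"
    unfolding x y z \<alpha> by (simp add: field_simps)
qed

text \<open>The determinant is a Lorentzian form on traceless matrices. If \<open>T\<close> is
  elliptic, its traceless part is timelike; on the orthogonal complement the determinant is then
  negative definite, while \<open>det N \<ge> 0\<close>. Hence \<open>N = 0\<close>.\<close>

lemma elliptic_commutes:
  fixes x y z \<alpha> \<beta> \<gamma> :: real
  assumes N: "x\<^sup>2 + y * z \<le> 0" and o: "2 * x * \<alpha> + y * \<gamma> + z * \<beta> = 0" and e: "\<alpha>\<^sup>2 + \<beta> * \<gamma> < 0"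
  shows "x = 0 \<and> y = 0 \<and> z = 0"
proof -
  have b0: "\<beta> * \<gamma> < 0" using e zero_le_power2[of \<alpha>] by linarith
  have sq: "4 * (x\<^sup>2 * \<alpha>\<^sup>2) = (y * \<gamma> - z * \<beta>)\<^sup>2 + 4 * ((y * z) * (\<beta> * \<gamma>))"
  proof -
    have "2 * x * \<alpha> = - (y * \<gamma> + z * \<beta>)" using o by simp
    then have "(2 * x * \<alpha>)\<^sup>2 = (y * \<gamma> + z * \<beta>)\<^sup>2" by (simp only: power2_minus)
    then show ?thesis by (simp add: power2_eq_square algebra_simps)
  qed
  have "(x\<^sup>2 + y * z) * (\<beta> * \<gamma>) \<ge> 0" using N b0 by (simp add: zero_le_mult_iff)
  then have "4 * (x\<^sup>2 * \<alpha>\<^sup>2) \<ge> (y * \<gamma> - z * \<beta>)\<^sup>2 - 4 * (x\<^sup>2 * (\<beta> * \<gamma>))" using sq by (simp add: algebra_simps)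
  then have "(y * \<gamma> - z * \<beta>)\<^sup>2 \<le> 4 * (x\<^sup>2 * (\<alpha>\<^sup>2 + \<beta> * \<gamma>))" by (simp add: algebra_simps)
  moreover have "x\<^sup>2 * (\<alpha>\<^sup>2 + \<beta> * \<gamma>) \<le> 0" using e by (simp add: mult_le_0_iff)
  moreover have "(y * \<gamma> - z * \<beta>)\<^sup>2 \<ge> 0" by simp
  ultimately have "x\<^sup>2 * (\<alpha>\<^sup>2 + \<beta> * \<gamma>) = 0" "(y * \<gamma> - z * \<beta>)\<^sup>2 = 0" by linarith+
  then have x: "x = 0" and yz: "y * \<gamma> = z * \<beta>" using e by auto
  then have "y * \<gamma> = 0" "z * \<beta> = 0" using o by auto
  then show ?thesis using x b0 by auto
qed

text \<open>If \<open>T\<close> is parabolic, its traceless part is lightlike, so that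
  \<open>N\<close>, orthogonal to it and with \<open>det N \<ge> 0\<close>, is a multiple of it
  and vanishes on the eigenvector \<open>(u, w)\<close> of \<open>T\<close>.\<close>

lemma parabolic_invariant:
  fixes x y z \<alpha> \<beta> \<gamma> u w :: real
  assumes N: "x\<^sup>2 + y * z \<le> 0" and o: "2 * x * \<alpha> + y * \<gamma> + z * \<beta> = 0" and e: "\<alpha>\<^sup>2 + \<beta> * \<gamma> = 0"
    and nz: "\<alpha> \<noteq> 0 \<or> \<beta> \<noteq> 0 \<or> \<gamma> \<noteq> 0" and v: "\<alpha> * u + \<beta> * w = 0" "\<gamma> * u - \<alpha> * w = 0"
  shows "x * u + y * w = 0 \<and> z * u - x * w = 0"
proof -
  have bc: "\<beta> * \<gamma> = - \<alpha>\<^sup>2" using e by simp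
  have "2 * x * \<alpha> = - (y * \<gamma> + z * \<beta>)" using o by simp
  then have "(2 * x * \<alpha>)\<^sup>2 = (y * \<gamma> + z * \<beta>)\<^sup>2" by (simp only: power2_minus)
  then have "4 * (\<alpha>\<^sup>2 * x\<^sup>2) = (y * \<gamma> - z * \<beta>)\<^sup>2 + 4 * (y * z) * (\<beta> * \<gamma>)" by (simp add: power2_eq_square algebra_simps)
  then have "4 * (\<alpha>\<^sup>2 * (x\<^sup>2 + y * z)) = (y * \<gamma> - z * \<beta>)\<^sup>2" unfolding bc by (simp add: algebra_simps)
  moreover have "\<alpha>\<^sup>2 * (x\<^sup>2 + y * z) \<le> 0" using N by (simp add: mult_le_0_iff)
  moreover have "(y * \<gamma> - z * \<beta>)\<^sup>2 \<ge> 0" by simp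
  ultimately have "(y * \<gamma> - z * \<beta>)\<^sup>2 = 0" by linarith
  then have yz: "y * \<gamma> = z * \<beta>" by simp
  then have xa: "x * \<alpha> = - (y * \<gamma>)" "x * \<alpha> = - (z * \<beta>)" using o by linarith+
  show ?thesis
  proof (cases "\<beta> = 0")
    case False
    have w: "w = - \<alpha> * u / \<beta>" using v(1) False by (simp add: field_simps)
    have z: "z = - x * \<alpha> / \<beta>" using xa(2) False by (simp add: field_simps)
    have "x * \<beta> = y * \<alpha>"
    proof (cases "\<gamma> = 0")
      case True
      then have "\<alpha> = 0" using e by simp
      then have "z = 0" using z by simp
      then show ?thesis using N \<open>\<alpha> = 0\<close> by simp
    next
      case False
      have "(x * \<beta>) * \<gamma> = x * (\<beta> * \<gamma>)" by simp
      also have "\<dots> = - \<alpha> * (x * \<alpha>)" unfolding bc by (simp add: power2_eq_square)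
      also have "\<dots> = (y * \<alpha>) * \<gamma>" unfolding xa(1) by simp
      finally show ?thesis using False by simp
    qed
    then show ?thesis unfolding w z using False by (simp add: field_simps)
  next
    case True
    then have a: "\<alpha> = 0" using e by simp
    then have g: "\<gamma> \<noteq> 0" using nz True by simp
    then have "u = 0" "y = 0" using v(2) a yz True by auto
    then show ?thesis using N by simp
  qed
qed

lemma exists_kernel:
  fixes \<alpha> \<beta> \<gamma> :: real
  assumes "\<alpha>\<^sup>2 + \<beta> * \<gamma> = 0"
  obtains u w where "(u, w) \<noteq> vzero" "\<alpha> * u + \<beta> * w = 0" "\<gamma> * u - \<alpha> * w = 0"
proof (cases "\<beta> = 0")
  case True
  then show ?thesis using that[of 0 1] assms by simp
next
  case False
  then show ?thesis using that[of \<beta> "- \<alpha>"] assms by (simp add: power2_eq_square algebra_simps)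
qed

text \<open>Take a nonscalar \<open>T\<close> in \<open>\<Lambda>\<close>. As no commutator
  \<open>mcomm T h\<close> is hyperbolic, \<open>h\<close> commutes with \<open>T\<close> if
  \<open>T\<close> is elliptic, and \<open>h\<close> preserves the eigenline of \<open>T\<close>
  if \<open>T\<close> is parabolic.\<close>

theorem no_hyperbolic:
  assumes det: "\<And>m. m \<in> \<Lambda> \<Longrightarrow> mdet m > 0"
    and mcomm: "\<And>m n. m \<in> \<Lambda> \<Longrightarrow> n \<in> \<Lambda> \<Longrightarrow> mcomm m n \<in> \<Lambda>"
    and nohyp: "\<And>m. m \<in> \<Lambda> \<Longrightarrow> \<not> hyperbolic m"
  shows "(\<exists>T. \<not> is_scal T \<and> (\<forall>m\<in>\<Lambda>. mmul m T = mmul T m)) \<or> (\<exists>v. v \<noteq> vzero \<and> (\<forall>m\<in>\<Lambda>. fixes_line v m))"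
proof (cases "\<forall>m\<in>\<Lambda>. is_scal m")
  case True
  have "fixes_line (1, 0) m" if "is_scal m" for m
    using that by (auto simp: fixes_line_def is_scal_def mscal_def)
  then show ?thesis using True by (intro disjI2 exI[of _ "(1, 0)"]) simp
next
  case False
  then obtain T where T: "T \<in> \<Lambda>" "\<not> is_scal T" by auto
  obtain p q r s where t: "T = (p, q, r, s)" by (metis prod_cases4)
  define \<alpha> where "\<alpha> = (p - s) / 2"
  have disc: "(mtr T)\<^sup>2 - 4 * mdet T = 4 * (\<alpha>\<^sup>2 + q * r)"
    by (simp add: t \<alpha>_def power2_eq_square field_simps)
  have le: "mtr (mcomm T h) \<le> 2 * (mdet T * mdet h)" if "h \<in> \<Lambda>" for h
    using mtr_mcomm_not_hyperbolic[OF det[OF T(1)] det[OF that] nohyp[OF mcomm[OF T(1) that]]] .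
  have "\<alpha>\<^sup>2 + q * r \<le> 0" using nohyp[OF T(1)] disc by (simp add: hyperbolic_def)
  then consider "\<alpha>\<^sup>2 + q * r < 0" | "\<alpha>\<^sup>2 + q * r = 0" by linarith
  then show ?thesis
  proof cases
    case 1
    have "mmul h T = mmul T h" if h: "h \<in> \<Lambda>" for h
    proof -
      obtain a b c d where hh: "h = (a, b, c, d)" by (metis prod_cases4)
      note c = commutator_det[OF t hh le[OF h] refl refl refl \<alpha>_def]
      show ?thesis
        using elliptic_commutes[OF c 1] by (simp add: t hh algebra_simps)
    qed
    then show ?thesis using T(2) by (intro disjI1 exI[of _ T]) blast
  next
    case 2
    obtain u w where uw: "(u, w) \<noteq> vzero" "\<alpha> * u + q * w = 0" "r * u - \<alpha> * w = 0"
      by (rule exists_kernel[OF 2])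
    have nz: "\<alpha> \<noteq> 0 \<or> q \<noteq> 0 \<or> r \<noteq> 0" using T(2) by (auto simp: t scal_iff \<alpha>_def)
    have "fixes_line (u, w) h" if h: "h \<in> \<Lambda>" for h
    proof -
      obtain a b c d where hh: "h = (a, b, c, d)" by (metis prod_cases4)
      note c = commutator_det[OF t hh le[OF h] refl refl refl \<alpha>_def]
      define u' w' where "u' = a * u + b * w" and "w' = c * u + d * w"
      have k: "\<alpha> * u' + q * w' = 0" "r * u' - \<alpha> * w' = 0"
      proof -
        have n: "(q * c - b * r) * u + (p * b + q * d - a * q - b * s) * w = 0"
          "(r * a + s * c - c * p - d * r) * u - (q * c - b * r) * w = 0"
          using parabolic_invariant[OF c 2 nz uw(2,3)] by auto
        have "\<alpha> * u' + q * w' = ((q * c - b * r) * u + (p * b + q * d - a * q - b * s) * w)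
            + a * (\<alpha> * u + q * w) + b * (r * u - \<alpha> * w)"
          by (simp add: u'_def w'_def \<alpha>_def field_simps)
        then show "\<alpha> * u' + q * w' = 0" using n uw by simp
        have "r * u' - \<alpha> * w' = ((r * a + s * c - c * p - d * r) * u - (q * c - b * r) * w)
            + c * (\<alpha> * u + q * w) + d * (r * u - \<alpha> * w)"
          by (simp add: u'_def w'_def \<alpha>_def field_simps)
        then show "r * u' - \<alpha> * w' = 0" using n uw by simp
      qed
      have "vdet (u, w) (u', w') = 0"
      proof -
        have "\<alpha> * (u * w' - u' * w) = 0" "q * (u * w' - u' * w) = 0" "r * (u * w' - u' * w) = 0"
        proof -
          have "\<alpha> * (u * w' - u' * w) = w' * (\<alpha> * u + q * w) - w * (\<alpha> * u' + q * w')"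
            "q * (u * w' - u' * w) = u * (\<alpha> * u' + q * w') - u' * (\<alpha> * u + q * w)"
            "r * (u * w' - u' * w) = w' * (r * u - \<alpha> * w) - w * (r * u' - \<alpha> * w')"
            by (simp_all add: algebra_simps)
          then show "\<alpha> * (u * w' - u' * w) = 0" "q * (u * w' - u' * w) = 0" "r * (u * w' - u' * w) = 0"
            using uw k by simp_all
        qed
        then show ?thesis using nz by auto
      qed
      then have "\<exists>k. (u', w') = vscale k (u, w)" using vdet_eq_0_iff[OF uw(1)] by blast
      then show ?thesis by (simp add: fixes_line_def hh u'_def w'_def)
    qed
    then show ?thesis using uw(1) by (intro disjI2 exI[of _ "(u, w)"]) blast
  qed
qed

lemma hyperbolic_eigenvectors:
  assumes h: "hyperbolic m" and d: "mdet m > 0"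
  obtains p q \<kappa> \<mu> where "p \<noteq> vzero" "q \<noteq> vzero" "mapp m p = vscale \<kappa> p" "mapp m q = vscale \<mu> q"
    "\<bar>\<mu>\<bar> < \<bar>\<kappa>\<bar>" "\<mu> \<noteq> 0" "\<kappa> * \<mu> = mdet m" "vdet p q \<noteq> 0"
proof -
  obtain a b c d where m: "m = (a, b, c, d)" by (metis prod_cases4)
  define s where "s = sqrt ((mtr m)\<^sup>2 - 4 * mdet m)"
  have s: "s > 0" "s\<^sup>2 = (mtr m)\<^sup>2 - 4 * mdet m"
    using h by (auto simp: s_def hyperbolic_def)
  define l r where "l = (mtr m + s) / 2" and "r = (mtr m - s) / 2"
  have lr: "l + r = mtr m" "l * r = mdet m"
    using s(2) by (auto simp: l_def r_def field_simps power2_eq_square)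
  have root: "\<exists>v. v \<noteq> vzero \<and> mapp m v = vscale k v" if k: "k = l \<or> k = r" for k
  proof -
    have "k * k - mtr m * k + mdet m = 0" using k lr[symmetric] by (auto simp: algebra_simps)
    then have e: "(a - k) * (d - k) = b * c" by (simp add: m algebra_simps)
    show ?thesis
    proof (cases "b = 0 \<and> a = k")
      case True
      show ?thesis
      proof (cases "c = 0 \<and> d = k")
        case True
        then show ?thesis using \<open>b = 0 \<and> a = k\<close> by (intro exI[of _ "(1, 0)"]) (simp add: m)
      next
        case False
        then show ?thesis using True by (intro exI[of _ "(k - d, c)"]) (auto simp: m algebra_simps)
      qed
    next
      case False
      then show ?thesis using e by (intro exI[of _ "(b, k - a)"]) (auto simp: m algebra_simps)
    qed
  qed
  obtain p where p: "p \<noteq> vzero" "mapp m p = vscale l p" using root[of l] by blast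
  obtain q where q: "q \<noteq> vzero" "mapp m q = vscale r q" using root[of r] by blast
  have nz: "l \<noteq> 0" "r \<noteq> 0" using lr(2) d by auto
  have ne: "l \<noteq> r" using s(1) by (simp add: l_def r_def)
  have pq: "vdet p q \<noteq> 0"
  proof
    assume "vdet p q = 0"
    then obtain k where k: "q = vscale k p" using vdet_eq_0_iff[OF p(1)] by auto
    have k0: "k \<noteq> 0" using q(1) k by (cases p) auto
    have "vscale (k * l) p = vscale (r * k) p" using q(2) p(2) k by simp
    then show False using p(1) k0 ne by (cases p) auto
  qed
  have qp: "vdet q p \<noteq> 0" using pq by (cases p, cases q) (auto simp: algebra_simps)
  have "\<bar>l\<bar> \<noteq> \<bar>r\<bar>"
  proof
    assume "\<bar>l\<bar> = \<bar>r\<bar>"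
    then have "l = - r" using ne by linarith
    then have "l * r = - (r * r)" by simp
    then show False using lr(2) d zero_le_square[of r] by linarith
  qed
  then consider "\<bar>r\<bar> < \<bar>l\<bar>" | "\<bar>l\<bar> < \<bar>r\<bar>" by linarith
  then show ?thesis
  proof cases
    case 1
    then show ?thesis using that[OF p(1) q(1) p(2) q(2) _ nz(2) lr(2) pq] by simp
  next
    case 2
    then show ?thesis using that[OF q(1) p(1) q(2) p(2) _ nz(1) _ qp] lr(2) by (simp add: mult.commute)
  qed
qed

section \<open>Ping-pong with hyperbolic homographies\<close>

text \<open>A neighbourhood of the point of \<open>p\<close>, small with
  \<open>\<epsilon>\<close>; if \<open>p\<close> and \<open>q\<close> are independent, its
  complement is a neighbourhood of the point of \<open>q\<close>. The condition does not depend on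
  the representative \<open>v\<close>, and homographies transport it by acting on \<open>p\<close>
  and \<open>q\<close>.\<close>

definition near :: "real \<Rightarrow> vec2 \<Rightarrow> vec2 \<Rightarrow> p1 set" where
  "near \<epsilon> p q = {vpoint v | v. v \<noteq> vzero \<and> \<bar>vdet v p\<bar> < \<epsilon> * \<bar>vdet v q\<bar>}"

lemma vpoint_near_iff:
  assumes "v \<noteq> vzero"
  shows "vpoint v \<in> near \<epsilon> p q \<longleftrightarrow> \<bar>vdet v p\<bar> < \<epsilon> * \<bar>vdet v q\<bar>"
proof
  assume "vpoint v \<in> near \<epsilon> p q"
  then obtain w where w: "vpoint v = vpoint w" "w \<noteq> vzero" "\<bar>vdet w p\<bar> < \<epsilon> * \<bar>vdet w q\<bar>"
    by (auto simp: near_def)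
  then have "vdet w v = 0" using vpoint_eq_iff[OF w(2) assms] by simp
  then obtain k where k: "v = vscale k w" using vdet_eq_0_iff[OF w(2)] by auto
  then have k0: "\<bar>k\<bar> > 0" using assms by (cases w) auto
  have sc: "vdet (vscale k w) u = k * vdet w u" for u by (cases w, cases u) (simp add: algebra_simps)
  have "\<bar>k\<bar> * \<bar>vdet w p\<bar> < \<bar>k\<bar> * (\<epsilon> * \<bar>vdet w q\<bar>)" using w(3) k0 by simp
  then show "\<bar>vdet v p\<bar> < \<epsilon> * \<bar>vdet v q\<bar>" unfolding k sc by (simp add: abs_mult algebra_simps)
next
  assume "\<bar>vdet v p\<bar> < \<epsilon> * \<bar>vdet v q\<bar>"
  then show "vpoint v \<in> near \<epsilon> p q" using assms unfolding near_def by blast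
qed

definition vnorm :: "vec2 \<Rightarrow> real" where "vnorm v = \<bar>fst v\<bar> + \<bar>snd v\<bar>"

lemma vnorm_pos: "v \<noteq> vzero \<Longrightarrow> vnorm v > 0"
  by (cases v) (auto simp: vnorm_def)

lemma vdet_le: "\<bar>vdet v w\<bar> \<le> vnorm v * vnorm w"
proof -
  obtain x y x' y' where vw: "v = (x, y)" "w = (x', y')" by (cases v, cases w)
  have "\<bar>x * y' - x' * y\<bar> \<le> \<bar>x\<bar> * \<bar>y'\<bar> + \<bar>x'\<bar> * \<bar>y\<bar>"
    using abs_triangle_ineq4[of "x * y'" "x' * y"] by (simp add: abs_mult)
  also have "\<dots> \<le> (\<bar>x\<bar> + \<bar>y\<bar>) * (\<bar>x'\<bar> + \<bar>y'\<bar>)" by (simp add: algebra_simps)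
  finally show ?thesis by (simp add: vw vnorm_def)
qed

text \<open>A vector nearly proportional to both of the independent vectors \<open>p\<close> and
  \<open>p'\<close> is zero; \<open>K\<close> makes this quantitative.\<close>

lemma near_disjoint:
  assumes pp: "vdet p p' \<noteq> 0"
  shows "\<exists>\<epsilon>0>0. \<forall>\<epsilon>. 0 < \<epsilon> \<and> \<epsilon> < \<epsilon>0 \<longrightarrow> near \<epsilon> p q \<inter> near \<epsilon> p' q' = {}"
proof -
  define K where "K = vnorm q' * vnorm p + vnorm q * vnorm p' + 1"
  have K: "K > 0" by (simp add: K_def vnorm_def add_nonneg_pos)
  show ?thesis
  proof (intro exI[of _ "\<bar>vdet p p'\<bar> / K"] conjI allI impI)
    show "0 < \<bar>vdet p p'\<bar> / K" using pp K by simp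
    fix \<epsilon> assume e: "0 < \<epsilon> \<and> \<epsilon> < \<bar>vdet p p'\<bar> / K"
    show "near \<epsilon> p q \<inter> near \<epsilon> p' q' = {}"
    proof (rule ccontr)
      assume "near \<epsilon> p q \<inter> near \<epsilon> p' q' \<noteq> {}"
      then obtain x where "x \<in> near \<epsilon> p q" "x \<in> near \<epsilon> p' q'" by auto
      then obtain v where v: "v \<noteq> vzero" "\<bar>vdet v p\<bar> < \<epsilon> * \<bar>vdet v q\<bar>" "\<bar>vdet v p'\<bar> < \<epsilon> * \<bar>vdet v q'\<bar>"
        by (metis vpoint_cases vpoint_near_iff)
      have q1: "\<bar>vdet v p\<bar> \<le> \<epsilon> * (vnorm v * vnorm q)"
        using v(2) mult_left_mono[OF vdet_le[of v q], of \<epsilon>] e by linarith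
      have q2: "\<bar>vdet v p'\<bar> \<le> \<epsilon> * (vnorm v * vnorm q')"
        using v(3) mult_left_mono[OF vdet_le[of v q'], of \<epsilon>] e by linarith
      obtain x y where vv: "v = (x, y)" by (cases v)
      obtain px py where p: "p = (px, py)" by (cases p)
      obtain p'x p'y where p': "p' = (p'x, p'y)" by (cases p')
      have i: "vdet p p' * x = px * vdet v p' - p'x * vdet v p" "vdet p p' * y = py * vdet v p' - p'y * vdet v p"
        by (simp_all add: vv p p' algebra_simps)
      have "\<bar>vdet p p'\<bar> * \<bar>x\<bar> \<le> \<bar>px\<bar> * \<bar>vdet v p'\<bar> + \<bar>p'x\<bar> * \<bar>vdet v p\<bar>"
        "\<bar>vdet p p'\<bar> * \<bar>y\<bar> \<le> \<bar>py\<bar> * \<bar>vdet v p'\<bar> + \<bar>p'y\<bar> * \<bar>vdet v p\<bar>"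
        unfolding abs_mult[symmetric] i by (rule abs_triangle_ineq4)+
      then have "\<bar>vdet p p'\<bar> * vnorm v \<le> vnorm p * \<bar>vdet v p'\<bar> + vnorm p' * \<bar>vdet v p\<bar>"
        by (simp add: vnorm_def vv p p' algebra_simps)
      also have "\<dots> \<le> vnorm p * (\<epsilon> * (vnorm v * vnorm q')) + vnorm p' * (\<epsilon> * (vnorm v * vnorm q))"
        by (intro add_mono mult_left_mono q1 q2) (auto simp: vnorm_def)
      also have "\<dots> = (\<epsilon> * (K - 1)) * vnorm v" by (simp add: K_def algebra_simps)
      also have "\<dots> < (\<epsilon> * K) * vnorm v"
        using vnorm_pos[OF v(1)] e by (simp add: algebra_simps)
      finally have "\<bar>vdet p p'\<bar> < \<epsilon> * K" using vnorm_pos[OF v(1)] by simp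
      then show False using e K by (simp add: field_simps)
    qed
  qed
qed

lemma near_mapp:
  assumes m: "mdet m \<noteq> 0"
  shows "mhom m x \<in> near \<epsilon> (mapp m p) (mapp m q) \<longleftrightarrow> x \<in> near \<epsilon> p q"
proof -
  obtain v where v: "x = vpoint v" "v \<noteq> vzero" by (rule vpoint_cases)
  have "\<epsilon> * (\<bar>mdet m\<bar> * \<bar>vdet v q\<bar>) = \<bar>mdet m\<bar> * (\<epsilon> * \<bar>vdet v q\<bar>)" by simp
  then show ?thesis
    unfolding v(1) mhom_vpoint[OF v(2)] vpoint_near_iff[OF v(2)] vpoint_near_iff[OF mapp_nonzero[OF m v(2)]]
    by (simp only: vdet_mapp abs_mult mult_less_cancel_left_pos zero_less_abs_iff m simp_thms)
qed

lemma vdet_mapp_eigen: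
  assumes "mapp m p = vscale \<kappa> p" "\<kappa> * \<mu> = mdet m" "\<kappa> \<noteq> 0"
  shows "vdet (mapp m v) p = \<mu> * vdet v p"
proof -
  have "\<kappa> * vdet (mapp m v) p = vdet (mapp m v) (mapp m p)"
    unfolding assms(1) by (cases "mapp m v", cases p) (simp add: algebra_simps)
  also have "\<dots> = \<kappa> * (\<mu> * vdet v p)" by (simp add: vdet_mapp flip: assms(2))
  finally show ?thesis using assms(3) by simp
qed

text \<open>In the eigenbasis, the quotient of the coordinates of a vector is multiplied by
  \<open>\<mu> / \<kappa>\<close> at each step.\<close>

lemma north_south:
  assumes p: "mapp m p = vscale \<kappa> p" and q: "mapp m q = vscale \<mu> q" and pq: "vdet p q \<noteq> 0"
    and lm: "\<kappa> * \<mu> = mdet m" "\<bar>\<mu>\<bar> < \<bar>\<kappa>\<bar>" "\<mu> \<noteq> 0" and \<epsilon>: "0 < \<epsilon>"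
  shows "\<exists>n0. \<forall>n\<ge>n0. \<forall>x. x \<notin> near \<epsilon> q p \<longrightarrow> (mhom m ^^ n) x \<in> near \<epsilon> p q"
proof -
  have l0: "\<kappa> \<noteq> 0" "mdet m \<noteq> 0" using lm by auto
  have "\<bar>\<mu>\<bar> / \<bar>\<kappa>\<bar> < 1" using lm l0 by simp
  then obtain n0 where n0: "(\<bar>\<mu>\<bar> / \<bar>\<kappa>\<bar>) ^ n0 < \<epsilon>\<^sup>2"
    using real_arch_pow_inv[of "\<epsilon>\<^sup>2" "\<bar>\<mu>\<bar> / \<bar>\<kappa>\<bar>"] \<epsilon> by auto
  show ?thesis
  proof (intro exI allI impI)
    fix n x assume n: "n \<ge> n0" and x: "x \<notin> near \<epsilon> q p"
    have "(\<bar>\<mu>\<bar> / \<bar>\<kappa>\<bar>) ^ n \<le> (\<bar>\<mu>\<bar> / \<bar>\<kappa>\<bar>) ^ n0"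
      by (rule power_decreasing) (use n lm in auto)
    then have "(\<bar>\<mu>\<bar> / \<bar>\<kappa>\<bar>) ^ n < \<epsilon>\<^sup>2" using n0 by linarith
    then have ratio: "\<bar>\<mu>\<bar> ^ n < \<epsilon>\<^sup>2 * \<bar>\<kappa>\<bar> ^ n"
      using l0 by (simp add: power_divide pos_divide_less_eq)
    obtain v where v: "x = vpoint v" "v \<noteq> vzero" by (rule vpoint_cases)
    have it: "(mhom m ^^ n) (vpoint v) = vpoint ((mapp m ^^ n) v) \<and> (mapp m ^^ n) v \<noteq> vzero
        \<and> vdet ((mapp m ^^ n) v) p = \<mu> ^ n * vdet v p \<and> vdet ((mapp m ^^ n) v) q = \<kappa> ^ n * vdet v q" for n
    proof (induction n)
      case 0
      then show ?case using v by simp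
    next
      case (Suc n)
      then show ?case
        using mapp_nonzero[OF l0(2)] vdet_mapp_eigen[OF p lm(1) l0(1)]
          vdet_mapp_eigen[OF q _ lm(3), of \<kappa>] lm(1) by (simp add: mhom_vpoint mult.commute mult.left_commute)
    qed
    have vq: "\<bar>vdet v q\<bar> \<ge> \<epsilon> * \<bar>vdet v p\<bar>" using x v vpoint_near_iff[OF v(2)] by auto
    have q0: "\<bar>vdet v q\<bar> > 0"
    proof (rule ccontr)
      assume "\<not> ?thesis"
      then have z: "vdet v q = 0" "vdet v p = 0" using vq \<epsilon> by (auto simp: mult_le_0_iff)
      then obtain k l where "q = vscale k v" "p = vscale l v" using vdet_eq_0_iff[OF v(2)] by metis
      then have "vdet p q = 0" by (cases v) (simp only: vscale.simps vdet.simps, simp)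
      then show False using pq by simp
    qed
    have "\<epsilon> * (\<bar>\<mu>\<bar> ^ n * \<bar>vdet v p\<bar>) = \<bar>\<mu>\<bar> ^ n * (\<epsilon> * \<bar>vdet v p\<bar>)"
      by (rule mult.left_commute)
    also have "\<dots> \<le> \<bar>\<mu>\<bar> ^ n * \<bar>vdet v q\<bar>" by (rule mult_left_mono[OF vq]) simp
    also have "\<dots> < (\<epsilon>\<^sup>2 * \<bar>\<kappa>\<bar> ^ n) * \<bar>vdet v q\<bar>" by (rule mult_strict_right_mono[OF ratio q0])
    also have "\<dots> = \<epsilon> * (\<epsilon> * (\<bar>\<kappa>\<bar> ^ n * \<bar>vdet v q\<bar>))" by (simp add: power2_eq_square)
    finally have "\<bar>\<mu>\<bar> ^ n * \<bar>vdet v p\<bar> < \<epsilon> * (\<bar>\<kappa>\<bar> ^ n * \<bar>vdet v q\<bar>)" using \<epsilon> by simp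
    then show "(mhom m ^^ n) x \<in> near \<epsilon> p q"
      unfolding v(1) using it[of n] vpoint_near_iff[of "(mapp m ^^ n) v" \<epsilon> p q]
      by (simp add: abs_mult power_abs)
  qed
qed

lemma near_opposite_disjoint:
  assumes "0 < \<epsilon>" "\<epsilon> < 1"
  shows "near \<epsilon> p q \<inter> near \<epsilon> q p = {}"
proof (rule ccontr)
  assume "near \<epsilon> p q \<inter> near \<epsilon> q p \<noteq> {}"
  then obtain v where v: "\<bar>vdet v p\<bar> < \<epsilon> * \<bar>vdet v q\<bar>" "\<bar>vdet v q\<bar> < \<epsilon> * \<bar>vdet v p\<bar>"
    by (metis disjoint_iff vpoint_cases vpoint_near_iff)
  have "\<epsilon> * \<bar>vdet v q\<bar> \<le> \<bar>vdet v q\<bar>" "\<epsilon> * \<bar>vdet v p\<bar> \<le> \<bar>vdet v p\<bar>"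
    using assms by (simp_all add: mult_left_le_one_le)
  then show False using v by linarith
qed

lemma near_avoid:
  assumes "v \<noteq> vzero" "vdet v p \<noteq> 0"
  shows "\<exists>\<epsilon>0>0. \<forall>\<epsilon>. 0 < \<epsilon> \<and> \<epsilon> < \<epsilon>0 \<longrightarrow> vpoint v \<notin> near \<epsilon> p q"
proof (intro exI[of _ "\<bar>vdet v p\<bar> / (\<bar>vdet v q\<bar> + 1)"] conjI allI impI)
  show "0 < \<bar>vdet v p\<bar> / (\<bar>vdet v q\<bar> + 1)" using assms by (simp add: add_nonneg_pos)
  fix \<epsilon> assume e: "0 < \<epsilon> \<and> \<epsilon> < \<bar>vdet v p\<bar> / (\<bar>vdet v q\<bar> + 1)"
  then have "\<epsilon> * (\<bar>vdet v q\<bar> + 1) < \<bar>vdet v p\<bar>" by (simp add: pos_less_divide_eq add_nonneg_pos)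
  then show "vpoint v \<notin> near \<epsilon> p q"
    using e vpoint_near_iff[OF assms(1)] by (simp add: algebra_simps)
qed

lemma infinite_p1: "infinite (UNIV :: p1 set)"
proof
  assume "finite (UNIV :: p1 set)"
  then have "finite (range (Some :: real \<Rightarrow> p1))" by (rule finite_subset[rotated]) simp
  then show False using finite_imageD[of "Some :: real \<Rightarrow> p1" UNIV] infinite_UNIV_char_0[where 'a = real] by (metis inj_Some)
qed

lemma exists_point_off:
  assumes "finite V" "vzero \<notin> V"
  obtains v where "v \<noteq> vzero" "\<And>w. w \<in> V \<Longrightarrow> vdet v w \<noteq> 0"
proof -
  obtain x where x: "x \<notin> vpoint ` V" using infinite_p1 assms(1) by (metis finite_imageI UNIV_I finite_subset subsetI)
  obtain v where v: "x = vpoint v" "v \<noteq> vzero" by (rule vpoint_cases)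
  show ?thesis
  proof (rule that[OF v(2)])
    fix w assume w: "w \<in> V"
    then have "w \<noteq> vzero" "vpoint v \<noteq> vpoint w" using assms(2) x v(1) by auto
    then show "vdet v w \<noteq> 0" using vpoint_eq_iff[OF v(2)] by simp
  qed
qed

text \<open>Only the homographies defined by the matrices need to multiply, so that matrices may
  be chosen up to scalars.\<close>

locale homographic_action = group G for G :: "('a, 'b) monoid_scheme" (structure) +
  fixes \<Delta> :: "'a set" and M :: "'a \<Rightarrow> mat2"
  assumes \<Delta>: "subgroup \<Delta> G" and det: "g \<in> \<Delta> \<Longrightarrow> mdet (M g) \<noteq> 0"
    and mult: "g \<in> \<Delta> \<Longrightarrow> h \<in> \<Delta> \<Longrightarrow> mhom (M (g \<otimes> h)) x = mhom (M g) (mhom (M h) x)"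
begin

definition act :: "'a \<Rightarrow> p1 \<Rightarrow> p1" where "act g = mhom (M g)"

lemma mem_carrier: "g \<in> \<Delta> \<Longrightarrow> g \<in> carrier G"
  using subgroup.mem_carrier[OF \<Delta>] .

lemma act_mult: "g \<in> \<Delta> \<Longrightarrow> h \<in> \<Delta> \<Longrightarrow> act (g \<otimes> h) x = act g (act h x)"
  by (simp add: act_def mult)

lemma act_inj: "g \<in> \<Delta> \<Longrightarrow> act g x = act g y \<Longrightarrow> x = y"
  unfolding act_def using mhom_madj(1)[OF det] by metis

lemma act_one: "act \<one> x = x"
  using act_mult[OF subgroup.one_closed[OF \<Delta>] subgroup.one_closed[OF \<Delta>], of x]
    act_inj[OF subgroup.one_closed[OF \<Delta>], of "act \<one> x" x] by simp

lemma act_inv: "g \<in> \<Delta> \<Longrightarrow> act (inv g) (act g x) = x" "g \<in> \<Delta> \<Longrightarrow> act g (act (inv g) x) = x"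
  using act_mult[of "inv g" g x] act_mult[of g "inv g" x] subgroup.m_inv_closed[OF \<Delta>, of g]
    mem_carrier act_one by simp_all

lemma act_pow: "g \<in> \<Delta> \<Longrightarrow> g [^] n \<in> \<Delta> \<and> act (g [^] n) x = (act g ^^ n) x" for n :: nat
proof (induction n arbitrary: x)
  case 0
  then show ?case by (simp add: act_one subgroup.one_closed[OF \<Delta>])
next
  case (Suc n)
  then have IH: "g [^] n \<in> \<Delta>" "act (g [^] n) y = (act g ^^ n) y" for y by auto
  show ?case
    using IH(1) Suc.prems act_mult[OF IH(1) Suc.prems, of x] IH(2)[of "act g x"] subgroup.m_closed[OF \<Delta>]
    by (simp add: funpow_swap1)
qed

lemma stabilizer_finite_index:
  assumes "finite ((\<lambda>g. act g x) ` \<Delta>)"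
  shows "subgroup {g \<in> \<Delta>. act g x = x} G" "finite_index (G\<lparr>carrier := \<Delta>\<rparr>) {g \<in> \<Delta>. act g x = x}"
proof -
  show "subgroup {g \<in> \<Delta>. act g x = x} G"
  proof (rule subgroupI)
    show "{g \<in> \<Delta>. act g x = x} \<subseteq> carrier G" using mem_carrier by auto
    show "{g \<in> \<Delta>. act g x = x} \<noteq> {}" using act_one subgroup.one_closed[OF \<Delta>] by auto
    fix g assume g: "g \<in> {g \<in> \<Delta>. act g x = x}"
    then show "inv g \<in> {g \<in> \<Delta>. act g x = x}"
      using act_inv(1)[of g x] subgroup.m_inv_closed[OF \<Delta>] by auto
    fix h assume "h \<in> {g \<in> \<Delta>. act g x = x}"
    then show "g \<otimes> h \<in> {g \<in> \<Delta>. act g x = x}"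
      using g act_mult subgroup.m_closed[OF \<Delta>] by auto
  qed
  show "finite_index (G\<lparr>carrier := \<Delta>\<rparr>) {g \<in> \<Delta>. act g x = x}"
  proof (rule group.finite_indexI[OF subgroup_imp_group[OF \<Delta>], of "\<lambda>g. act g x"])
    fix g h assume gh: "g \<in> carrier (G\<lparr>carrier := \<Delta>\<rparr>)" "h \<in> carrier (G\<lparr>carrier := \<Delta>\<rparr>)" "act g x = act h x"
    then have g: "g \<in> \<Delta>" "h \<in> \<Delta>" by simp_all
    have "act (inv g \<otimes> h) x = act (inv g) (act g x)"
      using act_mult[OF subgroup.m_inv_closed[OF \<Delta> g(1)] g(2)] gh(3) by simp
    then have "act (inv g \<otimes> h) x = x" using act_inv(1)[OF g(1)] by simp
    then show "inv\<^bsub>G\<lparr>carrier := \<Delta>\<rparr>\<^esub> g \<otimes>\<^bsub>G\<lparr>carrier := \<Delta>\<rparr>\<^esub> h \<in> {g \<in> \<Delta>. act g x = x}"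
      using m_inv_consistent[OF \<Delta> g(1)] subgroup.m_closed[OF \<Delta> subgroup.m_inv_closed[OF \<Delta> g(1)] g(2)] by simp
  qed (use assms in simp)
qed

text \<open>Any two translates of the pair \<open>{P, Q}\<close> meet. A translate without
  \<open>P\<close> would meet infinitely many translates through \<open>P\<close> at one of its
  two points, but a pair is determined by \<open>P\<close> and this second point.\<close>

lemma common_point:
  assumes PQ: "P \<noteq> Q" and meet: "\<And>g. g \<in> \<Delta> \<Longrightarrow> {act g P, act g Q} \<inter> {P, Q} \<noteq> {}"
    and inf: "infinite ((\<lambda>g. {act g P, act g Q}) ` {g \<in> \<Delta>. P \<in> {act g P, act g Q}})"
  shows "(\<lambda>g. act g P) ` \<Delta> \<subseteq> {P, Q}"
proof -
  have meet2: "{act h P, act h Q} \<inter> {act g P, act g Q} \<noteq> {}" if gh: "g \<in> \<Delta>" "h \<in> \<Delta>" for g h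
  proof -
    have "{act (inv g \<otimes> h) P, act (inv g \<otimes> h) Q} \<inter> {P, Q} \<noteq> {}"
      using meet gh subgroup.m_closed[OF \<Delta> subgroup.m_inv_closed[OF \<Delta> gh(1)] gh(2)] by blast
    then obtain A B where AB: "A \<in> {P, Q}" "B \<in> {P, Q}" "act (inv g \<otimes> h) A = B"
      unfolding disjoint_iff by auto
    then have e: "act h A = act g B"
      using act_mult[OF subgroup.m_inv_closed[OF \<Delta> gh(1)] gh(2)] act_inv(2)[OF gh(1)] by metis
    have "act h A \<in> {act h P, act h Q}" using AB(1) by auto
    moreover have "act h A \<in> {act g P, act g Q}" unfolding e using AB(2) by auto
    ultimately show ?thesis unfolding disjoint_iff by metis
  qed
  have all: "P \<in> {act h P, act h Q}" if h: "h \<in> \<Delta>" for h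
  proof (rule ccontr)
    assume n: "P \<notin> {act h P, act h Q}"
    have "(\<lambda>g. {act g P, act g Q}) ` {g \<in> \<Delta>. P \<in> {act g P, act g Q}} \<subseteq> {{P, act h P}, {P, act h Q}}"
    proof
      fix e assume "e \<in> (\<lambda>g. {act g P, act g Q}) ` {g \<in> \<Delta>. P \<in> {act g P, act g Q}}"
      then obtain g where g0: "e = {act g P, act g Q}" "g \<in> {g \<in> \<Delta>. P \<in> {act g P, act g Q}}"
        by (rule imageE)
      have g: "g \<in> \<Delta>" "e = {act g P, act g Q}" "P \<in> e" using g0(2) unfolding g0(1) by simp_all
      obtain y where y: "y \<in> {act h P, act h Q}" "y \<in> e"
        using meet2[OF g(1) h] unfolding g(2) disjoint_iff by metis
      then have "y \<noteq> P" using n by blast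
      moreover have "P = act g P \<or> P = act g Q" "y = act g P \<or> y = act g Q" using g(2,3) y(2) by blast+
      ultimately have "e = {P, y}" unfolding g(2) by (metis insert_commute)
      then show "e \<in> {{P, act h P}, {P, act h Q}}" using y(1) by blast
    qed
    then show False using inf finite_subset by blast
  qed
  show ?thesis
  proof
    fix y assume "y \<in> (\<lambda>g. act g P) ` \<Delta>"
    then obtain g where g: "g \<in> \<Delta>" "y = act g P" by blast
    have "P \<in> {act (inv g) P, act (inv g) Q}" using all[OF subgroup.m_inv_closed[OF \<Delta> g(1)]] .
    then have "act g P = P \<or> act g P = Q"
      using act_inv(2)[OF g(1), of P] act_inv(2)[OF g(1), of Q] by (metis insert_iff singletonD)
    then show "y \<in> {P, Q}" using g(2) by simp
  qed
qed

text \<open>If there are infinitely many translates, infinitely many pass through one of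
  \<open>P\<close> and \<open>Q\<close>.\<close>

lemma finite_orbit:
  assumes PQ: "P \<noteq> Q" and meet: "\<And>g. g \<in> \<Delta> \<Longrightarrow> {act g P, act g Q} \<inter> {P, Q} \<noteq> {}"
  shows "\<exists>x. finite ((\<lambda>g. act g x) ` \<Delta>)"
proof (cases "finite ((\<lambda>g. {act g P, act g Q}) ` \<Delta>)")
  case True
  have "(\<lambda>g. act g P) ` \<Delta> \<subseteq> \<Union> ((\<lambda>g. {act g P, act g Q}) ` \<Delta>)" by auto
  moreover have "finite (\<Union> ((\<lambda>g. {act g P, act g Q}) ` \<Delta>))"
    by (rule finite_Union[OF True]) auto
  ultimately have "finite ((\<lambda>g. act g P) ` \<Delta>)" by (rule finite_subset)
  then show ?thesis by (rule exI)
next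
  case False
  let ?e = "\<lambda>g. {act g P, act g Q}"
  let ?A = "{g \<in> \<Delta>. P \<in> ?e g}" and ?B = "{g \<in> \<Delta>. Q \<in> ?e g}"
  have "\<Delta> \<subseteq> ?A \<union> ?B"
  proof
    fix g assume g: "g \<in> \<Delta>"
    obtain y where "y \<in> ?e g" "y \<in> {P, Q}" using meet[OF g] unfolding disjoint_iff by metis
    then show "g \<in> ?A \<union> ?B" using g by auto
  qed
  then have sub: "?e ` \<Delta> \<subseteq> ?e ` ?A \<union> ?e ` ?B" unfolding image_Un[symmetric] by (rule image_mono)
  have "infinite (?e ` ?A) \<or> infinite (?e ` ?B)"
  proof (rule ccontr)
    assume "\<not> ?thesis"
    then have f: "finite (?e ` ?A)" "finite (?e ` ?B)" by (simp_all only: de_Morgan_disj not_not)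
    have "finite (?e ` \<Delta>)" by (rule finite_subset[OF sub finite_UnI[OF f]])
    with False show False by (rule notE)
  qed
  then show ?thesis
  proof
    assume i: "infinite (?e ` ?A)"
    have "finite ((\<lambda>g. act g P) ` \<Delta>)"
      by (rule finite_subset[OF common_point[OF PQ meet i]]) auto
    then show ?thesis by (rule exI)
  next
    assume i: "infinite (?e ` ?B)"
    have "(\<lambda>g. act g Q) ` \<Delta> \<subseteq> {Q, P}"
    proof (rule common_point)
      show "{act g Q, act g P} \<inter> {Q, P} \<noteq> {}" if "g \<in> \<Delta>" for g
        using meet[OF that] by (simp add: insert_commute)
      show "infinite ((\<lambda>g. {act g Q, act g P}) ` {g \<in> \<Delta>. Q \<in> {act g Q, act g P}})"
        using i by (simp add: insert_commute)
    qed (use PQ in simp)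
    then have "finite ((\<lambda>g. act g Q) ` \<Delta>)" by (rule finite_subset) auto
    then show ?thesis by (rule exI)
  qed
qed

text \<open>Let \<open>P\<close> and \<open>Q\<close> be the fixed points of \<open>a\<close>. If
  some \<open>g\<close> moves both off \<open>{P, Q}\<close>, then large powers of
  \<open>a\<close> and of its conjugate by \<open>g\<close> play ping-pong on small neighbourhoods
  of the four fixed points.\<close>

theorem hyperbolic_pingpong:
  assumes a: "a \<in> \<Delta>" "hyperbolic (M a)" "mdet (M a) > 0"
  shows "(\<exists>x. finite ((\<lambda>g. act g x) ` \<Delta>)) \<or>
    (\<exists>\<alpha> \<beta> D x0. \<alpha> \<noteq> \<beta> \<and> pingpong G \<Delta> {\<alpha>, \<beta>} act D x0)"
proof -
  obtain p q \<kappa> \<mu> where p: "p \<noteq> vzero" and q: "q \<noteq> vzero" and ep: "mapp (M a) p = vscale \<kappa> p"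
    and eq: "mapp (M a) q = vscale \<mu> q" and lm: "\<bar>\<mu>\<bar> < \<bar>\<kappa>\<bar>" "\<mu> \<noteq> 0" "\<kappa> * \<mu> = mdet (M a)" and pq: "vdet p q \<noteq> 0"
    by (rule hyperbolic_eigenvectors[OF a(2,3)])
  have PQ: "vpoint p \<noteq> vpoint q" using vpoint_eq_iff[OF p q] pq by simp
  show ?thesis
  proof (cases "\<forall>g\<in>\<Delta>. {act g (vpoint p), act g (vpoint q)} \<inter> {vpoint p, vpoint q} \<noteq> {}")
    case True
    show ?thesis by (rule disjI1[OF finite_orbit[OF PQ bspec[OF True]]])
  next
    case False
    then obtain g where g: "g \<in> \<Delta>" "{act g (vpoint p), act g (vpoint q)} \<inter> {vpoint p, vpoint q} = {}"
      by meson
    define p' q' where "p' = mapp (M g) p" and "q' = mapp (M g) q"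
    have dg: "mdet (M g) \<noteq> 0" by (rule det[OF g(1)])
    have p'0: "p' \<noteq> vzero" "q' \<noteq> vzero" unfolding p'_def q'_def using mapp_nonzero[OF dg] p q by auto
    have ap: "act g (vpoint p) = vpoint p'" "act g (vpoint q) = vpoint q'"
      by (simp_all add: act_def mhom_vpoint p q p'_def q'_def)
    have nz: "vdet p p' \<noteq> 0" "vdet p q' \<noteq> 0" "vdet q p' \<noteq> 0" "vdet q q' \<noteq> 0"
      using g(2) unfolding ap by (auto simp flip: vpoint_eq_iff[OF p p'0(1)] vpoint_eq_iff[OF p p'0(2)]
          vpoint_eq_iff[OF q p'0(1)] vpoint_eq_iff[OF q p'0(2)])
    obtain v where v0: "v \<noteq> vzero" "\<And>w. w \<in> {p, q, p', q'} \<Longrightarrow> vdet v w \<noteq> 0"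
    proof (rule exists_point_off[of "{p, q, p', q'}"])
      show "vzero \<notin> {p, q, p', q'}" using p q p'0 by (metis insert_iff empty_iff)
    qed auto
    have v: "v \<noteq> vzero" "vdet v p \<noteq> 0" "vdet v q \<noteq> 0" "vdet v p' \<noteq> 0" "vdet v q' \<noteq> 0"
      using v0 by simp_all
    obtain e1 where e1: "e1 > 0" "\<And>\<epsilon>. 0 < \<epsilon> \<Longrightarrow> \<epsilon> < e1 \<Longrightarrow> near \<epsilon> p q \<inter> near \<epsilon> p' q' = {}"
      using near_disjoint[OF nz(1), of q q'] by blast
    obtain e2 where e2: "e2 > 0" "\<And>\<epsilon>. 0 < \<epsilon> \<Longrightarrow> \<epsilon> < e2 \<Longrightarrow> near \<epsilon> p q \<inter> near \<epsilon> q' p' = {}"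
      using near_disjoint[OF nz(2), of q p'] by blast
    obtain e3 where e3: "e3 > 0" "\<And>\<epsilon>. 0 < \<epsilon> \<Longrightarrow> \<epsilon> < e3 \<Longrightarrow> near \<epsilon> q p \<inter> near \<epsilon> p' q' = {}"
      using near_disjoint[OF nz(3), of p q'] by blast
    obtain e4 where e4: "e4 > 0" "\<And>\<epsilon>. 0 < \<epsilon> \<Longrightarrow> \<epsilon> < e4 \<Longrightarrow> near \<epsilon> q p \<inter> near \<epsilon> q' p' = {}"
      using near_disjoint[OF nz(4), of p p'] by blast
    obtain f1 where f1: "f1 > 0" "\<And>\<epsilon>. 0 < \<epsilon> \<Longrightarrow> \<epsilon> < f1 \<Longrightarrow> vpoint v \<notin> near \<epsilon> p q"
      using near_avoid[OF v(1,2), of q] by blast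
    obtain f2 where f2: "f2 > 0" "\<And>\<epsilon>. 0 < \<epsilon> \<Longrightarrow> \<epsilon> < f2 \<Longrightarrow> vpoint v \<notin> near \<epsilon> q p"
      using near_avoid[OF v(1,3), of p] by blast
    obtain f3 where f3: "f3 > 0" "\<And>\<epsilon>. 0 < \<epsilon> \<Longrightarrow> \<epsilon> < f3 \<Longrightarrow> vpoint v \<notin> near \<epsilon> p' q'"
      using near_avoid[OF v(1,4), of q'] by blast
    obtain f4 where f4: "f4 > 0" "\<And>\<epsilon>. 0 < \<epsilon> \<Longrightarrow> \<epsilon> < f4 \<Longrightarrow> vpoint v \<notin> near \<epsilon> q' p'"
      using near_avoid[OF v(1,5), of p'] by blast
    \<comment> \<open>Small enough for the four regions to be pairwise disjoint and to miss the
      base point \<open>v\<close>.\<close>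
    define \<delta> where "\<delta> = min 1 (min (min (min e1 e2) (min e3 e4)) (min (min f1 f2) (min f3 f4)))"
    define \<epsilon> where "\<epsilon> = \<delta> / 2"
    have \<delta>: "0 < \<delta>"
      unfolding \<delta>_def using e1(1) e2(1) e3(1) e4(1) f1(1) f2(1) f3(1) f4(1) by (simp only: min_less_iff_conj zero_less_one simp_thms)
    have \<epsilon>: "0 < \<epsilon>" "\<epsilon> < \<delta>" using \<delta> by (simp_all add: \<epsilon>_def)
    have \<epsilon>': "\<epsilon> < 1" "\<epsilon> < e1" "\<epsilon> < e2" "\<epsilon> < e3" "\<epsilon> < e4" "\<epsilon> < f1" "\<epsilon> < f2" "\<epsilon> < f3" "\<epsilon> < f4"
      using \<epsilon>(2) unfolding \<delta>_def by (simp_all only: min_less_iff_conj)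
    let ?U = "\<lambda>e. if e then near \<epsilon> p q else near \<epsilon> q p" and ?V = "\<lambda>e. if e then near \<epsilon> p' q' else near \<epsilon> q' p'"
    obtain n where n: "\<And>x. x \<notin> near \<epsilon> q p \<Longrightarrow> (act a ^^ n) x \<in> near \<epsilon> p q"
      using north_south[OF ep eq pq lm(3,1,2) \<epsilon>(1)] unfolding act_def by blast
    define \<alpha> where "\<alpha> = a [^] n"
    have \<alpha>: "\<alpha> \<in> \<Delta>" "\<And>x. act \<alpha> x = (act a ^^ n) x" using act_pow[OF a(1)] by (auto simp: \<alpha>_def)
    have \<alpha>U: "x \<notin> ?U (\<not> e) \<Longrightarrow> act (letter G (\<alpha>, e)) x \<in> ?U e" for x e
    proof (cases e)
      case True
      then show "x \<notin> ?U (\<not> e) \<Longrightarrow> act (letter G (\<alpha>, e)) x \<in> ?U e" using n \<alpha>(2) by (simp add: letter_def)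
    next
      case False
      assume "x \<notin> ?U (\<not> e)"
      then have x: "x \<notin> near \<epsilon> p q" using False by simp
      have "act (inv \<alpha>) x \<in> near \<epsilon> q p"
        using n[of "act (inv \<alpha>) x"] x act_inv(2)[OF \<alpha>(1)] \<alpha>(2) by metis
      then show ?thesis using False by (simp add: letter_def)
    qed
    define \<beta> where "\<beta> = g \<otimes> \<alpha> \<otimes> inv g"
    have gi: "inv g \<in> \<Delta>" by (rule subgroup.m_inv_closed[OF \<Delta> g(1)])
    have \<beta>: "\<beta> \<in> \<Delta>" unfolding \<beta>_def using \<alpha>(1) g(1) gi by (intro subgroup.m_closed[OF \<Delta>])
    have l\<beta>: "letter G (\<beta>, e) = g \<otimes> letter G (\<alpha>, e) \<otimes> inv g" for e
      using mem_carrier[OF g(1)] mem_carrier[OF \<alpha>(1)] by (simp add: letter_def \<beta>_def inv_mult_group m_assoc)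
    have l\<alpha>: "letter G (\<alpha>, e) \<in> \<Delta>" for e using \<alpha>(1) subgroup.m_inv_closed[OF \<Delta>] by (simp add: letter_def)
    have UV: "act g x \<in> ?V e \<longleftrightarrow> x \<in> ?U e" for x e
      unfolding act_def p'_def q'_def using near_mapp[OF dg] by simp
    have \<beta>V: "act (letter G (\<beta>, e)) x \<in> ?V e" if x: "x \<notin> ?V (\<not> e)" for x e
    proof -
      have "act (inv g) x \<notin> ?U (\<not> e)" using x UV[of "act (inv g) x" "\<not> e"] act_inv(2)[OF g(1), of x] by simp
      then have "act (letter G (\<alpha>, e)) (act (inv g) x) \<in> ?U e" by (rule \<alpha>U)
      then have "act g (act (letter G (\<alpha>, e)) (act (inv g) x)) \<in> ?V e" using UV by blast
      then show ?thesis
        unfolding l\<beta> using act_mult g(1) gi l\<alpha>[of e] subgroup.m_closed[OF \<Delta> g(1) l\<alpha>[of e]] by metis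
    qed
    have UVd: "?U e \<inter> ?V e' = {}" for e e'
      using e1(2)[OF \<epsilon>(1) \<epsilon>'(2)] e2(2)[OF \<epsilon>(1) \<epsilon>'(3)] e3(2)[OF \<epsilon>(1) \<epsilon>'(4)] e4(2)[OF \<epsilon>(1) \<epsilon>'(5)] by simp
    have UU: "?U e \<inter> ?U (\<not> e) = {}" "?V e \<inter> ?V (\<not> e) = {}" for e
      using near_opposite_disjoint[OF \<epsilon>(1) \<epsilon>'(1)] by auto
    have x0: "vpoint v \<notin> ?U e" "vpoint v \<notin> ?V e" for e
      using f1(2)[OF \<epsilon>(1) \<epsilon>'(6)] f2(2)[OF \<epsilon>(1) \<epsilon>'(7)] f3(2)[OF \<epsilon>(1) \<epsilon>'(8)] f4(2)[OF \<epsilon>(1) \<epsilon>'(9)] by auto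
    have ne: "\<alpha> \<noteq> \<beta>"
      using \<alpha>U[OF x0(1), of True] \<beta>V[OF x0(2), of True] UVd[of True True] by (auto simp: letter_def)
    define D where "D l = (if fst l = \<alpha> then ?U (snd l) else ?V (snd l))" for l
    have "pingpong G \<Delta> {\<alpha>, \<beta>} act D (vpoint v)"
    proof (intro pingpong.intro pingpong_axioms.intro)
      show "D l \<inter> D l' = {}" if "fst l \<in> {\<alpha>, \<beta>}" "fst l' \<in> {\<alpha>, \<beta>}" "l \<noteq> l'" for l l'
      proof (cases "fst l = fst l'")
        case True
        then have "snd l' = (\<not> snd l)" using that(3) by (auto simp: prod_eq_iff)
        then show ?thesis using True UU[of "snd l"] by (simp add: D_def)
      next
        case False
        then show ?thesis using that(1,2) UVd[of "snd l" "snd l'"] UVd[of "snd l'" "snd l"] ne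
          unfolding D_def by auto
      qed
      show "act (letter G (s, e)) x \<in> D (s, e)" if "s \<in> {\<alpha>, \<beta>}" "x \<notin> D (s, \<not> e)" for s x e
        using that \<alpha>U[of x e] \<beta>V[of x e] ne unfolding D_def by auto
      show "vpoint v \<notin> D l" if "fst l \<in> {\<alpha>, \<beta>}" for l
        using x0 unfolding D_def by auto
    qed (use group_axioms \<Delta> \<alpha>(1) \<beta> act_one act_mult in auto)
    then show ?thesis using ne by blast
  qed
qed

end

section \<open>The projective line as a quotient of the real line\<close>

text \<open>The sine comes first so that \<open>proj \<theta>\<close> is \<open>tan
  \<theta>\<close>.\<close>

definition circ :: "real \<Rightarrow> vec2" where "circ \<theta> = (sin \<theta>, cos \<theta>)"
definition proj :: "real \<Rightarrow> p1" where "proj \<theta> = vpoint (circ \<theta>)"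

lemma circ_nonzero [simp]: "circ \<theta> \<noteq> vzero"
proof
  assume "circ \<theta> = vzero"
  then have "(sin \<theta>)\<^sup>2 + (cos \<theta>)\<^sup>2 = 0" by (simp add: circ_def)
  then show False by simp
qed

lemma proj_eq_iff: "proj \<theta> = proj \<phi> \<longleftrightarrow> (\<exists>k::int. \<theta> = \<phi> + of_int k * pi)"
proof -
  have "proj \<theta> = proj \<phi> \<longleftrightarrow> sin (\<theta> - \<phi>) = 0"
    unfolding proj_def vpoint_eq_iff[OF circ_nonzero circ_nonzero]
    by (simp add: circ_def sin_diff mult.commute)
  also have "\<dots> \<longleftrightarrow> (\<exists>k::int. \<theta> - \<phi> = of_int k * pi)" by (simp add: sin_zero_iff_int2)
  finally show ?thesis by (simp add: algebra_simps)
qed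

lemma proj_shift [simp]: "proj (\<theta> + of_int k * pi) = proj \<theta>"
  by (auto simp: proj_eq_iff)

lemma proj_surj: obtains \<theta> where "p = proj \<theta>"
proof -
  obtain v where v: "p = vpoint v" "v \<noteq> vzero" by (rule vpoint_cases)
  obtain x y where xy: "v = (x, y)" by (cases v)
  define r where "r = sqrt (x\<^sup>2 + y\<^sup>2)"
  have "x\<^sup>2 + y\<^sup>2 \<noteq> 0" using v(2) xy by (simp add: sum_power2_eq_zero_iff)
  then have "x\<^sup>2 + y\<^sup>2 > 0" using sum_power2_ge_zero[of x y] by linarith
  then have r: "r > 0" "r\<^sup>2 = x\<^sup>2 + y\<^sup>2" by (simp_all add: r_def)
  have "(y / r)\<^sup>2 + (x / r)\<^sup>2 = 1" using r(1) \<open>x\<^sup>2 + y\<^sup>2 \<noteq> 0\<close>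
    unfolding power_divide add_divide_distrib[symmetric] r(2) by (simp add: add.commute)
  then obtain \<theta> where \<theta>: "y / r = cos \<theta>" "x / r = sin \<theta>" using sincos_total_2pi by metis
  have "vdet v (circ \<theta>) = 0" unfolding circ_def \<theta>[symmetric] by (simp add: xy)
  then have "p = proj \<theta>" unfolding proj_def v(1) by (subst vpoint_eq_iff[OF v(2) circ_nonzero])
  then show ?thesis by (rule that)
qed

lemma proj_representative: "\<exists>\<theta>. p = proj \<theta> \<and> a \<le> \<theta> \<and> \<theta> < a + pi"
proof -
  obtain \<phi> where \<phi>: "p = proj \<phi>" by (rule proj_surj)
  define k where "k = \<lfloor>(\<phi> - a) / pi\<rfloor>"
  have "of_int k \<le> (\<phi> - a) / pi" "(\<phi> - a) / pi < of_int k + 1" by (simp_all add: k_def)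
  then have "of_int k * pi \<le> \<phi> - a" "\<phi> - a < (of_int k + 1) * pi"
    by (simp_all add: pos_le_divide_eq pos_divide_less_eq)
  moreover have "p = proj (\<phi> + of_int (- k) * pi)" unfolding proj_shift by (rule \<phi>)
  ultimately show ?thesis
    by (intro exI[of _ "\<phi> + of_int (- k) * pi"]) (simp add: algebra_simps)
qed

lemma proj_inj_on: "a \<le> \<theta> \<Longrightarrow> \<theta> < a + pi \<Longrightarrow> a \<le> \<phi> \<Longrightarrow> \<phi> < a + pi \<Longrightarrow> proj \<theta> = proj \<phi> \<Longrightarrow> \<theta> = \<phi>"
proof -
  assume a: "a \<le> \<theta>" "\<theta> < a + pi" "a \<le> \<phi>" "\<phi> < a + pi" and "proj \<theta> = proj \<phi>"
  then obtain k :: int where k: "\<theta> = \<phi> + of_int k * pi" by (auto simp: proj_eq_iff)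
  have "of_int k * pi < 1 * pi" "(- 1) * pi < of_int k * pi" using k a by linarith+
  then have "of_int k < (1::real)" "- 1 < (of_int k :: real)"
    by (simp_all only: mult_less_cancel_right_pos[OF pi_gt_zero])
  then have "k = 0" by linarith
  then show "\<theta> = \<phi>" using k by simp
qed

lemma infinite_proj_interval:
  assumes "a < b" shows "infinite (proj ` {a<..<b})"
proof -
  let ?I = "{a<..<min b (a + pi)}"
  have "inj_on proj ?I" by (rule inj_onI, rule proj_inj_on[of a]) auto
  moreover have "infinite ?I" using assms pi_gt_zero by (intro infinite_Ioo) simp
  ultimately have "infinite (proj ` ?I)" by (simp add: finite_image_iff)
  moreover have "proj ` ?I \<subseteq> proj ` {a<..<b}" by auto
  ultimately show ?thesis using finite_subset by auto
qed

lemma proj_Some: "cos \<theta> \<noteq> 0 \<Longrightarrow> proj \<theta> = Some (tan \<theta>)"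
  by (simp add: proj_def circ_def hpoint_def tan_def)

lemma proj_None: "cos \<theta> = 0 \<Longrightarrow> proj \<theta> = None"
  by (simp add: proj_def circ_def hpoint_def)

text \<open>Away from infinity \<open>proj\<close> is the tangent. The preimage of a compact set
  of real numbers is closed because it lies in the closed set \<open>F\<close>, on which the
  tangent is continuous.\<close>

lemma proj_continuous:
  assumes "openin P1 V" shows "open (proj -` V)"
proof -
  have ct: "open {\<theta>. cos \<theta> \<noteq> (0::real)}"
    by (intro open_Collect_neq continuous_intros)
  have tan: "continuous_on {\<theta>. cos \<theta> \<noteq> (0::real)} tan"
    by (intro continuous_intros) auto
  from assms consider U where "V = Some ` U" "open U"
    | C where "V = insert None (Some ` (- C))" "compact C"
    unfolding P1_def openin_Alexandroff_compactification by (auto simp: Compl_eq_Diff_UNIV)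
  then show ?thesis
  proof cases
    case 1
    have "proj -` V = {\<theta>. cos \<theta> \<noteq> 0} \<inter> tan -` U"
    proof (intro Set.set_eqI)
      fix \<theta> show "\<theta> \<in> proj -` V \<longleftrightarrow> \<theta> \<in> {\<theta>. cos \<theta> \<noteq> 0} \<inter> tan -` U"
        using proj_Some[of \<theta>] proj_None[of \<theta>] 1(1) by (cases "cos \<theta> = 0") auto
    qed
    then show ?thesis using continuous_on_open_vimage[OF ct] tan 1(2) by (metis Int_commute)
  next
    case 2
    obtain K where K: "\<And>x. x \<in> C \<Longrightarrow> \<bar>x\<bar> \<le> K"
      using compact_imp_bounded[OF 2(2)] unfolding bounded_real by auto
    define F where "F = {\<theta>. \<bar>sin \<theta>\<bar> \<le> K * \<bar>cos \<theta>\<bar>}"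
    have F: "closed F" unfolding F_def by (intro closed_Collect_le continuous_intros)
    have F0: "cos \<theta> \<noteq> 0" if "\<theta> \<in> F" for \<theta>
    proof
      assume "cos \<theta> = 0"
      then have "sin \<theta> = 0" using that by (simp add: F_def)
      then show False using circ_nonzero[of \<theta>] \<open>cos \<theta> = 0\<close> by (simp add: circ_def)
    qed
    have tanF: "continuous_on F tan" by (rule continuous_on_subset[OF tan]) (use F0 in auto)
    have "- (proj -` V) = F \<inter> tan -` C"
    proof (intro Set.set_eqI)
      fix \<theta>
      have "\<theta> \<in> F" if "tan \<theta> \<in> C" "cos \<theta> \<noteq> 0"
        using K[OF that(1)] that(2) by (simp add: F_def tan_def abs_divide pos_divide_le_eq)
      then show "\<theta> \<in> - (proj -` V) \<longleftrightarrow> \<theta> \<in> F \<inter> tan -` C"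
        using proj_Some[of \<theta>] proj_None[of \<theta>] 2(1) F0[of \<theta>] by (cases "cos \<theta> = 0") auto
    qed
    moreover have "closed (F \<inter> tan -` C)"
      using continuous_closed_preimage[OF tanF F compact_imp_closed[OF 2(2)]] .
    ultimately have "closed (- (proj -` V))" by (simp only:)
    then show ?thesis by (simp only: closed_def double_complement)
  qed
qed


section \<open>Lifts of homographies to the real line\<close>

definition rep :: "(real \<Rightarrow> real) \<Rightarrow> mat2 \<Rightarrow> bool" where
  "rep g m \<longleftrightarrow> mdet m \<noteq> 0 \<and> (\<forall>\<theta>. proj (g \<theta>) = mhom m (proj \<theta>))"

text \<open>The lifts to \<open>\<real>\<close> of all homographies, those reversing the
  orientation included.\<close>

definition lifts :: "(real \<Rightarrow> real) set" where
  "lifts = {g. surj g \<and> (strict_mono g \<or> strict_mono (\<lambda>x. - g x)) \<and> (\<exists>m. rep g m)}"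

abbreviation ginv :: "(real \<Rightarrow> real) \<Rightarrow> real \<Rightarrow> real" where "ginv g \<equiv> inv_into UNIV g"

lemma liftsI:
  "surj g \<Longrightarrow> strict_mono g \<or> strict_mono (\<lambda>x. - g x) \<Longrightarrow> rep g m \<Longrightarrow> g \<in> lifts"
  unfolding lifts_def by blast

lemma lifts_inj:
  assumes "g \<in> lifts" shows "inj g"
proof (rule injI)
  fix x y assume e: "g x = g y"
  have "strict_mono g \<or> strict_mono (\<lambda>x. - g x)" using assms by (simp add: lifts_def)
  then show "x = y"
  proof
    assume "strict_mono g"
    from strict_mono_eq[OF this, of x y] show ?thesis using e by simp
  next
    assume "strict_mono (\<lambda>x. - g x)"
    from strict_mono_eq[OF this, of x y] show ?thesis using e by simp
  qed
qed

lemma lifts_bij: "g \<in> lifts \<Longrightarrow> bij g"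
  using lifts_inj by (auto simp: bij_def lifts_def)

lemma lifts_inverse:
  assumes "g \<in> lifts" shows "ginv g (g x) = x" "g (ginv g x) = x"
  using lifts_inj[OF assms] assms by (auto simp: lifts_def surj_f_inv_f)

lemma lifts_mono_cases:
  assumes "g \<in> lifts"
  obtains "strict_mono g" | "\<not> strict_mono g" "\<And>x y. x < y \<Longrightarrow> g y < g x"
  using assms by (auto simp: lifts_def strict_mono_def)

lemma dec_not_inc: "(\<And>x y. x < y \<Longrightarrow> g y < g x) \<Longrightarrow> \<not> strict_mono (g :: real \<Rightarrow> real)"
  by (metis less_asym strict_monoD zero_less_one)

lemma lifts_continuous:
  assumes "g \<in> lifts" shows "continuous_on UNIV g"
proof (rule lifts_mono_cases[OF assms])
  have surj: "surj g" using assms by (simp add: lifts_def)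
  show ?thesis if "strict_mono g"
    by (rule continuous_onI_mono) (use surj that in \<open>auto simp: strict_mono_less_eq\<close>)
  assume d: "\<And>x y. x < y \<Longrightarrow> g y < g x"
  have "range (\<lambda>x. - g x) = UNIV"
  proof (rule surjI)
    show "- g (ginv g (- y)) = y" for y using lifts_inverse(2)[OF assms] by simp
  qed
  then have "continuous_on UNIV (\<lambda>x. - g x)"
    by (intro continuous_onI_mono) (use d in \<open>auto simp: less_eq_real_def\<close>)
  then have "continuous_on UNIV (\<lambda>x. - (- g x))" by (rule continuous_on_minus)
  then show ?thesis by simp
qed

lemma rep_comp: "rep g m \<Longrightarrow> rep h n \<Longrightarrow> rep (g \<circ> h) (mmul m n)"
  by (simp add: rep_def mdet_mmul mhom_mmul)

lemma rep_ginv: "g \<in> lifts \<Longrightarrow> rep g m \<Longrightarrow> rep (ginv g) (madj m)"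
  unfolding rep_def using lifts_inverse(2) mhom_madj(1) by (metis mdet_madj)

lemma rep_id: "k \<noteq> 0 \<Longrightarrow> rep id (mscal k)"
  by (simp add: rep_def mhom_scal) (simp add: mscal_def)

lemma lifts_rep: assumes "g \<in> lifts" obtains m where "rep g m"
  using assms unfolding lifts_def by blast

lemma lifts_id: "id \<in> lifts"
  by (rule liftsI[OF _ _ rep_id[of 1]]) (auto simp: strict_mono_def)

lemma strict_mono_comp_iff:
  assumes "g \<in> lifts" "h \<in> lifts"
  shows "strict_mono (g \<circ> h) \<longleftrightarrow> (strict_mono g \<longleftrightarrow> strict_mono h)"
proof -
  show ?thesis
    by (rule lifts_mono_cases[OF assms(1)]; rule lifts_mono_cases[OF assms(2)])
      (auto simp: strict_mono_def intro: dec_not_inc[unfolded strict_mono_def, rule_format]; metis less_asym zero_less_one)+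
qed

lemma lifts_comp:
  assumes "g \<in> lifts" "h \<in> lifts" shows "g \<circ> h \<in> lifts"
proof -
  obtain m where m: "rep g m" using assms(1) by (rule lifts_rep)
  obtain n where n: "rep h n" using assms(2) by (rule lifts_rep)
  note mn = m n
  have "strict_mono (g \<circ> h) \<or> strict_mono (\<lambda>x. - (g \<circ> h) x)"
    by (rule lifts_mono_cases[OF assms(1)]; rule lifts_mono_cases[OF assms(2)])
      (auto simp: strict_mono_def)
  moreover have "surj (g \<circ> h)" by (rule comp_surj) (use assms in \<open>simp_all add: lifts_def\<close>)
  ultimately show ?thesis using rep_comp[OF mn] liftsI by blast
qed

lemma strict_mono_ginv:
  assumes "g \<in> lifts" shows "strict_mono (ginv g) \<longleftrightarrow> strict_mono g"
    "strict_mono (ginv g) \<or> strict_mono (\<lambda>x. - ginv g x)"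
proof -
  have 1: "strict_mono (ginv g)" if m: "strict_mono g"
  proof (rule strict_monoI)
    fix x y :: real assume "x < y"
    then have "g (ginv g x) < g (ginv g y)" using lifts_inverse(2)[OF assms] by simp
    then show "ginv g x < ginv g y" using m by (simp add: strict_mono_less)
  qed
  have 2: "ginv g y < ginv g x" if d: "\<And>x y. x < y \<Longrightarrow> g y < g x" and "x < y" for x y
  proof (rule ccontr)
    assume "\<not> ginv g y < ginv g x"
    then have "g (ginv g y) \<le> g (ginv g x)"
      using d[of "ginv g x" "ginv g y"] by (cases "ginv g x = ginv g y") auto
    then show False using lifts_inverse(2)[OF assms] that(2) by simp
  qed
  show "strict_mono (ginv g) \<or> strict_mono (\<lambda>x. - ginv g x)"
    by (rule lifts_mono_cases[OF assms]) (use 1 2 in \<open>auto simp: strict_mono_def\<close>)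
  show "strict_mono (ginv g) \<longleftrightarrow> strict_mono g"
  proof (rule lifts_mono_cases[OF assms])
    assume d: "\<not> strict_mono g" "\<And>x y. x < y \<Longrightarrow> g y < g x"
    then show ?thesis using dec_not_inc[of "ginv g"] 2 by blast
  qed (use 1 in simp)
qed

lemma lifts_ginv:
  assumes "g \<in> lifts" shows "ginv g \<in> lifts"
proof -
  obtain m where "rep g m" using assms by (rule lifts_rep)
  then have "rep (ginv g) (madj m)" by (rule rep_ginv[OF assms])
  moreover have "surj (ginv g)" by (rule surjI[of _ g]) (rule lifts_inverse(1)[OF assms])
  ultimately show ?thesis using strict_mono_ginv(2)[OF assms] liftsI by blast
qed

lemma ginv_comp: "g \<in> lifts \<Longrightarrow> ginv g \<circ> g = id" "g \<in> lifts \<Longrightarrow> g \<circ> ginv g = id"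
  by (auto simp: fun_eq_iff lifts_inverse)

definition zshift :: "int \<Rightarrow> real \<Rightarrow> real" where "zshift k \<theta> = \<theta> + of_int k * pi"

lemma zshift_lifts: "zshift k \<in> lifts" "strict_mono (zshift k)" "rep (zshift k) (mscal 1)"
proof -
  show m: "strict_mono (zshift k)" by (auto simp: strict_mono_def zshift_def)
  show r: "rep (zshift k) (mscal 1)"
    by (simp add: rep_def mhom_scal zshift_def) (simp add: mscal_def)
  have "surj (zshift k)" by (rule surjI[of _ "zshift (- k)"]) (simp add: zshift_def)
  then show "zshift k \<in> lifts" using m r liftsI by blast
qed

text \<open>The difference of the two lifts is continuous with values in
  \<open>\<pi>\<int>\<close>.\<close>

lemma lifts_agree:
  assumes g: "g \<in> lifts" and h: "h \<in> lifts" and ag: "\<And>\<theta>. proj (g \<theta>) = proj (h \<theta>)"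
  shows "\<exists>k. g = zshift k \<circ> h"
proof -
  define f where "f \<theta> = (g \<theta> - h \<theta>) / pi" for \<theta>
  have f: "\<exists>k::int. f \<theta> = of_int k" for \<theta>
    using ag[of \<theta>] unfolding proj_eq_iff f_def by auto
  have "f constant_on UNIV"
  proof (rule continuous_discrete_range_constant)
    show "continuous_on UNIV f"
      unfolding f_def using lifts_continuous[OF g] lifts_continuous[OF h] by (intro continuous_intros) auto
    fix x
    have "1 \<le> norm (f y - f x)" if "f y \<noteq> f x" for y
    proof -
      obtain k l :: int where kl: "f x = of_int k" "f y = of_int l" using f by meson
      then have "1 \<le> \<bar>l - k\<bar>" using that by auto
      then have "1 \<le> real_of_int \<bar>l - k\<bar>" by linarith
      then show ?thesis by (simp add: kl)
    qed
    then show "\<exists>e>0. \<forall>y. y \<in> UNIV \<and> f y \<noteq> f x \<longrightarrow> e \<le> norm (f y - f x)"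
      using zero_less_one by blast
  qed auto
  then obtain c where c: "\<And>x. f x = c" unfolding constant_on_def by auto
  obtain k :: int where "c = of_int k" using f[of 0] c by auto
  then have "g \<theta> = zshift k (h \<theta>)" for \<theta>
    using c[of \<theta>] by (simp add: f_def zshift_def field_simps)
  then show ?thesis by (intro exI[of _ k]) auto
qed

lemma rep_agree:
  assumes "rep g m" "rep h n" and inf: "infinite S" and ag: "\<And>x. x \<in> S \<Longrightarrow> mhom m x = mhom n x"
  shows "is_scal (mmul (madj n) m)" "\<And>\<theta>. proj (g \<theta>) = proj (h \<theta>)"
proof -
  have d: "mdet m \<noteq> 0" "mdet n \<noteq> 0" using assms by (auto simp: rep_def)
  have "S \<subseteq> {p. mhom m p = mhom n p}" using ag by auto
  then have "infinite {p. mhom m p = mhom n p}" using inf finite_subset by auto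
  then show s: "is_scal (mmul (madj n) m)" by (rule mhom_agree_infinite[OF d])
  show "proj (g \<theta>) = proj (h \<theta>)" for \<theta>
    using mhom_eq_of_scal[OF d s] assms(1,2) by (simp add: rep_def)
qed

text \<open>An interval has infinitely many images on the circle, which is enough to determine a
  homography.\<close>

lemma lifts_agree_interval:
  assumes g: "g \<in> lifts" and h: "h \<in> lifts" and ab: "a < b"
    and ag: "\<And>\<theta>. a < \<theta> \<Longrightarrow> \<theta> < b \<Longrightarrow> proj (g \<theta>) = proj (h \<theta>)"
  shows "\<exists>k. g = zshift k \<circ> h"
proof -
  obtain m where m: "rep g m" using g by (rule lifts_rep)
  obtain n where n: "rep h n" using h by (rule lifts_rep)
  have "mhom m x = mhom n x" if "x \<in> proj ` {a<..<b}" for x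
    using that ag m n by (auto simp: rep_def)
  from rep_agree(2)[OF m n infinite_proj_interval[OF ab] this] show ?thesis
    using lifts_agree[OF g h] by blast
qed

lemma rep_unique:
  assumes "rep g m" "rep g n" shows "is_scal (mmul (madj n) m)"
proof (rule rep_agree(1)[OF assms infinite_p1])
  fix x
  obtain \<theta> where "x = proj \<theta>" by (rule proj_surj)
  then show "mhom m x = mhom n x" using assms by (simp add: rep_def)
qed

lemma rep_scal_zshift:
  assumes "g \<in> lifts" "rep g m" "is_scal m"
  shows "\<exists>k. g = zshift k"
proof -
  obtain k where k: "m = mscal k" using assms(3) by (auto simp: is_scal_def)
  then have "k \<noteq> 0" using assms(2) by (auto simp: rep_def mscal_def)
  then have "proj (g \<theta>) = proj (id \<theta>)" for \<theta> using assms(2) k by (simp add: rep_def mhom_scal)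
  from lifts_agree[OF assms(1) lifts_id this] show ?thesis unfolding comp_id .
qed

text \<open>A continuous injective function is monotone, and the period decides the direction.\<close>

lemma increasing_of_period:
  fixes g :: "real \<Rightarrow> real"
  assumes cont: "continuous_on UNIV g" and per: "\<And>\<theta>. g (\<theta> + pi) = g \<theta> + pi"
    and r: "rep g m"
  shows "strict_mono g"
proof -
  have perk: "g (\<theta> + of_nat k * pi) = g \<theta> + of_nat k * pi" for \<theta> k
  proof (induction k)
    case (Suc k)
    then show ?case using per[of "\<theta> + of_nat k * pi"] by (simp add: algebra_simps)
  qed simp
  have perz: "g (\<theta> + of_int k * pi) = g \<theta> + of_int k * pi" for \<theta> k
  proof (cases "k \<ge> 0")
    case True
    then show ?thesis using perk[of \<theta> "nat k"] by simp
  next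
    case False
    then show ?thesis using perk[of "\<theta> + of_int k * pi" "nat (- k)"] by simp
  qed
  have inj: "inj g"
  proof (rule injI)
    fix x y assume e: "g x = g y"
    then have "mhom m (proj x) = mhom m (proj y)" using r unfolding rep_def by metis
    then have "proj x = proj y" using r mhom_madj(1) unfolding rep_def by metis
    then obtain k :: int where k: "x = y + of_int k * pi" by (auto simp: proj_eq_iff)
    then have "g y + of_int k * pi = g y" using e perz[of y k] by simp
    then show "x = y" using k by simp
  qed
  show ?thesis
  proof (rule strict_monoI)
    fix x y :: real assume xy: "x < y"
    obtain k :: nat where k: "(y - x) / pi < of_nat k" using reals_Archimedean2 by blast
    then have y: "y < x + of_nat k * pi" by (simp add: field_simps)
    have "k \<noteq> 0" using y xy by (intro notI) simp
    then have "g x < g (x + of_nat k * pi)" unfolding perk by simp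
    then show "g x < g y"
      using continuous_inj_imp_mono[OF xy y, of g] continuous_on_subset[OF cont] inj_on_subset[OF inj] by auto
  qed
qed

lemma rotation_lift: "\<exists>g\<in>lifts. rep g (cos \<alpha>, sin \<alpha>, - sin \<alpha>, cos \<alpha>) \<and> (\<forall>\<theta>. g \<theta> = \<theta> + \<alpha>)"
proof -
  let ?g = "\<lambda>\<theta>. \<theta> + \<alpha>" and ?m = "(cos \<alpha>, sin \<alpha>, - sin \<alpha>, cos \<alpha>)"
  have "mdet ?m = (cos \<alpha>)\<^sup>2 + (sin \<alpha>)\<^sup>2" by (simp add: power2_eq_square)
  then have d: "mdet ?m \<noteq> 0" by simp
  have "proj (?g \<theta>) = mhom ?m (proj \<theta>)" for \<theta>
    unfolding proj_def mhom_vpoint[OF circ_nonzero] by (simp add: circ_def sin_add cos_add algebra_simps)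
  then have r: "rep ?g ?m" using d unfolding rep_def by blast
  have "surj ?g" by (rule surjI[of _ "\<lambda>\<theta>. \<theta> - \<alpha>"]) simp
  then show ?thesis using liftsI[OF _ _ r] r by (auto simp: strict_mono_def)
qed

text \<open>The angle from \<open>v = circ \<theta>\<close> to \<open>m v\<close> is \<open>arctan
  (N \<theta> / D \<theta>)\<close>, where \<open>D \<theta>\<close> is the scalar product of
  \<open>v\<close> with \<open>m v\<close> and \<open>N \<theta>\<close> that of the normal vector
  of \<open>v\<close> with \<open>m v\<close>.\<close>

lemma positive_lift:
  assumes m: "m = (a, b, b, d)" and pos: "a + d > 0" "mdet m > 0"
  shows "\<exists>g\<in>lifts. rep g m"
proof -
  define D where "D \<theta> = a * (sin \<theta>)\<^sup>2 + 2 * b * (sin \<theta> * cos \<theta>) + d * (cos \<theta>)\<^sup>2" for \<theta>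
  define N where "N \<theta> = (a - d) * (sin \<theta> * cos \<theta>) + b * ((cos \<theta>)\<^sup>2 - (sin \<theta>)\<^sup>2)" for \<theta>
  have ad: "a * d > b * b" using pos(2) by (simp add: m)
  have "a > 0"
  proof (rule ccontr)
    assume "\<not> a > 0"
    then have "a * d \<le> 0" using pos(1) by (simp add: mult_le_0_iff)
    then show False using ad zero_le_square[of b] by linarith
  qed
  have Dpos: "D \<theta> > 0" for \<theta>
  proof -
    have "a * D \<theta> = (a * sin \<theta> + b * cos \<theta>)\<^sup>2 + (a * d - b * b) * (cos \<theta>)\<^sup>2"
      by (simp add: D_def power2_eq_square algebra_simps)
    moreover have "\<dots> > 0"
    proof (cases "cos \<theta> = 0")
      case True
      then have "sin \<theta> \<noteq> 0" using circ_nonzero[of \<theta>] by (simp add: circ_def)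
      then show ?thesis using True \<open>a > 0\<close> by simp
    next
      case False
      then show ?thesis using ad by (intro add_nonneg_pos) auto
    qed
    ultimately show ?thesis using \<open>a > 0\<close> by (metis zero_less_mult_pos)
  qed
  define g where "g \<theta> = \<theta> + arctan (N \<theta> / D \<theta>)" for \<theta>
  have cont: "continuous_on UNIV g"
    unfolding g_def N_def D_def
    by (intro continuous_intros continuous_on_arctan) (use Dpos in \<open>auto simp: D_def less_imp_neq[symmetric]\<close>)
  have per: "g (\<theta> + pi) = g \<theta> + pi" for \<theta>
    by (simp add: g_def N_def D_def)
  have "proj (g \<theta>) = mhom m (proj \<theta>)" for \<theta>
  proof -
    define t where "t = arctan (N \<theta> / D \<theta>)"
    have ct: "cos t > 0" unfolding t_def using cos_gt_zero_pi arctan_bounded by blast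
    have "sin t = tan t * cos t" using ct by (simp add: tan_def)
    then have st: "D \<theta> * sin t = N \<theta> * cos t" using Dpos[of \<theta>] by (simp add: t_def tan_arctan)
    have sc: "(sin \<theta>)\<^sup>2 + (cos \<theta>)\<^sup>2 = 1" by simp
    define u v where "u = a * sin \<theta> + b * cos \<theta>" and "v = b * sin \<theta> + d * cos \<theta>"
    have uv: "D \<theta> = u * sin \<theta> + v * cos \<theta>" "N \<theta> = u * cos \<theta> - v * sin \<theta>"
      by (simp_all add: D_def N_def u_def v_def power2_eq_square algebra_simps)
    have "sin (\<theta> + t) * v - u * cos (\<theta> + t) = D \<theta> * sin t - N \<theta> * cos t"
      unfolding sin_add cos_add uv by (simp add: algebra_simps)
    then have "vdet (circ (g \<theta>)) (mapp m (circ \<theta>)) = 0"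
      using st by (simp add: circ_def m g_def t_def[symmetric] u_def v_def)
    then show ?thesis
      unfolding proj_def mhom_vpoint[OF circ_nonzero]
      using vpoint_eq_iff[OF circ_nonzero mapp_nonzero[OF _ circ_nonzero]] pos(2) by simp
  qed
  then have r: "rep g m" using pos(2) unfolding rep_def by simp
  have inc: "strict_mono g" by (rule increasing_of_period[OF cont per r])
  have "\<exists>x. g x = y" for y
  proof -
    have b: "\<bar>g x - x\<bar> \<le> pi / 2" for x
      using arctan_lbound[of "N x / D x"] arctan_ubound[of "N x / D x"] by (simp add: g_def abs_le_iff)
    have "g (y - pi) \<le> y" "y \<le> g (y + pi)" using b[of "y - pi"] b[of "y + pi"] pi_gt_zero by linarith+
    then show ?thesis
      using IVT'[of g "y - pi" y "y + pi"] continuous_on_subset[OF cont] pi_gt_zero by auto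
  qed
  then have "surj g" by (metis surjI)
  then show ?thesis using liftsI[OF _ _ r] inc r by blast
qed

text \<open>A matrix of positive determinant is the product of a rotation \<open>R\<close> and a
  positive definite matrix \<open>P\<close>, which turns every line by an angle less than
  \<open>\<pi> / 2\<close>.\<close>

lemma lift_exists_pos:
  assumes "mdet m > 0" shows "\<exists>g\<in>lifts. rep g m"
proof -
  obtain a b c d where m: "m = (a, b, c, d)" by (metis prod_cases4)
  define r where "r = sqrt ((a + d)\<^sup>2 + (b - c)\<^sup>2)"
  have "(a + d)\<^sup>2 + (b - c)\<^sup>2 = (a - d)\<^sup>2 + (b + c)\<^sup>2 + 4 * mdet m"
    by (simp add: m power2_eq_square algebra_simps)
  then have p: "(a + d)\<^sup>2 + (b - c)\<^sup>2 > 0" using assms by (simp add: add_nonneg_pos)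
  then have r: "r > 0" "r\<^sup>2 = (a + d)\<^sup>2 + (b - c)\<^sup>2" by (simp_all add: r_def)
  have "((a + d) / r)\<^sup>2 + ((b - c) / r)\<^sup>2 = 1"
    unfolding power_divide add_divide_distrib[symmetric] r(2) by (rule divide_self) (use p in linarith)
  then obtain \<alpha> where \<alpha>: "(a + d) / r = cos \<alpha>" "(b - c) / r = sin \<alpha>" using sincos_total_2pi by metis
  define R where "R = (cos \<alpha>, sin \<alpha>, - sin \<alpha>, cos \<alpha>)"
  define P where "P = mmul (madj R) m"
  have ad: "a + d = r * cos \<alpha>" "b - c = r * sin \<alpha>" using \<alpha> r(1) by (simp_all add: field_simps)
  have dR: "mdet R = 1" by (simp add: R_def flip: power2_eq_square)
  have sym: "cos \<alpha> * b - sin \<alpha> * d = sin \<alpha> * a + cos \<alpha> * c"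
  proof -
    have "cos \<alpha> * (b - c) = sin \<alpha> * (a + d)" unfolding ad by simp
    then show ?thesis by (simp add: algebra_simps)
  qed
  have P: "P = (cos \<alpha> * a - sin \<alpha> * c, cos \<alpha> * b - sin \<alpha> * d, cos \<alpha> * b - sin \<alpha> * d, sin \<alpha> * b + cos \<alpha> * d)"
    unfolding P_def R_def m using sym by simp
  have "(cos \<alpha> * a - sin \<alpha> * c) + (sin \<alpha> * b + cos \<alpha> * d) = cos \<alpha> * (a + d) + sin \<alpha> * (b - c)"
    by (simp add: algebra_simps)
  also have "\<dots> = r * ((cos \<alpha>)\<^sup>2 + (sin \<alpha>)\<^sup>2)" unfolding ad by (simp only: power2_eq_square distrib_left mult.left_commute)
  also have "\<dots> > 0" using r by simp
  finally have tr: "(cos \<alpha> * a - sin \<alpha> * c) + (sin \<alpha> * b + cos \<alpha> * d) > 0" .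
  have "mdet P = mdet m" unfolding P_def mdet_mmul mdet_madj dR by simp
  then obtain g where g: "g \<in> lifts" "rep g P" using positive_lift[OF P tr] assms by auto
  obtain h where h: "h \<in> lifts" "rep h R" using rotation_lift[of \<alpha>] unfolding R_def by auto
  have "mmul R P = m"
    unfolding P_def mmul_assoc[symmetric] mmul_madj dR by (cases m) (simp add: mscal_def)
  then show ?thesis using lifts_comp[OF h(1) g(1)] rep_comp[OF h(2) g(2)] by auto
qed

lemma reflection_lift: "(\<lambda>\<theta>. - \<theta>) \<in> lifts" "rep (\<lambda>\<theta>. - \<theta>) (- 1, 0, 0, 1)"
proof -
  have "proj (- \<theta>) = mhom (- 1, 0, 0, 1) (proj \<theta>)" for \<theta>
    unfolding proj_def mhom_vpoint[OF circ_nonzero] by (simp add: circ_def)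
  then show r: "rep (\<lambda>\<theta>. - \<theta>) (- 1, 0, 0, 1)" by (simp add: rep_def)
  show "(\<lambda>\<theta>. - \<theta>) \<in> lifts"
    by (rule liftsI[OF _ _ r]) (auto simp: strict_mono_def intro: surjI[of _ uminus])
qed

lemma lift_exists:
  assumes "mdet m \<noteq> 0" shows "\<exists>g\<in>lifts. rep g m"
proof (cases "mdet m > 0")
  case True
  then show ?thesis by (rule lift_exists_pos)
next
  case False
  let ?r = "(- 1, 0, 0, 1) :: mat2"
  have "mdet (mmul m ?r) > 0" using False assms by (simp add: mdet_mmul)
  then obtain g where g: "g \<in> lifts" "rep g (mmul m ?r)" using lift_exists_pos by blast
  have "mmul (mmul m ?r) ?r = m" by (cases m) simp
  then have "rep (g \<circ> (\<lambda>\<theta>. - \<theta>)) m" using rep_comp[OF g(2) reflection_lift(2)] by simp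
  then show ?thesis using lifts_comp[OF g(1) reflection_lift(1)] by blast
qed

lemma lift_through:
  assumes "mdet m \<noteq> 0" "mhom m (proj \<theta>) = proj \<phi>"
  shows "\<exists>g\<in>lifts. rep g m \<and> g \<theta> = \<phi>"
proof -
  obtain g where g: "g \<in> lifts" "rep g m" using lift_exists[OF assms(1)] by blast
  then have "proj \<phi> = proj (g \<theta>)" using assms(2) by (simp add: rep_def)
  then obtain k :: int where k: "\<phi> = g \<theta> + of_int k * pi" by (auto simp: proj_eq_iff)
  have "rep (zshift k \<circ> g) m" using g(2) by (simp add: rep_def zshift_def)
  then show ?thesis
    using lifts_comp[OF zshift_lifts(1) g(1), of k] k by (intro bexI[of _ "zshift k \<circ> g"]) (auto simp: zshift_def)
qed


section \<open>One-sided points\<close>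

text \<open>The pair \<open>(x, True)\<close> stands for the point \<open>x\<close> approached from the right, and \<open>(x, False)\<close> for
  \<open>x\<close> approached from the left.\<close>

type_synonym tip = "real \<times> bool"

definition near_side :: "tip \<Rightarrow> (real \<Rightarrow> bool) \<Rightarrow> bool" where
  "near_side p P \<longleftrightarrow> (if snd p then \<exists>b>fst p. \<forall>z. fst p < z \<and> z < b \<longrightarrow> P z
     else \<exists>b<fst p. \<forall>z. b < z \<and> z < fst p \<longrightarrow> P z)"

text \<open>A decreasing map exchanges the two sides of a point.\<close>

definition tapp :: "(real \<Rightarrow> real) \<Rightarrow> tip \<Rightarrow> tip" where
  "tapp g p = (g (fst p), snd p = strict_mono g)"

definition opp :: "tip \<Rightarrow> tip" where "opp p = (fst p, \<not> snd p)"

lemma opp_opp [simp]: "opp (opp p) = p" and fst_opp [simp]: "fst (opp p) = fst p" and snd_opp [simp]: "snd (opp p) = (\<not> snd p)"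
  by (auto simp: opp_def)

lemma tapp_opp: "tapp g (opp p) = opp (tapp g p)"
  by (auto simp: tapp_def opp_def)

lemma tapp_id [simp]: "tapp id p = p"
  by (simp add: tapp_def strict_mono_def)

lemma tapp_comp: "g \<in> lifts \<Longrightarrow> h \<in> lifts \<Longrightarrow> tapp (g \<circ> h) p = tapp g (tapp h p)"
  by (auto simp: tapp_def strict_mono_comp_iff)

lemma tapp_inverse: "g \<in> lifts \<Longrightarrow> tapp (ginv g) (tapp g p) = p" "g \<in> lifts \<Longrightarrow> tapp g (tapp (ginv g) p) = p"
  by (simp_all flip: tapp_comp add: lifts_ginv ginv_comp)

lemma near_side_mono: "near_side p P \<Longrightarrow> (\<And>z. P z \<Longrightarrow> Q z) \<Longrightarrow> near_side p Q"
  unfolding near_side_def by (auto split: if_splits; meson)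

lemma near_side_conj:
  assumes "near_side p P" "near_side p Q" shows "near_side p (\<lambda>z. P z \<and> Q z)"
proof (cases "snd p")
  case True
  then obtain b c where "b > fst p" "\<forall>z. fst p < z \<and> z < b \<longrightarrow> P z" "c > fst p" "\<forall>z. fst p < z \<and> z < c \<longrightarrow> Q z"
    using assms by (auto simp: near_side_def)
  then show ?thesis using True by (auto simp: near_side_def intro!: exI[of _ "min b c"])
next
  case False
  then obtain b c where "b < fst p" "\<forall>z. b < z \<and> z < fst p \<longrightarrow> P z" "c < fst p" "\<forall>z. c < z \<and> z < fst p \<longrightarrow> Q z"
    using assms by (auto simp: near_side_def)
  then show ?thesis using False by (auto simp: near_side_def intro!: exI[of _ "max b c"])
qed

lemma near_side_interval:
  assumes "near_side p P" obtains a b where "a < b" "\<And>z. a < z \<Longrightarrow> z < b \<Longrightarrow> P z"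
  using assms that by (auto simp: near_side_def split: if_splits)

lemma near_side_tapp:
  assumes g: "g \<in> lifts" and P: "near_side (tapp g p) P"
  shows "near_side p (\<lambda>z. P (g z))"
proof (rule lifts_mono_cases[OF g])
  assume m: "strict_mono g"
  show ?thesis
  proof (cases "snd p")
    case True
    then obtain b where b: "b > g (fst p)" "\<forall>z. g (fst p) < z \<and> z < b \<longrightarrow> P z"
      using P m by (auto simp: near_side_def tapp_def)
    then have "fst p < ginv g b" "\<And>z. z < ginv g b \<Longrightarrow> g z < b"
      using m lifts_inverse(2)[OF g, of b] by (metis strict_mono_less)+
    then show ?thesis using b(2) m True by (auto simp: near_side_def strict_mono_less intro!: exI[of _ "ginv g b"])
  next
    case False
    then obtain b where b: "b < g (fst p)" "\<forall>z. b < z \<and> z < g (fst p) \<longrightarrow> P z"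
      using P m by (auto simp: near_side_def tapp_def)
    then have "ginv g b < fst p" "\<And>z. ginv g b < z \<Longrightarrow> b < g z"
      using m lifts_inverse(2)[OF g, of b] by (metis strict_mono_less)+
    then show ?thesis using b(2) m False by (auto simp: near_side_def strict_mono_less intro!: exI[of _ "ginv g b"])
  qed
next
  assume m: "\<not> strict_mono g" "\<And>x y. x < y \<Longrightarrow> g y < g x"
  have less: "g x < g y \<longleftrightarrow> y < x" for x y using m(2) by (metis less_asym linorder_neqE)
  show ?thesis
  proof (cases "snd p")
    case True
    then obtain b where b: "b < g (fst p)" "\<forall>z. b < z \<and> z < g (fst p) \<longrightarrow> P z"
      using P m by (auto simp: near_side_def tapp_def)
    then have "fst p < ginv g b" "\<And>z. z < ginv g b \<Longrightarrow> b < g z"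
      using less lifts_inverse(2)[OF g, of b] by metis+
    then show ?thesis using b(2) True by (auto simp: near_side_def less intro!: exI[of _ "ginv g b"])
  next
    case False
    then obtain b where b: "b > g (fst p)" "\<forall>z. g (fst p) < z \<and> z < b \<longrightarrow> P z"
      using P m by (auto simp: near_side_def tapp_def)
    then have "ginv g b < fst p" "\<And>z. ginv g b < z \<Longrightarrow> g z < b"
      using less lifts_inverse(2)[OF g, of b] by metis+
    then show ?thesis using b(2) False by (auto simp: near_side_def less intro!: exI[of _ "ginv g b"])
  qed
qed

(* Tips and charts are treated as indivisible objects under quantifiers. *)
declare split_paired_Ex [simp del] split_paired_All [simp del]

section \<open>Germs of piecewise projective transformations\<close>

text \<open>The one-sided points of the circle cut open at \<open>proj 0\<close>, that is, the
  directions at the points of \<open>[0, \<pi>]\<close> that point into the interval.\<close>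

definition tips :: "tip set" where
  "tips = {(x, s). if s then 0 \<le> x \<and> x < pi else 0 < x \<and> x \<le> pi}"

lemma tips_iff: "(x, True) \<in> tips \<longleftrightarrow> 0 \<le> x \<and> x < pi" "(x, False) \<in> tips \<longleftrightarrow> 0 < x \<and> x \<le> pi"
  by (auto simp: tips_def)

lemma tips_interior: "0 < x \<Longrightarrow> x < pi \<Longrightarrow> (x, s) \<in> tips"
  by (auto simp: tips_def)

definition germ :: "(p1 \<Rightarrow> p1) \<Rightarrow> tip \<Rightarrow> (real \<Rightarrow> real) \<Rightarrow> bool" where
  "germ f p g \<longleftrightarrow> g \<in> lifts \<and> near_side p (\<lambda>\<theta>. f (proj \<theta>) = proj (g \<theta>))"

lemma near_side_avoid_finite:
  assumes "finite S" shows "near_side p (\<lambda>\<theta>. \<theta> \<notin> S)"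
  using assms
proof (induction S)
  case empty
  show ?case by (auto simp: near_side_def intro: gt_ex lt_ex)
next
  case (insert a S)
  have "near_side p (\<lambda>\<theta>. \<theta> \<noteq> a)"
  proof (cases "snd p")
    case True
    then show ?thesis
      by (auto simp: near_side_def intro!: exI[of _ "if a > fst p then a else fst p + 1"])
  next
    case False
    then show ?thesis
      by (auto simp: near_side_def intro!: exI[of _ "if a < fst p then a else fst p - 1"])
  qed
  from near_side_conj[OF this insert.IH] show ?case by (rule near_side_mono) simp
qed

lemma near_side_interior: "p \<in> tips \<Longrightarrow> near_side p (\<lambda>\<theta>. 0 < \<theta> \<and> \<theta> < pi)"
  by (cases p) (auto simp: tips_def near_side_def split: if_splits intro: exI[of _ pi] exI[of _ 0])

lemma near_side_avoid_proj:
  assumes "finite N" shows "near_side p (\<lambda>\<theta>. proj \<theta> \<notin> N)"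
proof -
  define a where "a = (if snd p then fst p else fst p - pi)"
  define S where "S = {\<theta>. a \<le> \<theta> \<and> \<theta> < a + pi \<and> proj \<theta> \<in> N}"
  have "inj_on proj S" by (rule inj_onI, rule proj_inj_on[of a]) (auto simp: S_def)
  moreover have "finite (proj ` S)" by (rule finite_subset[OF _ assms]) (auto simp: S_def)
  ultimately have "finite S" by (simp add: finite_image_iff)
  then have "near_side p (\<lambda>\<theta>. \<theta> \<notin> S)" by (rule near_side_avoid_finite)
  moreover have "near_side p (\<lambda>\<theta>. a \<le> \<theta> \<and> \<theta> < a + pi)"
  proof (cases "snd p")
    case True
    then show ?thesis by (auto simp: near_side_def a_def intro!: exI[of _ "fst p + pi"])
  next
    case False
    then show ?thesis by (auto simp: near_side_def a_def intro!: exI[of _ "fst p - pi"])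
  qed
  ultimately have "near_side p (\<lambda>\<theta>. \<theta> \<notin> S \<and> a \<le> \<theta> \<and> \<theta> < a + pi)" by (rule near_side_conj)
  then show ?thesis by (rule near_side_mono) (simp add: S_def)
qed

definition projective_at :: "(p1 \<Rightarrow> p1) \<Rightarrow> p1 \<Rightarrow> bool" where
  "projective_at f x \<longleftrightarrow> (\<exists>V. openin P1 V \<and> x \<in> V \<and> (\<exists>h\<in>PGL2. \<forall>x'\<in>V. f x' = h x'))"

lemma projective_atE:
  assumes "projective_at f (proj \<theta>)"
  obtains m \<delta> where "mdet m \<noteq> 0" "\<delta> > 0" "\<And>\<phi>. \<bar>\<phi> - \<theta>\<bar> < \<delta> \<Longrightarrow> f (proj \<phi>) = mhom m (proj \<phi>)"
proof -
  obtain V h where V: "openin P1 V" "proj \<theta> \<in> V" "h \<in> PGL2" "\<forall>x'\<in>V. f x' = h x'"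
    using assms unfolding projective_at_def by blast
  obtain m where m: "mdet m \<noteq> 0" "h = mhom m" using V(3) by (rule PGL2_E)
  obtain \<delta> where \<delta>: "\<delta> > 0" "\<And>\<phi>. dist \<phi> \<theta> < \<delta> \<Longrightarrow> \<phi> \<in> proj -` V"
    using proj_continuous[OF V(1)] V(2) unfolding open_dist by (metis vimageI2)
  show ?thesis
    by (rule that[OF m(1) \<delta>(1)]) (use \<delta>(2) V(4) m(2) in \<open>auto simp: dist_real_def\<close>)
qed

lemma mhom_agree_interval:
  assumes "mdet m \<noteq> 0" "mdet n \<noteq> 0" "a < b" "\<And>\<theta>. a < \<theta> \<Longrightarrow> \<theta> < b \<Longrightarrow> mhom m (proj \<theta>) = mhom n (proj \<theta>)"
  shows "mhom m = mhom n"
proof -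
  have "proj ` {a<..<b} \<subseteq> {p. mhom m p = mhom n p}" using assms(4) by auto
  then have "infinite {p. mhom m p = mhom n p}"
    using infinite_proj_interval[OF assms(3)] finite_subset by auto
  then show ?thesis using mhom_eq_of_scal[OF assms(1,2) mhom_agree_infinite[OF assms(1,2)]] by simp
qed

text \<open>The homography is locally constant as a function of the point, hence constant on the
  interval.\<close>

lemma projective_interval:
  assumes ab: "a < b" and pr: "\<And>\<theta>. a < \<theta> \<Longrightarrow> \<theta> < b \<Longrightarrow> projective_at f (proj \<theta>)"
  shows "\<exists>m. mdet m \<noteq> 0 \<and> (\<forall>\<theta>. a < \<theta> \<and> \<theta> < b \<longrightarrow> f (proj \<theta>) = mhom m (proj \<theta>))"
proof -
  define Q where "Q h \<theta> \<longleftrightarrow> (\<exists>m \<delta>. h = mhom m \<and> mdet m \<noteq> 0 \<and> \<delta> > 0 \<and>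
    (\<forall>\<phi>. \<bar>\<phi> - \<theta>\<bar> < \<delta> \<longrightarrow> f (proj \<phi>) = mhom m (proj \<phi>)))" for h \<theta>
  define H where "H \<theta> = (SOME h. Q h \<theta>)" for \<theta>
  have H: "Q (H \<theta>) \<theta>" if t: "a < \<theta>" "\<theta> < b" for \<theta>
  proof -
    obtain m \<delta> where "mdet m \<noteq> 0" "\<delta> > 0" "\<And>\<phi>. \<bar>\<phi> - \<theta>\<bar> < \<delta> \<Longrightarrow> f (proj \<phi>) = mhom m (proj \<phi>)"
      by (rule projective_atE[OF pr[OF t]]) blast
    then have "Q (mhom m) \<theta>" unfolding Q_def by blast
    then show ?thesis unfolding H_def by (rule someI[of "\<lambda>h. Q h \<theta>"])
  qed
  have uniq: "h = h'" if q1: "Q h \<theta>" and q2: "Q h' \<phi>" and near: "\<And>\<delta>. \<delta> > 0 \<Longrightarrow> \<exists>u v. u < v \<and> (\<forall>z. u < z \<and> z < v \<longrightarrow> \<bar>z - \<phi>\<bar> < \<delta> \<and> P z)"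
    and P: "\<And>z. P z \<Longrightarrow> f (proj z) = h (proj z)" for h h' \<theta> \<phi> P
  proof -
    obtain m where m: "h = mhom m" "mdet m \<noteq> 0" using q1 unfolding Q_def by blast
    obtain n \<delta> where n: "h' = mhom n" "mdet n \<noteq> 0" "\<delta> > 0"
      "\<And>z. \<bar>z - \<phi>\<bar> < \<delta> \<Longrightarrow> f (proj z) = mhom n (proj z)" using q2 unfolding Q_def by blast
    obtain u v where uv: "u < v" "\<And>z. u < z \<Longrightarrow> z < v \<Longrightarrow> \<bar>z - \<phi>\<bar> < \<delta> \<and> P z" using near[OF n(3)] by auto
    show ?thesis unfolding m(1) n(1)
      by (rule mhom_agree_interval[OF m(2) n(2) uv(1)]) (metis P m(1) n(4) uv(2))
  qed
  have const: "H \<theta> = H \<phi>" if "\<theta> \<in> {a<..<b}" "\<phi> \<in> {a<..<b}" for \<theta> \<phi>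
  proof (rule connected_local_const[of "{a<..<b}"])
    show "\<forall>\<theta>\<in>{a<..<b}. \<forall>\<^sub>F \<phi> in at \<theta> within {a<..<b}. H \<theta> = H \<phi>"
    proof
      fix \<theta> assume t: "\<theta> \<in> {a<..<b}"
      then have Q: "Q (H \<theta>) \<theta>" using H by simp
      obtain \<delta> where \<delta>: "\<delta> > 0" "\<And>z. \<bar>z - \<theta>\<bar> < \<delta> \<Longrightarrow> f (proj z) = H \<theta> (proj z)"
        using Q unfolding Q_def by metis
      have "H \<theta> = H \<phi>" if p: "\<phi> \<in> {a<..<b}" "\<bar>\<phi> - \<theta>\<bar> < \<delta>" for \<phi>
      proof (rule uniq[OF Q, of "H \<phi>" \<phi> "\<lambda>z. \<bar>z - \<theta>\<bar> < \<delta>"])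
        show "Q (H \<phi>) \<phi>" using H p by simp
        fix e :: real assume e: "e > 0"
        define \<eta> where "\<eta> = min e (\<delta> - \<bar>\<phi> - \<theta>\<bar>)"
        have "\<eta> > 0" using e p by (simp add: \<eta>_def)
        then show "\<exists>u v. u < v \<and> (\<forall>z. u < z \<and> z < v \<longrightarrow> \<bar>z - \<phi>\<bar> < e \<and> \<bar>z - \<theta>\<bar> < \<delta>)"
          by (intro exI[of _ "\<phi> - \<eta>"] exI[of _ "\<phi> + \<eta>"]) (auto simp: \<eta>_def)
      qed (use \<delta>(2) in auto)
      then show "\<forall>\<^sub>F \<phi> in at \<theta> within {a<..<b}. H \<theta> = H \<phi>"
        unfolding eventually_at using \<delta>(1) by (intro exI[of _ \<delta>]) (auto simp: dist_real_def)
    qed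
  qed (use that in auto)
  define \<theta>0 where "\<theta>0 = (a + b) / 2"
  have t0: "\<theta>0 \<in> {a<..<b}" using ab by (simp add: \<theta>0_def)
  have "Q (H \<theta>0) \<theta>0" using H[of \<theta>0] t0 by simp
  then obtain m where m: "H \<theta>0 = mhom m" "mdet m \<noteq> 0" unfolding Q_def by blast
  have "f (proj \<theta>) = mhom m (proj \<theta>)" if "a < \<theta>" "\<theta> < b" for \<theta>
  proof -
    have "H \<theta> = mhom m" using const[of \<theta> \<theta>0] that t0 m by simp
    moreover obtain m' \<delta>' where "H \<theta> = mhom m'" "\<delta>' > 0"
      "\<And>\<phi>. \<bar>\<phi> - \<theta>\<bar> < \<delta>' \<Longrightarrow> f (proj \<phi>) = mhom m' (proj \<phi>)"
      using H[OF \<open>a < \<theta>\<close> \<open>\<theta> < b\<close>] unfolding Q_def by blast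
    ultimately show ?thesis by simp
  qed
  then show ?thesis using m(2) by blast
qed

lemma germ_exists:
  assumes "piecewise_projective f"
  shows "\<exists>g. germ f p g"
proof -
  have "finite {x. \<not> projective_at f x}"
    using assms unfolding piecewise_projective_def projective_at_def eventually_cofinite .
  from near_side_avoid_proj[OF this, of p] have ns: "near_side p (\<lambda>\<theta>. projective_at f (proj \<theta>))" by simp
  have "\<exists>m. mdet m \<noteq> 0 \<and> near_side p (\<lambda>\<theta>. f (proj \<theta>) = mhom m (proj \<theta>))"
  proof (cases "snd p")
    case True
    then obtain b where "b > fst p" "\<And>z. fst p < z \<Longrightarrow> z < b \<Longrightarrow> projective_at f (proj z)"
      using ns by (auto simp: near_side_def)
    then obtain m where "mdet m \<noteq> 0" "\<forall>\<theta>. fst p < \<theta> \<and> \<theta> < b \<longrightarrow> f (proj \<theta>) = mhom m (proj \<theta>)"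
      using projective_interval[of "fst p" b f] by blast
    then show ?thesis using True \<open>b > fst p\<close> by (intro exI[of _ m]) (auto simp: near_side_def)
  next
    case False
    then obtain b where "b < fst p" "\<And>z. b < z \<Longrightarrow> z < fst p \<Longrightarrow> projective_at f (proj z)"
      using ns by (auto simp: near_side_def)
    then obtain m where "mdet m \<noteq> 0" "\<forall>\<theta>. b < \<theta> \<and> \<theta> < fst p \<longrightarrow> f (proj \<theta>) = mhom m (proj \<theta>)"
      using projective_interval[of b "fst p" f] by blast
    then show ?thesis using False \<open>b < fst p\<close> by (intro exI[of _ m]) (auto simp: near_side_def)
  qed
  then obtain m where m: "mdet m \<noteq> 0" "near_side p (\<lambda>\<theta>. f (proj \<theta>) = mhom m (proj \<theta>))" by blast
  obtain g where g: "g \<in> lifts" "rep g m" using lift_exists[OF m(1)] by blast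
  then show ?thesis using m(2) by (auto simp: germ_def rep_def)
qed

lemma germ_unique:
  assumes "germ f p g" "germ f p h" shows "\<exists>k. g = zshift k \<circ> h"
proof -
  have gh: "g \<in> lifts" "h \<in> lifts" using assms by (auto simp: germ_def)
  have "near_side p (\<lambda>\<theta>. f (proj \<theta>) = proj (g \<theta>) \<and> f (proj \<theta>) = proj (h \<theta>))"
    using assms by (auto simp: germ_def intro: near_side_conj)
  then obtain a b where ab: "a < b" "\<And>z. a < z \<Longrightarrow> z < b \<Longrightarrow> f (proj z) = proj (g z) \<and> f (proj z) = proj (h z)"
    by (rule near_side_interval) blast
  have "proj (g z) = proj (h z)" if "a < z" "z < b" for z
    using ab(2)[OF that] by metis
  from lifts_agree_interval[OF gh ab(1) this] show ?thesis .
qed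

lemma germ_zshift: "germ f p g \<Longrightarrow> germ f p (zshift k \<circ> g)"
  unfolding germ_def using lifts_comp[OF zshift_lifts(1)] by (auto simp: zshift_def)

lemma germ_comp:
  assumes "germ f2 p g2" "germ f1 (tapp g2 p) g1"
  shows "germ (f1 \<circ> f2) p (g1 \<circ> g2)"
proof -
  have g: "g1 \<in> lifts" "g2 \<in> lifts" using assms by (auto simp: germ_def)
  have "near_side p (\<lambda>\<theta>. f1 (proj (g2 \<theta>)) = proj (g1 (g2 \<theta>)))"
    by (rule near_side_tapp[OF g(2)]) (use assms(2) in \<open>simp add: germ_def\<close>)
  moreover have "near_side p (\<lambda>\<theta>. f2 (proj \<theta>) = proj (g2 \<theta>))" using assms(1) by (simp add: germ_def)
  ultimately have "near_side p (\<lambda>\<theta>. f1 (proj (g2 \<theta>)) = proj (g1 (g2 \<theta>)) \<and> f2 (proj \<theta>) = proj (g2 \<theta>))"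
    by (rule near_side_conj)
  then have "near_side p (\<lambda>\<theta>. (f1 \<circ> f2) (proj \<theta>) = proj ((g1 \<circ> g2) \<theta>))"
    by (rule near_side_mono) simp
  then show ?thesis using lifts_comp[OF g] by (simp add: germ_def)
qed

lemma germ_cong:
  assumes "germ f p g" "\<forall>\<^sub>\<infinity>x. f x = f' x" shows "germ f' p g"
proof -
  have "near_side p (\<lambda>\<theta>. proj \<theta> \<notin> {x. f x \<noteq> f' x})"
    by (rule near_side_avoid_proj) (use assms(2) in \<open>simp add: eventually_cofinite\<close>)
  from near_side_conj[OF _ this] assms(1)
  have "near_side p (\<lambda>\<theta>. f (proj \<theta>) = proj (g \<theta>) \<and> proj \<theta> \<notin> {x. f x \<noteq> f' x})" by (simp add: germ_def)
  then have "near_side p (\<lambda>\<theta>. f' (proj \<theta>) = proj (g \<theta>))" by (rule near_side_mono) auto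
  then show ?thesis using assms(1) by (simp add: germ_def)
qed

lemma tips_shift_exists: "\<exists>k. tapp (zshift k) p \<in> tips"
proof (cases "snd p")
  case True
  obtain \<theta> where \<theta>: "proj (fst p) = proj \<theta>" "0 \<le> \<theta>" "\<theta> < 0 + pi" using proj_representative by blast
  have "proj \<theta> = proj (fst p)" using \<theta>(1) by simp
  then obtain k :: int where "\<theta> = fst p + of_int k * pi" unfolding proj_eq_iff by blast
  then show ?thesis using \<theta> True zshift_lifts(2)
    by (intro exI[of _ k]) (simp add: tapp_def tips_def zshift_def)
next
  case False
  obtain \<theta> where \<theta>: "proj (- fst p) = proj \<theta>" "- pi \<le> \<theta>" "\<theta> < - pi + pi" using proj_representative by blast
  have "proj \<theta> = proj (- fst p)" using \<theta>(1) by simp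
  then obtain k :: int where "\<theta> = - fst p + of_int k * pi" unfolding proj_eq_iff by blast
  then show ?thesis using \<theta> False zshift_lifts(2)[of "- k"]
    by (intro exI[of _ "- k"]) (simp add: tapp_def tips_def zshift_def)
qed

lemma tips_shift_unique:
  assumes "p \<in> tips" "tapp (zshift k) p \<in> tips" shows "k = 0"
proof -
  obtain x t where p: "p = (x, t)" by (cases p)
  have "(x, t) \<in> tips" "(x + of_int k * pi, t) \<in> tips"
    using assms zshift_lifts(2)[of k] by (simp_all add: p tapp_def zshift_def)
  then consider "0 \<le> x" "x < pi" "0 \<le> x + of_int k * pi" "x + of_int k * pi < pi"
    | "0 < x" "x \<le> pi" "0 < x + of_int k * pi" "x + of_int k * pi \<le> pi"
    by (cases t) (simp_all add: tips_iff)
  then have "of_int k * pi < 1 * pi" "(- 1) * pi < of_int k * pi"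
    by (cases; linarith)+
  then have "of_int k < (1::real)" "- 1 < (of_int k :: real)"
    by (simp_all only: mult_less_cancel_right_pos[OF pi_gt_zero])
  then show ?thesis by linarith
qed

text \<open>Germs are determined up to translations by multiples of \<open>\<pi>\<close>; the lift
  is normalized by the requirement that the image of the tip lies in the fundamental domain.\<close>

definition tip_germ :: "(p1 \<Rightarrow> p1) \<Rightarrow> tip \<Rightarrow> (real \<Rightarrow> real) \<Rightarrow> bool" where
  "tip_germ f p g \<longleftrightarrow> germ f p g \<and> tapp g p \<in> tips"

lemma tip_germ_exists:
  assumes "piecewise_projective f" shows "\<exists>g. tip_germ f p g"
proof -
  obtain g where g: "germ f p g" using germ_exists[OF assms] by blast
  obtain k where k: "tapp (zshift k) (tapp g p) \<in> tips" using tips_shift_exists by blast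
  have "tapp (zshift k \<circ> g) p \<in> tips" using k tapp_comp[OF zshift_lifts(1)] g by (simp add: germ_def)
  then show ?thesis using germ_zshift[OF g] by (auto simp: tip_germ_def)
qed

lemma tip_germ_unique:
  assumes "tip_germ f p g" "tip_germ f p h" shows "g = h"
proof -
  obtain k where k: "g = zshift k \<circ> h" using germ_unique[of f p g h] assms by (auto simp: tip_germ_def)
  have h: "h \<in> lifts" using assms(2) by (simp add: tip_germ_def germ_def)
  have "tapp (zshift k) (tapp h p) \<in> tips" using assms(1) k tapp_comp[OF zshift_lifts(1) h] by (simp add: tip_germ_def)
  then have "k = 0" using tips_shift_unique[of "tapp h p" k] assms(2) by (simp add: tip_germ_def)
  then show ?thesis using k by (simp add: zshift_def fun_eq_iff)
qed

definition representative :: "(p1 \<Rightarrow> p1) set \<Rightarrow> p1 \<Rightarrow> p1" where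
  "representative A = (SOME f. f \<in> A \<and> piecewise_projective f)"

definition germ_cocycle :: "(p1 \<Rightarrow> p1) set \<Rightarrow> tip \<Rightarrow> real \<Rightarrow> real" where
  "germ_cocycle A p = (THE g. tip_germ (representative A) p g)"

lemma representative:
  assumes "A \<in> carrier PC_Proj"
  shows "representative A \<in> pc_maps" "A = pc_eq `` {representative A}" "piecewise_projective (representative A)"
proof -
  have A: "A \<in> carrier PC" "\<exists>f. f \<in> A \<and> piecewise_projective f" using assms by (auto simp: PC_Proj_def)
  then have r: "representative A \<in> A" "piecewise_projective (representative A)" unfolding representative_def using someI_ex[OF A(2)] by auto
  obtain f where f: "f \<in> pc_maps" "A = pc_eq `` {f}" using A(1) by (rule PC_carrierE)
  have fr: "(f, representative A) \<in> pc_eq" using r(1) f(2) by simp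
  then show "representative A \<in> pc_maps" by (simp add: pc_eq_def)
  show "A = pc_eq `` {representative A}" using pc_class_eqI[OF fr] f(2) by simp
  show "piecewise_projective (representative A)" by (rule r(2))
qed

lemma representative_class:
  assumes "A \<in> carrier PC_Proj" "A = pc_eq `` {f}" "f \<in> pc_maps"
  shows "\<forall>\<^sub>\<infinity>x. f x = representative A x"
proof -
  have "representative A \<in> pc_eq `` {representative A}" using representative(1)[OF assms(1)] by (auto simp: pc_eq_def)
  then have "representative A \<in> pc_eq `` {f}" using representative(2)[OF assms(1)] assms(2) by metis
  then show ?thesis by (simp add: pc_eq_def)
qed

lemma germ_cocycle:
  assumes "A \<in> carrier PC_Proj" shows "tip_germ (representative A) p (germ_cocycle A p)"
  unfolding germ_cocycle_def
  by (rule theI'[OF ex_ex1I[OF tip_germ_exists[OF representative(3)[OF assms]] tip_germ_unique]])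

lemma germ_cocycle_eqI: "A \<in> carrier PC_Proj \<Longrightarrow> tip_germ (representative A) p g \<Longrightarrow> germ_cocycle A p = g"
  by (rule tip_germ_unique[OF germ_cocycle])

lemma germ_cocycle_lifts: "A \<in> carrier PC_Proj \<Longrightarrow> germ_cocycle A p \<in> lifts"
  using germ_cocycle[of A p] by (simp add: tip_germ_def germ_def)

lemma germ_cocycle_tips: "A \<in> carrier PC_Proj \<Longrightarrow> tapp (germ_cocycle A p) p \<in> tips"
  using germ_cocycle[of A p] by (simp add: tip_germ_def)

lemma germ_cocycle_one:
  assumes "p \<in> tips" shows "germ_cocycle \<one>\<^bsub>PC_Proj\<^esub> p = id"
proof (rule germ_cocycle_eqI)
  show c: "\<one>\<^bsub>PC_Proj\<^esub> \<in> carrier PC_Proj" by (rule monoid.one_closed[OF group.is_monoid[OF group_PC_Proj]])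
  have "\<one>\<^bsub>PC_Proj\<^esub> = pc_eq `` {id}" by (simp add: PC_Proj_def PC_one)
  from representative_class[OF c this pc_maps_id] have e: "\<forall>\<^sub>\<infinity>x. id x = representative \<one>\<^bsub>PC_Proj\<^esub> x" .
  have "germ id p id" unfolding germ_def using lifts_id near_side_avoid_finite[of "{}" p] by simp
  from germ_cong[OF this e] show "tip_germ (representative \<one>\<^bsub>PC_Proj\<^esub>) p id"
    using assms by (simp add: tip_germ_def)
qed

lemma germ_cocycle_mult:
  assumes A: "A \<in> carrier PC_Proj" and B: "B \<in> carrier PC_Proj"
  shows "germ_cocycle (A \<otimes>\<^bsub>PC_Proj\<^esub> B) p = germ_cocycle A (tapp (germ_cocycle B p) p) \<circ> germ_cocycle B p"
proof (rule germ_cocycle_eqI)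
  show c: "A \<otimes>\<^bsub>PC_Proj\<^esub> B \<in> carrier PC_Proj"
    by (rule monoid.m_closed[OF group.is_monoid[OF group_PC_Proj] A B])
  have "A \<otimes>\<^bsub>PC_Proj\<^esub> B = pc_eq `` {representative A} \<otimes>\<^bsub>PC\<^esub> pc_eq `` {representative B}"
    using representative(2)[OF A] representative(2)[OF B] by (simp add: PC_Proj_def)
  also have "\<dots> = pc_eq `` {representative A \<circ> representative B}" by (rule PC_mult_class[OF representative(1)[OF A] representative(1)[OF B]])
  finally have e: "\<forall>\<^sub>\<infinity>x. (representative A \<circ> representative B) x = representative (A \<otimes>\<^bsub>PC_Proj\<^esub> B) x"
    by (rule representative_class[OF c _ pc_maps_comp[OF representative(1)[OF A] representative(1)[OF B]]])
  let ?q = "tapp (germ_cocycle B p) p"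
  have "germ (representative A \<circ> representative B) p (germ_cocycle A ?q \<circ> germ_cocycle B p)"
    using germ_cocycle[OF A, of ?q] germ_cocycle[OF B, of p] by (intro germ_comp) (auto simp: tip_germ_def)
  from germ_cong[OF this e] show "tip_germ (representative (A \<otimes>\<^bsub>PC_Proj\<^esub> B)) p (germ_cocycle A ?q \<circ> germ_cocycle B p)"
    using germ_cocycle_tips[OF A, of ?q] tapp_comp[OF germ_cocycle_lifts[OF A] germ_cocycle_lifts[OF B]] by (simp add: tip_germ_def)
qed

lemma germ_of_neighbourhood:
  assumes "g \<in> lifts" "\<delta> > 0" "\<And>\<phi>. \<bar>\<phi> - x\<bar> < \<delta> \<Longrightarrow> f (proj \<phi>) = proj (g \<phi>)"
  shows "germ f (x, s) g"
proof (cases s)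
  case True
  then show ?thesis unfolding germ_def near_side_def using assms by (auto intro!: exI[of _ "x + \<delta>"])
next
  case False
  then show ?thesis unfolding germ_def near_side_def using assms by (auto intro!: exI[of _ "x - \<delta>"])
qed

text \<open>Outside the points at which \<open>f\<close> is not projective, the two germs can
  differ only at a point that \<open>f\<close> maps to the cut \<open>proj 0\<close>.\<close>

lemma germ_cocycle_breaks:
  assumes A: "A \<in> carrier PC_Proj"
  shows "finite {x. 0 < x \<and> x < pi \<and> germ_cocycle A (x, False) \<noteq> germ_cocycle A (x, True)}"
proof -
  let ?f = "representative A"
  \<comment> \<open>The second set consists of the points mapped to the cut.\<close>
  define N where "N = {x. \<not> projective_at ?f x} \<union> {x. ?f x = proj 0}"
  have "finite {x. \<not> projective_at ?f x}"
    using representative(3)[OF A] unfolding piecewise_projective_def projective_at_def eventually_cofinite .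
  moreover have "\<forall>\<^sub>\<infinity>x. ?f x \<noteq> proj 0"
    by (rule pc_maps_MOST[OF representative(1)[OF A]]) (simp add: eventually_cofinite)
  ultimately have N: "finite N" by (simp add: N_def eventually_cofinite)
  have eq: "germ_cocycle A (x, False) = germ_cocycle A (x, True)" if x: "0 < x" "x < pi" "proj x \<notin> N" for x
  proof -
    obtain m \<delta> where m: "mdet m \<noteq> 0" "\<delta> > 0" "\<And>\<phi>. \<bar>\<phi> - x\<bar> < \<delta> \<Longrightarrow> ?f (proj \<phi>) = mhom m (proj \<phi>)"
    proof (rule projective_atE)
      show "projective_at ?f (proj x)" using x(3) by (simp add: N_def)
    qed blast
    obtain \<phi> where \<phi>: "?f (proj x) = proj \<phi>" "0 \<le> \<phi>" "\<phi> < 0 + pi" using proj_representative by blast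
    have "\<phi> \<noteq> 0" using x(3) \<phi>(1) by (auto simp: N_def)
    obtain g where g: "g \<in> lifts" "rep g m" "g x = \<phi>"
      using lift_through[OF m(1), of x \<phi>] m(2) m(3)[of x] \<phi>(1) by auto
    have "tip_germ ?f (x, s) g" for s
      unfolding tip_germ_def
    proof
      show "germ ?f (x, s) g" by (rule germ_of_neighbourhood[OF g(1) m(2)]) (use m(3) g(2) in \<open>simp add: rep_def\<close>)
      show "tapp g (x, s) \<in> tips" using g(3) \<phi> \<open>\<phi> \<noteq> 0\<close> by (simp add: tapp_def tips_def)
    qed
    from germ_cocycle_eqI[OF A this] show ?thesis by simp
  qed
  define S where "S = {x. 0 < x \<and> x < pi \<and> proj x \<in> N}"
  have "inj_on proj S" by (rule inj_onI, rule proj_inj_on[of 0]) (auto simp: S_def)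
  moreover have "finite (proj ` S)" by (rule finite_subset[OF _ N]) (auto simp: S_def)
  ultimately have "finite S" by (simp add: finite_image_iff)
  then show ?thesis by (rule finite_subset[rotated]) (use eq in \<open>auto simp: S_def\<close>)
qed

text \<open>Near a tip the same lift represents the germs on both sides, and it maps into the
  interior of the fundamental domain.\<close>

lemma germ_cocycle_local:
  assumes A: "A \<in> carrier PC_Proj" and p: "p \<in> tips"
  shows "near_side p (\<lambda>z. \<forall>s. germ_cocycle A (z, s) = germ_cocycle A p)"
proof -
  let ?f = "representative A" and ?g = "germ_cocycle A p"
  have g: "?g \<in> lifts" "near_side p (\<lambda>\<theta>. ?f (proj \<theta>) = proj (?g \<theta>))" "tapp ?g p \<in> tips"
    using germ_cocycle[OF A, of p] by (auto simp: tip_germ_def germ_def)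
  have "near_side p (\<lambda>z. 0 < ?g z \<and> ?g z < pi)"
    by (rule near_side_tapp[OF g(1) near_side_interior[OF g(3)]])
  from near_side_conj[OF g(2) this]
  have c: "near_side p (\<lambda>z. ?f (proj z) = proj (?g z) \<and> 0 < ?g z \<and> ?g z < pi)" (is "near_side p ?P") .
  have "\<forall>s. germ_cocycle A (z, s) = ?g" if ab: "a < z" "z < b" "\<And>w. a < w \<Longrightarrow> w < b \<Longrightarrow> ?P w" for a b z
  proof
    fix s
    have "germ ?f (z, s) ?g"
      by (rule germ_of_neighbourhood[OF g(1), of "min (z - a) (b - z)"]) (use ab in \<open>auto simp: abs_less_iff\<close>)
    moreover have "tapp ?g (z, s) \<in> tips" using ab(3)[OF ab(1,2)] by (simp add: tapp_def tips_def)
    ultimately show "germ_cocycle A (z, s) = ?g" using germ_cocycle_eqI[OF A] by (simp add: tip_germ_def)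
  qed
  note L = this
  show ?thesis
  proof (cases "snd p")
    case True
    then obtain b where b: "b > fst p" "\<And>z. fst p < z \<Longrightarrow> z < b \<Longrightarrow> ?P z" using c by (auto simp: near_side_def)
    show ?thesis using True b(1) L[of "fst p" _ b, OF _ _ b(2)] by (auto simp: near_side_def)
  next
    case False
    then obtain b where b: "b < fst p" "\<And>z. b < z \<Longrightarrow> z < fst p \<Longrightarrow> ?P z" using c by (auto simp: near_side_def)
    show ?thesis using False b(1) L[of b _ "fst p", OF _ _ b(2)] by (auto simp: near_side_def)
  qed
qed

lemma germ_cocycle_constant:
  assumes A: "A \<in> carrier PC_Proj" and xy: "0 \<le> x" "x < y" "y \<le> pi"
    and nb: "\<And>z. x < z \<Longrightarrow> z < y \<Longrightarrow> germ_cocycle A (z, False) = germ_cocycle A (z, True)"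
  shows "germ_cocycle A (y, False) = germ_cocycle A (x, True)" "\<And>z s. x < z \<Longrightarrow> z < y \<Longrightarrow> germ_cocycle A (z, s) = germ_cocycle A (x, True)"
proof -
  have const: "germ_cocycle A (u, True) = germ_cocycle A (v, True)" if "u \<in> {x<..<y}" "v \<in> {x<..<y}" for u v
  proof (rule connected_local_const[of "{x<..<y}"])
    show "\<forall>u\<in>{x<..<y}. \<forall>\<^sub>F v in at u within {x<..<y}. germ_cocycle A (u, True) = germ_cocycle A (v, True)"
    proof
      fix u assume u: "u \<in> {x<..<y}"
      have t: "(u, s) \<in> tips" for s using u xy by (auto intro: tips_interior)
      obtain b where b: "u < b" "\<And>z. u < z \<Longrightarrow> z < b \<Longrightarrow> germ_cocycle A (z, True) = germ_cocycle A (u, True)"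
        using germ_cocycle_local[OF A t[of True]] by (auto simp: near_side_def)
      obtain a where a: "a < u" "\<And>z. a < z \<Longrightarrow> z < u \<Longrightarrow> germ_cocycle A (z, True) = germ_cocycle A (u, False)"
        using germ_cocycle_local[OF A t[of False]] by (auto simp: near_side_def)
      have ev: "germ_cocycle A (u, True) = germ_cocycle A (v, True)" if v: "a < v" "v < b" for v
      proof (cases u v rule: linorder_cases)
        case less
        show ?thesis using b(2)[OF less v(2)] by simp
      next
        case greater
        have "germ_cocycle A (u, False) = germ_cocycle A (u, True)" using nb u by simp
        then show ?thesis using a(2)[OF v(1) greater] by simp
      qed simp
      then show "\<forall>\<^sub>F v in at u within {x<..<y}. germ_cocycle A (u, True) = germ_cocycle A (v, True)"
        unfolding eventually_at
      proof (intro exI[of _ "min (u - a) (b - u)"] conjI ballI impI)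
        show "0 < min (u - a) (b - u)" using a(1) b(1) by simp
        fix v assume "v \<noteq> u \<and> dist v u < min (u - a) (b - u)"
        then have "a < v" "v < b" unfolding dist_real_def by linarith+
        then show "germ_cocycle A (u, True) = germ_cocycle A (v, True)" by (rule ev)
      qed
    qed
  qed (use that in auto)
  have tx: "(x, True) \<in> tips" "(y, False) \<in> tips" using xy by (auto simp: tips_def)
  obtain b where b: "x < b" "\<And>z. x < z \<Longrightarrow> z < b \<Longrightarrow> germ_cocycle A (z, True) = germ_cocycle A (x, True)"
    using germ_cocycle_local[OF A tx(1)] by (auto simp: near_side_def)
  obtain a where a: "a < y" "\<And>z. a < z \<Longrightarrow> z < y \<Longrightarrow> germ_cocycle A (z, True) = germ_cocycle A (y, False)"
    using germ_cocycle_local[OF A tx(2)] by (auto simp: near_side_def)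
  obtain u where u: "x < u" "u < min b y" using dense[of x "min b y"] b(1) xy by auto
  obtain v where v: "max a x < v" "v < y" using dense[of "max a x" y] a(1) xy by auto
  have cu: "germ_cocycle A (z, True) = germ_cocycle A (x, True)" if "x < z" "z < y" for z
    using const[of z u] b(2)[of u] u that by auto
  show "germ_cocycle A (y, False) = germ_cocycle A (x, True)" using cu[of v] a(2)[of v] v by auto
  show "germ_cocycle A (z, s) = germ_cocycle A (x, True)" if "x < z" "z < y" for z s
    using cu[OF that] nb[OF that] by (cases s) auto
qed

lemma germ_cocycle_faithful:
  assumes A: "A \<in> carrier PC_Proj" and id: "\<And>p. p \<in> tips \<Longrightarrow> germ_cocycle A p = id"
  shows "A = \<one>\<^bsub>PC_Proj\<^esub>"
proof -
  let ?f = "representative A"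
  have "?f x = x" if x: "projective_at ?f x" for x
  proof -
    obtain \<theta> where \<theta>: "x = proj \<theta>" "0 \<le> \<theta>" "\<theta> < 0 + pi" using proj_representative by blast
    obtain m \<delta> where m: "mdet m \<noteq> 0" "\<delta> > 0" "\<And>\<phi>. \<bar>\<phi> - \<theta>\<bar> < \<delta> \<Longrightarrow> ?f (proj \<phi>) = mhom m (proj \<phi>)"
      by (rule projective_atE[OF x[unfolded \<theta>(1)]]) blast
    have t: "(\<theta>, True) \<in> tips" using \<theta> by (simp add: tips_def)
    have "near_side (\<theta>, True) (\<lambda>z. ?f (proj z) = proj z)"
      using germ_cocycle[OF A, of "(\<theta>, True)"] id[OF t] by (simp add: tip_germ_def germ_def)
    then obtain b where b: "\<theta> < b" "\<And>z. \<theta> < z \<Longrightarrow> z < b \<Longrightarrow> ?f (proj z) = proj z" by (auto simp: near_side_def)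
    have one: "mdet (mscal 1) \<noteq> 0" by (simp add: mscal_def)
    have "mhom m = mhom (mscal 1)"
    proof (rule mhom_agree_interval[OF m(1) one, of \<theta> "min b (\<theta> + \<delta>)"])
      fix z assume "\<theta> < z" "z < min b (\<theta> + \<delta>)"
      then show "mhom m (proj z) = mhom (mscal 1) (proj z)"
        using b(2)[of z] m(3)[of z] by (simp add: mhom_scal)
    qed (use b(1) m(2) in simp)
    then show ?thesis using m(2) m(3)[of \<theta>] \<theta>(1) by (simp add: mhom_scal)
  qed
  then have "{x. ?f x \<noteq> x} \<subseteq> {x. \<not> projective_at ?f x}" by auto
  moreover have "finite {x. \<not> projective_at ?f x}"
    using representative(3)[OF A] unfolding piecewise_projective_def projective_at_def eventually_cofinite .
  ultimately have "\<forall>\<^sub>\<infinity>x. ?f x = id x" unfolding eventually_cofinite id_def by (rule finite_subset)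
  then have "(?f, id) \<in> pc_eq" using representative(1)[OF A] pc_maps_id by (simp add: pc_eq_def)
  then have "pc_eq `` {?f} = pc_eq `` {id}" by (rule pc_class_eqI)
  with representative(2)[OF A] have "A = pc_eq `` {id}" by (rule trans)
  moreover have "\<one>\<^bsub>PC_Proj\<^esub> = pc_eq `` {id}" by (simp add: PC_Proj_def PC_one)
  ultimately show ?thesis by (simp only:)
qed

section \<open>Regluing\<close>

text \<open>The properties of the germ cocycle \<open>c\<close> that the argument uses, for an
  abstract group \<open>G\<close>.\<close>

locale piecewise_group = group G for G :: "('a, 'b) monoid_scheme" (structure) +
  fixes c :: "'a \<Rightarrow> tip \<Rightarrow> real \<Rightarrow> real"
  assumes c_lifts: "f \<in> carrier G \<Longrightarrow> p \<in> tips \<Longrightarrow> c f p \<in> lifts"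
    and c_tips: "f \<in> carrier G \<Longrightarrow> p \<in> tips \<Longrightarrow> tapp (c f p) p \<in> tips"
    and c_one: "p \<in> tips \<Longrightarrow> c \<one> p = id"
    and c_mult: "f \<in> carrier G \<Longrightarrow> g \<in> carrier G \<Longrightarrow> p \<in> tips \<Longrightarrow>
      c (f \<otimes> g) p = c f (tapp (c g p) p) \<circ> c g p"
    and c_breaks: "f \<in> carrier G \<Longrightarrow> finite {x. 0 < x \<and> x < pi \<and> c f (x, False) \<noteq> c f (x, True)}"
    and c_constant: "f \<in> carrier G \<Longrightarrow> 0 \<le> x \<Longrightarrow> x < y \<Longrightarrow> y \<le> pi \<Longrightarrow>
      (\<And>z. x < z \<Longrightarrow> z < y \<Longrightarrow> c f (z, False) = c f (z, True)) \<Longrightarrow>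
      c f (y, False) = c f (x, True) \<and> (\<forall>z s. x < z \<and> z < y \<longrightarrow> c f (z, s) = c f (x, True))"
    and faithful: "f \<in> carrier G \<Longrightarrow> (\<And>p. p \<in> tips \<Longrightarrow> c f p = id) \<Longrightarrow> f = \<one>"
begin

definition mv :: "'a \<Rightarrow> tip \<Rightarrow> tip" where "mv f p = tapp (c f p) p"

lemma mv_tips: "f \<in> carrier G \<Longrightarrow> p \<in> tips \<Longrightarrow> mv f p \<in> tips"
  by (simp add: mv_def c_tips)

lemma mv_one: "p \<in> tips \<Longrightarrow> mv \<one> p = p"
  by (simp add: mv_def c_one)

lemma mv_mult: "f \<in> carrier G \<Longrightarrow> g \<in> carrier G \<Longrightarrow> p \<in> tips \<Longrightarrow> mv (f \<otimes> g) p = mv f (mv g p)"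
  by (simp add: mv_def c_mult tapp_comp c_lifts c_tips)

lemma c_mult': "f \<in> carrier G \<Longrightarrow> g \<in> carrier G \<Longrightarrow> p \<in> tips \<Longrightarrow> c (f \<otimes> g) p = c f (mv g p) \<circ> c g p"
  by (simp add: mv_def c_mult)

lemma mv_inv: "f \<in> carrier G \<Longrightarrow> p \<in> tips \<Longrightarrow> mv (inv f) (mv f p) = p"
  "f \<in> carrier G \<Longrightarrow> p \<in> tips \<Longrightarrow> mv f (mv (inv f) p) = p"
  using mv_mult[of "inv f" f p] mv_mult[of f "inv f" p] mv_one[of p] by simp_all

lemma ginv_o: "g \<in> lifts \<Longrightarrow> h \<in> lifts \<Longrightarrow> ginv (g \<circ> h) = ginv h \<circ> ginv g"
proof
  fix x assume g: "g \<in> lifts" "h \<in> lifts"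
  have "(g \<circ> h) ((ginv h \<circ> ginv g) x) = x" using g by (simp add: lifts_inverse)
  then show "ginv (g \<circ> h) x = (ginv h \<circ> ginv g) x"
    using lifts_inverse(1)[OF lifts_comp[OF g], of "(ginv h \<circ> ginv g) x"] by simp
qed

lemma ginv_ginv: "g \<in> lifts \<Longrightarrow> ginv (ginv g) = g"
  using inv_inv_eq[OF lifts_bij] .

text \<open>The triple \<open>(p, q, k)\<close> means that the curve continues beyond the tip
  \<open>p\<close> at the tip \<open>q\<close>. In the coordinate \<open>k\<close> at
  \<open>p\<close>, the two tips are the opposite sides of one point, so that the coordinate
  extends projectively.\<close>

definition gluings :: "(tip \<times> tip \<times> (real \<Rightarrow> real)) set" where
  "gluings = {(p, q, k). p \<in> tips \<and> q \<in> tips \<and> k \<in> lifts \<and> tapp k p = opp q}"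

definition gluing_act :: "'a \<Rightarrow> tip \<times> tip \<times> (real \<Rightarrow> real) \<Rightarrow> tip \<times> tip \<times> (real \<Rightarrow> real)" where
  "gluing_act f = (\<lambda>(p, q, k). (mv f p, mv f q, c f q \<circ> k \<circ> ginv (c f p)))"

lemma gluing_act_closed:
  assumes f: "f \<in> carrier G" and e: "e \<in> gluings" shows "gluing_act f e \<in> gluings"
proof -
  obtain p q k where pqk: "e = (p, q, k)" by (cases e)
  have h: "p \<in> tips" "q \<in> tips" "k \<in> lifts" "tapp k p = opp q" using e by (auto simp: gluings_def pqk)
  have l: "c f p \<in> lifts" "c f q \<in> lifts" using c_lifts f h by auto
  have "tapp (c f q \<circ> k \<circ> ginv (c f p)) (mv f p) = tapp (c f q) (tapp k (tapp (ginv (c f p)) (mv f p)))"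
    using l h by (simp add: tapp_comp lifts_comp lifts_ginv)
  also have "\<dots> = opp (mv f q)" using l h by (simp add: mv_def tapp_inverse tapp_opp)
  finally show ?thesis
    using mv_tips[OF f] h l by (simp add: gluings_def gluing_act_def pqk lifts_comp lifts_ginv)
qed

lemma gluing_act_one: "e \<in> gluings \<Longrightarrow> gluing_act \<one> e = e"
proof -
  have "ginv id = (id :: real \<Rightarrow> real)" using ginv_comp(2)[OF lifts_id] by simp
  then show "e \<in> gluings \<Longrightarrow> gluing_act \<one> e = e" by (cases e) (auto simp: gluings_def gluing_act_def mv_one c_one)
qed

lemma gluing_act_mult:
  assumes "f \<in> carrier G" "g \<in> carrier G" "e \<in> gluings"
  shows "gluing_act (f \<otimes> g) e = gluing_act f (gluing_act g e)"
proof -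
  obtain p q k where pqk: "e = (p, q, k)" by (cases e)
  have h: "p \<in> tips" "q \<in> tips" using assms(3) by (auto simp: gluings_def pqk)
  have "ginv (c f (mv g p) \<circ> c g p) = ginv (c g p) \<circ> ginv (c f (mv g p))"
    using ginv_o assms h c_lifts mv_tips by simp
  then show ?thesis using h assms by (simp add: gluing_act_def pqk mv_mult c_mult' comp_assoc)
qed

definition trivial_gluings :: "(tip \<times> tip \<times> (real \<Rightarrow> real)) set" where
  "trivial_gluings = {((x, s), (x, \<not> s), id) | x s. 0 < x \<and> x < pi}"

lemma ginv_id: "ginv id = (id :: real \<Rightarrow> real)"
  using ginv_comp(2)[OF lifts_id] by simp

lemma trivial_gluings_subset: "trivial_gluings \<subseteq> gluings"
proof
  fix e assume "e \<in> trivial_gluings"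
  then obtain x s where "e = ((x, s), (x, \<not> s), id)" "0 < x" "x < pi" by (auto simp: trivial_gluings_def)
  then show "e \<in> gluings" using tips_interior[of x] by (simp add: gluings_def lifts_id opp_def)
qed

text \<open>Where \<open>c f\<close> does not jump, \<open>f\<close> maps the identity gluing of
  the two sides of a point to the identity gluing of the two sides of its image.\<close>

lemma trivial_gluings_commensurated:
  assumes f: "f \<in> carrier G" shows "finite (gluing_act f ` trivial_gluings - trivial_gluings)"
proof -
  let ?B = "{x. 0 < x \<and> x < pi \<and> c f (x, False) \<noteq> c f (x, True)}"
  have "gluing_act f ` trivial_gluings - trivial_gluings \<subseteq> (\<lambda>(x, s). gluing_act f ((x, s), (x, \<not> s), id)) ` (?B \<times> UNIV)"
  proof
    fix e assume e: "e \<in> gluing_act f ` trivial_gluings - trivial_gluings"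
    then obtain x s where x: "e = gluing_act f ((x, s), (x, \<not> s), id)" "0 < x" "x < pi" by (auto simp: trivial_gluings_def)
    have "x \<in> ?B"
    proof (rule ccontr)
      assume "x \<notin> ?B"
      then have eq: "c f (x, t) = c f (x, s)" for t using x by (cases t; cases s) auto
      let ?g = "c f (x, s)"
      have t: "(x, t) \<in> tips" for t using tips_interior x by simp
      have g: "?g \<in> lifts" by (rule c_lifts[OF f t])
      have mv: "mv f (x, t) = tapp ?g (x, t)" for t by (simp add: mv_def eq[of t])
      have "tapp ?g (x, True) \<in> tips" "tapp ?g (x, False) \<in> tips" using mv_tips[OF f t[of True]] mv_tips[OF f t[of False]] by (simp_all only: mv)
      then have "0 < ?g x \<and> ?g x < pi" by (cases "strict_mono ?g") (auto simp: tapp_def tips_def)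
      moreover have "e = (tapp ?g (x, s), opp (tapp ?g (x, s)), id)"
      proof -
        have "e = (mv f (x, s), mv f (x, \<not> s), c f (x, \<not> s) \<circ> id \<circ> ginv ?g)"
          by (simp add: x(1) gluing_act_def)
        moreover have "c f (x, \<not> s) \<circ> id \<circ> ginv ?g = id"
          unfolding eq[of "\<not> s"] by (simp add: ginv_comp(2)[OF g])
        moreover have "mv f (x, \<not> s) = opp (tapp ?g (x, s))"
          unfolding mv by (auto simp: tapp_def opp_def)
        ultimately show ?thesis by (simp add: mv[of s])
      qed
      ultimately have "e \<in> trivial_gluings" by (auto simp: trivial_gluings_def tapp_def opp_def)
      then show False using e by simp
    qed
    then show "e \<in> (\<lambda>(x, s). gluing_act f ((x, s), (x, \<not> s), id)) ` (?B \<times> UNIV)"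
      using x(1) by (intro image_eqI[of _ _ "(x, s)"]) auto
  qed
  then show ?thesis by (rule finite_subset) (use c_breaks[OF f] in simp)
qed

end

text \<open>A partial gluing of the tips, symmetric and invariant under the group, which agrees
  with the original circle except at finitely many points.\<close>

locale reglued_group = piecewise_group +
  fixes glue :: "tip \<Rightarrow> tip \<Rightarrow> (real \<Rightarrow> real) \<Rightarrow> bool"
  assumes glue_gluings: "glue p q k \<Longrightarrow> (p, q, k) \<in> gluings"
    and glue_sym: "glue p q k \<Longrightarrow> glue q p (ginv k)"
    and glue_fun: "glue p q k \<Longrightarrow> glue p q' k' \<Longrightarrow> q' = q \<and> k' = k"
    and glue_inv: "f \<in> carrier G \<Longrightarrow> glue p q k \<Longrightarrow> glue (mv f p) (mv f q) (c f q \<circ> k \<circ> ginv (c f p))"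
    and glue_regular: "finite {x. 0 < x \<and> x < pi \<and> \<not> glue (x, False) (x, True) id}"

text \<open>An invariant set \<open>Y\<close> from Property FW need not be a partial symmetric
  function. Keeping only the gluings that are the unique ones at both of their ends, in both
  directions, is an invariant condition and discards gluings at finitely many points only.\<close>

lemma (in piecewise_group) FW_reglue:
  assumes FW: "property_FW G"
  shows "\<exists>glue. reglued_group G c glue"
proof -
  obtain Y where Y: "Y \<subseteq> gluings" "\<And>f e. f \<in> carrier G \<Longrightarrow> e \<in> Y \<Longrightarrow> gluing_act f e \<in> Y" "finite (sym_diff trivial_gluings Y)"
    by (rule FW_commensurated[OF FW group_axioms gluing_act_closed gluing_act_one gluing_act_mult trivial_gluings_subset trivial_gluings_commensurated]) blast+
  \<comment> \<open>The last two clauses say that the gluing is unique at \<open>p\<close> and at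
    \<open>q\<close>.\<close>
  define glue where "glue p q k \<longleftrightarrow> (p, q, k) \<in> Y \<and> (q, p, ginv k) \<in> Y \<and>
    (\<forall>q' k'. (p, q', k') \<in> Y \<longrightarrow> q' = q \<and> k' = k) \<and>
    (\<forall>p' k'. (q, p', k') \<in> Y \<longrightarrow> p' = p \<and> k' = ginv k)" for p q k
  \<comment> \<open>Uniqueness at \<open>p\<close> carries over to uniqueness at its image under
    \<open>f\<close>.\<close>
  have pull: "q' = mv f q \<and> k' = c f q \<circ> k \<circ> ginv (c f p)"
    if f: "f \<in> carrier G" and p: "(p, q, k) \<in> Y" and u: "\<And>q' k'. (p, q', k') \<in> Y \<Longrightarrow> q' = q \<and> k' = k"
      and e: "(mv f p, q', k') \<in> Y" for f p q k q' k'
  proof -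
    have gluings: "(mv f p, q', k') \<in> gluings" "p \<in> tips" using e p Y(1) by (auto simp: gluings_def)
    have "gluing_act (inv f) (mv f p, q', k') \<in> Y" using Y(2)[of "inv f"] f e by simp
    moreover obtain q'' k'' where e2: "gluing_act (inv f) (mv f p, q', k') = (p, q'', k'')"
      using mv_inv(1)[OF f gluings(2)] by (simp add: gluing_act_def)
    ultimately have "q'' = q \<and> k'' = k" using u by simp
    then have "gluing_act f (p, q, k) = gluing_act f (gluing_act (inv f) (mv f p, q', k'))" using e2 by simp
    also have "\<dots> = (mv f p, q', k')" using gluing_act_mult[of f "inv f"] f gluings(1) gluing_act_one by simp
    finally show ?thesis by (simp add: gluing_act_def)
  qed
  have "reglued_group G c glue"
  proof (intro reglued_group.intro reglued_group_axioms.intro piecewise_group_axioms)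
    fix p q k assume g: "glue p q k"
    show e: "(p, q, k) \<in> gluings" using g Y(1) by (auto simp: glue_def)
    have k: "k \<in> lifts" using e by (simp add: gluings_def)
    show "glue q p (ginv k)" using g unfolding glue_def ginv_ginv[OF k] by simp
    show "q' = q \<and> k' = k" if "glue p q' k'" for q' k' using g that unfolding glue_def by blast
    fix f assume f: "f \<in> carrier G"
    let ?k = "c f q \<circ> k \<circ> ginv (c f p)"
    have l: "c f p \<in> lifts" "c f q \<in> lifts" using c_lifts f e by (auto simp: gluings_def)
    have ik: "ginv ?k = c f p \<circ> ginv k \<circ> ginv (c f q)"
      using l k by (simp add: ginv_o lifts_comp lifts_ginv ginv_ginv comp_assoc)
    have 1: "(p, q, k) \<in> Y" "(q, p, ginv k) \<in> Y" "\<And>q' k'. (p, q', k') \<in> Y \<Longrightarrow> q' = q \<and> k' = k"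
      "\<And>p' k'. (q, p', k') \<in> Y \<Longrightarrow> p' = p \<and> k' = ginv k" using g unfolding glue_def by blast+
    have "(mv f p, mv f q, ?k) \<in> Y" using Y(2)[OF f 1(1)] by (simp add: gluing_act_def)
    moreover have "(mv f q, mv f p, ginv ?k) \<in> Y" using Y(2)[OF f 1(2)] by (simp add: gluing_act_def ik)
    moreover have "\<forall>q' k'. (mv f p, q', k') \<in> Y \<longrightarrow> q' = mv f q \<and> k' = ?k"
      using pull[OF f 1(1) 1(3)] by blast
    moreover have "\<forall>p' k'. (mv f q, p', k') \<in> Y \<longrightarrow> p' = mv f p \<and> k' = ginv ?k"
      using pull[OF f 1(2) 1(4)] unfolding ik by blast
    ultimately show "glue (mv f p) (mv f q) ?k" unfolding glue_def by blast
  next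
    let ?D = "sym_diff trivial_gluings Y"
    have "x \<in> (\<lambda>e. fst (fst e)) ` ?D" if x: "0 < x" "x < pi" "\<not> glue (x, False) (x, True) id" for x
    proof (rule ccontr)
      assume n: "x \<notin> (\<lambda>e. fst (fst e)) ` ?D"
      have iff: "((x, s), r) \<in> Y \<longleftrightarrow> ((x, s), r) \<in> trivial_gluings" for s r
      proof (rule ccontr)
        assume "\<not> ?thesis"
        then have "((x, s), r) \<in> ?D" by blast
        then have "fst (fst ((x, s), r)) \<in> (\<lambda>e. fst (fst e)) ` ?D" by (rule imageI)
        then show False using n by simp
      qed
      have "glue (x, False) (x, True) id"
        unfolding glue_def iff ginv_id using x(1,2) by (auto simp: trivial_gluings_def)
      then show False using x(3) by simp
    qed
    then have "{x. 0 < x \<and> x < pi \<and> \<not> glue (x, False) (x, True) id} \<subseteq> (\<lambda>e. fst (fst e)) ` ?D" by blast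
    then show "finite {x. 0 < x \<and> x < pi \<and> \<not> glue (x, False) (x, True) id}"
      by (rule finite_subset) (use Y(3) in simp)
  qed
  then show ?thesis by blast
qed

section \<open>Developing the reglued curve\<close>

text \<open>A chart \<open>(p, h)\<close> is the germ of the curve at the tip \<open>p\<close>
  together with a lift \<open>h\<close> as a coordinate; its position on the real line is
  \<open>dev\<close>. Lifts act by change of coordinates (\<open>gact\<close>), the group by
  transport along the curve (\<open>push\<close>).\<close>

type_synonym chart = "tip \<times> (real \<Rightarrow> real)"

definition charts :: "chart set" where "charts = tips \<times> lifts"
definition dev :: "chart \<Rightarrow> tip" where "dev y = tapp (snd y) (fst y)"
definition gact :: "(real \<Rightarrow> real) \<Rightarrow> chart \<Rightarrow> chart" where "gact g y = (fst y, g \<circ> snd y)"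

text \<open>The two sides of a point \<open>x\<close> are ordered with the left side first.\<close>

definition tless :: "tip \<Rightarrow> tip \<Rightarrow> bool" where
  "tless p q \<longleftrightarrow> fst p < fst q \<or> fst p = fst q \<and> \<not> snd p \<and> snd q"

lemma tless_trans: "tless p q \<Longrightarrow> tless q r \<Longrightarrow> tless p r"
  by (auto simp: tless_def)

lemma tless_irrefl: "\<not> tless p p"
  by (simp add: tless_def)

lemma gact_charts: "g \<in> lifts \<Longrightarrow> y \<in> charts \<Longrightarrow> gact g y \<in> charts"
  by (auto simp: gact_def charts_def lifts_comp)

lemma dev_gact: "g \<in> lifts \<Longrightarrow> y \<in> charts \<Longrightarrow> dev (gact g y) = tapp g (dev y)"
  by (auto simp: gact_def charts_def dev_def tapp_comp)

lemma gact_gact: "gact g (gact h y) = gact (g \<circ> h) y"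
  by (simp add: gact_def comp_assoc)

lemma gact_id: "gact id y = y"
  by (simp add: gact_def)

lemma gact_cancel: "y \<in> charts \<Longrightarrow> gact g y = gact h y \<Longrightarrow> g = h"
proof
  fix x assume y: "y \<in> charts" and e: "gact g y = gact h y"
  have "g \<circ> snd y = h \<circ> snd y" using e by (simp add: gact_def)
  then have "g (snd y (ginv (snd y) x)) = h (snd y (ginv (snd y) x))" by (metis comp_apply)
  moreover have "snd y \<in> lifts" using y by (auto simp: charts_def)
  ultimately show "g x = h x" by (simp add: lifts_inverse)
qed

context reglued_group
begin

definition push :: "'a \<Rightarrow> chart \<Rightarrow> chart" where
  "push f y = (mv f (fst y), snd y \<circ> ginv (c f (fst y)))"

lemma push_charts: "f \<in> carrier G \<Longrightarrow> y \<in> charts \<Longrightarrow> push f y \<in> charts"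
  by (auto simp: push_def charts_def mv_tips lifts_comp lifts_ginv c_lifts)

lemma dev_push: "f \<in> carrier G \<Longrightarrow> y \<in> charts \<Longrightarrow> dev (push f y) = dev y"
  by (auto simp: push_def charts_def dev_def tapp_comp lifts_ginv c_lifts mv_def tapp_inverse)

lemma push_gact: "push f (gact g y) = gact g (push f y)"
  by (simp add: push_def gact_def comp_assoc)

lemma push_one: "y \<in> charts \<Longrightarrow> push \<one> y = y"
  by (auto simp: push_def charts_def mv_one c_one ginv_id)

lemma push_mult: "f \<in> carrier G \<Longrightarrow> g \<in> carrier G \<Longrightarrow> y \<in> charts \<Longrightarrow> push (f \<otimes> g) y = push f (push g y)"
  by (auto simp: push_def charts_def mv_mult c_mult' ginv_o c_lifts mv_tips comp_assoc)

definition regular :: "real \<Rightarrow> bool" where "regular x \<longleftrightarrow> glue (x, False) (x, True) id"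

definition seg :: "tip \<Rightarrow> tip \<Rightarrow> bool" where
  "seg p q \<longleftrightarrow> (\<exists>x y. 0 \<le> x \<and> x < y \<and> y \<le> pi \<and> (\<forall>z. x < z \<and> z < y \<longrightarrow> regular z) \<and>
     (p = (x, True) \<and> q = (y, False) \<or> p = (y, False) \<and> q = (x, True)))"

text \<open>A step moves to the right on the real line while the coordinate is continued along the
  curve. From a tip that faces right on the line it crosses an interval without cuts. From a tip
  that faces left it passes through the gluing to the other side of the same point.\<close>

definition step :: "chart \<Rightarrow> chart \<Rightarrow> bool" where
  "step y y' \<longleftrightarrow> y \<in> charts \<and> y' \<in> charts \<and>
     (seg (fst y) (fst y') \<and> snd y' = snd y \<and> snd (dev y) \<or>
      (\<exists>k. glue (fst y) (fst y') k \<and> snd y' = snd y \<circ> ginv k) \<and> \<not> snd (dev y))"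

abbreviation reach :: "chart \<Rightarrow> chart \<Rightarrow> bool" where "reach \<equiv> step\<^sup>*\<^sup>*"

lemma seg_sym: "seg p q \<Longrightarrow> seg q p"
  unfolding seg_def by blast

lemma seg_tips: "seg p q \<Longrightarrow> p \<in> tips \<and> q \<in> tips"
  by (auto simp: seg_def tips_def)

lemma glue_lifts: "glue p q k \<Longrightarrow> k \<in> lifts \<and> p \<in> tips \<and> q \<in> tips \<and> tapp k p = opp q"
  using glue_gluings by (auto simp: gluings_def)

lemma glue_dev:
  assumes "glue p q k" "h \<in> lifts"
  shows "dev (q, h \<circ> ginv k) = opp (dev (p, h))"
proof -
  have k: "k \<in> lifts" "tapp k p = opp q" using glue_lifts[OF assms(1)] by auto
  have "tapp (ginv k) (opp q) = p" using tapp_inverse(1)[OF k(1), of p] k(2) by simp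
  then have "tapp (ginv k) q = opp p" using tapp_opp[of "ginv k" "opp q"] by simp
  then show ?thesis using k assms by (simp add: dev_def tapp_comp lifts_ginv tapp_opp)
qed

lemma step_dev:
  assumes "step y y'" shows "tless (dev y) (dev y')" "snd (dev y') \<longleftrightarrow> \<not> snd (dev y)"
proof -
  have h: "snd y \<in> lifts" using assms by (auto simp: step_def charts_def)
  have "tless (dev y) (dev y') \<and> (snd (dev y') \<longleftrightarrow> \<not> snd (dev y))"
  proof (cases "snd (dev y)")
    case True
    then have s: "seg (fst y) (fst y')" "snd y' = snd y" using assms by (auto simp: step_def)
    then obtain a b where ab: "a < b" "fst y = (a, True) \<and> fst y' = (b, False) \<or> fst y = (b, False) \<and> fst y' = (a, True)"
      by (auto simp: seg_def)
    show ?thesis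
    proof (rule lifts_mono_cases[OF h])
      assume m: "strict_mono (snd y)"
      then show ?thesis using ab True s(2) by (auto simp: dev_def tapp_def tless_def strict_mono_less)
    next
      assume m: "\<not> strict_mono (snd y)" "\<And>u v. u < v \<Longrightarrow> snd y v < snd y u"
      then show ?thesis using ab True s(2) by (auto simp: dev_def tapp_def tless_def)
    qed
  next
    case False
    then obtain k where k: "glue (fst y) (fst y') k" "snd y' = snd y \<circ> ginv k" using assms by (auto simp: step_def)
    have "dev y' = opp (dev y)" using glue_dev[OF k(1) h] k(2) by (metis prod.collapse)
    then show ?thesis using False by (auto simp: tless_def)
  qed
  then show "tless (dev y) (dev y')" "snd (dev y') \<longleftrightarrow> \<not> snd (dev y)" by auto
qed

lemma reach_dev: "reach y y' \<Longrightarrow> y = y' \<or> tless (dev y) (dev y')"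
proof (induction rule: rtranclp_induct)
  case (step u v)
  then show ?case using step_dev(1)[OF step(2)] tless_trans[of "dev y" "dev u" "dev v"] by auto
qed simp

lemma step_glue_unique: "\<not> snd (dev y) \<Longrightarrow> step y u \<Longrightarrow> step y v \<Longrightarrow> u = v"
  unfolding step_def using glue_fun by (metis prod.expand)

lemma step_seg:
  assumes "x < y" "y < z" "0 \<le> x" "z \<le> pi" "\<And>w. x < w \<Longrightarrow> w < z \<Longrightarrow> regular w" "h \<in> lifts"
  shows "strict_mono h \<Longrightarrow> step ((y, False), h) ((y, True), h) \<and> step ((y, True), h) ((z, False), h)"
    "\<not> strict_mono h \<Longrightarrow> step ((y, True), h) ((y, False), h) \<and> step ((y, False), h) ((x, True), h)"
proof -
  have g: "glue (y, False) (y, True) id" using assms(5)[OF assms(1,2)] by (simp add: regular_def)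
  then have g': "glue (y, True) (y, False) id" using glue_sym[OF g] by (simp add: ginv_id)
  have t: "(y, s) \<in> tips" "(z, False) \<in> tips" "(x, True) \<in> tips" for s using assms by (auto simp: tips_def)
  have c: "(p, h) \<in> charts" if "p \<in> tips" for p using that assms(6) by (simp add: charts_def)
  have s1: "seg (y, True) (z, False)"
    unfolding seg_def by (rule exI[of _ y], rule exI[of _ z]) (use assms in auto)
  have s2: "seg (y, False) (x, True)"
    unfolding seg_def by (rule exI[of _ x], rule exI[of _ y]) (use assms in auto)
  show "strict_mono h \<Longrightarrow> step ((y, False), h) ((y, True), h) \<and> step ((y, True), h) ((z, False), h)"
    using g s1 c t unfolding step_def by (auto simp: dev_def tapp_def ginv_id)
  show "\<not> strict_mono h \<Longrightarrow> step ((y, True), h) ((y, False), h) \<and> step ((y, False), h) ((x, True), h)"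
    using g' s2 c t unfolding step_def by (auto simp: dev_def tapp_def ginv_id)
qed

text \<open>Two steps across intervals from one tip may stop at different points; the longer one
  passes through the end of the shorter one.\<close>

definition mid :: "chart \<Rightarrow> chart \<Rightarrow> bool" where
  "mid u v \<longleftrightarrow> \<not> snd (dev u) \<and> regular (fst (fst u)) \<and> fst (fst u) < pi \<and>
     (\<exists>w. step u w \<and> step w v \<and> fst (fst w) = fst (fst u))"

lemma step_diamond:
  assumes "step y u" "step y v"
  shows "u = v \<or> mid u v \<or> mid v u"
proof (cases "snd (dev y)")
  case False
  then show ?thesis using step_glue_unique[OF False assms] by simp
next
  case True
  have nu: "\<not> snd (dev u)" "\<not> snd (dev v)" using step_dev(2) assms True by auto
  obtain p h where y: "y = (p, h)" by (cases y)
  have h: "h \<in> lifts" using assms(1) by (auto simp: step_def charts_def y)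
  have su: "seg p (fst u)" "snd u = h" and sv: "seg p (fst v)" "snd v = h"
    using assms True by (auto simp: step_def y)
  have sm: "strict_mono h \<longleftrightarrow> snd p" using True by (auto simp: y dev_def tapp_def)
  show ?thesis
  proof (cases "snd p")
    case T: True
    then obtain x a where a: "p = (x, True)" "fst u = (a, False)" "0 \<le> x" "x < a" "a \<le> pi" "\<And>z. x < z \<Longrightarrow> z < a \<Longrightarrow> regular z"
      using su(1) by (auto simp: seg_def)
    then obtain b where b: "fst v = (b, False)" "x < b" "b \<le> pi" "\<And>z. x < z \<Longrightarrow> z < b \<Longrightarrow> regular z"
      using sv(1) T by (auto simp: seg_def)
    have u: "u = ((a, False), h)" and v: "v = ((b, False), h)" using a b su(2) sv(2) by (metis prod.collapse)+
    consider "a = b" | "a < b" | "b < a" by linarith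
    then show ?thesis
    proof cases
      case 2
      from step_seg(1)[OF a(4) 2 a(3) b(3) b(4) h] sm T have "mid u v"
        using nu 2 b(3) b(4)[OF a(4) 2] unfolding mid_def u v by (auto intro: exI[of _ "((a, True), h)"])
      then show ?thesis by simp
    next
      case 3
      from step_seg(1)[OF b(2) 3 a(3) a(5) a(6) h] sm T have "mid v u"
        using nu 3 a(5) a(6)[OF b(2) 3] unfolding mid_def u v by (auto intro: exI[of _ "((b, True), h)"])
      then show ?thesis by simp
    qed (simp add: u v)
  next
    case F: False
    then obtain x a where a: "p = (x, False)" "fst u = (a, True)" "0 \<le> a" "a < x" "x \<le> pi" "\<And>z. a < z \<Longrightarrow> z < x \<Longrightarrow> regular z"
      using su(1) by (auto simp: seg_def)
    then obtain b where b: "fst v = (b, True)" "0 \<le> b" "b < x" "\<And>z. b < z \<Longrightarrow> z < x \<Longrightarrow> regular z"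
      using sv(1) F by (auto simp: seg_def)
    have u: "u = ((a, True), h)" and v: "v = ((b, True), h)" using a b su(2) sv(2) by (metis prod.collapse)+
    consider "a = b" | "a < b" | "b < a" by linarith
    then show ?thesis
    proof cases
      case 2
      from step_seg(2)[OF 2 b(3) a(3) a(5) a(6) h] sm F have "mid v u"
        using nu b(3) a(5) a(6)[OF 2 b(3)] unfolding mid_def u v by (auto intro: exI[of _ "((b, False), h)"])
      then show ?thesis by simp
    next
      case 3
      from step_seg(2)[OF 3 a(4) b(2) a(5) b(4) h] sm F have "mid u v"
        using nu a(4,5) b(4)[OF 3 a(4)] unfolding mid_def u v by (auto intro: exI[of _ "((a, False), h)"])
      then show ?thesis by simp
    qed (simp add: u v)
  qed
qed

lemma relpow_reach: "(step ^^ n) y u \<Longrightarrow> reach y u"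
  by (rule relpowp_imp_rtranclp)

lemma step_relpow_comparable: "(step ^^ n) y u \<Longrightarrow> step y v \<Longrightarrow> reach u v \<or> reach v u"
proof (induction n arbitrary: y v rule: less_induct)
  case (less n y v)
  show ?case
  proof (cases n)
    case 0
    then show ?thesis using less.prems by auto
  next
    case (Suc m)
    then obtain w where w: "step y w" "(step ^^ m) w u" using less.prems(1) relpowp_Suc_D2[of m step y u] by blast
    have wu: "reach w u" by (rule relpow_reach[OF w(2)])
    from step_diamond[OF w(1) less.prems(2)] consider "w = v"
      | x where "\<not> snd (dev w)" "step w x" "step x v" | x where "step v x" "step x w"
      unfolding mid_def by blast
    then show ?thesis
    proof cases
      case 1
      then show ?thesis using wu by simp
    next
      case 2
      show ?thesis
      proof (cases m)
        case 0
        then have "w = u" using w(2) by simp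
        then show ?thesis using 2 by (meson converse_rtranclp_into_rtranclp rtranclp.rtrancl_refl)
      next
        case (Suc l)
        then obtain x' where x': "step w x'" "(step ^^ l) x' u" using w(2) relpowp_Suc_D2[of l step w u] by blast
        have "x' = x" by (rule step_glue_unique[OF 2(1) x'(1) 2(2)])
        then show ?thesis using less.IH[of l x v] x'(2) 2(3) \<open>n = Suc m\<close> Suc by simp
      qed
    next
      case 3
      then show ?thesis using wu by (meson converse_rtranclp_into_rtranclp)
    qed
  qed
qed

text \<open>Continuation along the curve is unique: two steps from one chart differ only by how
  far they go (\<open>step_diamond\<close>).\<close>

lemma reach_linear:
  assumes "reach y u" "reach y v" shows "reach u v \<or> reach v u"
  using assms(1)
proof (induction rule: rtranclp_induct)
  case base
  then show ?case using assms(2) by simp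
next
  case (step a b)
  from step.IH show ?case
  proof
    assume "reach v a"
    then show ?thesis using step.hyps(2) by (meson rtranclp.rtrancl_into_rtrancl)
  next
    assume "reach a v"
    then obtain n where "(step ^^ n) a v" by (auto dest: rtranclp_imp_relpowp)
    then show ?thesis using step_relpow_comparable step.hyps(2) by blast
  qed
qed

lemma snd_dev_gact: "g \<in> lifts \<Longrightarrow> y \<in> charts \<Longrightarrow> snd (dev (gact g y)) \<longleftrightarrow> snd (dev y) = strict_mono g"
  by (simp add: dev_gact) (simp add: tapp_def)

lemma step_charts: "step y u \<Longrightarrow> y \<in> charts \<and> u \<in> charts"
  by (simp add: step_def)

lemma step_gact_mono:
  assumes g: "g \<in> lifts" "strict_mono g" and s: "step y u"
  shows "step (gact g y) (gact g u)"
proof -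
  have c: "y \<in> charts" "u \<in> charts" using step_charts[OF s] by auto
  have "snd (dev (gact g y)) \<longleftrightarrow> snd (dev y)" using snd_dev_gact[OF g(1) c(1)] g(2) by simp
  then show ?thesis
    using s gact_charts[OF g(1)] unfolding step_def by (auto simp: gact_def comp_assoc)
qed

lemma step_gact_anti:
  assumes g: "g \<in> lifts" "\<not> strict_mono g" and s: "step y u"
  shows "step (gact g u) (gact g y)"
proof -
  have c: "y \<in> charts" "u \<in> charts" using step_charts[OF s] by auto
  have d: "snd (dev (gact g u)) \<longleftrightarrow> snd (dev y)"
    using snd_dev_gact[OF g(1) c(2)] g(2) step_dev(2)[OF s] by simp
  have "seg (fst u) (fst y) \<and> snd y = snd u" if "snd (dev y)"
    using s that seg_sym by (auto simp: step_def)
  moreover have "\<exists>k. glue (fst u) (fst y) k \<and> snd y = snd u \<circ> ginv k" if "\<not> snd (dev y)"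
  proof -
    obtain k where k: "glue (fst y) (fst u) k" "snd u = snd y \<circ> ginv k" using s \<open>\<not> snd (dev y)\<close> by (auto simp: step_def)
    have kl: "k \<in> lifts" using glue_lifts[OF k(1)] by simp
    have "snd y = snd u \<circ> ginv (ginv k)"
      unfolding k(2) ginv_ginv[OF kl] comp_assoc ginv_comp(1)[OF kl] by simp
    then show ?thesis using glue_sym[OF k(1)] by blast
  qed
  ultimately show ?thesis
    using gact_charts[OF g(1) c(1)] gact_charts[OF g(1) c(2)] d
    unfolding step_def by (cases "snd (dev y)") (auto simp: gact_def comp_assoc)
qed

lemma reach_gact_mono: "reach y u \<Longrightarrow> g \<in> lifts \<Longrightarrow> strict_mono g \<Longrightarrow> reach (gact g y) (gact g u)"
  by (induction rule: rtranclp_induct) (auto intro: rtranclp.rtrancl_into_rtrancl step_gact_mono)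

lemma reach_gact_anti: "reach y u \<Longrightarrow> g \<in> lifts \<Longrightarrow> \<not> strict_mono g \<Longrightarrow> reach (gact g u) (gact g y)"
  by (induction rule: rtranclp_induct) (auto intro: converse_rtranclp_into_rtranclp step_gact_anti)

lemma refl_not_mono: "\<not> strict_mono (\<lambda>\<theta>::real. - \<theta>)"
  by (rule dec_not_inc) simp

lemma gact_refl_refl: "gact (\<lambda>\<theta>. - \<theta>) (gact (\<lambda>\<theta>. - \<theta>) y) = y"
  by (simp add: gact_def comp_def)

text \<open>The reflection \<open>\<theta> \<mapsto> - \<theta>\<close> of the coordinate reverses
  all steps.\<close>

lemma reach_linear_back:
  assumes "reach u y" "reach v y" shows "reach u v \<or> reach v u"
proof -
  let ?r = "gact (\<lambda>\<theta>. - \<theta>)"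
  have "reach (?r y) (?r u)" "reach (?r y) (?r v)"
    using reach_gact_anti[OF _ reflection_lift(1) refl_not_mono] assms by auto
  from reach_linear[OF this] show ?thesis
    using reach_gact_anti[OF _ reflection_lift(1) refl_not_mono, of "?r u" "?r v"]
      reach_gact_anti[OF _ reflection_lift(1) refl_not_mono, of "?r v" "?r u"] unfolding gact_refl_refl by blast
qed

text \<open>A class of similar charts is a developed component of the curve with a coordinate.\<close>

definition sim :: "chart \<Rightarrow> chart \<Rightarrow> bool" where "sim y u \<longleftrightarrow> reach y u \<or> reach u y"

lemma sim_refl: "sim y y" and sim_sym: "sim y u \<Longrightarrow> sim u y"
  by (auto simp: sim_def)

lemma sim_trans: "sim y u \<Longrightarrow> sim u v \<Longrightarrow> sim y v"
  unfolding sim_def using reach_linear reach_linear_back by (meson rtranclp_trans)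

lemma sim_dev_inj: "sim y u \<Longrightarrow> dev y = dev u \<Longrightarrow> y = u"
  unfolding sim_def using reach_dev tless_irrefl by metis

lemma sim_gact: "sim y u \<Longrightarrow> g \<in> lifts \<Longrightarrow> sim (gact g y) (gact g u)"
  unfolding sim_def using reach_gact_mono reach_gact_anti by meson

lemma reach_charts: "reach y u \<Longrightarrow> y \<in> charts \<longleftrightarrow> u \<in> charts"
  by (induction rule: rtranclp_induct) (auto dest: step_charts)

lemma sim_charts: "sim y u \<Longrightarrow> y \<in> charts \<longleftrightarrow> u \<in> charts"
  unfolding sim_def using reach_charts by blast

lemma push_glue_step:
  assumes f: "f \<in> carrier G" and y: "y \<in> charts" "u \<in> charts" "\<not> snd (dev y)"
    and k: "glue (fst y) (fst u) k" "snd u = snd y \<circ> ginv k"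
  shows "step (push f y) (push f u)"
proof -
  let ?k = "c f (fst u) \<circ> k \<circ> ginv (c f (fst y))"
  have kl: "k \<in> lifts" using glue_lifts[OF k(1)] by simp
  have l: "c f (fst u) \<in> lifts" "c f (fst y) \<in> lifts" using c_lifts[OF f] y by (auto simp: charts_def)
  have "ginv ?k = c f (fst y) \<circ> ginv k \<circ> ginv (c f (fst u))"
    using l kl by (simp add: ginv_o lifts_comp lifts_ginv ginv_ginv comp_assoc)
  then have "snd (push f y) \<circ> ginv ?k = snd y \<circ> (ginv (c f (fst y)) \<circ> c f (fst y)) \<circ> ginv k \<circ> ginv (c f (fst u))"
    by (simp add: push_def comp_assoc)
  then have "snd (push f u) = snd (push f y) \<circ> ginv ?k"
    by (simp add: ginv_comp l push_def k(2))
  moreover have "glue (fst (push f y)) (fst (push f u)) ?k"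
    using glue_inv[OF f k(1)] by (simp add: push_def)
  ultimately show ?thesis
    using push_charts[OF f] y dev_push[OF f y(1)] unfolding step_def by auto
qed

text \<open>The element \<open>f\<close> may jump at points inside the interval. The interval is
  then cut at such a point \<open>b\<close>, whose two sides are glued, and by induction on the
  number of jumps the image of the interval is a path of several steps.\<close>

lemma push_seg:
  assumes f: "f \<in> carrier G" and h: "h \<in> lifts"
    and xy: "0 \<le> x" "x < y" "y \<le> pi" "\<And>z. x < z \<Longrightarrow> z < y \<Longrightarrow> regular z"
  shows "if strict_mono h then reach (push f ((x, True), h)) (push f ((y, False), h))
    else reach (push f ((y, False), h)) (push f ((x, True), h))"
  using xy
proof (induction "card {z. x < z \<and> z < y \<and> c f (z, False) \<noteq> c f (z, True)}" arbitrary: x y rule: less_induct)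
  case (less x y)
  let ?B = "\<lambda>x y. {z. x < z \<and> z < y \<and> c f (z, False) \<noteq> c f (z, True)}"
  have fin: "finite (?B x y)"
    by (rule finite_subset[OF _ c_breaks[OF f]]) (use less.prems in auto)
  have tx: "(x, True) \<in> tips" "(y, False) \<in> tips" using less.prems by (auto simp: tips_def)
  show ?case
  proof (cases "?B x y = {}")
    case False
    then obtain b where b: "x < b" "b < y" "c f (b, False) \<noteq> c f (b, True)" by blast
    have cb: "((b, s), h) \<in> charts" for s using b less.prems h by (auto simp: charts_def intro!: tips_interior)
    have "card (?B x b) < card (?B x y)" "card (?B b y) < card (?B x y)"
      using b by (auto intro!: psubset_card_mono fin)
    then have IH: "if strict_mono h then reach (push f ((x, True), h)) (push f ((b, False), h))
        else reach (push f ((b, False), h)) (push f ((x, True), h))"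
      "if strict_mono h then reach (push f ((b, True), h)) (push f ((y, False), h))
        else reach (push f ((y, False), h)) (push f ((b, True), h))"
      using less.hyps[of x b] less.hyps[of b y] less.prems b by auto
    have g: "glue (b, False) (b, True) id" using less.prems(4)[OF b(1,2)] by (simp add: regular_def)
    have g': "glue (b, True) (b, False) id" using glue_sym[OF g] by (simp add: ginv_id)
    show ?thesis
    proof (cases "strict_mono h")
      case True
      have "step (push f ((b, False), h)) (push f ((b, True), h))"
        by (rule push_glue_step[OF f cb cb]) (use True g in \<open>auto simp: dev_def tapp_def ginv_id\<close>)
      then show ?thesis using IH True by (auto intro: rtranclp_trans converse_rtranclp_into_rtranclp)
    next
      case False
      have "step (push f ((b, True), h)) (push f ((b, False), h))"
        by (rule push_glue_step[OF f cb cb]) (use False g' in \<open>auto simp: dev_def tapp_def ginv_id\<close>)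
      then show ?thesis using IH False by (auto intro: rtranclp_trans converse_rtranclp_into_rtranclp)
    qed
  next
    case True
    let ?g = "c f (x, True)"
    have g: "?g \<in> lifts" by (rule c_lifts[OF f tx(1)])
    have const: "c f (y, False) = ?g" "\<And>z s. x < z \<Longrightarrow> z < y \<Longrightarrow> c f (z, s) = ?g"
      using c_constant[OF f less.prems(1,2,3)] True by blast+
    have mvx: "mv f (x, True) = tapp ?g (x, True)" "mv f (y, False) = tapp ?g (y, False)"
      by (simp_all add: mv_def const)
    have tg: "tapp ?g (x, True) \<in> tips" "tapp ?g (y, False) \<in> tips" using mv_tips[OF f] tx mvx by metis+
    have reg: "regular (?g z)" if z: "x < z" "z < y" for z
    proof -
      have "glue (mv f (z, False)) (mv f (z, True)) (c f (z, True) \<circ> id \<circ> ginv (c f (z, False)))"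
        by (rule glue_inv[OF f]) (use less.prems(4)[OF z] in \<open>simp add: regular_def\<close>)
      then have gl: "glue (tapp ?g (z, False)) (tapp ?g (z, True)) id"
        by (simp add: mv_def const(2)[OF z] ginv_comp(2)[OF g])
      show ?thesis
      proof (cases "strict_mono ?g")
        case True
        then show ?thesis using gl by (simp add: regular_def tapp_def)
      next
        case False
        then have "glue (?g z, True) (?g z, False) id" using gl by (simp add: tapp_def)
        from glue_sym[OF this] show ?thesis by (simp add: regular_def ginv_id)
      qed
    qed
    have sg: "seg (tapp ?g (x, True)) (tapp ?g (y, False))"
    proof (rule lifts_mono_cases[OF g])
      assume m: "strict_mono ?g"
      have "regular w" if "?g x < w" "w < ?g y" for w
        using reg[of "ginv ?g w"] that lifts_inverse(2)[OF g, of w] m by (metis strict_mono_less)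
      then show ?thesis
        using tg m less.prems(2) unfolding seg_def
        by (intro exI[of _ "?g x"] exI[of _ "?g y"]) (auto simp: tapp_def tips_def strict_mono_less)
    next
      assume m: "\<not> strict_mono ?g" "\<And>x y. x < y \<Longrightarrow> ?g y < ?g x"
      have lt: "?g u < ?g v \<longleftrightarrow> v < u" for u v using m(2) by (metis less_asym linorder_neqE)
      have "regular w" if "?g y < w" "w < ?g x" for w
        using reg[of "ginv ?g w"] that lifts_inverse(2)[OF g, of w] lt by metis
      then show ?thesis
        using tg m(1) less.prems(2) lt unfolding seg_def
        by (intro exI[of _ "?g y"] exI[of _ "?g x"]) (auto simp: tapp_def tips_def)
    qed
    have fx: "push f ((x, True), h) = (tapp ?g (x, True), h \<circ> ginv ?g)"
      "push f ((y, False), h) = (tapp ?g (y, False), h \<circ> ginv ?g)"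
      by (simp_all add: push_def mvx const)
    have ch: "((x, True), h) \<in> charts" "((y, False), h) \<in> charts" using tx h by (auto simp: charts_def)
    have cf: "push f ((x, True), h) \<in> charts" "push f ((y, False), h) \<in> charts" using push_charts[OF f] ch by auto
    have df: "dev (push f ((x, True), h)) = tapp h (x, True)" "dev (push f ((y, False), h)) = tapp h (y, False)"
      using dev_push[OF f ch(1)] dev_push[OF f ch(2)] by (simp_all add: dev_def)
    show ?thesis
    proof (cases "strict_mono h")
      case True
      have "step (push f ((x, True), h)) (push f ((y, False), h))"
        unfolding step_def using cf df(1) True sg by (simp add: fx tapp_def[of h])
      then show ?thesis using True by simp
    next
      case False
      have "step (push f ((y, False), h)) (push f ((x, True), h))"
        unfolding step_def using cf df(2) False seg_sym[OF sg] by (simp add: fx tapp_def[of h])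
      then show ?thesis using False by simp
    qed
  qed
qed

lemma step_push:
  assumes f: "f \<in> carrier G" and s: "step y u" shows "reach (push f y) (push f u)"
proof (cases "snd (dev y)")
  case False
  then obtain k where "glue (fst y) (fst u) k" "snd u = snd y \<circ> ginv k" using s by (auto simp: step_def)
  then show ?thesis using push_glue_step[OF f _ _ False] step_charts[OF s] by blast
next
  case True
  then have sg: "seg (fst y) (fst u)" "snd u = snd y" using s by (auto simp: step_def)
  obtain a b where ab: "0 \<le> a" "a < b" "b \<le> pi" "\<forall>z. a < z \<and> z < b \<longrightarrow> regular z"
      "fst y = (a, True) \<and> fst u = (b, False) \<or> fst y = (b, False) \<and> fst u = (a, True)"
    using sg(1) unfolding seg_def by blast
  have h: "snd y \<in> lifts" using s by (auto simp: step_def charts_def)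
  have e: "y = (fst y, snd y)" "u = (fst u, snd y)" using sg(2) by (auto simp: prod_eq_iff)
  from ab(5) show ?thesis
  proof
    assume p: "fst y = (a, True) \<and> fst u = (b, False)"
    then have "strict_mono (snd y)" using True by (simp add: dev_def tapp_def)
    then show ?thesis using push_seg[OF f h ab(1,2,3)] ab(4) e p by metis
  next
    assume p: "fst y = (b, False) \<and> fst u = (a, True)"
    then have "\<not> strict_mono (snd y)" using True by (simp add: dev_def tapp_def)
    then show ?thesis using push_seg[OF f h ab(1,2,3)] ab(4) e p by metis
  qed
qed

lemma reach_push: "reach y u \<Longrightarrow> f \<in> carrier G \<Longrightarrow> reach (push f y) (push f u)"
  by (induction rule: rtranclp_induct) (auto intro: rtranclp_trans step_push)

lemma sim_push: "sim y u \<Longrightarrow> f \<in> carrier G \<Longrightarrow> sim (push f y) (push f u)"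
  unfolding sim_def using reach_push by blast

text \<open>The cut points and the end \<open>\<pi>\<close>, approached from the left: every piece
  of the cut circle has one of them at its right end.\<close>

definition nodes :: "tip set" where
  "nodes = {(y, False) | y. y = pi \<or> 0 < y \<and> y < pi \<and> \<not> regular y}"

lemma nodes_finite: "finite nodes"
proof -
  have "nodes \<subseteq> (\<lambda>y. (y, False)) ` (insert pi {x. 0 < x \<and> x < pi \<and> \<not> glue (x, False) (x, True) id})"
    unfolding nodes_def regular_def by blast
  then show ?thesis by (rule finite_subset) (use glue_regular in simp)
qed

lemma nodes_tips: "nodes \<subseteq> tips"
  by (auto simp: nodes_def tips_def)

text \<open>The node is \<open>p\<close> itself or the next cut point to the right.\<close>

lemma sim_node:
  assumes p: "p \<in> tips" obtains q where "q \<in> nodes" "\<And>h. h \<in> lifts \<Longrightarrow> sim (p, h) (q, h)"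
proof -
  have right: "\<exists>q\<in>nodes. \<forall>h\<in>lifts. sim ((x, True), h) (q, h)" if x: "0 \<le> x" "x < pi" for x
  proof -
    define S where "S = {y. (y, False) \<in> nodes \<and> x < y}"
    have "S \<subseteq> fst ` nodes" unfolding S_def by force
    then have finS: "finite S" by (rule finite_subset) (simp add: nodes_finite)
    have "pi \<in> S" using x by (simp add: S_def nodes_def)
    define y where "y = Min S"
    have y: "y \<in> S" "y \<le> pi" using Min_in[OF finS] Min_le[OF finS \<open>pi \<in> S\<close>] \<open>pi \<in> S\<close> by (auto simp: y_def)
    have reg: "regular z" if "x < z" "z < y" for z
    proof (rule ccontr)
      assume "\<not> regular z"
      then have "z \<in> S" using that x y(2) by (simp add: S_def nodes_def)
      then have "y \<le> z" unfolding y_def by (rule Min_le[OF finS])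
      then show False using that(2) by simp
    qed
    have xy: "x < y" using y(1) by (simp add: S_def)
    have sg: "seg (x, True) (y, False)"
      unfolding seg_def by (rule exI[of _ x], rule exI[of _ y]) (use x xy y(2) reg in auto)
    have "sim ((x, True), h) ((y, False), h)" if h: "h \<in> lifts" for h
    proof (cases "strict_mono h")
      case True
      then have "step ((x, True), h) ((y, False), h)"
        using sg seg_tips[OF sg] h by (simp add: step_def charts_def dev_def tapp_def)
      then show ?thesis by (auto simp: sim_def)
    next
      case False
      then have "step ((y, False), h) ((x, True), h)"
        using seg_sym[OF sg] seg_tips[OF sg] h by (simp add: step_def charts_def dev_def tapp_def)
      then show ?thesis by (auto simp: sim_def)
    qed
    then show ?thesis using y(1) by (auto simp: S_def)
  qed
  obtain x s where ps: "p = (x, s)" by (cases p)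
  have "\<exists>q\<in>nodes. \<forall>h\<in>lifts. sim (p, h) (q, h)"
  proof (cases s)
    case True
    then show ?thesis using right[of x] p ps by (simp add: tips_def)
  next
    case False
    show ?thesis
    proof (cases "p \<in> nodes")
      case True
      then show ?thesis using sim_refl by blast
    next
      case n: False
      then have x: "0 < x" "x < pi" "regular x" using p ps False by (auto simp: tips_def nodes_def less_le)
      then obtain q where q: "q \<in> nodes" "\<forall>h\<in>lifts. sim ((x, True), h) (q, h)" using right[of x] by auto
      have g: "glue (x, False) (x, True) id" using x(3) by (simp add: regular_def)
      have g': "glue (x, True) (x, False) id" using glue_sym[OF g] by (simp add: ginv_id)
      have t: "(x, s) \<in> tips" for s using tips_interior x by simp
      have "sim (p, h) (q, h)" if h: "h \<in> lifts" for h
      proof -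
        have "sim ((x, False), h) ((x, True), h)"
        proof (cases "strict_mono h")
          case True
          then have "step ((x, False), h) ((x, True), h)"
            using g t h by (auto simp: step_def charts_def dev_def tapp_def ginv_id intro!: exI[of _ id])
          then show ?thesis by (auto simp: sim_def)
        next
          case False
          then have "step ((x, True), h) ((x, False), h)"
            using g' t h by (auto simp: step_def charts_def dev_def tapp_def ginv_id intro!: exI[of _ id])
          then show ?thesis by (auto simp: sim_def)
        qed
        then show ?thesis using sim_trans q(2) h ps False by auto
      qed
      then show ?thesis using q(1) by blast
    qed
  qed
  then show ?thesis using that by blast
qed

end

section \<open>Orientation and commutators of lifts\<close>

text \<open>The interior of an interval of length at most \<open>\<pi>\<close> maps injectively to
  the circle, so the image of the interval under a lift is not longer than \<open>\<pi>\<close>.\<close>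

lemma lifts_displacement:
  assumes h: "h \<in> lifts" and xy: "x < y" "y \<le> x + pi"
  shows "\<bar>h y - h x\<bar> \<le> pi"
proof (rule ccontr)
  assume big: "\<not> ?thesis"
  obtain m where m: "rep h m" using h by (rule lifts_rep)
  have no: "\<not> (proj (h z) = proj (h x))" if z: "x < z" "z < y" for z
  proof
    assume "proj (h z) = proj (h x)"
    then have "mhom m (proj z) = mhom m (proj x)" using m unfolding rep_def by metis
    then have "proj z = proj x" using m mhom_madj(1) unfolding rep_def by metis
    then have "z = x" by (rule proj_inj_on[of x, rotated -1]) (use z xy in auto)
    then show False using z by simp
  qed
  show False
  proof (rule lifts_mono_cases[OF h])
    assume i: "strict_mono h"
    then have "h x < h y" using xy by (simp add: strict_mono_less)
    then have "h x + pi < h y" using big by simp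
    then have "x < ginv h (h x + pi)" "ginv h (h x + pi) < y"
      using i lifts_inverse(2)[OF h, of "h x + pi"] pi_gt_zero by (metis strict_mono_less less_add_same_cancel1)+
    moreover have "proj (h (ginv h (h x + pi))) = proj (h x)"
      using lifts_inverse(2)[OF h] proj_shift[of "h x" 1] by simp
    ultimately show False using no by blast
  next
    assume d: "\<not> strict_mono h" "\<And>x y. x < y \<Longrightarrow> h y < h x"
    have lt: "h u < h v \<longleftrightarrow> v < u" for u v using d(2) by (metis less_asym linorder_neqE)
    have "h y < h x" using d(2) xy by simp
    then have "h y < h x - pi" using big by simp
    then have "x < ginv h (h x - pi)" "ginv h (h x - pi) < y"
      using lt lifts_inverse(2)[OF h, of "h x - pi"] pi_gt_zero by (metis diff_less_eq less_add_same_cancel1)+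
    moreover have "proj (h (ginv h (h x - pi))) = proj (h x)"
      using lifts_inverse(2)[OF h] proj_shift[of "h x" "- 1"] by simp
    ultimately show False using no by blast
  qed
qed

text \<open>The lifts that preserve the orientation. The determinants of the matrices of one lift
  all have the same sign.\<close>

definition positive :: "(real \<Rightarrow> real) \<Rightarrow> bool" where
  "positive g \<longleftrightarrow> g \<in> lifts \<and> strict_mono g \<and> (\<exists>m. rep g m \<and> mdet m > 0)"

lemma positive_id: "positive id"
  unfolding positive_def using lifts_id rep_id[of 1] by (auto simp: strict_mono_def mscal_def intro!: exI[of _ "mscal 1"])

lemma positive_comp: "positive g \<Longrightarrow> positive h \<Longrightarrow> positive (g \<circ> h)"
  unfolding positive_def using lifts_comp strict_mono_comp_iff rep_comp mdet_mmul by (metis mult_pos_pos)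

lemma positive_ginv: "positive g \<Longrightarrow> positive (ginv g)"
  unfolding positive_def using lifts_ginv strict_mono_ginv(1) rep_ginv mdet_madj by metis

text \<open>The orbit of \<open>x\<close> is strictly monotone.\<close>

lemma strict_mono_funpow_neq:
  fixes t :: "real \<Rightarrow> real"
  assumes t: "strict_mono t" and x: "t x \<noteq> x" and n: "n > 0"
  shows "(t ^^ n) x \<noteq> x"
proof -
  have up: "x < (t ^^ n) x" if "x < t x" "n > 0" for n
    using that(2)
  proof (induction n)
    case (Suc n)
    show ?case
    proof (cases "n = 0")
      case False
      then have "t x < t ((t ^^ n) x)" using Suc t by (simp add: strict_mono_less)
      then show ?thesis using that(1) by simp
    qed (use that(1) in simp)
  qed simp
  have down: "(t ^^ n) x < x" if "t x < x" "n > 0" for n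
    using that(2)
  proof (induction n)
    case (Suc n)
    show ?case
    proof (cases "n = 0")
      case False
      then have "t ((t ^^ n) x) < t x" using Suc t by (simp add: strict_mono_less)
      then show ?thesis using that(1) by simp
    qed (use that(1) in simp)
  qed simp
  show ?thesis using up down x n by (metis less_irrefl linorder_neqE)
qed

definition closed_pred :: "((real \<Rightarrow> real) \<Rightarrow> bool) \<Rightarrow> bool" where
  "closed_pred Q \<longleftrightarrow> Q id \<and> (\<forall>g\<in>lifts. \<forall>h\<in>lifts. Q g \<longrightarrow> Q h \<longrightarrow> Q (g \<circ> h)) \<and> (\<forall>g\<in>lifts. Q g \<longrightarrow> Q (ginv g))"

definition gcomm :: "(real \<Rightarrow> real) \<Rightarrow> (real \<Rightarrow> real) \<Rightarrow> real \<Rightarrow> real" where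
  "gcomm g h = g \<circ> h \<circ> ginv g \<circ> ginv h"

lemma rep_gcomm: "g \<in> lifts \<Longrightarrow> h \<in> lifts \<Longrightarrow> rep g m \<Longrightarrow> rep h n \<Longrightarrow> rep (gcomm g h) (mcomm m n)"
  unfolding gcomm_def mcomm_def by (intro rep_comp rep_ginv)

lemma ginv_eqI:
  assumes "g \<in> lifts" "g \<circ> h = id" shows "ginv g = h"
proof
  fix x have "g (h x) = x" using assms(2) by (metis comp_apply id_apply)
  then show "ginv g x = h x" using lifts_inverse(1)[OF assms(1), of "h x"] by simp
qed

lemma closed_zshift: "closed_pred (\<lambda>g. \<exists>k. g = zshift k)"
proof -
  have "zshift k \<circ> zshift l = zshift (k + l)" for k l by (auto simp: zshift_def algebra_simps)
  moreover have z0: "id = zshift 0" by (auto simp: zshift_def)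
  moreover have "ginv (zshift k) = zshift (- k)" for k
    by (rule ginv_eqI[OF zshift_lifts(1)]) (auto simp: zshift_def)
  ultimately show ?thesis unfolding closed_pred_def by metis
qed

lemma gcomm_zshift: "gcomm (zshift k) (zshift l) = id"
proof -
  have "ginv (zshift k) = zshift (- k)" for k
    by (rule ginv_eqI[OF zshift_lifts(1)]) (auto simp: zshift_def)
  then show ?thesis by (auto simp: gcomm_def zshift_def)
qed

lemma closed_unip: "v \<noteq> vzero \<Longrightarrow> closed_pred (\<lambda>g. \<exists>m. rep g m \<and> unip_line v m)"
proof -
  assume v: "v \<noteq> vzero"
  have "unip_line v (mscal 1)"
    unfolding unip_line_def by (rule exI[of _ 1]) (cases v, simp add: mscal_def)
  then have 1: "\<exists>m. rep id m \<and> unip_line v m" using rep_id[of 1] by auto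
  have 2: "unip_line v (mmul m n)" if um: "unip_line v m" and un: "unip_line v n" for m n
  proof -
    obtain k where "k \<noteq> 0" "mapp m v = vscale k v" "mdet m = k\<^sup>2" using um unfolding unip_line_def by (elim exE conjE)
    moreover obtain l where "l \<noteq> 0" "mapp n v = vscale l v" "mdet n = l\<^sup>2" using un unfolding unip_line_def by (elim exE conjE)
    ultimately show ?thesis unfolding unip_line_def
      by (intro exI[of _ "l * k"]) (simp add: mapp_mmul mdet_mmul power_mult_distrib)
  qed
  have 3: "unip_line v (madj m)" if um: "unip_line v m" for m
  proof -
    obtain k where k: "k \<noteq> 0" "mapp m v = vscale k v" "mdet m = k\<^sup>2" using um unfolding unip_line_def by (elim exE conjE)
    have "mapp (madj m) v = vscale (mdet m / k) v" by (rule fixes_line_madj(2)[OF _ v k(2)]) (use k in simp)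
    then show ?thesis unfolding unip_line_def using k by (intro exI[of _ k]) (simp add: power2_eq_square)
  qed
  show ?thesis unfolding closed_pred_def
  proof (intro conjI ballI impI)
    fix g h assume g: "\<exists>m. rep g m \<and> unip_line v m" and h: "\<exists>m. rep h m \<and> unip_line v m"
    obtain m where m: "rep g m" "unip_line v m" using g by blast
    obtain n where n: "rep h n" "unip_line v n" using h by blast
    show "\<exists>m. rep (g \<circ> h) m \<and> unip_line v m" using rep_comp[OF m(1) n(1)] 2[OF m(2) n(2)] by blast
  next
    fix g assume gl: "g \<in> lifts" and g: "\<exists>m. rep g m \<and> unip_line v m"
    obtain m where m: "rep g m" "unip_line v m" using g by blast
    show "\<exists>m. rep (ginv g) m \<and> unip_line v m" using rep_ginv[OF gl m(1)] 3[OF m(2)] by blast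
  qed (rule 1)
qed

lemma mmul_scal_right: "mmul m (mscal k) = mmul (mscal k) m"
  by (cases m) (simp add: mscal_def)

lemma scal_quotient:
  assumes n: "mdet n \<noteq> 0" "mdet m \<noteq> 0" and s: "is_scal (mmul (madj n) m)"
  obtains k where "k \<noteq> 0" "m = mmul (mscal k) n"
proof -
  obtain j where j: "mmul (madj n) m = mscal j" using s by (auto simp: is_scal_def)
  have "mdet (mmul (madj n) m) \<noteq> 0" using n by (simp add: mdet_mmul)
  then have j0: "j \<noteq> 0" by (auto simp: j mscal_def)
  have "mmul (mscal (mdet n)) m = mmul n (mscal j)"
    by (simp add: mmul_madj(1)[symmetric] mmul_assoc j)
  then have "m = mmul (mscal (j / mdet n)) n"
    using n(1) by (cases m, cases n) (simp add: mscal_def field_simps)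
  then show ?thesis using that[of "j / mdet n"] j0 n(1) by simp
qed

lemma hyperbolic_scale: "k \<noteq> 0 \<Longrightarrow> hyperbolic (mmul (mscal k) n) \<longleftrightarrow> hyperbolic n"
proof -
  assume k: "k \<noteq> 0"
  have t: "mtr (mmul (mscal k) n) = k * mtr n" "mdet (mmul (mscal k) n) = k\<^sup>2 * mdet n"
    by (cases n; simp add: mscal_def power2_eq_square algebra_simps)+
  have "(k * mtr n)\<^sup>2 > 4 * (k\<^sup>2 * mdet n) \<longleftrightarrow> k\<^sup>2 * (4 * mdet n) < k\<^sup>2 * (mtr n)\<^sup>2"
    by (simp add: power_mult_distrib algebra_simps)
  also have "\<dots> \<longleftrightarrow> 4 * mdet n < (mtr n)\<^sup>2" using mult_less_cancel_left_pos[of "k\<^sup>2"] k by simp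
  finally show ?thesis by (simp only: hyperbolic_def t)
qed

definition sign_commutes :: "mat2 \<Rightarrow> mat2 \<Rightarrow> bool" where
  "sign_commutes T m \<longleftrightarrow> (\<exists>e. e * e = 1 \<and> mmul m T = mmul (mscal e) (mmul T m))"

text \<open>The two products represent the same lift, so they agree up to a scalar
  \<open>e\<close>, and \<open>e\<^sup>2 = 1\<close> by comparison of determinants.\<close>

lemma commuting_lifts_sign:
  assumes g: "g \<circ> t = t \<circ> g" and m: "rep g m" and T: "rep t T"
  shows "sign_commutes T m"
proof -
  have r: "rep (g \<circ> t) (mmul m T)" "rep (g \<circ> t) (mmul T m)"
    using rep_comp[OF m T] rep_comp[OF T m] g by simp_all
  have d: "mdet (mmul T m) \<noteq> 0" "mdet (mmul m T) \<noteq> 0" using r by (auto simp: rep_def)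
  obtain e where e: "e \<noteq> 0" "mmul m T = mmul (mscal e) (mmul T m)"
    using scal_quotient[OF d rep_unique[OF r(1,2)]] by blast
  have "mdet (mmul m T) = mdet (mscal e) * mdet (mmul T m)" using e(2) mdet_mmul by metis
  then have "mdet m * mdet T = (e * e) * (mdet m * mdet T)" by (simp add: mdet_mmul mscal_def)
  then have "e * e = 1" using d by (simp add: mdet_mmul)
  then show ?thesis using e(2) unfolding sign_commutes_def by blast
qed

text \<open>Each sign occurs twice in a commutator.\<close>

lemma sign_commutes_mcomm:
  assumes m: "mdet m \<noteq> 0" "sign_commutes T m" and n: "mdet n \<noteq> 0" "sign_commutes T n"
  shows "mmul (mcomm m n) T = mmul T (mcomm m n)"
proof -
  have sc: "mmul (mmul (mscal e) x) y = mmul (mscal e) (mmul x y)" "mmul x (mmul (mscal e) y) = mmul (mscal e) (mmul x y)" for e x y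
    by (cases x; cases y; simp add: mscal_def algebra_simps)+
  have ss: "mmul (mscal e) (mmul (mscal e') x) = mmul (mscal (e * e')) x" "mmul (mscal 1) x = x" for e e' x
    by (cases x; simp add: mscal_def algebra_simps)+
  have inv: "mmul (madj m) T = mmul (mscal e) (mmul T (madj m))"
    if d: "mdet m \<noteq> 0" and e: "e * e = 1" "mmul m T = mmul (mscal e) (mmul T m)" for m e
  proof -
    have "mmul (madj m) (mmul (mmul m T) (madj m)) = mmul (madj m) (mmul (mmul (mscal e) (mmul T m)) (madj m))"
      using e(2) by simp
    then have "mmul (mscal (mdet m)) (mmul T (madj m)) = mmul (mscal e) (mmul (mmul (madj m) T) (mscal (mdet m)))"
      by (simp add: sc mmul_assoc mmul_madj) (simp add: mmul_assoc[symmetric] mmul_madj)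
    then have "mmul (mscal (mdet m)) (mmul T (madj m)) = mmul (mscal (mdet m)) (mmul (mscal e) (mmul (madj m) T))"
      by (simp add: mmul_scal_right ss mult.commute)
    then have "mmul T (madj m) = mmul (mscal e) (mmul (madj m) T)"
      using d by (cases "mmul T (madj m)", cases "mmul (mscal e) (mmul (madj m) T)") (simp add: mscal_def)
    then have "mmul (mscal e) (mmul T (madj m)) = mmul (madj m) T" using e(1) by (simp add: ss)
    then show ?thesis by simp
  qed
  obtain e where e: "e * e = 1" "mmul m T = mmul (mscal e) (mmul T m)" using m(2) unfolding sign_commutes_def by blast
  obtain d where d: "d * d = 1" "mmul n T = mmul (mscal d) (mmul T n)" using n(2) unfolding sign_commutes_def by blast
  note i = inv[OF m(1) e] inv[OF n(1) d]
  have prod: "mmul (mmul x y) T = mmul (mscal (a * b)) (mmul T (mmul x y))"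
    if "mmul x T = mmul (mscal a) (mmul T x)" "mmul y T = mmul (mscal b) (mmul T y)" for x y a b
  proof -
    have "mmul (mmul x y) T = mmul x (mmul (mscal b) (mmul T y))" by (simp only: mmul_assoc that(2))
    also have "\<dots> = mmul (mscal b) (mmul (mmul x T) y)" by (simp only: sc mmul_assoc)
    also have "\<dots> = mmul (mscal b) (mmul (mscal a) (mmul T (mmul x y)))" by (simp only: that(1) sc(1) mmul_assoc)
    finally show ?thesis by (simp only: ss mult.commute)
  qed
  have "mmul (mcomm m n) T = mmul (mscal (e * d * e * d)) (mmul T (mcomm m n))"
    unfolding mcomm_def by (intro prod e(2) d(2) i)
  moreover have "e * d * e * d = 1" using e(1) d(1) by (metis mult.assoc mult.commute mult_1)
  ultimately show ?thesis by (simp add: ss)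
qed

context reglued_group
begin

lemma mid_not_node: "regular (fst p) \<Longrightarrow> fst p < pi \<Longrightarrow> p \<notin> nodes"
  by (auto simp: nodes_def)

section \<open>Nodes of the reglued curve\<close>

text \<open>Between the ends of a step across an interval there are only points without a cut.\<close>

lemma no_node_inside_step:
  "(step ^^ n) u w \<Longrightarrow> step u v \<Longrightarrow> reach w v \<Longrightarrow> w = u \<or> w = v \<or> fst w \<notin> nodes"
proof (induction n arbitrary: u rule: less_induct)
  case (less n u)
  have antisym: "w = v" if "reach v w"
    using reach_dev[OF that] reach_dev[OF less.prems(3)] tless_trans tless_irrefl by metis
  show ?case
  proof (cases n)
    case 0
    then show ?thesis using less.prems(1) by auto
  next
    case (Suc m)
    then obtain x where x: "step u x" "(step ^^ m) x w" using less.prems(1) relpowp_Suc_D2[of m step u w] by blast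
    have xw: "reach x w" by (rule relpow_reach[OF x(2)])
    from step_diamond[OF x(1) less.prems(2)] consider "x = v" | "mid x v" | "mid v x" by blast
    then show ?thesis
    proof cases
      case 1
      then show ?thesis using antisym xw by simp
    next
      case 3
      then have "reach v x" unfolding mid_def by (meson converse_rtranclp_into_rtranclp rtranclp.rtrancl_refl)
      then show ?thesis using antisym xw by (meson rtranclp_trans)
    next
      case 2
      then obtain z where z: "\<not> snd (dev x)" "regular (fst (fst x))" "fst (fst x) < pi" "step x z" "step z v" "fst (fst z) = fst (fst x)"
        unfolding mid_def by blast
      have nx: "fst x \<notin> nodes" "fst z \<notin> nodes" using mid_not_node z by auto
      show ?thesis
      proof (cases m)
        case 0
        then show ?thesis using x(2) nx by auto
      next
        case (Suc l)
        then obtain z' where z': "step x z'" "(step ^^ l) z' w" using x(2) relpowp_Suc_D2[of l step x w] by blast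
        have "z' = z" by (rule step_glue_unique[OF z(1) z'(1) z(4)])
        then show ?thesis using less.IH[of l z] z'(2) z(5) less.prems(3) nx \<open>n = Suc m\<close> Suc by auto
      qed
    qed
  qed
qed

definition between :: "chart \<Rightarrow> chart \<Rightarrow> chart set" where
  "between y u = {w. fst w \<in> nodes \<and> reach y w \<and> reach w u}"

text \<open>A path has finitely many steps, and there are no nodes inside a step.\<close>

lemma finite_between: "reach y u \<Longrightarrow> finite (between y u)"
proof (induction rule: rtranclp_induct)
  case base
  have "between y y \<subseteq> {y}"
    unfolding between_def using reach_dev tless_trans tless_irrefl by (smt (verit) mem_Collect_eq singletonI subsetI)
  then show ?case by (rule finite_subset) simp
next
  case (step u v)
  have "between y v \<subseteq> insert u (insert v (between y u))"
  proof
    fix w assume w: "w \<in> between y v"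
    then have "reach u w \<or> reach w u" using reach_linear step.hyps(1) by (auto simp: between_def)
    then show "w \<in> insert u (insert v (between y u))"
    proof
      assume "reach u w"
      then obtain n where "(step ^^ n) u w" by (auto dest: rtranclp_imp_relpowp)
      from no_node_inside_step[OF this step.hyps(2)] show ?thesis using w by (auto simp: between_def)
    qed (use w in \<open>auto simp: between_def\<close>)
  qed
  then show ?case by (rule finite_subset) (use step.IH in simp)
qed

text \<open>Deep subgroups are those to which the argument may pass.\<close>

definition deep :: "'a set \<Rightarrow> bool" where
  "deep H \<longleftrightarrow> subgroup H G \<and> finite_index G H \<and> property_FW (G\<lparr>carrier := H\<rparr>)"

lemma deepI: "property_FW G \<Longrightarrow> subgroup H G \<Longrightarrow> finite_index G H \<Longrightarrow> deep H"
  unfolding deep_def using FW_finite_index[OF _ group_axioms] by blast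

lemma deep_derived: "deep H \<Longrightarrow> deep (derived G H)"
  unfolding deep_def using FW_derived(1-3)[of H] by blast

end

section \<open>The action on a developed component\<close>

text \<open>The component of the reglued curve that contains the node \<open>q0\<close>, with the
  chart \<open>y0\<close> as its base point.\<close>

locale component = reglued_group +
  fixes q0 :: tip
  assumes q0: "q0 \<in> nodes"
begin

definition y0 :: chart where "y0 = (q0, id)"

lemma y0_charts: "y0 \<in> charts"
  using q0 nodes_tips lifts_id by (auto simp: y0_def charts_def)

text \<open>The transport of the component by \<open>f\<close>, read in a suitable coordinate
  \<open>g\<close>, is the component itself: \<open>f\<close> preserves the component and acts on
  its development by \<open>g\<close>.\<close>

definition lft :: "'a \<Rightarrow> (real \<Rightarrow> real) \<Rightarrow> bool" where
  "lft f g \<longleftrightarrow> f \<in> carrier G \<and> g \<in> lifts \<and> sim (gact g (push f y0)) y0"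

definition Fix :: "'a set" where
  "Fix = {f \<in> carrier G. \<forall>y. sim y y0 \<longrightarrow> push f y = y}"

lemma lft_act: "lft f g \<Longrightarrow> sim y y0 \<Longrightarrow> sim (gact g (push f y)) y0"
  unfolding lft_def using sim_gact[OF sim_push] sim_trans by blast

lemma lft_mult: "lft f g \<Longrightarrow> lft f' g' \<Longrightarrow> lft (f \<otimes> f') (g \<circ> g')"
proof -
  assume l: "lft f g" "lft f' g'"
  have "sim (gact g (push f (gact g' (push f' y0)))) y0"
    by (rule lft_act[OF l(1)]) (use l(2) in \<open>simp add: lft_def\<close>)
  moreover have "gact (g \<circ> g') (push (f \<otimes> f') y0) = gact g (push f (gact g' (push f' y0)))"
    using l y0_charts by (simp add: lft_def push_mult push_gact gact_gact)
  ultimately show ?thesis using l by (simp add: lft_def lifts_comp)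
qed

lemma lft_one: "lft \<one> id"
  by (simp add: lft_def lifts_id push_one y0_charts gact_id sim_refl)

lemma lft_inv: "lft f g \<Longrightarrow> lft (inv f) (ginv g)"
proof -
  assume l: "lft f g"
  have "sim (push (inv f) (gact (ginv g) (gact g (push f y0)))) (push (inv f) (gact (ginv g) y0))"
    using l by (intro sim_push sim_gact) (auto simp: lft_def lifts_ginv)
  moreover have "push (inv f) (gact (ginv g) (gact g (push f y0))) = y0"
    using l y0_charts push_mult[of "inv f" f y0] by (simp add: lft_def gact_gact ginv_comp gact_id push_one)
  ultimately show ?thesis using l sim_sym by (simp add: lft_def lifts_ginv push_gact)
qed

text \<open>Transport by \<open>f\<close> does not change the position on the line, and a
  component has at most one chart at each position.\<close>

lemma lft_id_Fix: "lft f id \<Longrightarrow> f \<in> Fix"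
proof -
  assume l: "lft f id"
  then have f: "f \<in> carrier G" by (simp add: lft_def)
  have "push f y = y" if y: "sim y y0" for y
  proof -
    have yc: "y \<in> charts" using sim_charts[OF y] y0_charts by simp
    have "sim (push f y) y0" using lft_act[OF l y] by (simp add: gact_id)
    then have "sim (push f y) y" using sim_trans[OF _ sim_sym[OF y]] by blast
    then show ?thesis by (rule sim_dev_inj) (rule dev_push[OF f yc])
  qed
  then show ?thesis using f by (simp add: Fix_def)
qed

text \<open>If commutators of lifts of elements of \<open>H\<close> have the property
  \<open>Q\<close>, so have suitable lifts of all elements of the derived subgroup. The lemma
  turns solvability of a group of lifts into triviality of the action of a deep subgroup.\<close>

lemma derived_lifts:
  assumes H: "subgroup H G" and P: "\<And>f. f \<in> H \<Longrightarrow> \<exists>g. lft f g \<and> P g"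
    and Q: "closed_pred Q" and PQ: "\<And>g h. g \<in> lifts \<Longrightarrow> h \<in> lifts \<Longrightarrow> P g \<Longrightarrow> P h \<Longrightarrow> Q (gcomm g h)"
    and f: "f \<in> derived G H"
  shows "\<exists>g. lft f g \<and> Q g"
proof -
  have comm: "\<exists>g. lft x g \<and> Q g" if x: "x \<in> derived_set G H" for x
  proof -
    obtain a b where ab: "a \<in> H" "b \<in> H" "x = a \<otimes> b \<otimes> inv a \<otimes> inv b" using x by auto
    obtain g where g: "lft a g" "P g" using P[OF ab(1)] by auto
    obtain h where h: "lft b h" "P h" using P[OF ab(2)] by auto
    have "lft x (gcomm g h)" unfolding ab(3) gcomm_def using g h by (intro lft_mult lft_inv)
    then show ?thesis using PQ[of g h] g h by (auto simp: lft_def)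
  qed
  have cl: "Q id" "\<And>g h. g \<in> lifts \<Longrightarrow> h \<in> lifts \<Longrightarrow> Q g \<Longrightarrow> Q h \<Longrightarrow> Q (g \<circ> h)" "\<And>g. g \<in> lifts \<Longrightarrow> Q g \<Longrightarrow> Q (ginv g)"
    using Q by (auto simp: closed_pred_def)
  show ?thesis using f unfolding derived_def
  proof (induction rule: generate.induct)
    case one
    then show ?case using lft_one cl(1) by auto
  next
    case (incl h)
    then show ?case by (rule comm)
  next
    case (inv h)
    then obtain g where "lft h g" "Q g" using comm by auto
    then show ?case using lft_inv cl(3)[of g] by (auto simp: lft_def)
  next
    case (eng h1 h2)
    then obtain g1 g2 where "lft h1 g1" "Q g1" "lft h2 g2" "Q g2" by auto
    then have "lft (h1 \<otimes> h2) (g1 \<circ> g2)" "Q (g1 \<circ> g2)"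
      using lft_mult[of h1 g1 h2 g2] cl(2)[of g1 g2] lft_def[of h1 g1] lft_def[of h2 g2] by simp_all
    then show ?case by blast
  qed
qed

text \<open>Translations by multiples of \<open>\<pi>\<close> commute, so the derived subgroup
  acts trivially.\<close>

lemma zshift_lifts_Fix:
  assumes H: "deep H" and P: "\<And>f. f \<in> H \<Longrightarrow> \<exists>g. lft f g \<and> (\<exists>k. g = zshift k)"
  shows "\<exists>K. deep K \<and> K \<subseteq> Fix"
proof (intro exI conjI)
  show "deep (derived G H)" by (rule deep_derived[OF H])
  have cid: "closed_pred (\<lambda>g. g = id)" by (simp add: closed_pred_def ginv_id)
  show "derived G H \<subseteq> Fix"
  proof
    fix f assume f: "f \<in> derived G H"
    have "\<exists>g. lft f g \<and> g = id"
      by (rule derived_lifts[OF _ P cid _ f]) (use H gcomm_zshift in \<open>auto simp: deep_def\<close>)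
    then show "f \<in> Fix" using lft_id_Fix by auto
  qed
qed

text \<open>The stabilizer of a line is solvable: its commutators are unipotent, and the
  commutators of these are scalar.\<close>

lemma line_lifts_Fix:
  assumes H: "deep H" and v: "v \<noteq> vzero"
    and P: "\<And>f. f \<in> H \<Longrightarrow> \<exists>g. lft f g \<and> (\<exists>m. rep g m \<and> fixes_line v m)"
  shows "\<exists>K. deep K \<and> K \<subseteq> Fix"
proof (rule zshift_lifts_Fix)
  have sub: "subgroup H G" "subgroup (derived G H) G" using H deep_derived[OF H] by (auto simp: deep_def)
  show "deep (derived G (derived G H))" by (intro deep_derived H)
  have 1: "\<exists>g. lft f g \<and> (\<exists>m. rep g m \<and> unip_line v m)" if f: "f \<in> derived G H" for f
  proof (rule derived_lifts[OF sub(1) P closed_unip[OF v] _ f])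
    fix g h assume gh: "g \<in> lifts" "h \<in> lifts" "\<exists>m. rep g m \<and> fixes_line v m" "\<exists>m. rep h m \<and> fixes_line v m"
    then obtain m n where mn: "rep g m" "fixes_line v m" "rep h n" "fixes_line v n" by blast
    show "\<exists>m. rep (gcomm g h) m \<and> unip_line v m"
      using rep_gcomm[OF gh(1,2) mn(1,3)] fixes_line_mcomm[OF _ _ v mn(2,4)] mn(1,3) unfolding rep_def by blast
  qed
  show "\<exists>g. lft f g \<and> (\<exists>k. g = zshift k)" if f: "f \<in> derived G (derived G H)" for f
  proof (rule derived_lifts[OF sub(2) 1 closed_zshift _ f])
    fix g h assume gh: "g \<in> lifts" "h \<in> lifts" "\<exists>m. rep g m \<and> unip_line v m" "\<exists>m. rep h m \<and> unip_line v m"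
    then obtain m n where mn: "rep g m" "unip_line v m" "rep h n" "unip_line v n" by blast
    have "is_scal (mcomm m n)"
      unfolding mcomm_scal[OF unip_line_commute[OF v mn(2,4)]] is_scal_def by blast
    moreover have "gcomm g h \<in> lifts" unfolding gcomm_def using gh by (intro lifts_comp lifts_ginv)
    ultimately show "\<exists>k. gcomm g h = zshift k"
      using rep_scal_zshift[OF _ rep_gcomm[OF gh(1,2) mn(1,3)]] by blast
  qed
qed

text \<open>The centralizer of a nonscalar matrix is commutative.\<close>

lemma commuting_lifts_Fix:
  assumes H: "deep H" and T: "\<not> is_scal T"
    and P: "\<And>f. f \<in> H \<Longrightarrow> \<exists>g. lft f g \<and> (\<exists>m. rep g m \<and> mmul m T = mmul T m)"
  shows "\<exists>K. deep K \<and> K \<subseteq> Fix"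
proof (rule zshift_lifts_Fix)
  have sub: "subgroup H G" using H by (simp add: deep_def)
  show "deep (derived G H)" by (intro deep_derived H)
  show "\<exists>g. lft f g \<and> (\<exists>k. g = zshift k)" if f: "f \<in> derived G H" for f
  proof (rule derived_lifts[OF sub P closed_zshift _ f])
    fix g h assume gh: "g \<in> lifts" "h \<in> lifts" "\<exists>m. rep g m \<and> mmul m T = mmul T m" "\<exists>m. rep h m \<and> mmul m T = mmul T m"
    then obtain m n where mn: "rep g m" "mmul m T = mmul T m" "rep h n" "mmul n T = mmul T n" by blast
    have "is_scal (mcomm m n)"
      unfolding mcomm_scal[OF centralizer_commute[OF T mn(2,4)]] is_scal_def by blast
    moreover have "gcomm g h \<in> lifts" unfolding gcomm_def using gh by (intro lifts_comp lifts_ginv)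
    ultimately show "\<exists>k. gcomm g h = zshift k"
      using rep_scal_zshift[OF _ rep_gcomm[OF gh(1,2) mn(1,3)]] by blast
  qed
qed

text \<open>Commutators of such lifts commute with \<open>t\<close>. Hence their matrices commute
  with \<open>T\<close> up to sign, and the matrices of commutators of these commute with
  \<open>T\<close>.\<close>

lemma normalizing_lifts_Fix:
  assumes H: "deep H" and t: "t \<in> lifts" "\<And>k. t \<noteq> zshift k"
    and P: "\<And>f. f \<in> H \<Longrightarrow> \<exists>g. lft f g \<and> (g \<circ> t \<circ> ginv g = t \<or> g \<circ> t \<circ> ginv g = ginv t)"
  shows "\<exists>K. deep K \<and> K \<subseteq> Fix"
proof -
  obtain T where T: "rep t T" using t(1) by (rule lifts_rep)
  have nT: "\<not> is_scal T" using rep_scal_zshift[OF t(1) T] t(2) by blast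
  have sub: "subgroup H G" "subgroup (derived G H) G" using H deep_derived[OF H] by (auto simp: deep_def)
  let ?R = "\<lambda>g. g \<circ> t = t \<circ> g"
  have clR: "closed_pred ?R"
    unfolding closed_pred_def
  proof (intro conjI ballI impI)
    fix g assume g: "g \<in> lifts" "g \<circ> t = t \<circ> g"
    have "ginv g \<circ> t = ginv g \<circ> (t \<circ> g) \<circ> ginv g" by (simp add: comp_assoc ginv_comp(2)[OF g(1)])
    also have "\<dots> = (ginv g \<circ> g) \<circ> t \<circ> ginv g" unfolding g(2)[symmetric] by (simp add: comp_assoc)
    finally show "ginv g \<circ> t = t \<circ> ginv g" by (simp add: ginv_comp(1)[OF g(1)])
  next
    fix g h assume "g \<circ> t = t \<circ> g" "h \<circ> t = t \<circ> h"
    then show "g \<circ> h \<circ> t = t \<circ> (g \<circ> h)" by (metis comp_assoc)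
  qed simp
  have 1: "\<exists>g. lft f g \<and> ?R g" if f: "f \<in> derived G H" for f
  proof (rule derived_lifts[OF sub(1) P clR _ f])
    fix g h assume g: "g \<in> lifts" "g \<circ> t \<circ> ginv g = t \<or> g \<circ> t \<circ> ginv g = ginv t"
      and h: "h \<in> lifts" "h \<circ> t \<circ> ginv h = t \<or> h \<circ> t \<circ> ginv h = ginv t"
    have inter: "g \<circ> u = w \<circ> g" "g \<circ> ginv u = ginv w \<circ> g" "ginv g \<circ> w = u \<circ> ginv g" "ginv g \<circ> ginv w = ginv u \<circ> ginv g"
      if g: "g \<in> lifts" and u: "u \<in> lifts" "g \<circ> u \<circ> ginv g = w" for g u w
    proof -
      have w: "w \<in> lifts" using u g lifts_comp lifts_ginv by blast
      show a: "g \<circ> u = w \<circ> g" unfolding u(2)[symmetric] by (simp add: comp_assoc ginv_comp(1)[OF g])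
      have "ginv w \<circ> g = ginv w \<circ> (g \<circ> u) \<circ> ginv u" by (simp add: comp_assoc ginv_comp(2)[OF u(1)])
      also have "\<dots> = (ginv w \<circ> w) \<circ> g \<circ> ginv u" unfolding a by (simp add: comp_assoc)
      finally show b: "g \<circ> ginv u = ginv w \<circ> g" by (simp add: ginv_comp(1)[OF w])
      have bk: "ginv g \<circ> w = u \<circ> ginv g" if e: "g \<circ> u = w \<circ> g" for u w
      proof -
        have "ginv g \<circ> w = ginv g \<circ> (w \<circ> g) \<circ> ginv g" by (simp add: comp_assoc ginv_comp(2)[OF g])
        also have "\<dots> = (ginv g \<circ> g) \<circ> u \<circ> ginv g" unfolding e[symmetric] by (simp add: comp_assoc)
        finally show ?thesis by (simp add: ginv_comp(1)[OF g])
      qed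
      show "ginv g \<circ> w = u \<circ> ginv g" by (rule bk[OF a])
      show "ginv g \<circ> ginv w = ginv u \<circ> ginv g" by (rule bk[OF b])
    qed
    let ?C = "\<lambda>g. g \<circ> t = t \<circ> g \<and> g \<circ> ginv t = ginv t \<circ> g \<and> ginv g \<circ> t = t \<circ> ginv g \<and> ginv g \<circ> ginv t = ginv t \<circ> ginv g"
    let ?A = "\<lambda>g. g \<circ> t = ginv t \<circ> g \<and> g \<circ> ginv t = t \<circ> g \<and> ginv g \<circ> t = ginv t \<circ> ginv g \<and> ginv g \<circ> ginv t = t \<circ> ginv g"
    have sg: "?C g \<or> ?A g" if g: "g \<in> lifts" "g \<circ> t \<circ> ginv g = t \<or> g \<circ> t \<circ> ginv g = ginv t" for g
      using g(2)
    proof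
      assume "g \<circ> t \<circ> ginv g = t"
      then show ?thesis using inter[OF g(1) t(1)] by simp
    next
      assume "g \<circ> t \<circ> ginv g = ginv t"
      from inter[OF g(1) t(1) this] show ?thesis by (simp add: ginv_ginv[OF t(1)])
    qed
    have m: "(a \<circ> b) \<circ> u = w' \<circ> (a \<circ> b)" if "b \<circ> u = w \<circ> b" "a \<circ> w = w' \<circ> a" for a b u w w' :: "real \<Rightarrow> real"
      using that by (metis comp_assoc)
    show "gcomm g h \<circ> t = t \<circ> gcomm g h"
      using sg[OF g]
    proof
      assume g: "?C g"
      note g = g[THEN conjunct1] g[THEN conjunct2, THEN conjunct1] g[THEN conjunct2, THEN conjunct2, THEN conjunct1] g[THEN conjunct2, THEN conjunct2, THEN conjunct2]
      show ?thesis unfolding gcomm_def using sg[OF h]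
      proof
        assume h: "?C h"
        note h = h[THEN conjunct1] h[THEN conjunct2, THEN conjunct1] h[THEN conjunct2, THEN conjunct2, THEN conjunct1]
        show "g \<circ> h \<circ> ginv g \<circ> ginv h \<circ> t = t \<circ> (g \<circ> h \<circ> ginv g \<circ> ginv h)" by (rule m[OF h(3) m[OF g(3) m[OF h(1) g(1)]]])
      next
        assume h: "?A h"
        note h = h[THEN conjunct1] h[THEN conjunct2, THEN conjunct1] h[THEN conjunct2, THEN conjunct2, THEN conjunct1]
        show "g \<circ> h \<circ> ginv g \<circ> ginv h \<circ> t = t \<circ> (g \<circ> h \<circ> ginv g \<circ> ginv h)" by (rule m[OF h(3) m[OF g(4) m[OF h(2) g(1)]]])
      qed
    next
      assume g: "?A g"
      note g = g[THEN conjunct1] g[THEN conjunct2, THEN conjunct1] g[THEN conjunct2, THEN conjunct2, THEN conjunct1] g[THEN conjunct2, THEN conjunct2, THEN conjunct2]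
      show ?thesis unfolding gcomm_def using sg[OF h]
      proof
        assume h: "?C h"
        note h = h[THEN conjunct1] h[THEN conjunct2, THEN conjunct1] h[THEN conjunct2, THEN conjunct2, THEN conjunct1]
        show "g \<circ> h \<circ> ginv g \<circ> ginv h \<circ> t = t \<circ> (g \<circ> h \<circ> ginv g \<circ> ginv h)" by (rule m[OF h(3) m[OF g(3) m[OF h(2) g(2)]]])
      next
        assume h: "?A h"
        note h = h[THEN conjunct1] h[THEN conjunct2, THEN conjunct1] h[THEN conjunct2, THEN conjunct2, THEN conjunct1]
        show "g \<circ> h \<circ> ginv g \<circ> ginv h \<circ> t = t \<circ> (g \<circ> h \<circ> ginv g \<circ> ginv h)" by (rule m[OF h(3) m[OF g(4) m[OF h(1) g(2)]]])
      qed
    qed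
  qed
  have 2: "\<exists>g. lft f g \<and> (\<exists>m. rep g m \<and> mmul m T = mmul T m)" if f: "f \<in> derived G (derived G H)" for f
  proof -
    let ?S = "\<lambda>g. \<exists>m. rep g m \<and> mmul m T = mmul T m"
    have clS: "closed_pred ?S"
      unfolding closed_pred_def
    proof (intro conjI ballI impI)
      show "?S id" using rep_id[of 1] by (intro exI[of _ "mscal 1"]) (simp add: mmul_scal_right)
      fix g assume g: "g \<in> lifts" "?S g"
      then obtain m where m: "rep g m" "mmul m T = mmul T m" by blast
      have d: "mdet m \<noteq> 0" using m(1) by (simp add: rep_def)
      have "mmul (madj m) (mmul (mmul m T) (madj m)) = mmul (madj m) (mmul (mmul T m) (madj m))" using m(2) by simp
      then have "mmul (mscal (mdet m)) (mmul T (madj m)) = mmul (mmul (madj m) T) (mscal (mdet m))"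
        by (simp add: mmul_assoc mmul_madj) (simp add: mmul_assoc[symmetric] mmul_madj)
      then have "mmul T (madj m) = mmul (madj m) T"
        using d by (cases "mmul T (madj m)", cases "mmul (madj m) T") (simp add: mscal_def)
      then show "?S (ginv g)" using rep_ginv[OF g(1) m(1)] by metis
      fix h assume "?S h"
      then obtain n where n: "rep h n" "mmul n T = mmul T n" by blast
      have "mmul (mmul m n) T = mmul T (mmul m n)" using m(2) n(2) by (metis mmul_assoc)
      then show "?S (g \<circ> h)" using rep_comp[OF m(1) n(1)] by blast
    qed
    show ?thesis
    proof (rule derived_lifts[OF sub(2) 1 clS _ f])
      fix g h assume gh: "g \<in> lifts" "h \<in> lifts" "?R g" "?R h"
      obtain m where m: "rep g m" using gh(1) by (rule lifts_rep)
      obtain n where n: "rep h n" using gh(2) by (rule lifts_rep)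
      have "mmul (mcomm m n) T = mmul T (mcomm m n)"
        by (rule sign_commutes_mcomm[OF _ commuting_lifts_sign[OF gh(3) m T] _ commuting_lifts_sign[OF gh(4) n T]])
          (use m n in \<open>simp_all add: rep_def\<close>)
      then show "?S (gcomm g h)" using rep_gcomm[OF gh(1,2) m n] by blast
    qed
  qed
  show ?thesis by (rule commuting_lifts_Fix[OF deep_derived[OF deep_derived[OF H]] nT 2])
qed

end

definition orient :: "(real \<Rightarrow> real) \<Rightarrow> bool \<times> bool" where
  "orient g = (strict_mono g, \<exists>m. rep g m \<and> mdet m > 0)"

text \<open>There are finitely many types \<open>orient g\<close>, and two lifts of the same type
  differ by a positive lift.\<close>

lemma orient_quotient:
  assumes g: "g \<in> lifts" and h: "h \<in> lifts" and o: "orient g = orient h"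
  shows "positive (ginv g \<circ> h)" "positive (h \<circ> ginv g)"
proof -
  have mono: "strict_mono g \<longleftrightarrow> strict_mono h" using o by (simp add: orient_def)
  have "\<exists>m n. rep g m \<and> rep h n \<and> mdet m * mdet n > 0"
  proof (cases "\<exists>m. rep g m \<and> mdet m > 0")
    case True
    then obtain m where m: "rep g m" "mdet m > 0" by blast
    have "\<exists>n. rep h n \<and> mdet n > 0" using o True by (simp add: orient_def)
    then obtain n where n: "rep h n" "mdet n > 0" by blast
    show ?thesis using m n by (intro exI[of _ m] exI[of _ n]) simp
  next
    case False
    then have F: "\<not> (\<exists>n. rep h n \<and> mdet n > 0)" using o unfolding orient_def prod.inject by blast
    obtain m where m: "rep g m" using g by (rule lifts_rep)
    obtain n where n: "rep h n" using h by (rule lifts_rep)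
    have "mdet m \<noteq> 0" "mdet n \<noteq> 0" using m n by (auto simp: rep_def)
    moreover have "\<not> mdet m > 0" "\<not> mdet n > 0" using False F m n by blast+
    ultimately have "mdet m < 0" "mdet n < 0" by linarith+
    then show ?thesis using m n by (intro exI[of _ m] exI[of _ n]) (simp add: mult_neg_neg)
  qed
  then obtain m n where mn: "rep g m" "rep h n" "mdet m * mdet n > 0" by blast
  have gi: "ginv g \<in> lifts" by (rule lifts_ginv[OF g])
  have "strict_mono (ginv g \<circ> h)" "strict_mono (h \<circ> ginv g)"
    using strict_mono_comp_iff[OF gi h] strict_mono_comp_iff[OF h gi] strict_mono_ginv(1)[OF g] mono by simp_all
  moreover have "rep (ginv g \<circ> h) (mmul (madj m) n)" "rep (h \<circ> ginv g) (mmul n (madj m))"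
    by (intro rep_comp rep_ginv[OF g] mn)+
  moreover have "mdet (mmul (madj m) n) > 0" "mdet (mmul n (madj m)) > 0"
    using mn(3) by (simp_all add: mdet_mmul mult.commute)
  ultimately show "positive (ginv g \<circ> h)" "positive (h \<circ> ginv g)"
    unfolding positive_def using lifts_comp[OF gi h] lifts_comp[OF h gi] by blast+
qed

lemma fixes_line_of_mhom:
  assumes "mdet m \<noteq> 0" "mhom m (proj b) = proj b" shows "fixes_line (circ b) m"
proof -
  have nz: "mapp m (circ b) \<noteq> vzero" by (rule mapp_nonzero[OF assms(1) circ_nonzero])
  have "vpoint (circ b) = vpoint (mapp m (circ b))"
    using assms(2) mhom_vpoint[OF circ_nonzero, of m b] by (simp add: proj_def)
  then have "vdet (circ b) (mapp m (circ b)) = 0" using vpoint_eq_iff[OF circ_nonzero nz] by simp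
  then show ?thesis using vdet_eq_0_iff[OF circ_nonzero] by (simp add: fixes_line_def)
qed

lemma (in reglued_group) reach_antisym: "reach u v \<Longrightarrow> reach v u \<Longrightarrow> u = v"
  using reach_dev[of u v] reach_dev[of v u] tless_trans[of "dev u" "dev v" "dev u"] tless_irrefl by blast

context component
begin

definition plft :: "'a \<Rightarrow> (real \<Rightarrow> real) \<Rightarrow> bool" where "plft f g \<longleftrightarrow> lft f g \<and> positive g"
definition \<Delta> :: "'a set" where "\<Delta> = {f \<in> carrier G. \<exists>g. plft f g}"

lemma plft_mult: "plft f g \<Longrightarrow> plft f' g' \<Longrightarrow> plft (f \<otimes> f') (g \<circ> g')"
  by (simp add: plft_def lft_mult positive_comp)

lemma plft_inv: "plft f g \<Longrightarrow> plft (inv f) (ginv g)"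
  by (simp add: plft_def lft_inv positive_ginv)

lemma plft_one: "plft \<one> id"
  by (simp add: plft_def lft_one positive_id)

lemma plft_carrier: "plft f g \<Longrightarrow> f \<in> carrier G"
  by (simp add: plft_def lft_def)

lemma plft_lifts: "plft f g \<Longrightarrow> g \<in> lifts"
  by (simp add: plft_def lft_def)

lemma plft_\<Delta>: "plft f g \<Longrightarrow> f \<in> \<Delta>"
  unfolding \<Delta>_def using plft_carrier by blast

lemma subgroup_\<Delta>: "subgroup \<Delta> G"
proof (rule subgroupI)
  show "\<Delta> \<subseteq> carrier G" by (auto simp: \<Delta>_def)
  show "\<Delta> \<noteq> {}" using plft_\<Delta>[OF plft_one] by blast
next
  fix f assume "f \<in> \<Delta>"
  then obtain g where "plft f g" by (auto simp: \<Delta>_def)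
  then show "inv f \<in> \<Delta>" by (rule plft_\<Delta>[OF plft_inv])
next
  fix f f' assume "f \<in> \<Delta>" "f' \<in> \<Delta>"
  then obtain g g' where "plft f g" "plft f' g'" by (auto simp: \<Delta>_def)
  then show "f \<otimes> f' \<in> \<Delta>" by (rule plft_\<Delta>[OF plft_mult])
qed

text \<open>The transport of \<open>y0\<close> by \<open>f\<close> lies in the component of some
  node and is brought to its standard chart by a lift \<open>g\<close>. If two elements share this
  node and the type of \<open>g\<close>, their quotient preserves the component and the
  orientation.\<close>

lemma finite_index_\<Delta>: "finite_index G \<Delta>"
proof -
  have ex: "\<exists>qg. fst qg \<in> nodes \<and> snd qg \<in> lifts \<and> sim (gact (snd qg) (push f y0)) (fst qg, id)" if f: "f \<in> carrier G" for f
  proof -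
    obtain p h where ph: "push f y0 = (p, h)" by (cases "push f y0")
    have c: "p \<in> tips" "h \<in> lifts" using push_charts[OF f y0_charts] by (auto simp: ph charts_def)
    obtain q where q: "q \<in> nodes" "\<And>h. h \<in> lifts \<Longrightarrow> sim (p, h) (q, h)" by (rule sim_node[OF c(1)]) blast
    have "sim (gact (ginv h) (p, h)) (gact (ginv h) (q, h))" by (rule sim_gact[OF q(2)[OF c(2)] lifts_ginv[OF c(2)]])
    then have "sim (gact (ginv h) (push f y0)) (q, id)" by (simp add: ph gact_def ginv_comp(1)[OF c(2)])
    then show ?thesis using q(1) lifts_ginv[OF c(2)] by (intro exI[of _ "(q, ginv h)"]) simp
  qed
  define \<kappa> where "\<kappa> f = (SOME qg. fst qg \<in> nodes \<and> snd qg \<in> lifts \<and> sim (gact (snd qg) (push f y0)) (fst qg, id))" for f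
  have \<kappa>: "fst (\<kappa> f) \<in> nodes" "snd (\<kappa> f) \<in> lifts" "sim (gact (snd (\<kappa> f)) (push f y0)) (fst (\<kappa> f), id)" if f: "f \<in> carrier G" for f
    using someI_ex[OF ex[OF f]] unfolding \<kappa>_def[symmetric] by simp_all
  show ?thesis
  proof (rule finite_indexI)
    show "finite ((\<lambda>f. (fst (\<kappa> f), orient (snd (\<kappa> f)))) ` carrier G)"
      by (rule finite_subset[of _ "nodes \<times> UNIV"]) (use \<kappa>(1) nodes_finite in auto)
    fix f f' assume f: "f \<in> carrier G" and f': "f' \<in> carrier G"
      and e: "(fst (\<kappa> f), orient (snd (\<kappa> f))) = (fst (\<kappa> f'), orient (snd (\<kappa> f')))"
    define g g' where "g = snd (\<kappa> f)" and "g' = snd (\<kappa> f')"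
    have gl: "g \<in> lifts" "g' \<in> lifts" using \<kappa>(2)[OF f] \<kappa>(2)[OF f'] by (simp_all add: g_def g'_def)
    have gi: "ginv g \<in> lifts" by (rule lifts_ginv[OF gl(1)])
    have "sim (gact g' (push f' y0)) (gact g (push f y0))"
      using sim_trans[OF \<kappa>(3)[OF f'] sim_sym[OF \<kappa>(3)[OF f, unfolded arg_cong[OF e, of fst, simplified]]]]
      by (simp add: g_def g'_def)
    from sim_gact[OF this gi] have "sim (gact (ginv g \<circ> g') (push f' y0)) (push f y0)"
      by (simp add: gact_gact ginv_comp(1)[OF gl(1)] gact_id)
    from sim_push[OF this, of "inv f"] have "sim (gact (ginv g \<circ> g') (push (inv f \<otimes> f') y0)) (push (inv f \<otimes> f) y0)"
      using f f' by (simp only: push_gact push_mult[OF inv_closed[OF f] f' y0_charts] push_mult[OF inv_closed[OF f] f y0_charts] inv_closed)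
    then have "lft (inv f \<otimes> f') (ginv g \<circ> g')"
      using f f' gl gi by (simp add: lft_def push_one[OF y0_charts] lifts_comp)
    moreover have "positive (ginv g \<circ> g')" by (rule orient_quotient(1)[OF gl]) (use e in \<open>simp add: g_def g'_def\<close>)
    ultimately show "inv f \<otimes> f' \<in> \<Delta>" by (intro plft_\<Delta>) (simp add: plft_def)
  qed
qed

lemma deep_\<Delta>: "property_FW G \<Longrightarrow> deep \<Delta>"
  by (rule deepI[OF _ subgroup_\<Delta> finite_index_\<Delta>])

section \<open>Bounded developments\<close>

text \<open>The developed component as a subset of the real line.\<close>

definition window :: "real set" where "window = (\<lambda>y. fst (dev y)) ` {y. sim y y0}"

lemma window_invariant:
  assumes l: "lft f g" and w: "w \<in> window" shows "g w \<in> window"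
proof -
  obtain y where y: "sim y y0" "w = fst (dev y)" using w by (auto simp: window_def)
  have c: "y \<in> charts" using sim_charts[OF y(1)] y0_charts by simp
  have f: "f \<in> carrier G" "g \<in> lifts" using l by (simp_all add: lft_def)
  have "dev (gact g (push f y)) = tapp g (dev y)" by (simp add: dev_gact[OF f(2) push_charts[OF f(1) c]] dev_push[OF f(1) c])
  then have "g w = fst (dev (gact g (push f y)))" by (simp add: y(2) tapp_def)
  then show ?thesis using lft_act[OF l y(1)] by (auto simp: window_def)
qed

text \<open>Increasing lifts that preserve the set fix its supremum.\<close>

lemma bounded_window_Fix:
  assumes FW: "property_FW G" and bdd: "bdd_above window"
  shows "\<exists>K. deep K \<and> K \<subseteq> Fix"
proof (rule line_lifts_Fix[OF deep_\<Delta>[OF FW] circ_nonzero[of "Sup window"]])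
  let ?b = "Sup window"
  have ne: "window \<noteq> {}" using sim_refl[of y0] by (auto simp: window_def)
  have le: "?b \<le> g ?b" if l: "lft f g" "strict_mono g" for f g
  proof (rule cSup_least[OF ne])
    fix w assume "w \<in> window"
    then have "ginv g w \<in> window" by (rule window_invariant[OF lft_inv[OF l(1)]])
    then have "ginv g w \<le> ?b" by (rule cSup_upper[OF _ bdd])
    then have "g (ginv g w) \<le> g ?b" using l(2) by (simp add: strict_mono_less_eq)
    then show "w \<le> g ?b" using l(1) by (simp add: lft_def lifts_inverse)
  qed
  fix f assume "f \<in> \<Delta>"
  then obtain g where g: "plft f g" by (auto simp: \<Delta>_def)
  have l: "lft f g" "strict_mono g" "g \<in> lifts" using g by (simp_all add: plft_def positive_def)
  have "?b \<le> ginv g ?b" by (rule le[OF lft_inv[OF l(1)]]) (simp add: strict_mono_ginv(1)[OF l(3)] l(2))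
  then have "g ?b \<le> g (ginv g ?b)" using l(2) by (simp add: strict_mono_less_eq)
  then have b: "g ?b = ?b" using le[OF l(1,2)] by (simp add: lifts_inverse(2)[OF l(3)])
  obtain m where m: "rep g m" using l(3) by (rule lifts_rep)
  have "mhom m (proj ?b) = proj ?b" using m b unfolding rep_def by metis
  then have "fixes_line (circ ?b) m" using m by (intro fixes_line_of_mhom) (simp_all add: rep_def)
  then show "\<exists>g. lft f g \<and> (\<exists>m. rep g m \<and> fixes_line (circ ?b) m)" using l(1) m by blast
qed

section \<open>Deck transformations\<close>

text \<open>The positive deck transformations, that is, the lifts by which the neutral element
  acts.\<close>

definition Hplus :: "(real \<Rightarrow> real) set" where "Hplus = {t. plft \<one> t}"

lemma Hplus_iff: "t \<in> Hplus \<longleftrightarrow> positive t \<and> sim (gact t y0) y0"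
  by (auto simp: Hplus_def plft_def lft_def positive_def push_one[OF y0_charts])

lemma Hplus_comp: "s \<in> Hplus \<Longrightarrow> t \<in> Hplus \<Longrightarrow> s \<circ> t \<in> Hplus"
  using plft_mult[of \<one> s \<one> t] by (simp add: Hplus_def)

lemma Hplus_ginv: "s \<in> Hplus \<Longrightarrow> ginv s \<in> Hplus"
  using plft_inv[of \<one> s] by (simp add: Hplus_def)

lemma Hplus_conj: "plft f g \<Longrightarrow> t \<in> Hplus \<Longrightarrow> g \<circ> t \<circ> ginv g \<in> Hplus"
  using plft_mult[OF plft_mult[of f g \<one> t] plft_inv[of f g]] plft_carrier[of f g] by (simp add: Hplus_def)

lemma Hplus_lifts: "t \<in> Hplus \<Longrightarrow> t \<in> lifts" and Hplus_mono: "t \<in> Hplus \<Longrightarrow> strict_mono t"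
  by (simp_all add: Hplus_iff positive_def)

text \<open>A deck transformation is determined by the image of one chart, since a component has
  at most one chart at each position.\<close>

lemma Hplus_moves:
  assumes t: "t \<in> Hplus" "t \<noteq> id" shows "t (fst q0) \<noteq> fst q0"
proof
  assume e: "t (fst q0) = fst q0"
  have tl: "t \<in> lifts" by (rule Hplus_lifts[OF t(1)])
  have "dev y0 = q0" by (simp add: dev_def y0_def)
  then have "dev (gact t y0) = dev y0"
    using dev_gact[OF tl y0_charts] e Hplus_mono[OF t(1)] by (simp add: tapp_def prod_eq_iff)
  then have "gact t y0 = gact id y0" using sim_dev_inj[of "gact t y0" y0] t(1) by (simp add: Hplus_iff gact_id)
  then show False using gact_cancel[OF y0_charts] t(2) by blast
qed

lemma reach_Hplus_cancel:
  assumes t: "t \<in> Hplus" and r: "reach (gact t u) v" shows "reach u (gact (ginv t) v)"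
  using reach_gact_mono[OF r lifts_ginv[OF Hplus_lifts[OF t]]] strict_mono_ginv(1)[OF Hplus_lifts[OF t]] Hplus_mono[OF t]
  by (simp add: gact_gact ginv_comp(1)[OF Hplus_lifts[OF t]] gact_id)

text \<open>An unbounded development passes to the right through infinitely many charts at nodes,
  because the charts of a component can be moved to nodes by less than \<open>\<pi>\<close>. Two
  of them lie at the same node and have coordinates of the same type, and their quotient is a deck
  transformation.\<close>

lemma Hplus_nontrivial:
  assumes nb: "\<not> bdd_above window" obtains t where "t \<in> Hplus" "t \<noteq> id"
proof -
  define N where "N = {w. fst w \<in> nodes \<and> sim w y0 \<and> reach y0 w}"
  have inf: "infinite N"
  proof
    assume fin: "finite N"
    let ?S = "insert (fst (dev y0)) ((\<lambda>w. fst (dev w)) ` N)"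
    have "v \<le> Max ?S + pi" if v: "v \<in> window" for v
    proof -
      obtain y where y: "sim y y0" "v = fst (dev y)" using v by (auto simp: window_def)
      have "y \<in> charts" using sim_charts[OF y(1)] y0_charts by simp
      then have c: "fst y \<in> tips" "snd y \<in> lifts" by (auto simp: charts_def)
      obtain q where q: "q \<in> nodes" "\<And>h. h \<in> lifts \<Longrightarrow> sim (fst y, h) (q, h)" by (rule sim_node[OF c(1)]) blast
      have "sim (q, snd y) y" using sim_sym[OF q(2)[OF c(2)]] by simp
      then have s: "sim (q, snd y) y0" using sim_trans y(1) by blast
      have qt: "q \<in> tips" using q(1) nodes_tips by blast
      have "0 \<le> fst p \<and> fst p \<le> pi" if "p \<in> tips" for p
        using that by (auto simp: tips_def split: if_splits)
      then have r: "0 \<le> fst q" "fst q \<le> pi" "0 \<le> fst (fst y)" "fst (fst y) \<le> pi"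
        using qt c(1) by blast+
      have "\<bar>snd y (fst (fst y)) - snd y (fst q)\<bar> \<le> pi"
        using lifts_displacement[OF c(2), of "fst q" "fst (fst y)"] lifts_displacement[OF c(2), of "fst (fst y)" "fst q"] r
        by (cases "fst q" "fst (fst y)" rule: linorder_cases) auto
      then have a: "v \<le> fst (dev (q, snd y)) + pi" by (simp add: y(2) dev_def tapp_def)
      have "fst (dev (q, snd y)) \<le> Max ?S"
      proof (cases "reach y0 (q, snd y)")
        case True
        then have "(q, snd y) \<in> N" using q(1) s by (simp add: N_def)
        then show ?thesis using fin by (intro Max_ge) auto
      next
        case False
        then have "reach (q, snd y) y0" using s by (auto simp: sim_def)
        from reach_dev[OF this] have "fst (dev (q, snd y)) \<le> fst (dev y0)" by (auto simp: tless_def)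
        also have "\<dots> \<le> Max ?S" using fin by (intro Max_ge) auto
        finally show ?thesis .
      qed
      then show ?thesis using a by simp
    qed
    then show False using nb by (auto simp: bdd_above_def)
  qed
  have "\<not> inj_on (\<lambda>w. (fst w, orient (snd w))) N"
  proof
    assume i: "inj_on (\<lambda>w. (fst w, orient (snd w))) N"
    have "finite ((\<lambda>w. (fst w, orient (snd w))) ` N)"
      by (rule finite_subset[of _ "nodes \<times> UNIV"]) (use nodes_finite in \<open>auto simp: N_def\<close>)
    then show False using finite_imageD[OF _ i] inf by blast
  qed
  then obtain w1 w2 where w: "w1 \<in> N" "w2 \<in> N" "w1 \<noteq> w2" "fst w1 = fst w2" "orient (snd w1) = orient (snd w2)"
    unfolding inj_on_def prod.inject by blast
  have s: "sim w1 y0" "sim w2 y0" using w by (simp_all add: N_def)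
  then have "w1 \<in> charts" "w2 \<in> charts" using sim_charts y0_charts by blast+
  then have l: "snd w1 \<in> lifts" "snd w2 \<in> lifts" by (auto simp: charts_def)
  define t where "t = snd w2 \<circ> ginv (snd w1)"
  have tl: "t \<in> lifts" unfolding t_def by (intro lifts_comp lifts_ginv l)
  have g: "gact t w1 = w2"
    by (simp add: gact_def t_def comp_assoc ginv_comp(1)[OF l(1)] w(4) prod_eq_iff)
  have "sim (gact t y0) w2" using sim_gact[OF sim_sym[OF s(1)] tl] by (simp add: g)
  then have "sim (gact t y0) y0" using sim_trans s(2) by blast
  moreover have "positive t" unfolding t_def by (rule orient_quotient(2)[OF l w(5)])
  moreover have "t \<noteq> id" using g w(3) gact_id[of w1] by auto
  ultimately show ?thesis using that by (simp add: Hplus_iff)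
qed

text \<open>Deck transformations that move \<open>y0\<close> to the right are measured by the
  number of charts at nodes that are passed on the way. This number is finite, and one with the
  smallest number generates the group.\<close>

lemma Hplus_cyclic:
  assumes nb: "\<not> bdd_above window"
  obtains t where "t \<in> Hplus" "t \<noteq> id" "\<And>s. s \<in> Hplus \<Longrightarrow> \<exists>n. s = t ^^ n \<or> ginv s = t ^^ n"
proof -
  define P where "P s \<longleftrightarrow> s \<in> Hplus \<and> s \<noteq> id \<and> reach y0 (gact s y0)" for s
  define N where "N s = card (between y0 (gact s y0))" for s
  have back_or_forth: "reach y0 (gact s y0) \<or> reach y0 (gact (ginv s) y0)" if s: "s \<in> Hplus" for s
  proof -
    have "reach (gact s y0) y0 \<or> reach y0 (gact s y0)" using s by (simp add: Hplus_iff sim_def)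
    then show ?thesis using reach_Hplus_cancel[OF s] by blast
  qed
  have exP: "\<exists>s. P s"
  proof -
    obtain s where s: "s \<in> Hplus" "s \<noteq> id" using Hplus_nontrivial[OF nb] by blast
    have "ginv s \<noteq> id"
    proof
      assume "ginv s = id"
      then show False using ginv_comp(2)[OF Hplus_lifts[OF s(1)]] s(2) by simp
    qed
    then show ?thesis using back_or_forth[OF s(1)] s Hplus_ginv[OF s(1)] unfolding P_def by blast
  qed
  then obtain t where t: "P t" and min: "\<And>s. P s \<Longrightarrow> N t \<le> N s" using ex_has_least_nat[of P _ N] by blast
  have tH: "t \<in> Hplus" "t \<noteq> id" "reach y0 (gact t y0)" using t by (simp_all add: P_def)
  have tl: "t \<in> lifts" by (rule Hplus_lifts[OF tH(1)])
  have node: "fst y0 \<in> nodes" "fst (gact s y0) \<in> nodes" for s using q0 by (simp_all add: y0_def gact_def)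
  have pow: "\<exists>n. s = t ^^ n" if "s \<in> Hplus" "reach y0 (gact s y0)" for s
    using that
  proof (induction "N s" arbitrary: s rule: less_induct)
    case (less s)
    show ?case
    proof (cases "s = id")
      case True
      then show ?thesis by (intro exI[of _ 0]) (simp add: id_def)
    next
      case False
      have fin: "finite (between y0 (gact s y0))" "finite (between y0 (gact t y0))"
        by (intro finite_between less.prems tH(3))+
      have r: "reach (gact t y0) (gact s y0)"
      proof (rule ccontr)
        assume n: "\<not> reach (gact t y0) (gact s y0)"
        then have st: "reach (gact s y0) (gact t y0)" using reach_linear[OF tH(3) less.prems(2)] by blast
        have "between y0 (gact s y0) \<subset> between y0 (gact t y0)"
        proof
          show "between y0 (gact s y0) \<subseteq> between y0 (gact t y0)"
            unfolding between_def using rtranclp_trans[OF _ st] by blast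
          have "gact t y0 \<in> between y0 (gact t y0)" using tH(3) node by (simp add: between_def)
          moreover have "gact t y0 \<notin> between y0 (gact s y0)" using n by (simp add: between_def)
          ultimately show "between y0 (gact s y0) \<noteq> between y0 (gact t y0)" by blast
        qed
        then have "N s < N t" unfolding N_def by (rule psubset_card_mono[OF fin(2)])
        moreover have "P s" using less.prems False by (simp add: P_def)
        ultimately show False using min by fastforce
      qed
      define u where "u = ginv t \<circ> s"
      have u: "u \<in> Hplus" unfolding u_def by (intro Hplus_comp Hplus_ginv tH less.prems)
      have ru: "reach y0 (gact u y0)" using reach_Hplus_cancel[OF tH(1) r] by (simp add: gact_gact u_def)
      have tu: "t \<circ> u = s" unfolding u_def by (simp add: comp_assoc[symmetric] ginv_comp(2)[OF tl])
      have inj: "inj_on (gact t) A" for A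
      proof (rule inj_on_inverseI)
        fix w show "gact (ginv t) (gact t w) = w" by (simp add: gact_gact ginv_comp(1)[OF tl] gact_id)
      qed
      have "gact t ` between y0 (gact u y0) \<subset> between y0 (gact s y0)"
      proof
        show "gact t ` between y0 (gact u y0) \<subseteq> between y0 (gact s y0)"
        proof
          fix w assume "w \<in> gact t ` between y0 (gact u y0)"
          then obtain x where x: "w = gact t x" "fst x \<in> nodes" "reach y0 x" "reach x (gact u y0)"
            by (auto simp: between_def)
          have "reach (gact t y0) w" "reach w (gact s y0)"
            using reach_gact_mono[OF x(3) tl Hplus_mono[OF tH(1)]] reach_gact_mono[OF x(4) tl Hplus_mono[OF tH(1)]]
            by (simp_all add: x(1) gact_gact tu)
          then show "w \<in> between y0 (gact s y0)"
            using rtranclp_trans[OF tH(3)] x(2) by (simp add: between_def x(1) gact_def[of t x])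
        qed
        have "y0 \<in> between y0 (gact s y0)" using less.prems(2) node by (simp add: between_def)
        moreover have "y0 \<notin> gact t ` between y0 (gact u y0)"
        proof
          assume "y0 \<in> gact t ` between y0 (gact u y0)"
          then obtain x where x: "y0 = gact t x" "reach y0 x" by (auto simp: between_def)
          have "reach (gact t y0) y0" using reach_gact_mono[OF x(2) tl Hplus_mono[OF tH(1)]] x(1) by simp
          then have "gact t y0 = y0" using reach_antisym[OF _ tH(3)] by blast
          then show False using gact_cancel[OF y0_charts, of t id] tH(2) by (simp add: gact_id)
        qed
        ultimately show "gact t ` between y0 (gact u y0) \<noteq> between y0 (gact s y0)" by blast
      qed
      then have "N u < N s" unfolding N_def using psubset_card_mono[OF fin(1)] card_image[OF inj] by metis
      then obtain n where "u = t ^^ n" using less.hyps[OF _ u ru] by blast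
      then have "s = t ^^ Suc n" using tu by simp
      then show ?thesis by blast
    qed
  qed
  have "\<exists>n. s = t ^^ n \<or> ginv s = t ^^ n" if s: "s \<in> Hplus" for s
    using back_or_forth[OF s] pow[OF s] pow[OF Hplus_ginv[OF s]] by blast
  then show ?thesis using that tH(1,2) by blast
qed

end

section \<open>Ping-pong or trivial action\<close>

text \<open>Distinct powers of \<open>t\<close> differ at \<open>x\<close>.\<close>

lemma funpow_eq_self:
  fixes t :: "real \<Rightarrow> real"
  assumes t: "t \<in> lifts" "strict_mono t" and x: "t x \<noteq> x" and e: "t ^^ j = t \<or> t ^^ j = ginv t"
  shows "j = 1"
  using e
proof
  assume e: "t ^^ j = t"
  show ?thesis
  proof (cases j)
    case 0
    then have "t = id" using e by (simp add: id_def)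
    then show ?thesis using x by simp
  next
    case (Suc i)
    then have "t ((t ^^ i) x) = t x" using e by (metis comp_apply funpow.simps(2))
    then have "(t ^^ i) x = x" using lifts_inverse(1)[OF t(1)] by metis
    then have "i = 0" using strict_mono_funpow_neq[OF t(2) x, of i] by blast
    then show ?thesis using Suc by simp
  qed
next
  assume e: "t ^^ j = ginv t"
  have "(t ^^ Suc j) x = x" using lifts_inverse(2)[OF t(1), of x] by (simp add: e)
  then show ?thesis using strict_mono_funpow_neq[OF t(2) x, of "Suc j"] by simp
qed

lemma ginv_funpow: "t \<in> lifts \<Longrightarrow> ginv (t ^^ n) = ginv t ^^ n"
  by (rule inv_fn[OF lifts_bij])

lemma lifts_funpow: "t \<in> lifts \<Longrightarrow> t ^^ n \<in> lifts"
  by (induction n) (simp_all add: lifts_comp lifts_id[unfolded id_def] id_def lifts_id)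

lemma conj_funpow:
  assumes g: "g \<in> lifts"
  shows "(ginv g \<circ> t \<circ> g) ^^ n = ginv g \<circ> t ^^ n \<circ> g"
proof
  fix x show "((ginv g \<circ> t \<circ> g) ^^ n) x = (ginv g \<circ> t ^^ n \<circ> g) x"
    by (induction n) (simp_all add: lifts_inverse[OF g])
qed

context component
begin

text \<open>Conjugation by \<open>g\<close> maps the infinite cyclic deck group onto itself, so it
  maps a generator to a generator.\<close>

lemma conj_generator:
  assumes t: "t \<in> Hplus" "t \<noteq> id" and cyc: "\<And>s. s \<in> Hplus \<Longrightarrow> \<exists>n. s = t ^^ n \<or> ginv s = t ^^ n"
    and g: "plft f g"
  shows "g \<circ> t \<circ> ginv g = t \<or> g \<circ> t \<circ> ginv g = ginv t"
proof -
  have gl: "g \<in> lifts" by (rule plft_lifts[OF g])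
  have tl: "t \<in> lifts" by (rule Hplus_lifts[OF t(1)])
  let ?s = "g \<circ> t \<circ> ginv g" and ?r = "ginv g \<circ> t \<circ> g"
  have s: "?s \<in> Hplus" by (rule Hplus_conj[OF g t(1)])
  have r: "?r \<in> Hplus" using Hplus_conj[OF plft_inv[OF g] t(1)] by (simp add: ginv_ginv[OF gl])
  have sl: "?s \<in> lifts" and rl: "?r \<in> lifts" by (rule Hplus_lifts[OF s], rule Hplus_lifts[OF r])
  obtain n where n: "?s = t ^^ n \<or> ginv ?s = t ^^ n" using cyc[OF s] by blast
  obtain k where k: "?r = t ^^ k \<or> ginv ?r = t ^^ k" using cyc[OF r] by blast
  have rs: "ginv g \<circ> ?s \<circ> g = t"
    by (simp add: comp_assoc ginv_comp(1)[OF gl]) (simp add: comp_assoc[symmetric] ginv_comp(1)[OF gl])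
  have ri: "ginv g \<circ> ginv ?s \<circ> g = ginv t"
  proof -
    have "ginv (ginv g \<circ> ?s \<circ> g) = ginv g \<circ> ginv ?s \<circ> g"
      using ginv_o[OF lifts_comp[OF lifts_ginv[OF gl] sl] gl] ginv_o[OF lifts_ginv[OF gl] sl] ginv_ginv[OF gl]
      by (simp add: comp_assoc)
    then show ?thesis unfolding rs by simp
  qed
  have "ginv g \<circ> t ^^ n \<circ> g = t \<or> ginv g \<circ> t ^^ n \<circ> g = ginv t" using n rs ri by metis
  then have rn: "?r ^^ n = t \<or> ?r ^^ n = ginv t" by (simp only: conj_funpow[OF gl])
  have "t ^^ (k * n) = t \<or> t ^^ (k * n) = ginv t"
    using k
  proof
    assume "?r = t ^^ k"
    then show ?thesis using rn by (simp only: funpow_mult mult.commute)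
  next
    assume e: "ginv ?r = t ^^ k"
    have "ginv (?r ^^ n) = t ^^ (k * n)" by (simp only: ginv_funpow[OF rl] e funpow_mult mult.commute)
    then show ?thesis using rn ginv_ginv[OF tl] by metis
  qed
  then have "k * n = 1" by (rule funpow_eq_self[OF tl Hplus_mono[OF t(1)] Hplus_moves[OF t]])
  then have "n = 1" by simp
  then have "?s = t \<or> ginv ?s = t" using n by simp
  then show ?thesis using ginv_ginv[OF sl] by metis
qed

definition matrix :: "'a \<Rightarrow> mat2" where
  "matrix f = (SOME m. \<exists>g. plft f g \<and> rep g m \<and> mdet m > 0)"

text \<open>Two lifts of the same element differ by a deck transformation, that is, by a
  translation that is trivial on the projective line.\<close>

lemma matrix:
  assumes H: "\<And>s. s \<in> Hplus \<Longrightarrow> \<exists>k. s = zshift k" and f: "plft f g"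
  shows "rep g (matrix f)" "mdet (matrix f) > 0"
proof -
  have "\<exists>m g. plft f g \<and> rep g m \<and> mdet m > 0" using f by (auto simp: plft_def positive_def)
  then have "\<exists>g. plft f g \<and> rep g (matrix f) \<and> mdet (matrix f) > 0" unfolding matrix_def by (rule someI_ex)
  then obtain h where h: "plft f h" "rep h (matrix f)" "mdet (matrix f) > 0" by blast
  show "mdet (matrix f) > 0" by (rule h(3))
  have hl: "h \<in> lifts" by (rule plft_lifts[OF h(1)])
  have "g \<circ> ginv h \<in> Hplus"
    using plft_mult[OF f plft_inv[OF h(1)]] plft_carrier[OF f] by (simp add: Hplus_def)
  then obtain k where k: "g \<circ> ginv h = zshift k" using H by blast
  have "g = (g \<circ> ginv h) \<circ> h" by (simp add: comp_assoc ginv_comp(1)[OF hl])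
  then have "g = zshift k \<circ> h" by (simp only: k)
  then have "proj (g x) = proj (h x)" for x by (simp add: zshift_def)
  then show "rep g (matrix f)" using h(2) by (simp add: rep_def)
qed

lemma homographic_action_\<Delta>:
  assumes H: "\<And>s. s \<in> Hplus \<Longrightarrow> \<exists>k. s = zshift k"
  shows "homographic_action G \<Delta> matrix"
proof (rule homographic_action.intro[OF group_axioms], rule homographic_action_axioms.intro)
  show "subgroup \<Delta> G" by (rule subgroup_\<Delta>)
  show "mdet (matrix f) \<noteq> 0" if "f \<in> \<Delta>" for f using that matrix(2)[OF H] by (fastforce simp: \<Delta>_def)
  fix f f' x assume "f \<in> \<Delta>" "f' \<in> \<Delta>"
  then obtain g g' where g: "plft f g" "plft f' g'" by (auto simp: \<Delta>_def)
  obtain \<theta> where x: "x = proj \<theta>" by (rule proj_surj)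
  have "mhom (matrix (f \<otimes> f')) (proj \<theta>) = proj (g (g' \<theta>))"
    using matrix(1)[OF H plft_mult[OF g]] by (simp add: rep_def)
  then show "mhom (matrix (f \<otimes> f')) x = mhom (matrix f) (mhom (matrix f') x)"
    using matrix(1)[OF H g(1)] matrix(1)[OF H g(2)] by (simp add: rep_def x)
qed

text \<open>The case distinction on the developed component and its deck group.\<close>

theorem pingpong_or_Fix:
  assumes FW: "property_FW G"
  shows "(\<exists>\<alpha> \<beta> (act :: 'a \<Rightarrow> p1 \<Rightarrow> p1) D x0. \<alpha> \<noteq> \<beta> \<and> pingpong G \<Delta> {\<alpha>, \<beta>} act D x0) \<or> (\<exists>K. deep K \<and> K \<subseteq> Fix)"
proof (cases "bdd_above window")
  case True
  then show ?thesis using bounded_window_Fix[OF FW] by blast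
next
  case False
  obtain t where t: "t \<in> Hplus" "t \<noteq> id" and cyc: "\<And>s. s \<in> Hplus \<Longrightarrow> \<exists>n. s = t ^^ n \<or> ginv s = t ^^ n"
    by (rule Hplus_cyclic[OF False]) blast
  have tl: "t \<in> lifts" by (rule Hplus_lifts[OF t(1)])
  have D: "deep \<Delta>" by (rule deep_\<Delta>[OF FW])
  have gD: "\<exists>g. plft f g" if "f \<in> \<Delta>" for f using that by (auto simp: \<Delta>_def)
  show ?thesis
  proof (cases "\<exists>k. t = zshift k")
    case nz: False
    have "\<exists>g. lft f g \<and> (g \<circ> t \<circ> ginv g = t \<or> g \<circ> t \<circ> ginv g = ginv t)" if f: "f \<in> \<Delta>" for f
    proof -
      obtain g where g: "plft f g" using gD[OF f] by blast
      from conj_generator[OF t cyc g] g show ?thesis unfolding plft_def by blast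
    qed
    then have "\<exists>K. deep K \<and> K \<subseteq> Fix" using nz by (intro normalizing_lifts_Fix[OF D tl]) blast+
    then show ?thesis by blast
  next
    case True
    have zf: "\<exists>k. t ^^ n = zshift k" for n
    proof (induction n)
      case 0
      then show ?case using closed_zshift by (simp add: closed_pred_def id_def)
    next
      case (Suc n)
      then show ?case using closed_zshift True tl lifts_funpow[OF tl] unfolding closed_pred_def funpow.simps by blast
    qed
    have H: "\<exists>k. s = zshift k" if s: "s \<in> Hplus" for s
    proof -
      obtain n where "s = t ^^ n \<or> ginv s = t ^^ n" using cyc[OF s] by blast
      then have "s = t ^^ n \<or> s = ginv (t ^^ n)" using ginv_ginv[OF Hplus_lifts[OF s]] by metis
      then show ?thesis using zf[of n] closed_zshift lifts_funpow[OF tl, of n] unfolding closed_pred_def by blast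
    qed
    interpret A: homographic_action G \<Delta> matrix by (rule homographic_action_\<Delta>[OF H])
    define \<Lambda> where "\<Lambda> = {m. mdet m > 0 \<and> (\<exists>f g. plft f g \<and> rep g m)}"
    have lam: "\<exists>g m. plft f g \<and> rep g m \<and> m \<in> \<Lambda>" if f: "f \<in> \<Delta>" for f
    proof -
      obtain g where g: "plft f g" using gD[OF f] by blast
      have "matrix f \<in> \<Lambda>" using matrix[OF H g] g by (auto simp: \<Lambda>_def)
      then show ?thesis using matrix(1)[OF H g] g by blast
    qed
    show ?thesis
    proof (cases "\<exists>m\<in>\<Lambda>. hyperbolic m")
      case True
      then obtain m f g where m: "hyperbolic m" "mdet m > 0" "plft f g" "rep g m" by (auto simp: \<Lambda>_def)
      note M = matrix[OF H m(3)]
      have d: "mdet m \<noteq> 0" "mdet (matrix f) \<noteq> 0" using m(2) M(2) by simp_all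
      obtain k where k: "k \<noteq> 0" "matrix f = mmul (mscal k) m" by (rule scal_quotient[OF d rep_unique[OF M(1) m(4)]])
      have hyp: "hyperbolic (matrix f)" using m(1) hyperbolic_scale[OF k(1)] by (simp add: k(2))
      from A.hyperbolic_pingpong[OF plft_\<Delta>[OF m(3)] hyp M(2)] show ?thesis
      proof
        assume "\<exists>x. finite ((\<lambda>g. A.act g x) ` \<Delta>)"
        then obtain x where x: "finite ((\<lambda>g. A.act g x) ` \<Delta>)" by blast
        let ?S = "{g \<in> \<Delta>. A.act g x = x}"
        note st = A.stabilizer_finite_index[OF x]
        have "finite_index G ?S" by (rule finite_index_trans[OF subgroup_\<Delta> finite_index_\<Delta> st(1) _ st(2)]) blast
        then have dS: "deep ?S" by (rule deepI[OF FW st(1)])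
        obtain b where b: "x = proj b" by (rule proj_surj)
        have "\<exists>g. lft f g \<and> (\<exists>m. rep g m \<and> fixes_line (circ b) m)" if f: "f \<in> ?S" for f
        proof -
          obtain g where g: "plft f g" using gD f by blast
          have "mhom (matrix f) (proj b) = proj b" using f by (simp add: A.act_def b)
          then have "fixes_line (circ b) (matrix f)"
            using matrix(2)[OF H g] by (intro fixes_line_of_mhom) simp_all
          then show ?thesis using matrix(1)[OF H g] g unfolding plft_def by blast
        qed
        then show ?thesis using line_lifts_Fix[OF dS circ_nonzero] by blast
      next
        assume "\<exists>\<alpha> \<beta> D x0. \<alpha> \<noteq> \<beta> \<and> pingpong G \<Delta> {\<alpha>, \<beta>} A.act D x0"
        then obtain \<alpha> \<beta> D x0 where "\<alpha> \<noteq> \<beta> \<and> pingpong G \<Delta> {\<alpha>, \<beta>} A.act D x0" by (elim exE)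
        then show ?thesis
          by (intro disjI1 exI[of _ \<alpha>] exI[of _ \<beta>] exI[of _ A.act] exI[of _ D] exI[of _ x0])
      qed
    next
      case False
      have cm: "mcomm m n \<in> \<Lambda>" if mL: "m \<in> \<Lambda>" and nL: "n \<in> \<Lambda>" for m n
      proof -
        obtain f g where m: "mdet m > 0" "plft f g" "rep g m" using mL by (auto simp: \<Lambda>_def)
        obtain f' g' where n: "mdet n > 0" "plft f' g'" "rep g' n" using nL by (auto simp: \<Lambda>_def)
        have "plft (f \<otimes> f' \<otimes> inv f \<otimes> inv f') (gcomm g g')"
          unfolding gcomm_def by (intro plft_mult plft_inv m n)
        moreover have "rep (gcomm g g') (mcomm m n)" by (rule rep_gcomm[OF plft_lifts[OF m(2)] plft_lifts[OF n(2)] m(3) n(3)])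
        moreover have "mdet (mcomm m n) > 0" using m(1) n(1) by (simp add: mdet_mcomm)
        ultimately show ?thesis unfolding \<Lambda>_def by blast
      qed
      have "(\<exists>T. \<not> is_scal T \<and> (\<forall>m\<in>\<Lambda>. mmul m T = mmul T m)) \<or> (\<exists>v. v \<noteq> vzero \<and> (\<forall>m\<in>\<Lambda>. fixes_line v m))"
        by (rule no_hyperbolic[OF _ cm]) (use False in \<open>auto simp: \<Lambda>_def\<close>)
      then have "\<exists>K. deep K \<and> K \<subseteq> Fix"
      proof
        assume "\<exists>T. \<not> is_scal T \<and> (\<forall>m\<in>\<Lambda>. mmul m T = mmul T m)"
        then obtain T where T: "\<not> is_scal T" "\<And>m. m \<in> \<Lambda> \<Longrightarrow> mmul m T = mmul T m" by blast
        show ?thesis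
          by (rule commuting_lifts_Fix[OF D T(1)]) (use lam T(2) in \<open>unfold plft_def, blast\<close>)
      next
        assume "\<exists>v. v \<noteq> vzero \<and> (\<forall>m\<in>\<Lambda>. fixes_line v m)"
        then obtain v where v: "v \<noteq> vzero" "\<And>m. m \<in> \<Lambda> \<Longrightarrow> fixes_line v m" by blast
        show ?thesis
          by (rule line_lifts_Fix[OF D v(1)]) (use lam v(2) in \<open>unfold plft_def, blast\<close>)
      qed
      then show ?thesis by blast
    qed
  qed
qed

end

context reglued_group
begin

text \<open>A subgroup of finite index that acts trivially on every component is trivial, because
  every tip lies in the component of a node.\<close>

theorem finite_or_pingpong:
  assumes FW: "property_FW G"
  shows "finite (carrier G) \<or>
    (\<exists>\<Delta> \<alpha> \<beta> (act :: 'a \<Rightarrow> p1 \<Rightarrow> p1) D x0. finite_index G \<Delta> \<and> \<alpha> \<noteq> \<beta> \<and> pingpong G \<Delta> {\<alpha>, \<beta>} act D x0)"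
proof (rule disjCI)
  assume no: "\<not> (\<exists>\<Delta> \<alpha> \<beta> (act :: 'a \<Rightarrow> p1 \<Rightarrow> p1) D x0. finite_index G \<Delta> \<and> \<alpha> \<noteq> \<beta> \<and> pingpong G \<Delta> {\<alpha>, \<beta>} act D x0)"
  have "\<exists>K. deep K \<and> (\<forall>f\<in>K. f \<in> carrier G \<and> (\<forall>y. sim y (q, id) \<longrightarrow> push f y = y))" if q: "q \<in> nodes" for q
  proof -
    interpret component G c glue q by (unfold_locales) (rule q)
    have "\<exists>K. deep K \<and> K \<subseteq> Fix" using pingpong_or_Fix[OF FW] finite_index_\<Delta> no by blast
    then show ?thesis unfolding Fix_def y0_def by blast
  qed
  then obtain K where K: "\<And>q. q \<in> nodes \<Longrightarrow> deep (K q)"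
    "\<And>q f y. q \<in> nodes \<Longrightarrow> f \<in> K q \<Longrightarrow> sim y (q, id) \<Longrightarrow> push f y = y"
    by metis
  have fi: "finite_index G (carrier G \<inter> (\<Inter>q\<in>nodes. K q))"
    by (rule finite_index_INT[OF nodes_finite]) (use K(1) in \<open>auto simp: deep_def\<close>)
  have "f = \<one>" if f: "f \<in> carrier G" "\<And>q. q \<in> nodes \<Longrightarrow> f \<in> K q" for f
  proof (rule faithful[OF f(1)])
    fix p assume p: "p \<in> tips"
    obtain q where q: "q \<in> nodes" "\<And>h. h \<in> lifts \<Longrightarrow> sim (p, h) (q, h)" by (rule sim_node[OF p]) blast
    have "push f (p, id) = (p, id)" by (rule K(2)[OF q(1) f(2)[OF q(1)] q(2)[OF lifts_id]])
    then have "ginv (c f p) = id" by (simp add: push_def)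
    then show "c f p = id" using ginv_comp(2)[OF c_lifts[OF f(1) p]] by simp
  qed
  then have "carrier G \<inter> (\<Inter>q\<in>nodes. K q) \<subseteq> {\<one>}" by blast
  from finite_index_mono[OF fi this] show "finite (carrier G)" by (rule finite_index_one_imp_finite)
qed

end

section \<open>Infinite groups with Property FW\<close>

lemma piecewise_group_subgroup:
  assumes \<Gamma>: "subgroup \<Gamma> PC_Proj"
  shows "piecewise_group (PC_Proj\<lparr>carrier := \<Gamma>\<rparr>) germ_cocycle"
proof (rule piecewise_group.intro)
  show "group (PC_Proj\<lparr>carrier := \<Gamma>\<rparr>)" by (rule subgroup.subgroup_is_group[OF \<Gamma> group_PC_Proj])
  have sub: "A \<in> carrier PC_Proj" if "A \<in> carrier (PC_Proj\<lparr>carrier := \<Gamma>\<rparr>)" for A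
    using that subgroup.mem_carrier[OF \<Gamma>] by simp
  show "piecewise_group_axioms (PC_Proj\<lparr>carrier := \<Gamma>\<rparr>) germ_cocycle"
  proof (rule piecewise_group_axioms.intro)
    fix A B p x y assume A: "A \<in> carrier (PC_Proj\<lparr>carrier := \<Gamma>\<rparr>)"
    note A' = sub[OF A]
    show "germ_cocycle A p \<in> lifts" by (rule germ_cocycle_lifts[OF A'])
    show "tapp (germ_cocycle A p) p \<in> tips" by (rule germ_cocycle_tips[OF A'])
    show "finite {x. 0 < x \<and> x < pi \<and> germ_cocycle A (x, False) \<noteq> germ_cocycle A (x, True)}" by (rule germ_cocycle_breaks[OF A'])
    show "germ_cocycle (A \<otimes>\<^bsub>PC_Proj\<lparr>carrier := \<Gamma>\<rparr>\<^esub> B) p = germ_cocycle A (tapp (germ_cocycle B p) p) \<circ> germ_cocycle B p"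
      if B: "B \<in> carrier (PC_Proj\<lparr>carrier := \<Gamma>\<rparr>)" using germ_cocycle_mult[OF A' sub[OF B]] by simp
    show "germ_cocycle A (y, False) = germ_cocycle A (x, True) \<and> (\<forall>z s. x < z \<and> z < y \<longrightarrow> germ_cocycle A (z, s) = germ_cocycle A (x, True))"
      if h: "0 \<le> x" "x < y" "y \<le> pi" "\<And>z. x < z \<Longrightarrow> z < y \<Longrightarrow> germ_cocycle A (z, False) = germ_cocycle A (z, True)"
      using germ_cocycle_constant[OF A' h] by blast
    show "A = \<one>\<^bsub>PC_Proj\<lparr>carrier := \<Gamma>\<rparr>\<^esub>" if "\<And>p. p \<in> tips \<Longrightarrow> germ_cocycle A p = id"
      using germ_cocycle_faithful[OF A' that] by simp
  next
    fix p assume "p \<in> tips"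
    then show "germ_cocycle \<one>\<^bsub>PC_Proj\<lparr>carrier := \<Gamma>\<rparr>\<^esub> p = id" using germ_cocycle_one by simp
  qed
qed

theorem corollary1p2:
  shows "(\<forall>\<Gamma>. subgroup \<Gamma> PC_Proj \<and> infinite \<Gamma> \<and> property_FW (PC_Proj\<lparr>carrier := \<Gamma>\<rparr>) \<longrightarrow>
            has_nonabelian_free_subgroup (PC_Proj\<lparr>carrier := \<Gamma>\<rparr>))
       \<and> \<not> (\<exists>\<Gamma>. subgroup \<Gamma> PC_Proj \<and> infinite \<Gamma> \<and> amenable (PC_Proj\<lparr>carrier := \<Gamma>\<rparr>)
              \<and> property_FW (PC_Proj\<lparr>carrier := \<Gamma>\<rparr>))"
proof -
  have main: "has_nonabelian_free_subgroup (PC_Proj\<lparr>carrier := \<Gamma>\<rparr>) \<and> \<not> amenable (PC_Proj\<lparr>carrier := \<Gamma>\<rparr>)"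
    if \<Gamma>: "subgroup \<Gamma> PC_Proj" and inf: "infinite \<Gamma>" and FW: "property_FW (PC_Proj\<lparr>carrier := \<Gamma>\<rparr>)" for \<Gamma>
  proof -
    let ?G = "PC_Proj\<lparr>carrier := \<Gamma>\<rparr>"
    obtain glue where r: "reglued_group ?G germ_cocycle glue"
      using piecewise_group.FW_reglue[OF piecewise_group_subgroup[OF \<Gamma>] FW] by blast
    have "\<not> finite (carrier ?G)" using inf by simp
    with reglued_group.finite_or_pingpong[OF r FW]
    obtain \<Delta> \<alpha> \<beta> D x0 and act :: "(p1 \<Rightarrow> p1) set \<Rightarrow> p1 \<Rightarrow> p1"
      where "finite_index ?G \<Delta> \<and> \<alpha> \<noteq> \<beta> \<and> pingpong ?G \<Delta> {\<alpha>, \<beta>} act D x0" by (elim disjE exE) blast+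
    then have fi: "finite_index ?G \<Delta>" and ne: "\<alpha> \<noteq> \<beta>" and pp: "pingpong ?G \<Delta> {\<alpha>, \<beta>} act D x0" by simp_all
    have "has_nonabelian_free_subgroup ?G" by (rule pingpong.nonabelian_free[OF pp _ _ ne]) simp_all
    moreover have "\<not> amenable ?G" by (rule pingpong.not_amenable[OF pp _ _ ne fi]) simp_all
    ultimately show ?thesis ..
  qed
  then show ?thesis by blast
qed

end
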